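(* Let $S(t)$ be an entire function of order and type zero such that there exist $M>0$ and $c\in(0,1)$ with $|S(t)|\le M\,(-c|t|;q)_\infty$ for all $t\in\mathbb{C}$. Suppose that the Cauchy–Heine integral representation $$(\mathcal{L}_{q,\theta}B)(z)=\frac{-1}{\ln q}\int_0^\infty\frac{S(-t)}{\theta_q(t)\,(t+z)}\,dt$$ holds, or equivalently, that the connection formulas $$(\mathcal{L}_{q,E}B)(ze^{2\pi i})=(\mathcal{L}_{q,E}B)(z)-2\pi i\,C_q\,S(z)\,E_q(ze^{\pi i}),\qquad (\mathcal{L}_{q,\theta}B)(ze^{2\pi i})=(\mathcal{L}_{q,\theta}B)(z)+\frac{2\pi i\,S(z)}{\ln(q)\,\theta_q(-z)}$$ hold. Then $$(\mathcal{L}_{q,\theta}B)(z)-(\mathcal{L}_{q,E}B)(z)=\frac{S(z)}{\theta_q(-z)}P_q^{(c)}(z),\qquad (\mathcal{L}_{q,\theta}B)(z)-(\mathcal{L}_{q,\lambda}B)(z)=\frac{S(z)}{\theta_q(-z)}P_q^{(d)}(z;\lambda),$$ in which $$P_q^{(d)}(z;\lambda)=\frac{\lambda\theta_q'(\lambda)}{\theta_q(\lambda)}-\frac{\lambda\theta_q'(\lambda/z)}{z\,\theta_q(\lambda/z)}+\frac{\ln z}{\ln q}=\frac{\lambda\mathcal{P}_q'(\lambda)}{\mathcal{P}_q(\lambda)}-\frac{\lambda\mathcal{P}_q'(\lambda/z)}{z\,\mathcal{P}_q(\lambda/z)},$$ $$P_q^{(c)}(z)=\frac{-1}{\ln q}\int_q^1\mathcal{P}_q\!\left(\frac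 tz\right)P_q^{(d)}(z;t)\frac{dt}{t}=\frac{\ln z}{\ln q}+\frac{1}{z\ln q}\int_q^1\mathcal{P}_q(t)\frac{\theta_q'(t/z)}{\theta_q(t/z)}\,dt=\frac{1}{z\ln q}\int_q^1\frac{\mathcal{P}_q(t)\,\mathcal{P}_q'(t/z)}{\mathcal{P}_q(t/z)}\,dt$$ $$=\frac{-2\pi}{\ln q}\sum_{n=1}^\infty(-1)^n\hat q^{\,n^2}\frac{\sin\left(2\pi n\frac{\ln z}{\ln q}\right)}{\sinh(n\ln\hat q)},$$ and $$P_q^{(d)}(z;\lambda_1)-P_q^{(d)}(z;\lambda_2)=\frac{\lambda_1\theta_q'(\lambda_1)}{\theta_q(\lambda_1)}-\frac{\lambda_1\theta_q'(\lambda_1/z)}{z\,\theta_q(\lambda_1/z)}-\frac{\lambda_2\theta_q'(\lambda_2)}{\theta_q(\lambda_2)}+\frac{\lambda_2\theta_q'(\lambda_2/z)}{z\,\theta_q(\lambda_2/z)}=\frac{(q;q)_\infty^3\,\theta_q(-z)\,\theta_q\!\left(\frac{-\lambda_1}{\lambda_2}\right)\theta_q\!\left(\frac{-\lambda_1\lambda_2}{z}\right)}{\theta_q(\lambda_1)\,\theta_q(\lambda_2)\,\theta_q\!\left(\frac{\lambda_1}{z}\right)\theta_q\!\left(\frac{z}{\lambda_2}\right)}$$ are $q$-periodic functions of $z$. The right-hand sides of the two difference formulas have removable singularities at $z=q^m$, $m\in\mathbb{Z}$: $$\lim_{z\to q^m}\frac{P_q^{(c)}(z)}{\theta_q(-z)}=\frac{(-1)^mq^{\binom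 m2}}{(q;q)_\infty^3}\left(\frac{2\pi}{\ln q}\right)^2\sum_{n=1}^\infty(-1)^n\hat q^{\,n^2}\frac{n}{\sinh(n\ln\hat q)},$$ $$\lim_{z\to q^m}\frac{P_q^{(d)}(z;\lambda)}{\theta_q(-z)}=\frac{(-1)^{m-1}q^{\binom m2}}{(q;q)_\infty^3}\left(\frac1{\ln q}+\sum_{n=-\infty}^\infty\frac{\lambda q^n}{(1+\lambda q^n)^2}\right)=\frac{(-1)^{m-1}q^{\binom m2}}{(q;q)_\infty^3}\left(\frac1{\ln q}+\lambda\frac{d}{d\lambda}\left(\frac{\lambda\theta_q'(\lambda)}{\theta_q(\lambda)}\right)\right).$$
   Context: Throughout $0<q<1$, $\hat q=e^{2\pi^2/\ln q}$, $(a;q)_\infty=\prod_{n\ge0}(1-aq^n)$, $C_q=1/\sqrt{-2\pi\ln q}$, and $$E_q(\tau)=\exp\left(\frac{\ln^2(\tau/\sqrt q)}{2\ln q}\right),\qquad \theta_q(\tau)=(q;q)_\infty(-\tau;q)_\infty(-q/\tau;q)_\infty=\sum_{n=-\infty}^\infty q^{\binom n2}\tau^n,\qquad \mathcal{P}_q(\tau)=-\ln(q)\,C_q\,E_q(\tau)\,\theta_q(\tau).$$ Primes denote derivatives. A function $f$ is $q$-periodic if $f(q\tau)=f(\tau)$. Here $B(t)$ is (the analytic continuation of) a convergent power series $B(t)=\sum_{n\ge0}a_nt^n$ for which the following three $q$-Laplace transforms are defined: $$(\mathcal{L}_{q,E}B)(z)=C_q\int_0^\infty B(t)E_q\!\left(\tfrac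 tz\right)\frac{dt}{t},\quad(\mathcal{L}_{q,\theta}B)(z)=\frac{-1}{\ln q}\int_0^\infty\frac{B(t)}{\theta_q(t/z)}\frac{dt}{t},\quad(\mathcal{L}_{q,\lambda}B)(z)=\sum_{n=-\infty}^\infty\frac{B(q^n\lambda)}{\theta_q(q^n\lambda/z)}.$$ The parameters $\lambda,\lambda_1,\lambda_2$ are nonzero and not in $\{-q^n:n\in\mathbb{Z}\}$, the points $q^n\lambda$ stay away from the singularities of $B$, and $z\notin\{-q^n\lambda:n\in\mathbb{Z}\}$ (similarly for $\lambda_1,\lambda_2$). The functions $\mathcal{L}_{q,E}B$, $\mathcal{L}_{q,\theta}B$, $E_q$, $\mathcal{P}_q$, $\ln$ are multivalued: the formulas are understood with the principal branch for $|\arg z|<\pi$ (with $\ln(\lambda/z)=\ln\lambda-\ln z$) and elsewhere by analytic continuation; $ze^{2\pi i}$ denotes continuation once around the origin in the positive sense. The limits $z\to q^m$ are taken on the principal sheet.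
   Formalization: "Or equivalently" fails as stated (B=1, S=0: connection formulas hold, Cauchy–Heine fails). All conclusions are proved from either hypothesis; Cauchy–Heine is shown equivalent to the connection formulas plus L_{q,θ}B(z)→0 as z→∞ off the negative axis. *)

theory Defs
  imports "HOL-Complex_Analysis.Complex_Analysis" "HOL-Library.Landau_Symbols"
begin

text \<open>
  Points of the Riemann surface of the logarithm are represented by their logarithm:
  \<open>w :: complex\<close> stands for the point over \<open>z = exp w\<close> with \<open>ln z = w\<close>.  The principal sheet
  \<open>\<bar>arg z\<bar> < \<pi>\<close> is \<open>\<bar>Im w\<bar> < pi\<close> (where \<open>w = Ln z\<close>), the point \<open>z e\<^sup>2\<^sup>\<pi>\<^sup>i\<close> is \<open>w + 2 * pi * \<i>\<close>,
  \<open>q z\<close> is \<open>w + ln q\<close>, and \<open>t/z\<close> for \<open>t > 0\<close> is \<open>ln t - w\<close>.  Multivalued functions take such a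
  \<open>w\<close> as argument; single-valued ones take \<open>z\<close>.
\<close>

definition qpoch :: "'a::real_normed_field \<Rightarrow> 'a \<Rightarrow> 'a" where
  "qpoch a q = (\<Prod>n. 1 - a * q ^ n)"

definition qpowers :: "real \<Rightarrow> complex set" where
  "qpowers q = range (\<lambda>n::int. complex_of_real q powi n)"

definition qhat :: "real \<Rightarrow> real" where
  "qhat q = exp (2 * pi\<^sup>2 / ln q)"

definition Cq :: "real \<Rightarrow> real" where
  "Cq q = 1 / sqrt (- 2 * pi * ln q)"

definition Eq :: "real \<Rightarrow> complex \<Rightarrow> complex" where
  "Eq q w = exp ((w - of_real (ln (sqrt q)))\<^sup>2 / of_real (2 * ln q))"

definition thetaq :: "real \<Rightarrow> complex \<Rightarrow> complex" where
  "thetaq q \<tau> = qpoch (of_real q) (of_real q) * qpoch (- \<tau>) (of_real q)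
                 * qpoch (- (of_real q / \<tau>)) (of_real q)"

definition Pq :: "real \<Rightarrow> complex \<Rightarrow> complex" where
  "Pq q w = - of_real (ln q) * of_real (Cq q) * Eq q w * thetaq q (exp w)"

text \<open>The derivative of \<open>Pq\<close> with respect to \<open>\<tau> = exp w\<close>, by the chain rule.\<close>

definition Pq' :: "real \<Rightarrow> complex \<Rightarrow> complex" where
  "Pq' q w = deriv (Pq q) w / exp w"

abbreviation thetaq' :: "real \<Rightarrow> complex \<Rightarrow> complex" where
  "thetaq' q \<equiv> deriv (thetaq q)"

text \<open>The three q-Laplace transforms.  \<open>LapE\<close> and \<open>Laptheta\<close> are used for points of the principal
  sheet only; their values elsewhere are given by \<open>continuations\<close> below.\<close>

definition LapE :: "real \<Rightarrow> (complex \<Rightarrow> complex) \<Rightarrow> complex \<Rightarrow> complex" where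
  "LapE q B w = of_real (Cq q)
     * set_lebesgue_integral lborel {0<..} (\<lambda>t. B (of_real t) * Eq q (of_real (ln t) - w) / of_real t)"

definition LapE_defined :: "real \<Rightarrow> (complex \<Rightarrow> complex) \<Rightarrow> complex \<Rightarrow> bool" where
  "LapE_defined q B w \<longleftrightarrow>
     set_integrable lborel {0<..} (\<lambda>t. B (of_real t) * Eq q (of_real (ln t) - w) / of_real t)"

definition Laptheta :: "real \<Rightarrow> (complex \<Rightarrow> complex) \<Rightarrow> complex \<Rightarrow> complex" where
  "Laptheta q B z = of_real (- 1 / ln q)
     * set_lebesgue_integral lborel {0<..} (\<lambda>t. B (of_real t) / thetaq q (of_real t / z) / of_real t)"

definition Laptheta_defined :: "real \<Rightarrow> (complex \<Rightarrow> complex) \<Rightarrow> complex \<Rightarrow> bool" where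
  "Laptheta_defined q B z \<longleftrightarrow>
     set_integrable lborel {0<..} (\<lambda>t. B (of_real t) / thetaq q (of_real t / z) / of_real t)"

definition Laplam :: "real \<Rightarrow> complex \<Rightarrow> (complex \<Rightarrow> complex) \<Rightarrow> complex \<Rightarrow> complex" where
  "Laplam q lam B z = (\<Sum>\<^sub>\<infinity>n::int. B (of_real q powi n * lam) / thetaq q (of_real q powi n * lam / z))"

definition Laplam_defined :: "real \<Rightarrow> complex \<Rightarrow> (complex \<Rightarrow> complex) \<Rightarrow> complex \<Rightarrow> bool" where
  "Laplam_defined q lam B z \<longleftrightarrow>
     (\<lambda>n::int. B (of_real q powi n * lam) / thetaq q (of_real q powi n * lam / z)) summable_on UNIV"

text \<open>\<open>FE\<close> and \<open>Ft\<close> are the analytic continuations of the first two transforms from the principal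
  sheet to the Riemann surface of the logarithm.  On the other sheets the second one may be
  singular over the points \<open>q\<^sup>m\<close>.  Both domains are connected, so continuations are unique.\<close>

definition continuations ::
    "real \<Rightarrow> (complex \<Rightarrow> complex) \<Rightarrow> (complex \<Rightarrow> complex) \<Rightarrow> (complex \<Rightarrow> complex) \<Rightarrow> bool" where
  "continuations q B FE Ft \<longleftrightarrow>
     FE holomorphic_on UNIV \<and>
     (\<forall>w. \<bar>Im w\<bar> < pi \<longrightarrow> FE w = LapE q B w) \<and>
     Ft holomorphic_on (- {w. exp w \<in> qpowers q \<and> Im w \<noteq> 0}) \<and>
     (\<forall>w. \<bar>Im w\<bar> < pi \<longrightarrow> Ft w = Laptheta q B (exp w))"

definition connection_formulas ::
    "real \<Rightarrow> (complex \<Rightarrow> complex) \<Rightarrow> (complex \<Rightarrow> complex) \<Rightarrow> (complex \<Rightarrow> complex) \<Rightarrow> bool" where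
  "connection_formulas q S FE Ft \<longleftrightarrow>
     (\<forall>w. FE (w + of_real (2 * pi) * \<i>)
            = FE w - of_real (2 * pi * Cq q) * \<i> * S (exp w) * Eq q (w + of_real pi * \<i>)) \<and>
     (\<forall>w. exp w \<notin> qpowers q \<longrightarrow>
          Ft (w + of_real (2 * pi) * \<i>)
            = Ft w + of_real (2 * pi) * \<i> * S (exp w) / (of_real (ln q) * thetaq q (- exp w)))"

definition cauchy_heine :: "real \<Rightarrow> (complex \<Rightarrow> complex) \<Rightarrow> (complex \<Rightarrow> complex) \<Rightarrow> bool" where
  "cauchy_heine q S B \<longleftrightarrow>
     (\<forall>z. z \<notin> \<real>\<^sub>\<le>\<^sub>0 \<longrightarrow>
        set_integrable lborel {0<..} (\<lambda>t. S (- of_real t) / (thetaq q (of_real t) * (of_real t + z))) \<and>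
        Laptheta q B z = of_real (- 1 / ln q)
          * set_lebesgue_integral lborel {0<..}
              (\<lambda>t. S (- of_real t) / (thetaq q (of_real t) * (of_real t + z))))"

text \<open>Order of an entire function, and its type in the sense of exponential type, i.e. relative to
  \<open>exp (\<sigma> \<bar>z\<bar>)\<close>.\<close>

definition entire_order :: "(complex \<Rightarrow> complex) \<Rightarrow> ereal" where
  "entire_order f =
     Inf (ereal ` {\<rho>. 0 \<le> \<rho> \<and> (\<lambda>z. norm (f z)) \<in> O[at_infinity](\<lambda>z. exp (norm z powr \<rho>))})"

definition entire_type :: "(complex \<Rightarrow> complex) \<Rightarrow> ereal" where
  "entire_type f =
     Inf (ereal ` {\<sigma>. 0 \<le> \<sigma> \<and> (\<lambda>z. norm (f z)) \<in> O[at_infinity](\<lambda>z. exp (\<sigma> * norm z))})"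

text \<open>\<open>\<lambda> \<noteq> 0\<close>, \<open>\<lambda> \<notin> {-q\<^sup>n}\<close> and \<open>z \<notin> {-q\<^sup>n \<lambda>}\<close> for \<open>z = exp w\<close>.\<close>

definition admissible :: "real \<Rightarrow> complex \<Rightarrow> complex \<Rightarrow> bool" where
  "admissible q lam w \<longleftrightarrow> lam \<noteq> 0 \<and> - lam \<notin> qpowers q \<and>
     (\<forall>n::int. exp w \<noteq> - (of_real q powi n * lam))"

definition Pd :: "real \<Rightarrow> complex \<Rightarrow> complex \<Rightarrow> complex" where
  "Pd q lam w = lam * thetaq' q lam / thetaq q lam
      - lam * thetaq' q (lam / exp w) / (exp w * thetaq q (lam / exp w)) + w / of_real (ln q)"

text \<open>For \<open>Im w\<close> an odd multiple of \<open>pi\<close> the integrand has one removable singularity in \<open>[q, 1]\<close>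
  (or one at each endpoint), so this formula makes sense on every sheet.\<close>

definition Pc :: "real \<Rightarrow> complex \<Rightarrow> complex" where
  "Pc q w = of_real (- 1 / ln q)
     * set_lebesgue_integral lborel {q..1}
         (\<lambda>t. Pq q (of_real (ln t) - w) * Pd q (of_real t) w / of_real t)"

text \<open>Summands (for \<open>n \<ge> 1\<close>) of the series for \<open>Pc\<close> and of the series in its limits at \<open>q\<^sup>m\<close>.\<close>

definition Pc_term :: "real \<Rightarrow> complex \<Rightarrow> nat \<Rightarrow> complex" where
  "Pc_term q w n = of_real ((- 1) ^ n * qhat q ^ n\<^sup>2)
     * sin (of_real (2 * pi * real n) * (w / of_real (ln q))) / of_real (sinh (real n * ln (qhat q)))"

definition limit_term :: "real \<Rightarrow> nat \<Rightarrow> real" where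
  "limit_term q n = (- 1) ^ n * qhat q ^ n\<^sup>2 * (real n / sinh (real n * ln (qhat q)))"

definition removable_singularity_at :: "(complex \<Rightarrow> complex) \<Rightarrow> complex \<Rightarrow> bool" where
  "removable_singularity_at f z \<longleftrightarrow>
     (\<exists>g. g analytic_on {z} \<and> (\<forall>\<^sub>F x in at z. g x = f x))"

end

theory Submission
 imports Defs "HOL-Probability.Distributions"
begin

text \<open>
Everything rests on one discrete identity. Write \<open>L = ln q\<close>, let \<open>P\<close> be the \<open>q\<close>-periodic function
\<open>Pq\<close> and \<open>Q\<close> its logarithmic derivative in the coordinate \<open>u = ln \<tau>\<close>, so that
\<open>Pd (exp l) w = Q l - Q (l - w)\<close>. For the model kernel \<open>1 / (1 + t / q)\<close> the discrete transform is an
Appell-Lerch series in \<open>\<lambda> = exp l\<close> and \<open>z = exp w\<close>. As a function of \<open>l\<close> it is elliptic with periods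
\<open>L\<close> and \<open>2 \<pi> \<i>\<close>, and its poles are those of \<open>- Pd / \<theta> (- z)\<close>; by Liouville the sum with
\<open>Pd / \<theta> (- z)\<close> does not depend on \<open>l\<close> (\<open>AL_Pd_constant\<close>).

The growth condition says, through Cauchy's estimates on the circles of radius \<open>q powi (- m)\<close>, that
\<open>S z / \<theta> (- z)\<close> is a geometrically convergent sum of the functions \<open>1 / \<theta> (- q ^ m * z)\<close>. Summing the
model identity at the points \<open>q ^ m * z\<close> gives a kernel \<open>B1\<close> with simple poles, all of whose discrete
transforms are \<open>\<kappa> - Pd * S z / \<theta> (- z)\<close> with a common \<open>\<kappa>\<close> (\<open>B1_lattice\<close>). The two integral
transforms are integrals over the line in \<open>s = ln t\<close>. Folding them modulo \<open>L\<close> makes them means of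
the discrete transforms over a period, with weight \<open>P (s - w)\<close> for the Gaussian and constant weight
for the theta kernel (\<open>fold_GE\<close>, \<open>fold_GT\<close>). The mean of \<open>Pd\<close> is zero for the constant weight and is
\<open>Pc\<close> by definition for the other, and this yields both difference formulas. The monodromy of
\<open>\<kappa>\<close>, which is that of \<open>ln z / L\<close>, and that of \<open>Pc\<close> give the connection formulas.

It remains to see that either hypothesis forces \<open>B = B1\<close> up to a harmless summand. A reflection of
the integration variable shows that the Cauchy-Heine integral is the theta transform of \<open>B1\<close>
(\<open>CHI_GT\<close>), and \<open>q\<close>-Laplace transforms at the powers of \<open>q\<close> determine a kernel that is analytic at the
origin (\<open>transform_uniqueness\<close>). Under the connection formulas the Gaussian transforms of \<open>B\<close> and
\<open>B1\<close> differ by a function without monodromy, bounded at the origin, that is, by an entire function of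
\<open>z\<close>. Such a function is the common value of all three transforms of an entire kernel \<open>B2\<close>, so it
drops out of every difference. The normalization at infinity removes it, since the
Cauchy-Heine integral tends to zero there (\<open>CHI_tendsto\<close>).

The closed forms of \<open>Pc\<close> come from theta inversion: \<open>P\<close> has a Fourier series in \<open>u / L\<close> with theta
coefficients of nome \<open>qhat q\<close>, and the Fourier coefficients of \<open>Q\<close> are reciprocal hyperbolic sines.
\<close>

section \<open>The q-Pochhammer symbol\<close>

text \<open>The weight \<open>q\<close> to the power \<open>n\<close> choose 2, for every integer \<open>n\<close>; the division is exact.\<close>

definition qb :: "real \<Rightarrow> int \<Rightarrow> real" where
 "qb q n = q powi (n * (n - 1) div 2)"

locale qbase =
 fixes q :: real
 assumes q_pos: "0 < q" and q_less_1: "q < 1"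
begin

abbreviation qc :: complex where "qc \<equiv> of_real q"
abbreviation L :: real where "L \<equiv> ln q"
abbreviation \<theta> :: "complex \<Rightarrow> complex" where "\<theta> \<equiv> thetaq q"
abbreviation qpc :: "complex \<Rightarrow> complex" where "qpc a \<equiv> qpoch a qc"

definition g :: "complex \<Rightarrow> complex" where "g \<tau> = \<tau> * deriv \<theta> \<tau> / \<theta> \<tau>"

lemma L_neg: "L < 0"
 using q_pos q_less_1 by simp

lemma qc_nz [simp]: "qc ~= 0"
 using q_pos by simp

lemma q_nz [simp]: "q ~= 0"
 using q_pos by simp

lemma norm_qc [simp]: "norm qc = q"
 using q_pos by simp

lemma exp_L [simp]: "exp (of_real L) = qc"
 by (metis exp_ln exp_of_real q_pos)

lemma convergent_qpoch: "convergent_prod (%n. 1 - a * qc ^ n)"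
proof (intro abs_convergent_prod_imp_convergent_prod summable_imp_abs_convergent_prod)
 show "summable (%i. norm (1 - a * qc ^ i - 1))"
  using q_pos q_less_1
  by (auto simp: norm_mult norm_power intro!: summable_mult summable_geometric)
qed

lemma has_prod_qpoch: "(%n. 1 - a * qc ^ n) has_prod qpc a"
 unfolding qpoch_def by (rule convergent_prod_has_prod[OF convergent_qpoch])

lemma qpoch_rec: "qpc a = (1 - a) * qpc (a * qc)"
proof -
 have "(%n. 1 - a * qc ^ Suc n) has_prod qpc (a * qc)"
  using has_prod_qpoch[of "a * qc"] by (simp add: mult.assoc)
 from has_prod_Suc_imp[OF this] have "(%n. 1 - a * qc ^ n) has_prod (qpc (a * qc) * (1 - a))"
  by simp
 from has_prod_unique2[OF has_prod_qpoch this] show ?thesis by (simp only: mult.commute)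
qed

lemma qpoch_eq_0_iff: "qpc a = 0 \<longleftrightarrow> (\<exists>n::nat. a * qc ^ n = 1)"
proof -
 have "qpc a = 0 \<longleftrightarrow> (\<exists>n. 1 - a * qc ^ n = 0)"
  unfolding has_prod_eq_0_iff[OF has_prod_qpoch[of a]] image_iff by (metis UNIV_I)
 thus ?thesis by (simp add: eq_commute[of 1])
qed

lemma qpoch_qc_nz [simp]: "qpc qc ~= 0"
proof
 assume "qpc qc = 0"
 then obtain n where "qc * qc ^ n = 1" by (auto simp: qpoch_eq_0_iff)
 hence "norm (qc ^ Suc n) = 1" by simp
 hence "q ^ Suc n = 1" by (simp only: norm_power norm_qc)
 moreover have "q ^ Suc n < 1" by (rule power_Suc_less_one) (use q_pos q_less_1 in auto)
 ultimately show False by linarith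
qed

lemma convergent_qpoch_real: "convergent_prod (%n. 1 - x * q ^ n)" for x :: real
proof -
 have "(%i. norm ((1 - x * q ^ i) - 1)) = (%i. \<bar>x\<bar> * q ^ i)"
  using q_pos by (auto simp: abs_mult)
 moreover have "summable (%i. \<bar>x\<bar> * q ^ i)"
  using q_pos q_less_1 by (intro summable_mult summable_geometric) auto
 ultimately have "summable (%i. norm ((1 - x * q ^ i) - 1))" by metis
 from abs_convergent_prod_imp_convergent_prod[OF summable_imp_abs_convergent_prod[OF this]]
 show ?thesis .
qed

lemma qpoch_of_real: "qpc (of_real x) = of_real (qpoch x q)"
proof -
 have 1: "(%n. 1 - x * q ^ n) has_prod qpoch x q"
  unfolding qpoch_def by (rule convergent_prod_has_prod[OF convergent_qpoch_real])
 have "(%n. of_real (1 - x * q ^ n) :: complex) has_prod of_real (qpoch x q)"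
  by (subst has_prod_of_real_iff) (rule 1)
 moreover have "(%n. of_real (1 - x * q ^ n) :: complex) = (%n. 1 - of_real x * qc ^ n)"
  by (simp only: of_real_diff of_real_mult of_real_power of_real_1)
 ultimately have "(%n. 1 - of_real x * qc ^ n) has_prod (of_real (qpoch x q) :: complex)"
  by (simp only:)
 from has_prod_unique2[OF has_prod_qpoch this] show ?thesis .
qed

lemma uniform_limit_qpoch:
 assumes "compact A"
 shows "uniform_limit A (%n a. \<Prod>k<n. 1 - a * qc ^ k) qpc sequentially"
proof -
 obtain R where R: "\<And>a. a \<in> A ==> norm a \<le> R"
  using compact_imp_bounded[OF assms] by (auto simp: bounded_iff)
 have "uniformly_convergent_on A (%N a. \<Sum>n<N. norm (1 - a * qc ^ n - 1))"
 proof (rule Weierstrass_m_test')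
  show "norm (norm (1 - a * qc ^ n - 1)) \<le> R * q ^ n" if "a \<in> A" for n a
   using R[OF that] q_pos by (auto simp: norm_mult norm_power intro!: mult_right_mono)
  show "summable (%n. R * q ^ n)"
   using q_pos q_less_1 by (auto intro!: summable_mult summable_geometric)
 qed
 hence "uniformly_convergent_on A (%n a. \<Prod>k<n. 1 - a * qc ^ k)"
  by (intro uniformly_convergent_on_prod' assms continuous_intros)
 hence "uniform_limit A (%n a. \<Prod>k<n. 1 - a * qc ^ k)
     (%a. lim (%n. \<Prod>k<n. 1 - a * qc ^ k)) sequentially"
  by (simp add: uniformly_convergent_uniform_limit_iff)
 moreover have "lim (%n. \<Prod>k<n. 1 - a * qc ^ k) = qpc a" for a
 proof (rule limI)
  show "(%n. \<Prod>k<n. 1 - a * qc ^ k) \<longlonglongrightarrow> qpc a"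
   unfolding qpoch_def using convergent_prod_LIMSEQ[OF convergent_qpoch[of a]]
   by (simp add: LIMSEQ_lessThan_iff_atMost)
 qed
 ultimately show ?thesis by simp
qed

lemma holomorphic_qpoch: "qpc holomorphic_on UNIV"
proof (rule holomorphic_uniform_sequence)
 show "(%a. \<Prod>k<n. 1 - a * qc ^ k) holomorphic_on UNIV" for n
  by (intro holomorphic_intros)
 show "\<exists>d>0. cball x d \<subseteq> UNIV \<and>
     uniform_limit (cball x d) (%n a. \<Prod>k<n. 1 - a * qc ^ k) qpc sequentially" for x
  by (intro exI[of _ 1]) (auto intro: uniform_limit_qpoch)
qed auto

lemmas holomorphic_qpoch' [holomorphic_intros] =
 holomorphic_on_compose_gen[OF _ holomorphic_qpoch, unfolded o_def, simplified]

lemma field_differentiable_qpoch: "qpc field_differentiable at a"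
 using holomorphic_qpoch holomorphic_on_imp_differentiable_at by blast

lemma logderiv_qpoch:
 assumes "qpc a ~= 0"
 shows "(%k. a * qc ^ k / (1 - a * qc ^ k)) sums (- a * deriv qpc a / qpc a)"
proof -
 have "(%k. deriv (%x. 1 - x * qc ^ k) a / (1 - a * qc ^ k)) sums (deriv qpc a / qpc a)"
 proof (rule logderiv_prodinf_complex_uniform_limit)
  show "uniform_limit (ball a 1) (%n x. \<Prod>k<n. 1 - x * qc ^ k) qpc sequentially"
   by (rule uniform_limit_on_subset[OF uniform_limit_qpoch[of "cball a 1"]]) auto
 qed (use assms in \<open>auto intro!: holomorphic_intros\<close>)
 also have "(%k. deriv (%x. 1 - x * qc ^ k) a) = (%k. - (qc ^ k))"
  by (auto intro!: DERIV_imp_deriv derivative_eq_intros)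
 finally have "(%k. - a * (- (qc ^ k) / (1 - a * qc ^ k))) sums (- a * (deriv qpc a / qpc a))"
  by (rule sums_mult)
 thus ?thesis by simp
qed

section \<open>The theta function\<close>

lemma theta_eq: "\<theta> \<tau> = qpc qc * qpc (-\<tau>) * qpc (- (qc / \<tau>))"
 by (simp add: thetaq_def)

lemma theta_0 [simp]: "\<theta> 0 = qpc qc"
proof -
 have "qpc 0 = 1" by (simp add: qpoch_def)
 thus ?thesis by (simp add: theta_eq)
qed

lemma theta_q: "\<tau> ~= 0 ==> \<theta> (qc * \<tau>) = \<theta> \<tau> / \<tau>"
proof -
 assume \<tau>: "\<tau> ~= 0"
 have 1: "qpc (-\<tau>) = (1 + \<tau>) * qpc (- (qc * \<tau>))"
  using qpoch_rec[of "-\<tau>"] by (simp add: mult.commute)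
 have 2: "qpc (- (1/\<tau>)) = (1 + 1/\<tau>) * qpc (- (qc/\<tau>))"
  using qpoch_rec[of "-(1/\<tau>)"] by (simp add: mult.commute)
 have "\<theta> (qc * \<tau>) = qpc qc * qpc (- (qc * \<tau>)) * qpc (- (1/\<tau>))"
  by (simp add: theta_eq)
 also have "\<dots> = qpc qc * ((1 + \<tau>) * qpc (- (qc * \<tau>))) * qpc (- (qc/\<tau>)) / \<tau>"
  unfolding 2 using \<tau> by (simp add: field_simps)
 also have "\<dots> = \<theta> \<tau> / \<tau>"
  by (simp add: theta_eq 1)
 finally show ?thesis .
qed

lemma theta_qc_div: "\<theta> (qc / \<tau>) = \<theta> \<tau>" if "\<tau> ~= 0"
proof -
 have "qc / (qc / \<tau>) = \<tau>" using that by simp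
 thus ?thesis by (simp only: theta_eq mult_ac)
qed

lemma theta_inverse: "\<theta> (1 / \<tau>) = \<theta> \<tau> / \<tau>" if "\<tau> ~= 0"
proof -
 have "\<theta> (qc / \<tau>) = \<theta> (1 / \<tau>) * \<tau>"
  using theta_q[of "1/\<tau>"] that by simp
 thus ?thesis using theta_qc_div[OF that] that by simp
qed

lemma tri_succ: "(n + 1) * (n + 1 - 1) div 2 = n * (n - 1) div 2 + (n::int)"
proof -
 have "(n + 1) * (n + 1 - 1) = n * (n - 1) + n * 2" by (simp add: algebra_simps)
 thus ?thesis by simp
qed

lemma tri_double: "2 * (n * (n - 1) div 2) = n * (n - 1::int)"
 by (rule dvd_mult_div_cancel) auto

lemma tri_add: "(m + n) * (m + n - 1) div 2 = m * (m - 1) div 2 + n * (n - 1) div 2 + m * (n::int)"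
proof -
 have "2 * ((m + n) * (m + n - 1) div 2)
   = 2 * (m * (m - 1) div 2 + n * (n - 1) div 2 + m * (n::int))"
  unfolding tri_double distrib_left by (simp add: algebra_simps)
 thus ?thesis by (subst (asm) mult_cancel_left) auto
qed

lemma qb_pos: "qb q n > 0"
 using q_pos by (simp add: qb_def)

lemma qb_nz [simp]: "qb q n ~= 0"
 using qb_pos[of n] by simp

lemma qb_0 [simp]: "qb q 0 = 1" and qb_1 [simp]: "qb q 1 = 1"
 by (auto simp: qb_def)

lemma qb_Suc: "qb q (n + 1) = qb q n * q powi n"
 using q_pos unfolding qb_def tri_succ by (simp add: power_int_add)

lemma qb_add: "qb q (m + n) = qb q m * qb q n * q powi (m * n)"
 using q_pos unfolding qb_def tri_add by (simp add: power_int_add)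

lemma qb_refl: "qb q (1 - n) = qb q n"
proof -
 have "(1 - n) * (1 - n - 1) = n * (n - 1)" by (simp add: algebra_simps)
 thus ?thesis by (simp add: qb_def)
qed

lemma theta_powi: "\<tau> ~= 0 ==> \<theta> (qc powi n * \<tau>) = \<theta> \<tau> / (\<tau> powi n * of_real (qb q n))"
proof (induction n rule: int_induct[where k = 0])
 case base
 thus ?case by simp
next
 case (step1 n)
 have "\<theta> (qc powi (n + 1) * \<tau>) = \<theta> (qc * (qc powi n * \<tau>))"
  by (simp add: power_int_add mult_ac)
 also have "\<dots> = \<theta> (qc powi n * \<tau>) / (qc powi n * \<tau>)"
  by (rule theta_q) (use step1 in auto)
 also have "\<dots> = \<theta> \<tau> / (\<tau> powi (n + 1) * of_real (qb q (n + 1)))"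
  using step1 by (simp add: power_int_add qb_Suc mult_ac of_real_power_int)
 finally show ?case .
next
 case (step2 n)
 have "\<theta> (qc powi n * \<tau>) = \<theta> (qc * (qc powi (n - 1) * \<tau>))"
  by (simp add: power_int_diff)
 also have "\<dots> = \<theta> (qc powi (n - 1) * \<tau>) / (qc powi (n - 1) * \<tau>)"
  by (rule theta_q) (use step2 in auto)
 finally have "\<theta> (qc powi (n - 1) * \<tau>) = \<theta> (qc powi n * \<tau>) * (qc powi (n - 1) * \<tau>)"
  using step2.prems by simp
 also have "\<dots> = \<theta> \<tau> / (\<tau> powi n * of_real (qb q n)) * (qc powi (n - 1) * \<tau>)"
  using step2 by simp
 also have "qb q n = qb q (n - 1) * q powi (n - 1)"
  using qb_Suc[of "n - 1"] by simp
 finally show ?case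
  using step2.prems by (simp add: power_int_diff of_real_power_int field_simps)
qed

lemma theta_eq_0_iff: "\<theta> \<tau> = 0 \<longleftrightarrow> -\<tau> \<in> qpowers q"
proof
 assume z: "\<theta> \<tau> = 0"
 hence \<tau>: "\<tau> ~= 0" by auto
 from z consider "qpc (-\<tau>) = 0" | "qpc (- (qc / \<tau>)) = 0" by (auto simp: theta_eq)
 thus "-\<tau> \<in> qpowers q"
 proof cases
  case 1
  then obtain n::nat where "- \<tau> * qc ^ n = 1" by (auto simp: qpoch_eq_0_iff)
  hence "-\<tau> = qc powi (- int n)" by (auto simp: power_int_minus field_simps)
  thus ?thesis unfolding qpowers_def by (rule image_eqI) auto
 next
  case 2
  then obtain n::nat where "- (qc / \<tau>) * qc ^ n = 1" by (auto simp: qpoch_eq_0_iff)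
  hence "-\<tau> = qc ^ Suc n" using \<tau> by (auto simp: field_simps)
  hence "-\<tau> = qc powi (int (Suc n))" by (simp only: power_int_of_nat)
  thus ?thesis unfolding qpowers_def by (rule image_eqI) auto
 qed
next
 assume "-\<tau> \<in> qpowers q"
 then obtain n where "-\<tau> = qc powi n" by (auto simp: qpowers_def)
 hence \<tau>: "\<tau> = qc powi n * (-1)" by (metis minus_minus mult_minus1_right)
 have "qpc 1 = 0" unfolding qpoch_eq_0_iff by (rule exI[of _ 0]) simp
 hence "\<theta> (-1) = 0" by (simp add: theta_eq)
 thus "\<theta> \<tau> = 0" unfolding \<tau> by (subst theta_powi) auto
qed

lemma theta_minus1 [simp]: "\<theta> (-1) = 0"
 unfolding theta_eq_0_iff qpowers_def by (rule image_eqI[of _ _ 0]) auto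

lemma qpowers_real_pos: "x \<in> qpowers q ==> \<exists>t>0. x = of_real t"
proof -
 assume "x \<in> qpowers q"
 then obtain n where "x = qc powi n" by (auto simp: qpowers_def)
 hence "x = of_real (q powi n)" by (simp only: of_real_power_int)
 moreover have "q powi n > 0" using q_pos by simp
 ultimately show ?thesis by blast
qed

lemma theta_nz_pos: "t > 0 ==> \<theta> (of_real t) ~= 0"
proof
 assume "t > 0" "\<theta> (of_real t) = 0"
 then obtain s where "s > 0" "- complex_of_real t = of_real s"
  using qpowers_real_pos theta_eq_0_iff by blast
 hence "s = -t" by (metis of_real_eq_iff of_real_minus)
 with \<open>t > 0\<close> \<open>s > 0\<close> show False by simp
qed

lemma holomorphic_theta: "\<theta> holomorphic_on -{0}"
proof -
 have "(%\<tau>. qpc qc * qpc (-\<tau>) * qpc (- (qc / \<tau>))) holomorphic_on -{0}"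
  by (intro holomorphic_intros) auto
 thus ?thesis by (simp add: theta_eq[abs_def])
qed

lemma holomorphic_theta' [holomorphic_intros]:
 assumes "f holomorphic_on A" "\<And>x. x \<in> A ==> f x ~= 0"
 shows "(%x. \<theta> (f x)) holomorphic_on A"
proof -
 have "f ` A \<subseteq> -{0}" using assms(2) by auto
 from holomorphic_on_compose_gen[OF assms(1) holomorphic_theta this]
 show ?thesis by (simp only: o_def)
qed

lemma theta_field_derivative: "\<tau> ~= 0 ==> (\<theta> has_field_derivative deriv \<theta> \<tau>) (at \<tau>)"
 by (rule holomorphic_derivI[OF holomorphic_theta]) (auto simp: open_Compl)

lemma theta_deriv_minus1: "(\<theta> has_field_derivative qpc qc ^ 3) (at (-1))"
proof -
 define h where "h = (%\<tau>. qpc qc * qpc (- (qc * \<tau>)) * qpc (- (qc / \<tau>)))"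
 have h: "h holomorphic_on -{0}"
  unfolding h_def by (intro holomorphic_intros) auto
 have "(h has_field_derivative deriv h (-1)) (at (-1))"
  by (rule holomorphic_derivI[OF h]) (auto simp: open_Compl)
 hence "((%\<tau>. (1 + \<tau>) * h \<tau>) has_field_derivative h (-1)) (at (-1))"
  by (auto intro!: derivative_eq_intros)
 moreover have "(%\<tau>. (1 + \<tau>) * h \<tau>) = \<theta>"
 proof
  fix \<tau>
  have "qpc (-\<tau>) = (1 + \<tau>) * qpc (- (qc * \<tau>))"
   using qpoch_rec[of "-\<tau>"] by (simp add: mult.commute)
  thus "(1 + \<tau>) * h \<tau> = \<theta> \<tau>" by (simp add: h_def theta_eq mult_ac)
 qed
 moreover have "h (-1) = qpc qc ^ 3" by (simp add: h_def power3_eq_cube)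
 ultimately show ?thesis by simp
qed

lemma g_sums:
 assumes \<tau>: "\<tau> ~= 0" and nz: "\<theta> \<tau> ~= 0"
 shows "(%k. \<tau> * qc ^ k / (1 + \<tau> * qc ^ k) - (qc / \<tau>) * qc ^ k / (1 + qc / \<tau> * qc ^ k)) sums g \<tau>"
proof -
 from nz have nz1: "qpc (-\<tau>) ~= 0" and nz2: "qpc (- (qc / \<tau>)) ~= 0"
  by (auto simp: theta_eq)
 define D where "D = deriv qpc"
 have [derivative_intros]: "((%x. qpc (f x)) has_field_derivative D (f x) * f') (at x)"
  if "(f has_field_derivative f') (at x)" for f f' x
  using DERIV_chain[OF field_differentiable_derivI[OF field_differentiable_qpoch[of "f x"]] that]
  by (simp add: o_def D_def)
 have "(\<theta> has_field_derivative
     qpc qc * (- D (-\<tau>) * qpc (- (qc / \<tau>)) + qpc (-\<tau>) * (D (- (qc/\<tau>)) * (qc/\<tau>^2)))) (at \<tau>)"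
  unfolding theta_eq[abs_def] using \<tau>
  by (auto intro!: derivative_eq_intros simp: field_simps power2_eq_square)
 hence "deriv \<theta> \<tau> = qpc qc * (- D (-\<tau>) * qpc (- (qc / \<tau>)) + qpc (-\<tau>) * (D (- (qc/\<tau>)) * (qc/\<tau>^2)))"
  by (rule DERIV_imp_deriv)
 hence "g \<tau> = - (- (-\<tau>) * D (-\<tau>) / qpc (-\<tau>)) + (- (- (qc/\<tau>)) * D (- (qc/\<tau>)) / qpc (- (qc/\<tau>)))"
  using nz1 nz2 \<tau> unfolding g_def theta_eq by (simp add: field_simps power2_eq_square)
 moreover have "(%k. - ((-\<tau>) * qc ^ k / (1 - (-\<tau>) * qc ^ k))) sums
   (- (- (-\<tau>) * D (-\<tau>) / qpc (-\<tau>)))"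
  using sums_minus[OF logderiv_qpoch[OF nz1]] by (simp add: D_def)
 moreover have "(%k. (- (qc/\<tau>)) * qc ^ k / (1 - (- (qc/\<tau>)) * qc ^ k)) sums
   (- (- (qc/\<tau>)) * D (- (qc/\<tau>)) / qpc (- (qc/\<tau>)))"
  using logderiv_qpoch[OF nz2] by (simp add: D_def)
 ultimately show ?thesis
  using sums_add by fastforce
qed

end

section \<open>The Jacobi triple product\<close>

lemma has_sum_int_halves:
 fixes f :: "int \<Rightarrow> 'a::banach"
 assumes "summable (%m. norm (f (int m)))" "summable (%m. norm (f (- int m - 1)))"
 shows "(f has_sum ((\<Sum>m. f (int m)) + (\<Sum>m. f (- int m - 1)))) UNIV"
proof -
 have 1: "((%m. f (int m)) has_sum (\<Sum>m. f (int m))) UNIV"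
  by (rule norm_summable_imp_has_sum[OF assms(1)])
   (use summable_norm_cancel[OF assms(1)] summable_sums in blast)
 have 2: "((%m. f (- int m - 1)) has_sum (\<Sum>m. f (- int m - 1))) UNIV"
  by (rule norm_summable_imp_has_sum[OF assms(2)])
   (use summable_norm_cancel[OF assms(2)] summable_sums in blast)
 have b1: "bij_betw int UNIV {0..}"
  by (rule bij_betwI[of _ _ _ nat]) auto
 have b2: "bij_betw (%m. - int m - 1) UNIV {..<0}"
  by (rule bij_betwI[of _ _ _ "%n. nat (- n - 1)"]) auto
 have "(f has_sum (\<Sum>m. f (int m))) {0..}"
  using 1 has_sum_reindex_bij_betw[OF b1, of f] by blast
 moreover have "(f has_sum (\<Sum>m. f (- int m - 1))) {..<0}"
  using 2 has_sum_reindex_bij_betw[OF b2, of f] by blast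
 ultimately have "(f has_sum ((\<Sum>m. f (int m)) + (\<Sum>m. f (- int m - 1)))) ({0..} \<union> {..<0})"
  by (rule has_sum_Un_disjoint) auto
 moreover have "{0..} \<union> {..<0} = (UNIV :: int set)" by auto
 ultimately show ?thesis by simp
qed

context qbase
begin

lemma summable_qb_pos: "summable (%m. qb q (int m) * r ^ m)" if "r \<ge> 0"
proof -
 have "(%n. q ^ n * r) \<longlonglongrightarrow> 0 * r"
  using q_pos q_less_1 by (intro tendsto_mult tendsto_const LIMSEQ_realpow_zero) auto
 hence "eventually (%n. q ^ n * r < 1/2) sequentially"
  by (rule order_tendstoD) simp
 then obtain N where N: "\<And>n. n \<ge> N ==> q ^ n * r < 1/2"
  by (auto simp: eventually_sequentially)
 show ?thesis
 proof (rule summable_ratio_test[of "1/2" N])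
  fix n assume n: "n \<ge> N"
  have "qb q (int (Suc n)) = qb q (int n) * q ^ n"
   using qb_Suc[of "int n"] by (simp add: add.commute)
  hence "norm (qb q (int (Suc n)) * r ^ Suc n) = (q ^ n * r) * (qb q (int n) * r ^ n)"
   using that qb_pos[of "int n"] q_pos by (simp add: abs_mult)
  also have "\<dots> \<le> 1/2 * (qb q (int n) * r ^ n)"
   using N[OF n] that less_imp_le[OF qb_pos[of "int n"]] by (intro mult_right_mono) auto
  finally show "norm (qb q (int (Suc n)) * r ^ Suc n) \<le> 1/2 * norm (qb q (int n) * r ^ n)"
   using that less_imp_le[OF qb_pos[of "int n"]] by (simp add: abs_mult)
 qed simp
qed

lemma qb_neg_index: "qb q (- int m - 1) = qb q (int m) * (q * q ^ m * q ^ m)"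
proof -
 have "qb q (- int m - 1) = qb q (1 - (- int m - 1))" by (rule qb_refl[symmetric])
 also have "1 - (- int m - 1) = (int m + 1) + 1" by simp
 also have "qb q \<dots> = qb q (int m) * (q powi int m * q powi (int m + 1))"
  by (simp only: qb_Suc mult.assoc)
 also have "q powi int m * q powi (int m + 1) = q * q ^ m * q ^ m"
  by (simp add: power_int_add)
 finally show ?thesis .
qed

lemma summable_qb_neg: "summable (%m. qb q (- int m - 1) * r powi (- int m - 1))" if "r > 0"
proof (rule summable_comparison_test')
 show "summable (%m. 1 / r * (qb q (int m) * (1 / r) ^ m))"
  using that by (intro summable_mult summable_qb_pos) auto
 fix m :: nat
 have "qb q (- int m - 1) \<le> qb q (int m)"
  unfolding qb_neg_index using q_pos q_less_1 less_imp_le[OF qb_pos[of "int m"]]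
  by (intro mult_left_le mult_le_one power_le_one) auto
 moreover have "r powi (- int m - 1) = 1 / r * (1 / r) ^ m"
  using that by (simp add: power_int_diff power_int_minus power_one_over field_simps)
 ultimately show "norm (qb q (- int m - 1) * r powi (- int m - 1)) \<le> 1 / r * (qb q (int m) * (1 / r) ^ m)"
  using that less_imp_le[OF qb_pos[of "- int m - 1"]]
  by (simp add: abs_mult mult_right_mono divide_right_mono power_one_over)
qed

definition qfac :: "nat \<Rightarrow> complex" where "qfac n = (\<Prod>k<n. 1 - qc * qc ^ k)"

lemma qfac_nz: "qfac n ~= 0"
proof -
 have "qc * qc ^ k ~= 1" for k using qpoch_qc_nz unfolding qpoch_eq_0_iff by blast
 thus ?thesis by (simp add: qfac_def)
qed

lemma qfac_0 [simp]: "qfac 0 = 1"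
 by (simp add: qfac_def)

lemma qfac_Suc: "qfac (Suc n) = qfac n * (1 - qc ^ Suc n)"
 by (simp add: qfac_def)

lemma q_binomial:
 "(\<Prod>k<n. 1 + x * qc ^ k) =
  (\<Sum>j\<le>n. qfac n / (qfac j * qfac (n - j)) * of_real (qb q (int j)) * x ^ j)"
proof (induction n)
 case 0
 show ?case by (simp add: qfac_def)
next
 case (Suc n)
 define B where "B = (%n j. if j \<le> n then qfac n / (qfac j * qfac (n - j)) else 0)"
 have pascal: "B (Suc n) (Suc j) = B n (Suc j) + qc ^ (n - j) * B n j" if "j \<le> n" for j
 proof (cases "j = n")
  case True
  thus ?thesis using qfac_nz by (simp add: B_def)
 next
  case False
  with that have jn: "j < n" by simp
  then obtain d where d: "n = j + Suc d" using less_imp_Suc_add by fastforce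
  have "B (Suc n) (Suc j) = qfac n * (1 - qc ^ Suc n) / (qfac (Suc j) * qfac (Suc d))"
   using d by (simp add: B_def qfac_Suc)
  moreover have "B n (Suc j) = qfac n / (qfac (Suc j) * qfac d)"
   using d by (simp add: B_def)
  moreover have "B n j = qfac n / (qfac j * qfac (Suc d))"
   using d by (simp add: B_def)
  moreover have "1 - qc ^ Suc d ~= 0" "1 - qc ^ Suc j ~= 0"
   using qfac_nz[of "Suc d"] qfac_nz[of "Suc j"] qfac_Suc by auto
  moreover have "n - j = Suc d" "qc ^ Suc n = qc ^ Suc d * qc ^ Suc j"
   using d by (auto simp: power_add)
  moreover have "u * (1 - X * Y) / (a * (1 - Y) * (b * (1 - X))) = u / (a * (1 - Y) * b) + X * (u / (a * (b * (1 - X))))"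
   if "a ~= 0" "b ~= 0" "1 - X ~= 0" "1 - Y ~= 0" for u X Y a b :: complex
   using that by (simp add: divide_simps) (simp add: algebra_simps)
  ultimately show ?thesis using qfac_nz[of j] qfac_nz[of d]
   by (simp only: qfac_Suc) (simp only: not_False_eq_True)
 qed
 define c where "c = (%j. complex_of_real (qb q (int j)))"
 have c_Suc: "c (Suc j) = c j * qc ^ j" for j
  using qb_Suc[of "int j"] by (simp add: c_def add.commute)
 have IH: "(\<Prod>k<n. 1 + x * qc ^ k) = (\<Sum>j\<le>n. B n j * c j * x ^ j)"
  unfolding Suc.IH by (intro sum.cong) (auto simp: B_def c_def)
 have "(\<Prod>k<Suc n. 1 + x * qc ^ k) = (\<Sum>j\<le>n. B n j * c j * x ^ j) * (1 + x * qc ^ n)"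
  by (simp add: IH)
 also have "\<dots> = (\<Sum>j\<le>n. B n j * c j * x ^ j) + (\<Sum>j\<le>n. qc ^ n * B n j * c j * x ^ Suc j)"
  by (simp add: distrib_left sum_distrib_right sum_distrib_left sum.distrib mult_ac)
 also have "(\<Sum>j\<le>n. B n j * c j * x ^ j) = (\<Sum>j\<le>Suc n. B n j * c j * x ^ j)"
  by (simp add: B_def)
 also have "\<dots> = B n 0 * c 0 + (\<Sum>j\<le>n. B n (Suc j) * c (Suc j) * x ^ Suc j)"
  by (subst sum.atMost_Suc_shift) simp
 also have "(\<Sum>j\<le>n. qc ^ n * B n j * c j * x ^ Suc j)
   = (\<Sum>j\<le>n. qc ^ (n - j) * B n j * c (Suc j) * x ^ Suc j)"
 proof (intro sum.cong refl)
  fix j assume "j \<in> {..n}"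
  hence "qc ^ n = qc ^ (n - j) * qc ^ j" by (simp flip: power_add)
  thus "qc ^ n * B n j * c j * x ^ Suc j = qc ^ (n - j) * B n j * c (Suc j) * x ^ Suc j"
   by (simp add: c_Suc)
 qed
 also have "B n 0 * c 0 + (\<Sum>j\<le>n. B n (Suc j) * c (Suc j) * x ^ Suc j) + \<dots>
   = B n 0 * c 0 + (\<Sum>j\<le>n. B (Suc n) (Suc j) * c (Suc j) * x ^ Suc j)"
  by (simp add: pascal sum.distrib distrib_right add.assoc)
 also have "B n 0 = B (Suc n) 0" using qfac_nz by (simp add: B_def)
 also have "B (Suc n) 0 * c 0 + (\<Sum>j\<le>n. B (Suc n) (Suc j) * c (Suc j) * x ^ Suc j)
   = (\<Sum>j\<le>Suc n. B (Suc n) j * c j * x ^ j)"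
  by (subst sum.atMost_Suc_shift) simp
 also have "\<dots> = (\<Sum>j\<le>Suc n. qfac (Suc n) / (qfac j * qfac (Suc n - j)) * c j * x ^ j)"
  by (intro sum.cong) (auto simp: B_def)
 finally show ?case by (simp only: c_def)
qed

lemma sum_atMost_split_middle:
 fixes f :: "nat \<Rightarrow> 'a::comm_monoid_add"
 shows "(\<Sum>j\<le>2*N. f j) = (\<Sum>m\<le>N. f (N + m)) + (\<Sum>m<N. f (N - Suc m))"
proof -
 have "{..2*N} = {..<N} \<union> {N..2*N}" by auto
 hence "(\<Sum>j\<le>2*N. f j) = (\<Sum>j<N. f j) + (\<Sum>j\<in>{N..2*N}. f j)"
  by (simp only:) (rule sum.union_disjoint, auto)
 also have "(\<Sum>j<N. f j) = (\<Sum>m<N. f (N - Suc m))"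
  by (rule sum.nat_diff_reindex[symmetric])
 also have "(\<Sum>j\<in>{N..2*N}. f j) = (\<Sum>m\<le>N. f (N + m))"
  by (rule sum.reindex_bij_witness[of _ "%m. N + m" "%j. j - N"]) auto
 finally show ?thesis by (simp add: add.commute)
qed

text \<open>The \<open>q\<close>-binomial theorem for an even number of factors, with the index moved to the middle: this
splits the product into factors growing in both directions.\<close>

lemma finite_triple_product:
 assumes \<tau>: "\<tau> ~= 0"
 defines "T \<equiv> %n::int. of_real (qb q n) * \<tau> powi n"
 shows "(\<Prod>k<N. 1 + \<tau> * qc ^ k) * (\<Prod>k<N. 1 + qc / \<tau> * qc ^ k)
  = (\<Sum>m\<le>N. qfac (2 * N) / (qfac (N + m) * qfac (N - m)) * T (int m))
  + (\<Sum>m<N. qfac (2 * N) / (qfac (N - Suc m) * qfac (Suc (N + m))) * T (- int m - 1))"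
proof -
 define x where "x = \<tau> * qc powi (- int N)"
 define K where "K = \<tau> ^ N * of_real (qb q (int N)) * qc powi (- int N * int N)"
 have K: "K ~= 0" using \<tau> by (simp add: K_def)
 have split: "(\<Prod>k<2*N. 1 + x * qc ^ k) = (\<Prod>k<N. 1 + x * qc ^ (N - Suc k)) * (\<Prod>k<N. 1 + x * qc ^ (N + k))"
 proof -
  have "(\<Prod>k<2*N. 1 + x * qc ^ k) = (\<Prod>k<N. 1 + x * qc ^ k) * (\<Prod>k\<in>{N..<2*N}. 1 + x * qc ^ k)"
   by (subst prod.union_disjoint[symmetric]) (auto intro!: prod.cong)
  also have "(\<Prod>k<N. 1 + x * qc ^ k) = (\<Prod>k<N. 1 + x * qc ^ (N - Suc k))"
   by (rule prod.nat_diff_reindex[symmetric])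
  also have "(\<Prod>k\<in>{N..<2*N}. 1 + x * qc ^ k) = (\<Prod>k<N. 1 + x * qc ^ (N + k))"
   by (rule prod.reindex_bij_witness[of _ "%m. N + m" "%j. j - N"]) auto
  finally show ?thesis .
 qed
 have p1: "(\<Prod>k<N. 1 + x * qc ^ (N + k)) = (\<Prod>k<N. 1 + \<tau> * qc ^ k)"
  by (intro prod.cong refl) (simp add: x_def power_int_minus power_add field_simps)
 have p2: "(\<Prod>k<N. 1 + x * qc ^ (N - Suc k)) = K * (\<Prod>k<N. 1 + qc / \<tau> * qc ^ k)"
 proof -
  have "1 + x * qc ^ (N - Suc k) = (\<tau> / qc * (1 / qc ^ k)) * (1 + qc / \<tau> * qc ^ k)" if "k < N" for k
  proof -
   from that have "qc ^ N = qc ^ (N - Suc k) * (qc * qc ^ k)"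
    by (metis Suc_leI le_add_diff_inverse2 power_Suc power_add)
   thus ?thesis using \<tau> by (simp add: x_def power_int_minus field_simps)
  qed
  hence "(\<Prod>k<N. 1 + x * qc ^ (N - Suc k))
    = (\<Prod>k<N. (\<tau> / qc * (1 / qc ^ k)) * (1 + qc / \<tau> * qc ^ k))"
   by (intro prod.cong) auto
  also have "\<dots> = (\<Prod>k<N. \<tau> / qc * (1 / qc ^ k)) * (\<Prod>k<N. 1 + qc / \<tau> * qc ^ k)"
   by (rule prod.distrib)
  also have "(\<Prod>k<N. \<tau> / qc * (1 / qc ^ k)) = K"
   unfolding K_def
  proof (induction N)
   case (Suc N)
   have "- int (Suc N) * int (Suc N) = - int N * int N - int N - int N - 1"
    by (simp add: algebra_simps)
   hence "qc powi (- int (Suc N) * int (Suc N)) = qc powi (- int N * int N) / (qc * qc ^ N * qc ^ N)"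
    by (simp only: power_int_diff qc_nz not_False_eq_True simp_thms power_int_of_nat
       power_int_1_right divide_divide_eq_left) (simp only: mult_ac)
   moreover have "qb q (int (Suc N)) = qb q (int N) * q ^ N"
    using qb_Suc[of "int N"] by (simp add: add.commute)
   ultimately show ?case using Suc by (simp add: mult_ac)
  qed simp
  finally show ?thesis .
 qed
 have term1: "of_real (qb q (int (N + m))) * x ^ (N + m) = K * T (int m)" for m
 proof -
  have "x ^ (N + m) = x powi (int N + int m)" by (simp only: of_nat_add[symmetric] power_int_of_nat)
  also have "\<dots> = \<tau> powi (int N + int m) * qc powi (- int N * (int N + int m))"
   unfolding x_def by (simp only: power_int_mult_distrib power_int_mult)
  also have "\<tau> powi (int N + int m) = \<tau> ^ N * \<tau> ^ m"
   by (simp only: of_nat_add[symmetric] power_int_of_nat power_add)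
  also have "qc powi (- int N * (int N + int m)) = qc powi (- int N * int N) / qc powi (int N * int m)"
   by (simp add: distrib_left power_int_diff)
  finally show ?thesis
   using qb_add[of "int N" "int m"] \<tau> by (simp add: K_def T_def of_real_power_int field_simps)
 qed
 have term2: "of_real (qb q (int (N - Suc m))) * x ^ (N - Suc m) = K * T (- int m - 1)" if "m < N" for m
 proof -
  have i: "int (N - Suc m) = int N + (- int m - 1)" using that by auto
  have "x ^ (N - Suc m) = x powi (int (N - Suc m))" by (simp only: power_int_of_nat)
  also have "\<dots> = \<tau> powi (int N + (- int m - 1)) * qc powi (- int N * (int N + (- int m - 1)))"
   unfolding i x_def by (simp only: power_int_mult_distrib power_int_mult)
  also have "qc powi (- int N * (int N + (- int m - 1))) = qc powi (- int N * int N) / qc powi (int N * (- int m - 1))"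
   by (simp only: distrib_left minus_mult_left[symmetric] power_int_add qc_nz disj_not1 simp_thms power_int_minus divide_inverse)
  also have "\<tau> powi (int N + (- int m - 1)) = \<tau> ^ N * \<tau> powi (- int m - 1)"
   using \<tau> by (simp only: power_int_add simp_thms power_int_of_nat)
  finally show ?thesis
   unfolding i qb_add using \<tau> by (simp add: K_def T_def of_real_power_int field_simps)
 qed
 have "K * ((\<Prod>k<N. 1 + \<tau> * qc ^ k) * (\<Prod>k<N. 1 + qc / \<tau> * qc ^ k)) = (\<Prod>k<2*N. 1 + x * qc ^ k)"
  unfolding split p1 p2 by (simp only: mult_ac)
 also have "\<dots> = (\<Sum>m\<le>N. qfac (2*N) / (qfac (N + m) * qfac (2*N - (N + m))) * (of_real (qb q (int (N + m))) * x ^ (N + m)))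
  + (\<Sum>m<N. qfac (2*N) / (qfac (N - Suc m) * qfac (2*N - (N - Suc m))) * (of_real (qb q (int (N - Suc m))) * x ^ (N - Suc m)))"
  unfolding q_binomial sum_atMost_split_middle by (simp only: mult.assoc)
 also have "\<dots> = K * ((\<Sum>m\<le>N. qfac (2 * N) / (qfac (N + m) * qfac (N - m)) * T (int m))
  + (\<Sum>m<N. qfac (2 * N) / (qfac (N - Suc m) * qfac (Suc (N + m))) * T (- int m - 1)))"
  unfolding distrib_left sum_distrib_left
 proof (intro arg_cong2[of _ _ _ _ "(+)"] sum.cong refl)
  fix m assume "m \<in> {..<N}"
  hence m: "m < N" by simp
  hence e: "2 * N - (N - Suc m) = Suc (N + m)" by simp
  show "qfac (2*N) / (qfac (N - Suc m) * qfac (2*N - (N - Suc m))) * (of_real (qb q (int (N - Suc m))) * x ^ (N - Suc m))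
    = K * (qfac (2 * N) / (qfac (N - Suc m) * qfac (Suc (N + m))) * T (- int m - 1))"
   unfolding e term2[OF m] by (simp only: mult_ac)
 next
  fix m
  have e: "2 * N - (N + m) = N - m" by simp
  show "qfac (2*N) / (qfac (N + m) * qfac (2*N - (N + m))) * (of_real (qb q (int (N + m))) * x ^ (N + m))
    = K * (qfac (2 * N) / (qfac (N + m) * qfac (N - m)) * T (int m))"
   unfolding e term1 by (simp only: mult_ac)
 qed
 finally show ?thesis using K by simp
qed

lemma qfac_limit: "qfac \<longlonglongrightarrow> qpc qc"
 unfolding qfac_def qpoch_def using convergent_prod_LIMSEQ[OF convergent_qpoch[of qc]]
 by (simp add: LIMSEQ_lessThan_iff_atMost)

text \<open>The limit of the finite identity, whose terms are dominated by those of the bilateral series, so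
that Tannery's theorem applies.\<close>

theorem jacobi_triple_product:
 assumes \<tau>: "\<tau> ~= 0"
 shows "((%n. of_real (qb q n) * \<tau> powi n) has_sum \<theta> \<tau>) UNIV"
proof -
 define T where "T = (%n::int. complex_of_real (qb q n) * \<tau> powi n)"
 have s1: "summable (%m. norm (T (int m)))"
  using summable_qb_pos[of "norm \<tau>"] less_imp_le[OF qb_pos]
  by (simp add: T_def norm_mult norm_power)
 have s2: "summable (%m. norm (T (- int m - 1)))"
  using summable_qb_neg[of "norm \<tau>"] less_imp_le[OF qb_pos] \<tau>
  by (simp add: T_def norm_mult norm_power_int)
 obtain C where C: "\<And>n. norm (inverse (qfac n)) \<le> C"
  using tendsto_inverse[OF qfac_limit qpoch_qc_nz, THEN convergentI, THEN convergent_imp_Bseq]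
  by (auto simp: Bseq_def)
 obtain C' where C': "\<And>n. norm (qfac n) \<le> C'"
  using qfac_limit[THEN convergentI, THEN convergent_imp_Bseq]
  by (auto simp: Bseq_def)
 have Cpos: "C \<ge> 0" "C' \<ge> 0" using C[of 0] C'[of 0] norm_ge_zero order_trans by blast+
 have bound: "norm (qfac i / (qfac j * qfac k)) \<le> C' * (C * C)" for i j k
  unfolding divide_inverse inverse_mult_distrib norm_mult
  by (intro mult_mono C C' mult_nonneg_nonneg Cpos norm_ge_zero)
 have lim0: "(%N. qfac (a N) / (qfac (b N) * qfac (c N))) \<longlonglongrightarrow> 1 / qpc qc"
  if "filterlim a at_top sequentially" "filterlim b at_top sequentially" "filterlim c at_top sequentially"
  for a b c :: "nat \<Rightarrow> nat"
 proof -
  have "(%N. qfac (a N) / (qfac (b N) * qfac (c N))) \<longlonglongrightarrow> qpc qc / (qpc qc * qpc qc)"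
   using that by (intro tendsto_divide tendsto_mult filterlim_compose[OF qfac_limit]) auto
  thus ?thesis by simp
 qed
 define u where "u = (%m N. if m \<le> N then qfac (2 * N) / (qfac (N + m) * qfac (N - m)) * T (int m) else 0)"
 define v where "v = (%m N. if m < N then qfac (2 * N) / (qfac (N - Suc m) * qfac (Suc (N + m))) * T (- int m - 1) else 0)"
 have L1: "(%N. \<Sum>m. u m N) \<longlonglongrightarrow> (\<Sum>m. 1 / qpc qc * T (int m))"
 proof (rule tannerys_theorem[THEN conjunct2, THEN conjunct2])
  fix m
  have "(%N. qfac (2 * N) / (qfac (N + m) * qfac (N - m)) * T (int m)) \<longlonglongrightarrow> 1 / qpc qc * T (int m)"
   by (intro tendsto_mult tendsto_const lim0 mult_nat_left_at_top filterlim_add_const_nat_at_top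
      filterlim_minus_const_nat_at_top) auto
  moreover have "eventually (%N. u m N = qfac (2 * N) / (qfac (N + m) * qfac (N - m)) * T (int m)) sequentially"
   using eventually_ge_at_top[of m] by eventually_elim (auto simp: u_def)
  ultimately show "(%N. u m N) \<longlonglongrightarrow> 1 / qpc qc * T (int m)"
   by (simp add: filterlim_cong)
 next
  show "summable (%m. C' * (C * C) * norm (T (int m)))" by (intro summable_mult s1)
  show "\<forall>\<^sub>F (k, n) in sequentially \<times>\<^sub>F sequentially. norm (u k n) \<le> C' * (C * C) * norm (T (int k))"
  proof (intro always_eventually allI, clarify)
   fix k n
   show "norm (u k n) \<le> C' * (C * C) * norm (T (int k))"
   proof (cases "k \<le> n")
    case True
    thus ?thesis unfolding u_def using bound[of "2*n" "n+k" "n-k"]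
     by (simp only: if_True norm_mult) (intro mult_right_mono, auto)
   qed (use Cpos in \<open>auto simp: u_def\<close>)
  qed
 qed auto
 have L2: "(%N. \<Sum>m. v m N) \<longlonglongrightarrow> (\<Sum>m. 1 / qpc qc * T (- int m - 1))"
 proof (rule tannerys_theorem[THEN conjunct2, THEN conjunct2])
  fix m
  have "filterlim (%N. Suc (N + m)) at_top sequentially"
   using filterlim_add_const_nat_at_top[of "Suc m"] by simp
  hence "(%N. qfac (2 * N) / (qfac (N - Suc m) * qfac (Suc (N + m))) * T (- int m - 1)) \<longlonglongrightarrow> 1 / qpc qc * T (- int m - 1)"
   by (intro tendsto_mult tendsto_const lim0 mult_nat_left_at_top 
      filterlim_minus_const_nat_at_top) auto
  moreover have "eventually (%N. v m N = qfac (2 * N) / (qfac (N - Suc m) * qfac (Suc (N + m))) * T (- int m - 1)) sequentially"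
   using eventually_gt_at_top[of m] by eventually_elim (auto simp: v_def)
  ultimately show "(%N. v m N) \<longlonglongrightarrow> 1 / qpc qc * T (- int m - 1)"
   by (simp add: filterlim_cong)
 next
  show "summable (%m. C' * (C * C) * norm (T (- int m - 1)))" by (intro summable_mult s2)
  show "\<forall>\<^sub>F (k, n) in sequentially \<times>\<^sub>F sequentially. norm (v k n) \<le> C' * (C * C) * norm (T (- int k - 1))"
  proof (intro always_eventually allI, clarify)
   fix k n
   show "norm (v k n) \<le> C' * (C * C) * norm (T (- int k - 1))"
   proof (cases "k < n")
    case True
    thus ?thesis unfolding v_def using bound[of "2*n" "n - Suc k" "Suc (n+k)"]
     by (simp only: if_True norm_mult) (intro mult_right_mono, auto)
   qed (use Cpos in \<open>auto simp: v_def\<close>)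
  qed
 qed auto
 have "(\<Prod>k<N. 1 + \<tau> * qc ^ k) * (\<Prod>k<N. 1 + qc / \<tau> * qc ^ k) = (\<Sum>m. u m N) + (\<Sum>m. v m N)" for N
 proof -
  have h1: "(\<Sum>m. u m N) = (\<Sum>m\<le>N. u m N)" by (rule suminf_finite) (auto simp: u_def)
  have h2: "(\<Sum>m. v m N) = (\<Sum>m<N. v m N)" by (rule suminf_finite) (auto simp: v_def)
  show ?thesis
   unfolding h1 h2 finite_triple_product[OF \<tau>] by (simp add: u_def v_def T_def)
 qed
 with tendsto_add[OF L1 L2]
 have "(%N. (\<Prod>k<N. 1 + \<tau> * qc ^ k) * (\<Prod>k<N. 1 + qc / \<tau> * qc ^ k))
  \<longlonglongrightarrow> (\<Sum>m. 1 / qpc qc * T (int m)) + (\<Sum>m. 1 / qpc qc * T (- int m - 1))" by simp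
 moreover have pl: "(%N. (\<Prod>k<N. 1 - a * qc ^ k)) \<longlonglongrightarrow> qpc a" for a
  unfolding qpoch_def using convergent_prod_LIMSEQ[OF convergent_qpoch[of a]]
  by (simp add: LIMSEQ_lessThan_iff_atMost)
 hence "(%N. (\<Prod>k<N. 1 + \<tau> * qc ^ k) * (\<Prod>k<N. 1 + qc / \<tau> * qc ^ k)) \<longlonglongrightarrow> qpc (-\<tau>) * qpc (- (qc/\<tau>))"
  using tendsto_mult[OF pl[of "-\<tau>"] pl[of "- (qc/\<tau>)"]] by simp
 ultimately have e: "(\<Sum>m. 1 / qpc qc * T (int m)) + (\<Sum>m. 1 / qpc qc * T (- int m - 1)) = qpc (-\<tau>) * qpc (- (qc/\<tau>))"
  using LIMSEQ_unique by blast
 have e1: "(\<Sum>m. 1 / qpc qc * T (int m)) = 1 / qpc qc * (\<Sum>m. T (int m))"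
  by (rule suminf_mult) (rule summable_norm_cancel[OF s1])
 have e2: "(\<Sum>m. 1 / qpc qc * T (- int m - 1)) = 1 / qpc qc * (\<Sum>m. T (- int m - 1))"
  by (rule suminf_mult) (rule summable_norm_cancel[OF s2])
 have "(\<Sum>m. T (int m)) + (\<Sum>m. T (- int m - 1)) = \<theta> \<tau>"
  using e[unfolded e1 e2] by (simp add: theta_eq field_simps)
 with has_sum_int_halves[OF s1 s2] show ?thesis by (simp add: T_def)
qed

end

section \<open>Liouville's theorem for doubly periodic functions\<close>

lemma tendsto_simple_zero:
 fixes F :: "complex \<Rightarrow> complex"
 assumes "(F has_field_derivative D) (at \<zeta>)" "F \<zeta> = 0" "D ~= 0"
 shows "((%u. (u - \<zeta>) / F u) \<longlongrightarrow> 1 / D) (at \<zeta>)"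
proof -
 have "((%u. F u / (u - \<zeta>)) \<longlongrightarrow> D) (at \<zeta>)"
  using assms by (simp add: has_field_derivative_iff)
 from tendsto_inverse[OF this \<open>D ~= 0\<close>] show ?thesis by (simp add: inverse_eq_divide)
qed

text \<open>After the singularities have been removed \<open>f\<close> is entire and takes all its values on one compact
parallelogram. The entire function \<open>h\<close> serves to describe the singular set as a set of
zeros, and the limit is required at only one point of each singular orbit.\<close>

lemma doubly_periodic_imp_constant:
 fixes f h :: "complex \<Rightarrow> complex" and a b :: real
 assumes a: "a ~= 0" and b: "b ~= 0"
  and h: "h holomorphic_on UNIV" "h u0 ~= 0"
  and f: "f holomorphic_on {u. h u ~= 0}"
  and h_per: "\<And>u. h (u + of_real a) = 0 \<longleftrightarrow> h u = 0" "\<And>u. h (u + of_real b * \<i>) = 0 \<longleftrightarrow> h u = 0"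
  and f_per: "\<And>u. h u ~= 0 ==> f (u + of_real a) = f u" "\<And>u. h u ~= 0 ==> f (u + of_real b * \<i>) = f u"
  and lim: "\<And>\<zeta>. h \<zeta> = 0 ==> \<exists>(m::int) (n::int) \<zeta>0. \<zeta> = \<zeta>0 + of_int m * of_real a + of_int n * (of_real b * \<i>)
        \<and> ((%u. (u - \<zeta>0) * f u) \<longlongrightarrow> 0) (at \<zeta>0)"
 shows "\<exists>c. \<forall>u. h u ~= 0 \<longrightarrow> f u = c"
proof -
 define Z where "Z = {u. h u = 0}"
 have ev: "eventually (%u. u \<notin> Z) (at \<zeta>)" for \<zeta>
  using non_zero_neighbour_alt[OF h(1) open_UNIV connected_UNIV UNIV_I UNIV_I h(2), of \<zeta>]
  by (auto simp: Z_def elim: eventually_mono)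
 have opZ: "open (-Z)"
 proof -
  have "open (h -` (-{0}))"
   by (rule open_vimage) (auto intro: holomorphic_on_imp_continuous_on[OF h(1)])
  moreover have "h -` (-{0}) = -Z" by (auto simp: Z_def)
  ultimately show ?thesis by simp
 qed
 have fZ: "f holomorphic_on -Z" using f by (simp add: Z_def Compl_eq)
 have shift1: "(h (u + of_int m * of_real a) = 0 \<longleftrightarrow> h u = 0) \<and> (h u ~= 0 \<longrightarrow> f (u + of_int m * of_real a) = f u)" for u and m :: int
 proof (induction m rule: int_induct[where k = 0])
  case (step1 m)
  thus ?case using h_per(1)[of "u + of_int m * of_real a"] f_per(1)[of "u + of_int m * of_real a"]
   by (auto simp: algebra_simps)
 next
  case (step2 m)
  thus ?case using h_per(1)[of "u + of_int (m - 1) * of_real a"] f_per(1)[of "u + of_int (m - 1) * of_real a"]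
   by (auto simp: algebra_simps)
 qed auto
 have shift2: "(h (u + of_int m * (of_real b * \<i>)) = 0 \<longleftrightarrow> h u = 0) \<and> (h u ~= 0 \<longrightarrow> f (u + of_int m * (of_real b * \<i>)) = f u)" for u and m :: int
 proof (induction m rule: int_induct[where k = 0])
  case (step1 m)
  thus ?case using h_per(2)[of "u + of_int m * (of_real b * \<i>)"] f_per(2)[of "u + of_int m * (of_real b * \<i>)"]
   by (auto simp: algebra_simps)
 next
  case (step2 m)
  thus ?case using h_per(2)[of "u + of_int (m - 1) * (of_real b * \<i>)"] f_per(2)[of "u + of_int (m - 1) * (of_real b * \<i>)"]
   by (auto simp: algebra_simps)
 qed auto
 define sh where "sh = (%m n. complex_of_int m * of_real a + of_int n * (of_real b * \<i>))"
 have shift: "(h (u + sh m n) = 0 \<longleftrightarrow> h u = 0) \<and> (h u ~= 0 \<longrightarrow> f (u + sh m n) = f u)" for u m n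
  using shift1[of u m] shift2[of "u + of_int m * of_real a" n] by (auto simp: sh_def add.assoc)
 have lim': "((%u. (u - \<zeta>) * f u) \<longlongrightarrow> 0) (at \<zeta>)" for \<zeta>
 proof (cases "h \<zeta> = 0")
  case True
  from lim[OF this] obtain m n \<zeta>0 where \<zeta>: "\<zeta> = \<zeta>0 + sh m n"
   and l0: "((%u. (u - \<zeta>0) * f u) \<longlongrightarrow> 0) (at \<zeta>0)"
   by (auto simp: sh_def add.assoc)
  have "eventually (%u. (u - \<zeta>0) * f u = (u - \<zeta>0) * f (u + sh m n)) (at \<zeta>0)"
   using ev[of \<zeta>0] by eventually_elim (use shift in \<open>auto simp: Z_def\<close>)
  hence "((%u. (u - \<zeta>0) * f (u + sh m n)) \<longlongrightarrow> 0) (at \<zeta>0)"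
   by (rule Lim_transform_eventually[OF l0])
  hence "((%v. v * f (v + \<zeta>0 + sh m n)) \<longlongrightarrow> 0) (at 0)"
   by (subst (asm) at_to_0) (simp add: filterlim_filtermap)
  thus ?thesis unfolding \<zeta>
   by (subst at_to_0) (simp add: filterlim_filtermap add.assoc)
 next
  case False
  hence "f field_differentiable at \<zeta>"
   using holomorphic_on_imp_differentiable_at[OF fZ opZ] by (auto simp: Z_def)
  hence "isCont (%u. (u - \<zeta>) * f u) \<zeta>"
   by (intro continuous_intros field_differentiable_imp_continuous_at)
  thus ?thesis by (simp add: isCont_def)
 qed
 define F where "F = (%u. if u \<in> Z then Lim (at u) f else f u)"
 have ext: "\<exists>r>0. \<exists>k. k holomorphic_on ball \<zeta> r \<and> (\<forall>u\<in>ball \<zeta> r. F u = k u)" for \<zeta>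
 proof -
  from ev[of \<zeta>] obtain r where r: "r > 0" "\<And>u. u \<in> ball \<zeta> r - {\<zeta>} ==> u \<notin> Z"
   unfolding eventually_at by (auto simp: dist_commute)
  have "f holomorphic_on ball \<zeta> r - {\<zeta>}"
   by (rule holomorphic_on_subset[OF fZ]) (use r in auto)
  from holomorphic_on_extend_lim[OF this, of ] r(1) lim'[of \<zeta>]
  obtain k where k: "k holomorphic_on ball \<zeta> r" "\<And>u. u \<in> ball \<zeta> r - {\<zeta>} ==> k u = f u"
   by (auto simp: interior_open)
  have "isCont k \<zeta>"
   using k(1) r(1) by (intro field_differentiable_imp_continuous_at holomorphic_on_imp_differentiable_at[OF k(1)]) auto
  hence "(k \<longlongrightarrow> k \<zeta>) (at \<zeta>)" by (simp add: isCont_def)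
  moreover have "eventually (%u. k u = f u) (at \<zeta>)"
   unfolding eventually_at by (rule exI[of _ r]) (use r(1) k(2) in \<open>auto simp: dist_commute\<close>)
  ultimately have kl: "(f \<longlongrightarrow> k \<zeta>) (at \<zeta>)" by (rule Lim_transform_eventually)
  have "F \<zeta> = k \<zeta>"
  proof (cases "\<zeta> \<in> Z")
   case True
   thus ?thesis using tendsto_Lim[OF _ kl] by (simp add: F_def)
  next
   case False
   hence "isCont f \<zeta>"
    using holomorphic_on_imp_differentiable_at[OF fZ opZ] by (auto intro!: field_differentiable_imp_continuous_at)
   hence "(f \<longlongrightarrow> f \<zeta>) (at \<zeta>)" by (simp add: isCont_def)
   from tendsto_unique[OF _ this kl] show ?thesis using False by (simp add: F_def)
  qed
  moreover have "F u = k u" if "u \<in> ball \<zeta> r - {\<zeta>}" for u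
   using r(2)[OF that] k(2)[OF that] by (simp add: F_def)
  ultimately have "\<forall>u\<in>ball \<zeta> r. F u = k u" by blast
  with r(1) k(1) show ?thesis by blast
 qed
 have F_hol: "F holomorphic_on UNIV"
 proof (subst holomorphic_on_open, simp, intro ballI)
  fix \<zeta> :: complex
  from ext[of \<zeta>] obtain r k where r: "r > 0" "k holomorphic_on ball \<zeta> r" "\<forall>u\<in>ball \<zeta> r. F u = k u" by blast
  hence "F holomorphic_on ball \<zeta> r" using holomorphic_cong by blast
  thus "\<exists>f'. (F has_field_derivative f') (at \<zeta>)"
   using r(1) holomorphic_on_open[of "ball \<zeta> r" F] by auto
 qed
 have F_cont: "continuous_on UNIV F" using F_hol by (rule holomorphic_on_imp_continuous_on)
 define R where "R = cbox 0 (Complex \<bar>a\<bar> \<bar>b\<bar>)"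
 have "bounded (F ` R)"
  by (intro compact_imp_bounded compact_continuous_image continuous_on_subset[OF F_cont]) (auto simp: R_def)
 then obtain C where C: "\<And>u. u \<in> R ==> norm (F u) \<le> C" by (auto simp: bounded_iff)
 have bd: "norm (F u) \<le> C" if "u \<notin> Z" for u
 proof -
  define m where "m = \<lfloor>Re u / \<bar>a\<bar>\<rfloor>"
  define n where "n = \<lfloor>Im u / \<bar>b\<bar>\<rfloor>"
  have 1: "0 \<le> Re u - of_int m * \<bar>a\<bar>" "Re u - of_int m * \<bar>a\<bar> \<le> \<bar>a\<bar>"
  proof -
   have "of_int m \<le> Re u / \<bar>a\<bar>" "Re u / \<bar>a\<bar> \<le> of_int m + 1" unfolding m_def by linarith+
   thus "0 \<le> Re u - of_int m * \<bar>a\<bar>" "Re u - of_int m * \<bar>a\<bar> \<le> \<bar>a\<bar>" using a by (auto simp: field_simps)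
  qed
  have 2: "0 \<le> Im u - of_int n * \<bar>b\<bar>" "Im u - of_int n * \<bar>b\<bar> \<le> \<bar>b\<bar>"
  proof -
   have "of_int n \<le> Im u / \<bar>b\<bar>" "Im u / \<bar>b\<bar> \<le> of_int n + 1" unfolding n_def by linarith+
   thus "0 \<le> Im u - of_int n * \<bar>b\<bar>" "Im u - of_int n * \<bar>b\<bar> \<le> \<bar>b\<bar>" using b by (auto simp: field_simps)
  qed
  define m' where "m' = (if a > 0 then -m else m)"
  define n' where "n' = (if b > 0 then -n else n)"
  have "u + sh m' n' \<in> R"
   using 1 2 a b by (auto simp: R_def in_cbox_complex_iff sh_def m'_def n'_def)
  moreover have "F (u + sh m' n') = F u"
   using shift[of u m' n'] that by (auto simp: F_def Z_def)
  ultimately show ?thesis using C by metis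
 qed
 have "norm (F u) \<le> C" for u
 proof -
  have "isCont F u" using F_cont by (simp add: continuous_on_eq_continuous_at)
  hence "((%u. norm (F u)) \<longlongrightarrow> norm (F u)) (at u)" by (intro tendsto_norm) (simp add: isCont_def)
  moreover have "eventually (%u. norm (F u) \<le> C) (at u)"
   using ev[of u] by eventually_elim (rule bd)
  ultimately show ?thesis by (rule tendsto_upperbound) simp
 qed
 hence "bounded (range F)" by (auto simp: bounded_iff)
 from Liouville_theorem[OF F_hol this] obtain c where "\<And>u. F u = c"
  by (auto simp: constant_on_def)
 note Fc = this
 have "f u = c" if "h u ~= 0" for u
  using Fc[of u] that by (simp add: F_def Z_def)
 thus ?thesis by blast
qed

section \<open>Holomorphic bilateral series\<close>

text \<open>Enumerating the integers reduces this to the Weierstrass test.\<close>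

lemma holomorphic_infsum_int:
 fixes f :: "int \<Rightarrow> complex \<Rightarrow> complex"
 assumes A: "open A" and hol: "\<And>n. f n holomorphic_on A"
  and bound: "\<And>K. compact K ==> K \<subseteq> A ==> \<exists>M. M summable_on UNIV \<and> (\<forall>n. \<forall>u\<in>K. norm (f n u) \<le> M n)"
 shows "(%u. \<Sum>\<^sub>\<infinity>n. f n u) holomorphic_on A"
proof (rule holomorphic_uniform_sequence[OF A])
 define F where "F = (%N u. \<Sum>m<N::nat. f (int m) u + f (- int m - 1) u)"
 show "F N holomorphic_on A" for N
  unfolding F_def by (intro holomorphic_intros hol)
 fix x assume "x \<in> A"
 then obtain d where d: "d > 0" "cball x d \<subseteq> A" using A open_contains_cball by blast
 obtain M where M: "M summable_on UNIV" "\<And>n u. u \<in> cball x d ==> norm (f n u) \<le> M n"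
  using bound[OF compact_cball d(2)] by blast
 have M1: "summable (%m. M (int m))"
  using summable_on_reindex[of int UNIV M] summable_on_subset_banach[OF M(1), of "range int"]
  by (intro summable_on_imp_summable) (auto simp: o_def)
 have "inj (%m. - int m - 1)" by (auto simp: inj_on_def)
 hence M2: "summable (%m. M (- int m - 1))"
  using summable_on_reindex[of "%m. - int m - 1" UNIV M] summable_on_subset_banach[OF M(1), of "range (%m. - int m - 1)"]
  by (intro summable_on_imp_summable) (auto simp: o_def)
 have "uniform_limit (cball x d) F (%u. \<Sum>m. f (int m) u + f (- int m - 1) u) sequentially"
  unfolding F_def
 proof (rule Weierstrass_m_test)
  show "norm (f (int n) u + f (- int n - 1) u) \<le> M (int n) + M (- int n - 1)" if "u \<in> cball x d" for n u
   by (intro norm_triangle_le add_mono M(2) that)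
  show "summable (%n. M (int n) + M (- int n - 1))" by (intro summable_add M1 M2)
 qed
 also have "?this \<longleftrightarrow> uniform_limit (cball x d) F (%u. \<Sum>\<^sub>\<infinity>n. f n u) sequentially"
 proof (intro uniform_limit_cong' refl)
  fix u assume u: "u \<in> cball x d"
  have s1: "summable (%m. norm (f (int m) u))"
   by (rule summable_comparison_test'[OF M1]) (use M(2)[OF u] in auto)
  have s2: "summable (%m. norm (f (- int m - 1) u))"
   by (rule summable_comparison_test'[OF M2]) (use M(2)[OF u] in auto)
  have "(\<Sum>\<^sub>\<infinity>n. f n u) = (\<Sum>m. f (int m) u) + (\<Sum>m. f (- int m - 1) u)"
   by (rule infsumI, rule has_sum_int_halves[OF s1 s2])
  also have "\<dots> = (\<Sum>m. f (int m) u + f (- int m - 1) u)"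
   by (rule suminf_add) (auto intro: summable_norm_cancel s1 s2)
  finally show "(\<Sum>m. f (int m) u + f (- int m - 1) u) = (\<Sum>\<^sub>\<infinity>n. f n u)" ..
 qed
 finally show "\<exists>d>0. cball x d \<subseteq> A \<and> uniform_limit (cball x d) F (%u. \<Sum>\<^sub>\<infinity>n. f n u) sequentially"
  using d by blast
qed

context qbase
begin

section \<open>The Gaussian, the periodic function and its logarithmic derivative\<close>

abbreviation \<omega> :: complex where "\<omega> \<equiv> of_real (2 * pi) * \<i>"
abbreviation ipi :: complex where "ipi \<equiv> of_real pi * \<i>"
abbreviation E :: "complex \<Rightarrow> complex" where "E \<equiv> Eq q"
abbreviation P :: "complex \<Rightarrow> complex" where "P \<equiv> Pq q"
abbreviation lc :: complex where "lc \<equiv> of_real L"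
text \<open>The logarithmic derivative of \<open>P\<close>. It is written in terms of \<open>g\<close>, so that \<open>Pd_eq\<close>
holds without side conditions.\<close>

definition Q :: "complex \<Rightarrow> complex" where "Q u = u / lc - 1 / 2 + g (exp u)"
text \<open>What is left of \<open>\<theta>\<close> after its zero at \<open>- 1\<close> has been split off.\<close>

definition \<theta>1 :: "complex \<Rightarrow> complex" where
 "\<theta>1 \<tau> = qpc qc * qpc (- (qc * \<tau>)) * qpc (- (qc / \<tau>))"

lemma theta_theta1: "\<theta> \<tau> = (1 + \<tau>) * \<theta>1 \<tau>"
proof -
 have "qpc (-\<tau>) = (1 + \<tau>) * qpc (- (qc * \<tau>))"
  using qpoch_rec[of "-\<tau>"] by (simp add: mult.commute)
 thus ?thesis by (simp add: \<theta>1_def theta_eq mult_ac)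
qed

lemma theta1_minus1: "\<theta>1 (-1) = qpc qc ^ 3"
 by (simp add: \<theta>1_def power3_eq_cube)

lemma holomorphic_theta1 [holomorphic_intros]:
 assumes "f holomorphic_on A" "\<And>x. x \<in> A ==> f x ~= 0"
 shows "(%x. \<theta>1 (f x)) holomorphic_on A"
 unfolding \<theta>1_def using assms by (intro holomorphic_intros) auto

lemma L_nz [simp]: "L ~= 0"
 using L_neg by linarith

lemma lc_nz [simp]: "lc ~= 0"
 by simp

lemma E_eq: "E u = exp ((u - lc / 2)\<^sup>2 / (2 * lc))"
proof -
 have "ln (sqrt q) = L / 2" using q_pos by (simp add: ln_sqrt)
 hence "complex_of_real (ln (sqrt q)) = lc / 2" by (simp only: of_real_divide of_real_numeral)
 thus ?thesis by (simp only: Eq_def of_real_mult of_real_numeral)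
qed

lemma E_nz [simp]: "E u ~= 0"
 by (simp add: E_eq)

lemma holomorphic_E [holomorphic_intros]: "f holomorphic_on A ==> (%x. E (f x)) holomorphic_on A"
 unfolding E_eq by (intro holomorphic_intros) auto

lemma E_add: "E (u + v) = E u * exp (u * v / lc) * exp (v\<^sup>2 / (2 * lc) - v / 2)"
proof -
 have "(u + v - l / 2)\<^sup>2 / (2 * l) = (u - l / 2)\<^sup>2 / (2 * l) + u * v / l + (v\<^sup>2 / (2 * l) - v / 2)"
  if "l ~= 0" for l
  using that by (simp add: divide_simps power2_eq_square) (simp add: algebra_simps)
 from this[OF lc_nz] show ?thesis by (simp only: E_eq exp_add)
qed

lemma E_L: "E (u + lc) = E u * exp u"
proof -
 have "l\<^sup>2 / (2 * l) - l / 2 = 0" "u * l / l = u" if "l ~= 0" for l :: complex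
  using that by (auto simp: power2_eq_square)
 from this[OF lc_nz] show ?thesis by (simp only: E_add exp_zero mult_1_right)
qed

lemma E_powi: "E (u + of_int n * lc) = E u * exp u powi n * of_real (qb q n)"
proof (induction n rule: int_induct[where k = 0])
 case (step1 n)
 have "E (u + of_int (n + 1) * lc) = E ((u + of_int n * lc) + lc)" by (simp add: algebra_simps)
 also have "\<dots> = E (u + of_int n * lc) * (exp u * exp (of_int n * lc))" by (simp only: E_L exp_add)
 also have "exp (of_int n * lc) = qc powi n" by (subst exp_power_int[symmetric]) simp
 finally show ?case using step1 by (simp add: power_int_add qb_Suc of_real_power_int mult_ac)
next
 case (step2 n)
 have "E (u + of_int n * lc) = E ((u + of_int (n - 1) * lc) + lc)" by (simp add: algebra_simps)
 also have "\<dots> = E (u + of_int (n - 1) * lc) * (exp u * exp (of_int (n - 1) * lc))" by (simp only: E_L exp_add)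
 also have "exp (of_int (n - 1) * lc) = qc powi (n - 1)" by (subst exp_power_int[symmetric]) simp
 finally have "E (u + of_int (n - 1) * lc) * (exp u * qc powi (n - 1)) = E u * exp u powi n * of_real (qb q n)"
  using step2 by simp
 moreover have "qb q n = qb q (n - 1) * q powi (n - 1)" using qb_Suc[of "n - 1"] by simp
 ultimately show ?case by (simp add: power_int_diff of_real_power_int field_simps)
qed simp

lemma exp_int_L: "exp (of_int n * lc) = qc powi n"
 by (subst exp_power_int[symmetric]) simp

lemma P_eq: "P u = - lc * of_real (Cq q) * E u * \<theta> (exp u)"
 by (simp add: Pq_def)

lemma Cq_pos: "Cq q > 0"
 unfolding Cq_def using L_neg by (simp add: mult_neg_neg mult_pos_neg)

lemma P_eq_0_iff: "P u = 0 \<longleftrightarrow> \<theta> (exp u) = 0"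
 using Cq_pos by (simp add: P_eq)

lemma holomorphic_P [holomorphic_intros]: "f holomorphic_on A ==> (%x. P (f x)) holomorphic_on A"
 unfolding P_eq by (intro holomorphic_intros) auto

lemma P_L [simp]: "P (u + lc) = P u"
 using theta_q[of "exp u"] by (simp add: P_eq E_L exp_add mult.commute[of "exp u" qc])

lemma P_minus: "P (- u) = P u"
proof -
 have "(- u - lc / 2)\<^sup>2 = (u + lc / 2)\<^sup>2" by (simp add: power2_eq_square algebra_simps)
 moreover have "(u + lc - lc / 2) = u + lc / 2" by simp
 ultimately have "E (- u) = E (u + lc)" by (simp only: E_eq)
 hence "E (- u) = E u * exp u" by (simp only: E_L)
 moreover have "\<theta> (exp (- u)) = \<theta> (exp u) / exp u"
  using theta_inverse[of "exp u"] by (simp add: exp_minus inverse_eq_divide)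
 ultimately show ?thesis by (simp add: P_eq)
qed

lemma P_has_deriv: "(P has_field_derivative deriv P u) (at u)"
 by (rule holomorphic_derivI[of _ UNIV]) (auto intro!: holomorphic_intros)

lemma deriv_P_L [simp]: "deriv P (u + lc) = deriv P u"
proof -
 have "((%u. P (u + lc)) has_field_derivative deriv P (u + lc)) (at u)"
  using P_has_deriv[of "u + lc"] by (subst (asm) DERIV_shift)
 thus ?thesis by (simp add: DERIV_imp_deriv)
qed

lemma deriv_P_minus [simp]: "deriv P (- u) = - deriv P u"
proof -
 have "((%u. P (- u)) has_field_derivative deriv P (- u) * (-1)) (at u)"
  by (rule DERIV_chain2[OF P_has_deriv]) (auto intro!: derivative_eq_intros)
 hence "deriv P u = - deriv P (- u)" by (simp add: P_minus DERIV_imp_deriv)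
 thus ?thesis by simp
qed

lemma deriv_P_eq:
 "deriv P u = - lc * of_real (Cq q) * E u * ((u - lc / 2) / lc * \<theta> (exp u) + exp u * deriv \<theta> (exp u))"
proof -
 have "(E has_field_derivative E u * ((u - lc / 2) / lc)) (at u)"
  unfolding E_eq[abs_def] by (auto intro!: derivative_eq_intros simp: field_simps power2_eq_square)
 moreover have "((%u. \<theta> (exp u)) has_field_derivative deriv \<theta> (exp u) * exp u) (at u)"
  by (rule DERIV_chain2[OF theta_field_derivative DERIV_exp]) simp
 ultimately have "((%u. - lc * of_real (Cq q) * (E u * \<theta> (exp u))) has_field_derivative
  - lc * of_real (Cq q) * (E u * ((u - lc / 2) / lc) * \<theta> (exp u) + deriv \<theta> (exp u) * exp u * E u)) (at u)"
  by (intro DERIV_cmult DERIV_mult)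
 hence "deriv (%u. - lc * of_real (Cq q) * (E u * \<theta> (exp u))) u =
  - lc * of_real (Cq q) * (E u * ((u - lc / 2) / lc) * \<theta> (exp u) + deriv \<theta> (exp u) * exp u * E u)"
  by (rule DERIV_imp_deriv)
 moreover have "P = (%u. - lc * of_real (Cq q) * (E u * \<theta> (exp u)))"
  by (simp add: P_eq fun_eq_iff mult_ac)
 ultimately show ?thesis by (simp only:) (simp only: distrib_left mult_ac)
qed

lemma Q_eq: "P u ~= 0 ==> Q u = deriv P u / P u"
 using Cq_pos unfolding P_eq_0_iff by (simp add: deriv_P_eq P_eq Q_def g_def field_simps)

lemma P_times_Q: "P u ~= 0 ==> P u * Q u = deriv P u"
 by (simp add: Q_eq)

lemma Q_L: "P u ~= 0 ==> Q (u + lc) = Q u"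
 by (simp add: Q_eq)

lemma periodic_int:
 fixes f :: "complex \<Rightarrow> 'b"
 assumes f: "\<And>u. f (u + p) = f u"
 shows "f (u + of_int n * p) = f u"
proof (induction n rule: int_induct[where k = 0])
 case (step1 n) thus ?case using f[of "u + of_int n * p"] by (simp add: algebra_simps)
next
 case (step2 n) thus ?case using f[of "u + of_int (n - 1) * p"] by (simp add: algebra_simps)
qed simp

lemma P_int_L: "P (u + of_int n * lc) = P u"
 by (rule periodic_int) simp

lemma Q_int_L: "P u ~= 0 ==> Q (u + of_int n * lc) = Q u"
 using periodic_int[of "deriv P" lc u n] by (simp add: Q_eq P_int_L)

lemma period_representative:
 assumes "\<bar>Im u\<bar> \<le> Y"
 obtains n :: int where "u + of_int n * lc \<in> cbox (Complex L (- Y)) (Complex 0 Y)"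
proof -
 define n where "n = \<lfloor>Re u / L\<rfloor>"
 have "of_int n \<le> Re u / L" "Re u / L < of_int n + 1" unfolding n_def by linarith+
 hence "Re u \<le> of_int n * L" "(of_int n + 1) * L < Re u" using L_neg by (auto simp: field_simps)
 hence "u + of_int (- n) * lc \<in> cbox (Complex L (- Y)) (Complex 0 Y)"
  using assms by (auto simp: in_cbox_complex_iff algebra_simps)
 thus thesis by (rule that)
qed

lemma Q_minus: "P u ~= 0 ==> Q (- u) = - Q u"
 by (simp add: Q_eq P_minus)

lemma Q_2pi: "Q (u + \<omega>) = Q u + \<omega> / lc"
proof -
 have "exp (u + \<omega>) = exp u" by (simp add: exp_add)
 thus ?thesis unfolding Q_def by (simp add: add_divide_distrib)
qed

lemma holomorphic_deriv_P: "deriv P holomorphic_on UNIV"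
 by (rule holomorphic_deriv) (auto intro!: holomorphic_intros)

lemma holomorphic_Q: "Q holomorphic_on {u. P u ~= 0}"
proof -
 have "deriv P holomorphic_on {u. P u ~= 0}"
  by (rule holomorphic_on_subset[OF holomorphic_deriv_P]) auto
 moreover have "P holomorphic_on {u. P u ~= 0}"
  by (intro holomorphic_intros)
 ultimately have "(%u. deriv P u / P u) holomorphic_on {u. P u ~= 0}"
  by (rule holomorphic_on_divide) auto
 thus ?thesis by (rule holomorphic_transform) (simp add: Q_eq)
qed

lemma holomorphic_Q' [holomorphic_intros]:
 assumes "f holomorphic_on A" "\<And>x. x \<in> A ==> \<theta> (exp (f x)) ~= 0"
 shows "(%x. Q (f x)) holomorphic_on A"
proof -
 have "f ` A \<subseteq> {u. P u ~= 0}" using assms(2) by (auto simp: P_eq_0_iff)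
 from holomorphic_on_compose_gen[OF assms(1) holomorphic_Q this]
 show ?thesis by (simp only: o_def)
qed

lemma Pd_eq: "Pd q (exp l) w = Q l - Q (l - w)"
 by (simp add: Pd_def Q_def g_def exp_diff diff_divide_distrib)

lemma theta_exp_zero:
 assumes "\<theta> (exp u) = 0"
 shows "\<exists>(m::int) (n::int). u = ipi + of_int m * lc + of_int n * (\<omega>)"
proof -
 from assms obtain m where "- exp u = qc powi m" by (auto simp: theta_eq_0_iff qpowers_def)
 hence "exp u = exp (ipi + of_int m * lc)"
  by (simp add: exp_add exp_pi_i exp_int_L) (metis minus_minus)
 then obtain n :: int where "u = ipi + of_int m * lc + (of_int (2 * n) * pi) * \<i>"
  unfolding exp_eq by blast
 hence "u = ipi + of_int m * lc + of_int n * (\<omega>)"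
  by (simp add: mult_ac)
 thus ?thesis by blast
qed

lemma theta_exp_per1: "\<theta> (exp (u + of_real L)) = 0 \<longleftrightarrow> \<theta> (exp u) = 0"
 using theta_q[of "exp u"] by (simp add: exp_add mult.commute[of _ qc])

lemma exp_2pi: "exp (u + \<omega>) = exp u"
 by (simp add: exp_add)

lemma theta_exp_deriv_zero:
 "((%u. \<theta> (exp (u - v))) has_field_derivative - (qpc qc ^ 3)) (at (v + ipi))"
proof -
 have "((%u. exp (u - v)) has_field_derivative -1) (at (v + ipi))"
  by (auto intro!: derivative_eq_intros simp: exp_pi_i)
 have "(\<theta> has_field_derivative qpc qc ^ 3) (at (exp (v + ipi - v)))"
  using theta_deriv_minus1 by (simp add: exp_pi_i)
 from DERIV_chain2[where f = \<theta> and g = "%u. exp (u - v)",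
    OF this \<open>((%u. exp (u - v)) has_field_derivative -1) (at (v + ipi))\<close>]
 show ?thesis by simp
qed

lemma tendsto_div_theta_exp:
 "((%u. (u - (v + ipi)) / \<theta> (exp (u - v))) \<longlongrightarrow> - (1 / qpc qc ^ 3)) (at (v + ipi))"
 using tendsto_simple_zero[OF theta_exp_deriv_zero[of v]] by (simp add: exp_pi_i)

lemma tendsto_Q_residue:
 "((%u. (u - (v + ipi)) * Q (u - v)) \<longlongrightarrow> 1) (at (v + ipi))"
proof -
 define p where "p = v + ipi"
 define K where "K = - lc * of_real (Cq q)"
 have K: "K ~= 0" using Cq_pos by (simp add: K_def)
 have pi: "exp (p - v) = -1" by (simp add: p_def exp_pi_i)
 have d\<theta>: "deriv \<theta> (-1) = qpc qc ^ 3" using theta_deriv_minus1 by (rule DERIV_imp_deriv)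
 have dP: "deriv P (p - v) = - K * E (p - v) * qpc qc ^ 3"
  by (simp add: deriv_P_eq pi d\<theta> K_def)
 have 1: "((%u. (u - p) / \<theta> (exp (u - v))) \<longlongrightarrow> - (1 / qpc qc ^ 3)) (at p)"
  using tendsto_div_theta_exp by (simp add: p_def)
 have "(%u. deriv P (u - v) / (K * E (u - v))) holomorphic_on UNIV"
  by (intro holomorphic_intros holomorphic_on_compose_gen[OF _ holomorphic_deriv_P, unfolded o_def])
   (use K in auto)
 hence "isCont (%u. deriv P (u - v) / (K * E (u - v))) p"
  using holomorphic_on_imp_continuous_on continuous_on_eq_continuous_at open_UNIV by blast
 hence 2: "((%u. deriv P (u - v) / (K * E (u - v))) \<longlongrightarrow> - (qpc qc ^ 3)) (at p)"
  using K by (simp add: isCont_def dP)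
 have "((%u. (u - p) / \<theta> (exp (u - v)) * (deriv P (u - v) / (K * E (u - v)))) \<longlongrightarrow> 1) (at p)"
  using tendsto_mult[OF 1 2] by simp
 moreover have "eventually (%u. (u - p) / \<theta> (exp (u - v)) * (deriv P (u - v) / (K * E (u - v))) = (u - p) * Q (u - v)) (at p)"
 proof -
  have "(%u. P (u - v)) holomorphic_on UNIV" by (intro holomorphic_intros)
  moreover have "P (v - v) ~= 0" using theta_nz_pos[of 1] by (simp add: P_eq_0_iff)
  ultimately have "eventually (%u. P (u - v) ~= 0 \<and> u \<in> UNIV) (at p)"
   by (rule non_zero_neighbour_alt[OF _ open_UNIV connected_UNIV UNIV_I UNIV_I])
  moreover have "P x = K * E x * \<theta> (exp x)" for x by (simp add: P_eq K_def)
  ultimately show ?thesis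
   by (elim eventually_mono) (simp add: Q_eq)
 qed
 ultimately show ?thesis unfolding p_def by (rule Lim_transform_eventually)
qed

end

context qbase
begin

section \<open>An Appell-Lerch series\<close>

lemma theta1_eq_0_iff: "\<tau> ~= 0 ==> \<theta>1 \<tau> = 0 \<longleftrightarrow> \<tau> ~= -1 \<and> - \<tau> \<in> qpowers q"
proof (cases "\<tau> = -1")
 case True
 thus ?thesis by (simp add: theta1_minus1)
next
 case False
 hence "1 + \<tau> ~= 0" by (metis add.commute add_eq_0_iff2)
 thus ?thesis using False theta_eq_0_iff[of \<tau>] by (simp add: theta_theta1)
qed

lemma lower_bound_1_plus:
 assumes K: "compact K" "0 \<notin> K" "\<And>y. y \<in> K ==> \<theta>1 y ~= 0"
 shows "\<exists>\<delta>>0. \<forall>y\<in>K. \<forall>k::int. k ~= 0 \<longrightarrow> \<delta> \<le> norm (1 + y * qc powi k)"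
proof (cases "K = {}")
 case False
 define W where "W = {y. y = 0 \<or> \<theta>1 y = 0}"
 have "open ((-{0}) \<inter> \<theta>1 -` (-{0}))"
  by (intro continuous_open_preimage holomorphic_on_imp_continuous_on holomorphic_intros) auto
 moreover have "(-{0}) \<inter> \<theta>1 -` (-{0}) = -W" by (auto simp: W_def)
 ultimately have W: "closed W" by (simp add: closed_def)
 have "K \<inter> W = {}" using K(2,3) by (auto simp: W_def)
 from separate_compact_closed[OF K(1) W this]
 obtain d where d: "d > 0" "\<And>y x. y \<in> K ==> x \<in> W ==> d \<le> dist y x" by blast
 obtain R where R: "R > 0" "\<And>y. y \<in> K ==> norm y \<le> R"
  using compact_imp_bounded[OF K(1)] by (auto simp: bounded_pos)
 define \<delta> where "\<delta> = min d (min (1/2) (d / (2 * R)))"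
 have "\<delta> > 0" using d R by (simp add: \<delta>_def)
 moreover have "\<delta> \<le> norm (1 + y * qc powi k)" if y: "y \<in> K" and k: "k ~= 0" for y and k :: int
 proof -
  have qk: "q powi k > 0" using q_pos by simp
  have "- (qc powi (-k)) \<in> W"
  proof -
   have "qc powi (-k) ~= 1"
   proof
    assume "qc powi (-k) = 1"
    hence "norm (qc powi (-k)) = 1" by simp
    hence "q powi (-k) = 1" by (simp only: norm_power_int norm_qc)
    moreover have "q powi (-k) = exp (of_int (-k) * L)"
     by (subst exp_power_int[symmetric]) (simp add: q_pos)
    ultimately have "of_int (-k) * L = 0" by (metis exp_eq_one_iff)
    thus False using k by simp
   qed
   thus ?thesis by (auto simp: W_def theta1_eq_0_iff qpowers_def)
  qed
  from d(2)[OF y this] have dd: "d \<le> norm (y + qc powi (-k))" by (simp add: dist_norm)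
  have "1 + y * qc powi k = qc powi k * (y + qc powi (-k))"
   by (simp add: distrib_left power_int_minus)
  hence n: "norm (1 + y * qc powi k) = q powi k * norm (y + qc powi (-k))"
   by (simp only: norm_mult norm_power_int norm_qc)
  show ?thesis
  proof (cases "q powi k \<le> 1 / (2 * R)")
   case True
   have "norm (y * qc powi k) \<le> R * (1 / (2 * R))"
    unfolding norm_mult norm_power_int norm_qc
    using R(2)[OF y] True qk R(1) by (intro mult_mono) auto
   hence "norm (y * qc powi k) \<le> 1/2" using R(1) by simp
   moreover have "1 - norm (y * qc powi k) \<le> norm (1 + y * qc powi k)"
    using norm_diff_ineq[of 1 "y * qc powi k"] by simp
   ultimately show ?thesis by (simp add: \<delta>_def)
  next
   case False
   hence "1 / (2 * R) * d \<le> q powi k * norm (y + qc powi (-k))"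
    using dd d(1) qk by (intro mult_mono) auto
   thus ?thesis unfolding n by (simp add: \<delta>_def)
  qed
 qed
 ultimately show ?thesis by blast
qed (auto intro: exI[of _ 1])

lemma has_sum_qb_abs: "r > 0 ==> ((%n. qb q n * r powi n) has_sum Re (\<theta> (of_real r))) UNIV"
proof -
 assume "r > 0"
 hence "((%n. complex_of_real (qb q n * r powi n)) has_sum \<theta> (of_real r)) UNIV"
  using jacobi_triple_product[of "of_real r"] by simp
 from has_sum_Re[OF this] show ?thesis by (simp only: Re_complex_of_real)
qed

lemma summable_qb_abs: "r > 0 ==> (%n. qb q n * r powi n) summable_on UNIV"
 using has_sum_qb_abs has_sum_imp_summable by blast

text \<open>The term with index 1 is the only one with a pole at \<open>y = - 1\<close>.\<close>

definition AL1 :: "complex \<Rightarrow> complex \<Rightarrow> complex" where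
 "AL1 x y = (\<Sum>\<^sub>\<infinity>n::int. if n = 1 then 0 else of_real (qb q n) * x powi n / (1 + y * qc powi (n - 1)))"

text \<open>Up to the factor \<open>1 / \<theta> x\<close>, the discrete transform of \<open>1 / (1 + t / q)\<close> for
\<open>y = \<lambda>\<close> and \<open>x = \<lambda> / z\<close>.\<close>

definition AL :: "complex \<Rightarrow> complex \<Rightarrow> complex" where
 "AL x y = (\<Sum>\<^sub>\<infinity>n::int. of_real (qb q n) * x powi n / (1 + y * qc powi (n - 1)))"

lemma powi_le_sum:
 fixes t r R :: real
 assumes "0 < r" "r \<le> t" "t \<le> R"
 shows "t powi n \<le> R powi n + r powi n"
proof (cases "n \<ge> 0")
 case True
 hence "t powi n \<le> R powi n" using assms by (intro power_int_mono) auto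
 moreover have "r powi n \<ge> 0" using assms by simp
 ultimately show ?thesis by linarith
next
 case False
 hence "t powi n \<le> r powi n" using assms by (intro power_int_antimono) auto
 moreover have "R powi n \<ge> 0" using assms by simp
 ultimately show ?thesis by linarith
qed

lemma AL1_holomorphic:
 assumes A: "open A" and x: "x holomorphic_on A" "\<And>u. u \<in> A ==> x u ~= 0"
  and y: "y holomorphic_on A" "\<And>u. u \<in> A ==> y u ~= 0" "\<And>u. u \<in> A ==> \<theta>1 (y u) ~= 0"
 shows "(%u. AL1 (x u) (y u)) holomorphic_on A"
  and "u \<in> A ==> (%n. norm (if n = 1 then 0 else of_real (qb q n) * x u powi n / (1 + y u * qc powi (n - 1)))) summable_on UNIV"
proof -
 define f where "f = (%n u. if n = 1 then 0 else of_real (qb q n) * x u powi n / (1 + y u * qc powi (n - 1)))"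
 have nz: "1 + y u * qc powi (n - 1) ~= 0" if "u \<in> A" "n ~= 1" for u n
 proof -
  have "0 \<notin> {y u}" "\<And>v. v \<in> {y u} ==> \<theta>1 v ~= 0" using y(2,3)[OF that(1)] by auto
  from lower_bound_1_plus[OF _ this] obtain \<delta> :: real
   where d: "\<delta> > 0" "\<forall>v\<in>{y u}. \<forall>k::int. k ~= 0 \<longrightarrow> \<delta> \<le> norm (1 + v * qc powi k)" by auto
  from d(2) have "\<delta> \<le> norm (1 + y u * qc powi (n - 1))" using that(2) by simp
  with d(1) show ?thesis by (metis norm_zero not_less)
 qed
 have hol: "f n holomorphic_on A" for n
 proof (cases "n = 1")
  case False
  thus ?thesis unfolding f_def using nz x(2) by (auto intro!: holomorphic_intros x(1) y(1))
 qed (simp add: f_def)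
 have bound: "\<exists>M. M summable_on UNIV \<and> (\<forall>n. \<forall>u\<in>K. norm (f n u) \<le> M n)" if K: "compact K" "K \<subseteq> A" for K
 proof (cases "K = {}")
  case False
  have cx: "continuous_on K x" and cy: "continuous_on K y"
   using continuous_on_subset[OF holomorphic_on_imp_continuous_on[OF x(1)] K(2)]
    continuous_on_subset[OF holomorphic_on_imp_continuous_on[OF y(1)] K(2)] by simp_all
  have "compact (y ` K)" using cy K(1) by (rule compact_continuous_image)
  moreover have yK: "y u ~= 0" "\<theta>1 (y u) ~= 0" if "u \<in> K" for u
   using y(2)[OF subsetD[OF K(2) that]] y(3)[OF subsetD[OF K(2) that]] by simp_all
  have "0 \<notin> y ` K"
  proof
   assume "0 \<in> y ` K"
   then obtain u where "u \<in> K" "0 = y u" by (rule imageE)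
   thus False using yK(1)[of u] by simp
  qed
  moreover have "\<theta>1 v ~= 0" if v: "v \<in> y ` K" for v
  proof -
   from v obtain u where "v = y u" "u \<in> K" by (rule imageE)
   thus ?thesis using yK(2)[of u] by simp
  qed
  ultimately obtain \<delta> :: real
   where \<delta>': "\<delta> > 0" "\<forall>v\<in>y ` K. \<forall>k::int. k ~= 0 \<longrightarrow> \<delta> \<le> norm (1 + v * qc powi k)"
   using lower_bound_1_plus[of "y ` K"] by meson
  have \<delta>2: "\<delta> \<le> norm (1 + y u * qc powi k)" if "u \<in> K" "k ~= 0" for u and k :: int
   using \<delta>'(2) that by simp
  note \<delta> = \<delta>'(1) \<delta>2
  have "compact (x ` K)" using cx K(1) by (rule compact_continuous_image)
  from compact_imp_bounded[OF this] obtain R where R: "\<And>u. u \<in> K ==> norm (x u) \<le> R" "R > 0"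
   unfolding bounded_pos by blast
  obtain u0 where u0: "u0 \<in> K" "\<And>u. u \<in> K ==> norm (x u0) \<le> norm (x u)"
   using continuous_attains_inf[OF K(1) False continuous_on_norm[OF cx]] by blast
  define r where "r = norm (x u0)"
  have r: "r > 0" using x(2) u0(1) K(2) by (auto simp: r_def)
  define M where "M = (%n. (qb q n * R powi n + qb q n * r powi n) * (1 / \<delta>))"
  have "M summable_on UNIV"
   unfolding M_def by (intro summable_on_cmult_left summable_on_add summable_qb_abs r R(2))
  moreover have "norm (f n u) \<le> M n" if u: "u \<in> K" for n u
  proof (cases "n = 1")
   case True
   thus ?thesis using less_imp_le[OF qb_pos] R(2) r \<delta>(1) by (simp add: f_def M_def)
  next
   case False
   have "norm (f n u) = qb q n * norm (x u) powi n * (1 / norm (1 + y u * qc powi (n - 1)))"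
    using False less_imp_le[OF qb_pos] by (simp add: f_def norm_mult norm_divide norm_power_int)
   also have "\<dots> \<le> (qb q n * (R powi n + r powi n)) * (1 / \<delta>)"
   proof (rule mult_mono)
    show "qb q n * norm (x u) powi n \<le> qb q n * (R powi n + r powi n)"
     using powi_le_sum[OF r, of "norm (x u)" R n] u0(2)[OF u] R(1)[OF u] less_imp_le[OF qb_pos[of n]]
     by (intro mult_left_mono) (simp_all add: r_def)
    have "\<delta> \<le> norm (1 + y u * qc powi (n - 1))" using \<delta>(2)[OF u, of "n - 1"] False by simp
    thus "1 / norm (1 + y u * qc powi (n - 1)) \<le> 1 / \<delta>"
     using \<delta>(1) by (intro divide_left_mono mult_pos_pos) linarith+
    show "0 \<le> qb q n * (R powi n + r powi n)"
     using less_imp_le[OF qb_pos[of n]] R(2) r by simp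
   qed simp
   finally show ?thesis by (simp add: M_def distrib_left)
  qed
  ultimately show ?thesis by blast
 qed (auto intro!: exI[of _ "%_. 0"])
 show "(%u. AL1 (x u) (y u)) holomorphic_on A"
  using holomorphic_infsum_int[OF A hol bound] by (simp add: f_def AL1_def)
 show "(%n. norm (if n = 1 then 0 else of_real (qb q n) * x u powi n / (1 + y u * qc powi (n - 1)))) summable_on UNIV"
  if "u \<in> A"
 proof -
  from bound[of "{u}"] that obtain M where M: "M summable_on UNIV" "\<And>n. norm (f n u) \<le> M n" by auto
  have "(%n. norm (f n u)) summable_on UNIV"
   by (rule summable_on_comparison_test[OF M(1)]) (use M(2) in auto)
  thus ?thesis unfolding f_def .
 qed
qed

lemma AL_abs_summable:
 assumes "x ~= 0" "y ~= 0" "\<theta>1 y ~= 0"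
 shows "(%n. norm (of_real (qb q n) * x powi n / (1 + y * qc powi (n - 1)))) summable_on UNIV"
proof -
 define f1 where "f1 = (%n. norm (if n = 1 then 0 else of_real (qb q n) * x powi n / (1 + y * qc powi (n - 1))))"
 define f2 where "f2 = (%n. norm (of_real (qb q n) * x powi n / (1 + y * qc powi (n - 1))))"
 have "f1 summable_on UNIV"
  using AL1_holomorphic(2)[of UNIV "%_. x" "%_. y"] assms unfolding f1_def by simp
 hence "f1 summable_on (UNIV - {1})"
  by (rule summable_on_subset_banach) simp
 moreover have "f1 summable_on (UNIV - {1}) \<longleftrightarrow> f2 summable_on (UNIV - {1})"
  by (rule summable_on_cong) (simp add: f1_def f2_def)
 ultimately have "f2 summable_on (insert 1 (UNIV - {1}))"
  unfolding summable_on_insert_iff by blast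
 moreover have *: "insert 1 (UNIV - {1}) = (UNIV :: int set)" by auto
 ultimately show ?thesis unfolding * f2_def by blast
qed

lemma AL_has_sum:
 assumes "x ~= 0" "y ~= 0" "\<theta>1 y ~= 0"
 shows "((%n. of_real (qb q n) * x powi n / (1 + y * qc powi (n - 1))) has_sum AL x y) UNIV"
 unfolding AL_def by (rule has_sum_infsum[OF abs_summable_summable[OF AL_abs_summable[OF assms]]])

lemma AL_split:
 assumes "x ~= 0" "y ~= 0" "\<theta>1 y ~= 0"
 shows "AL x y = x / (1 + y) + AL1 x y"
proof -
 define a where "a = (%n. of_real (qb q n) * x powi n / (1 + y * qc powi (n - 1)))"
 have s: "((%n. if n = 1 then 0 else a n) has_sum AL1 x y) UNIV"
  unfolding AL1_def a_def
 proof (rule has_sum_infsum, rule abs_summable_summable)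
  show "(%n. norm (if n = 1 then 0 else of_real (qb q n) * x powi n / (1 + y * qc powi (n - 1)))) summable_on UNIV"
   using AL1_holomorphic(2)[of UNIV "%_. x" "%_. y"] assms by simp
 qed
 have "((%n. if n = 1 then a 1 else 0) has_sum (\<Sum>n\<in>{1}. a n)) UNIV"
  by (rule has_sum_finite_neutralI[of "{1}"]) auto
 from has_sum_add[OF this s]
 have "((%n. (if n = 1 then a 1 else 0) + (if n = 1 then 0 else a n)) has_sum (a 1 + AL1 x y)) UNIV" by simp
 moreover have "(%n. (if n = 1 then a 1 else 0) + (if n = 1 then 0 else a n)) = a" by auto
 ultimately have "(a has_sum (a 1 + AL1 x y)) UNIV" by (simp only:)
 moreover have "(a has_sum AL x y) UNIV" unfolding a_def by (rule AL_has_sum[OF assms])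
 ultimately have "AL x y = a 1 + AL1 x y" using has_sum_unique by blast
 thus ?thesis by (simp add: a_def)
qed

lemma AL_q: "x ~= 0 ==> AL (qc * x) (qc * y) = AL x y / x"
proof -
 assume x: "x ~= 0"
 have "AL (qc * x) (qc * y) = (\<Sum>\<^sub>\<infinity>n::int. of_real (qb q n) * (qc * x) powi n / (1 + y * qc powi n))"
  unfolding AL_def
 proof (intro infsum_cong)
  fix n :: int
  have "qc * y * qc powi (n - 1) = y * qc powi n" by (simp add: power_int_diff)
  thus "of_real (qb q n) * (qc * x) powi n / (1 + qc * y * qc powi (n - 1))
    = of_real (qb q n) * (qc * x) powi n / (1 + y * qc powi n)" by (simp only:)
 qed
 also have "\<dots> = (\<Sum>\<^sub>\<infinity>n::int. of_real (qb q (n + 1)) * x powi (n + 1) / (1 + y * qc powi ((n + 1) - 1)) / x)"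
  using x by (intro infsum_cong) (simp add: qb_Suc power_int_add power_int_mult_distrib of_real_power_int)
 also have "\<dots> = (\<Sum>\<^sub>\<infinity>n::int. of_real (qb q n) * x powi n / (1 + y * qc powi (n - 1)) / x)"
  by (rule infsum_reindex_bij_betw[of "%n. n + 1" UNIV UNIV "%n. of_real (qb q n) * x powi n / (1 + y * qc powi (n - 1)) / x"])
   (rule bij_betwI[of _ _ _ "%n. n - 1"], auto)
 also have "\<dots> = AL x y / x"
  unfolding AL_def divide_inverse by (rule infsum_cmult_left')
 finally show ?thesis .
qed

text \<open>The partial fraction expansion of \<open>1 / \<theta>\<close>. The product of the series with \<open>\<theta> (- z)\<close> is elliptic
and its poles are cancelled by the zeros of \<open>\<theta>\<close>, so it is constant; at \<open>z = 1\<close> only one term survives.\<close>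

lemma AL_minus1:
 assumes "z ~= 0" "\<theta> (-z) ~= 0"
 shows "AL (-1) (-z) = - (qpc qc ^ 3) / \<theta> (-z)"
proof -
 define h where "h = (%u. \<theta> (- exp u))"
 define f where "f = (%u. AL (-1) (- exp u) * \<theta> (- exp u))"
 have nz1: "\<theta>1 (- exp u) ~= 0" if "h u ~= 0" for u
  using that by (auto simp: h_def theta_theta1)
 have h_hol: "h holomorphic_on UNIV" unfolding h_def by (intro holomorphic_intros) auto
 have op: "open {u. h u ~= 0}"
  by (rule open_Collect_neq) (auto intro: holomorphic_on_imp_continuous_on[OF h_hol])
 have f_eq: "f u = (-1 / (1 - exp u) + AL1 (-1) (- exp u)) * \<theta> (- exp u)" if "\<theta>1 (- exp u) ~= 0" for u
  using that by (simp add: f_def AL_split)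
 have f_eq2: "f u = - \<theta>1 (- exp u) + AL1 (-1) (- exp u) * \<theta> (- exp u)" if "\<theta>1 (- exp u) ~= 0" "exp u ~= 1" for u
 proof -
  have "(-1 / a + A) * (a * T) = - T + A * (a * T)" if "a ~= 0" for a A T :: complex
   using that by (simp add: field_simps)
  from this[of "1 - exp u"] that(2) show ?thesis
   unfolding f_eq[OF that(1)] theta_theta1 by simp
 qed
 have h_per: "h (u + of_real L) = 0 \<longleftrightarrow> h u = 0" for u
  using theta_q[of "- exp u"] by (simp add: h_def exp_add mult.commute[of _ qc])
 have f_L: "f (u + of_real L) = f u" if "h u ~= 0" for u
 proof -
  define a where "a = (%n. complex_of_real (qb q n) * (-1) powi n)"
  define y where "y = - exp u"
  have y: "y ~= 0" by (simp add: y_def)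
  have y1: "\<theta>1 y ~= 0" using nz1[OF that] by (simp add: y_def)
  have ynz: "1 + y * qc powi (n - 1) ~= 0" for n
  proof
   assume "1 + y * qc powi (n - 1) = 0"
   hence "- y = qc powi (1 - n)" by (simp add: power_int_diff add_eq_0_iff field_simps)
   hence "\<theta> y = 0" by (auto simp: theta_eq_0_iff qpowers_def)
   with that show False by (simp add: h_def y_def)
  qed
  have s: "((%n. a n / (1 + y * qc powi (n - 1))) has_sum AL (-1) y) UNIV"
   unfolding a_def by (rule AL_has_sum) (use y y1 in auto)
  have "((%n. a n * (1/qc) powi (n - 1)) has_sum (qc * \<theta> (- (1 / qc)))) UNIV"
  proof -
   have "((%n. qc * (of_real (qb q n) * (- (1/qc)) powi n)) has_sum (qc * \<theta> (- (1 / qc)))) UNIV"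
    by (intro has_sum_cmult_right jacobi_triple_product) auto
   moreover have "qc * (of_real (qb q n) * (- (1/qc)) powi n) = a n * (1/qc) powi (n - 1)" for n
    using power_int_mult_distrib[of "-1::complex" "1/qc" n]
    by (simp add: a_def power_int_diff field_simps)
   ultimately show ?thesis by simp
  qed
  moreover have "\<theta> (- (1 / qc)) = 0"
  proof -
   have "- (- (1 / qc)) = qc powi (-1)" by (simp add: power_int_minus field_simps)
   thus ?thesis unfolding theta_eq_0_iff qpowers_def by blast
  qed
  ultimately have z: "((%n. a n * (1/qc) powi (n - 1)) has_sum 0) UNIV" by simp
  have "((%n. - (a n * (1/qc) powi (n - 1) + (- y) * (a n / (1 + y * qc powi (n - 1))))) has_sum - (0 + (- y) * AL (-1) y)) UNIV"
   by (intro has_sum_uminusI has_sum_add z has_sum_cmult_right s)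
  moreover have "- (a n * (1/qc) powi (n - 1) + (- y) * (a n / (1 + y * qc powi (n - 1))))
    = a (n - 1) / (1 + (qc * y) * qc powi ((n - 1) - 1))" for n
  proof -
   define X where "X = qc powi (n - 1)"
   have X: "X ~= 0" by (simp add: X_def)
   have "a n = - (a (n - 1) * X)"
    using qb_Suc[of "n - 1"] by (simp add: a_def X_def of_real_power_int power_int_diff)
   moreover have "(1/qc) powi (n - 1) = 1 / X"
    by (simp add: X_def power_int_divide_distrib)
   moreover have "(qc * y) * qc powi ((n - 1) - 1) = y * X"
by (simp add: X_def power_int_diff power2_eq_square)
   ultimately show ?thesis using ynz[of n] X unfolding X_def[symmetric]
    by (simp only:) (simp add: divide_simps, simp add: algebra_simps)
  qed
  ultimately have "((%n. a (n - 1) / (1 + (qc * y) * qc powi ((n - 1) - 1))) has_sum (y * AL (-1) y)) UNIV"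
   by simp
  hence "((%n. a n / (1 + (qc * y) * qc powi (n - 1))) has_sum (y * AL (-1) y)) UNIV"
   using has_sum_reindex_bij_betw[of "%n. n - 1" UNIV UNIV "%n. a n / (1 + (qc * y) * qc powi (n - 1))"]
    bij_betwI[of "%n::int. n - 1" UNIV UNIV "%n. n + 1"] by auto
  hence "AL (-1) (qc * y) = y * AL (-1) y"
   unfolding AL_def[of "-1" "qc * y"] a_def by (rule infsumI)
  thus ?thesis
   using theta_q[OF y] y by (simp add: f_def y_def exp_add mult.commute[of _ qc])
 qed
 have "\<exists>c. \<forall>u. h u ~= 0 \<longrightarrow> f u = c"
 proof (rule doubly_periodic_imp_constant[of L "2 * pi"])
  show "h (ipi) ~= 0" using theta_nz_pos[of 1] by (simp add: h_def)
  have "(%u. (-1 / (1 - exp u) + AL1 (-1) (- exp u)) * \<theta> (- exp u)) holomorphic_on {u. h u ~= 0}"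
  proof (intro holomorphic_intros AL1_holomorphic(1) op)
   show "1 - exp u ~= 0" if "u \<in> {u. h u ~= 0}" for u
    using that by (auto simp: h_def theta_theta1)
  qed (use nz1 in auto)
  thus "f holomorphic_on {u. h u ~= 0}"
   by (rule holomorphic_transform) (use nz1 f_eq in auto)
  show "\<exists>m n \<zeta>0. \<zeta> = \<zeta>0 + of_int m * of_real L + of_int n * (\<omega>) \<and>
      ((%u. (u - \<zeta>0) * f u) \<longlongrightarrow> 0) (at \<zeta>0)" if z: "h \<zeta> = 0" for \<zeta>
  proof -
   have "\<theta> (exp (\<zeta> + ipi)) = 0" using z by (simp add: h_def exp_add)
   from theta_exp_zero[OF this] obtain m n :: int
    where mn: "\<zeta> = 0 + of_int m * of_real L + of_int n * (\<omega>)" by auto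
   define B where "B = {u. \<theta>1 (- exp u) ~= 0}"
   have B: "open B" unfolding B_def
    by (rule open_Collect_neq) (auto intro!: holomorphic_on_imp_continuous_on holomorphic_intros)
   have 0: "0 \<in> B" by (simp add: B_def theta1_minus1)
   have "(%u. u * (- \<theta>1 (- exp u) + AL1 (-1) (- exp u) * \<theta> (- exp u))) holomorphic_on B"
    by (intro holomorphic_intros AL1_holomorphic(1) B) (auto simp: B_def)
   hence "isCont (%u. u * (- \<theta>1 (- exp u) + AL1 (-1) (- exp u) * \<theta> (- exp u))) 0"
    using holomorphic_on_imp_continuous_on continuous_on_eq_continuous_at[OF B] 0 by blast
   hence "((%u. u * (- \<theta>1 (- exp u) + AL1 (-1) (- exp u) * \<theta> (- exp u))) \<longlongrightarrow> 0) (at 0)"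
    by (simp add: isCont_def)
   moreover have "eventually (%u. u * (- \<theta>1 (- exp u) + AL1 (-1) (- exp u) * \<theta> (- exp u)) = (u - 0) * f u) (at 0)"
   proof -
    have "eventually (%u. h u ~= 0 \<and> u \<in> UNIV) (at 0)"
     by (rule non_zero_neighbour_alt[OF h_hol open_UNIV connected_UNIV UNIV_I UNIV_I])
      (rule \<open>h (ipi) ~= 0\<close>)
    thus ?thesis
    proof eventually_elim
     case (elim u)
     hence "exp u ~= 1" by (auto simp: h_def)
     with f_eq2[of u] nz1[of u] elim show ?case by simp
    qed
   qed
   ultimately have "((%u. (u - 0) * f u) \<longlongrightarrow> 0) (at 0)" by (rule Lim_transform_eventually)
   with mn show ?thesis by blast
  qed
  show "h (u + of_real L) = 0 \<longleftrightarrow> h u = 0" for u by (rule h_per)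
  show "f (u + of_real L) = f u" if "h u ~= 0" for u by (rule f_L[OF that])
 qed (use h_hol in \<open>auto simp: h_def f_def exp_2pi[simplified]\<close>)
 then obtain c where c: "\<And>u. h u ~= 0 ==> f u = c" by blast
 have "c = - (qpc qc ^ 3)"
 proof -
  define B where "B = {u. \<theta>1 (- exp u) ~= 0}"
  have B: "open B" unfolding B_def
   by (rule open_Collect_neq) (auto intro!: holomorphic_on_imp_continuous_on holomorphic_intros)
  have 0: "0 \<in> B" by (simp add: B_def theta1_minus1)
  have "(%u. - \<theta>1 (- exp u) + AL1 (-1) (- exp u) * \<theta> (- exp u)) holomorphic_on B"
   by (intro holomorphic_intros AL1_holomorphic(1) B) (auto simp: B_def)
  hence "isCont (%u. - \<theta>1 (- exp u) + AL1 (-1) (- exp u) * \<theta> (- exp u)) 0"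
   using holomorphic_on_imp_continuous_on continuous_on_eq_continuous_at[OF B] 0 by blast
  hence 1: "((%u. - \<theta>1 (- exp u) + AL1 (-1) (- exp u) * \<theta> (- exp u)) \<longlongrightarrow> - (qpc qc ^ 3)) (at 0)"
   by (simp add: isCont_def theta1_minus1)
  have "eventually (%u. h u ~= 0 \<and> u \<in> UNIV) (at 0)"
   by (rule non_zero_neighbour_alt[OF h_hol open_UNIV connected_UNIV UNIV_I UNIV_I, of "ipi"])
    (use theta_nz_pos[of 1] in \<open>simp add: h_def\<close>)
  hence "eventually (%u. - \<theta>1 (- exp u) + AL1 (-1) (- exp u) * \<theta> (- exp u) = c) (at 0)"
  proof eventually_elim
   case (elim u)
   hence "exp u ~= 1" by (auto simp: h_def)
   with f_eq2[of u] nz1[of u] elim c[of u] show ?case by simp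
  qed
  with 1 have "((%_. c) \<longlongrightarrow> - (qpc qc ^ 3)) (at (0::complex))" by (rule Lim_transform_eventually)
  thus ?thesis by (simp add: tendsto_const_iff)
 qed
 moreover have "exp (Ln z) = z" using assms(1) by simp
 ultimately show ?thesis using c[of "Ln z"] assms(2) by (simp add: h_def f_def field_simps)
qed

end

context qbase
begin

section \<open>Elliptic identities for the discrete transform\<close>

lemma AL1_exp_holomorphic:
 "open A ==> (\<And>l. l \<in> A ==> \<theta>1 (exp l) ~= 0) ==> (%l. AL1 (exp (l - w)) (exp l)) holomorphic_on A"
 by (rule AL1_holomorphic(1)) (auto intro!: holomorphic_intros)

lemma theta_exp_nz_open: "open {l. \<theta> (exp l) * \<theta> (exp (l - w)) ~= 0}"
 by (rule open_Collect_neq) (auto intro!: holomorphic_on_imp_continuous_on holomorphic_intros)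

lemma eventually_theta_exp_nz:
 "eventually (%l. \<theta> (exp l) ~= 0 \<and> \<theta> (exp (l - w)) ~= 0) (at p)"
proof -
 have 1: "eventually (%l. \<theta> (exp (l - v)) ~= 0 \<and> l \<in> UNIV) (at p)" for v
  by (rule non_zero_neighbour_alt[of "%l. \<theta> (exp (l - v))", OF _ open_UNIV connected_UNIV UNIV_I UNIV_I, of v])
   (use theta_nz_pos[of 1] in \<open>auto intro!: holomorphic_intros\<close>)
 from 1[of 0] 1[of w] show ?thesis by eventually_elim auto
qed

lemma theta_minus_exp_inverse: "\<theta> (- (1 / z)) = - \<theta> (- z) / z" if "z ~= 0"
 using theta_inverse[of "-z"] that by simp

lemma zeros_two_thetas:
 assumes "\<theta> (exp l) * \<theta> (exp (l - w)) = 0"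
  and 1: "Plim (ipi)" and 2: "Plim (w + ipi)"
 shows "\<exists>m n \<zeta>0. l = \<zeta>0 + of_int m * of_real L + of_int n * (\<omega>) \<and> Plim \<zeta>0"
proof -
 from assms consider "\<theta> (exp l) = 0" | "\<theta> (exp (l - w)) = 0" by auto
 thus ?thesis
 proof cases
  case 1
  from theta_exp_zero[OF this] assms(2) show ?thesis by blast
 next
  case 2
  from theta_exp_zero[OF this] obtain m n :: int
   where "l - w = ipi + of_int m * of_real L + of_int n * (\<omega>)" by blast
  hence "l = (w + ipi) + of_int m * of_real L + of_int n * (\<omega>)"
   by (simp add: algebra_simps)
  with assms(3) show ?thesis by blast
 qed
qed

lemma two_thetas_periodic:
 "\<theta> (exp (l + of_real L)) * \<theta> (exp (l + of_real L - w)) = 0 \<longleftrightarrow> \<theta> (exp l) * \<theta> (exp (l - w)) = 0"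
 using theta_exp_per1[of l] theta_exp_per1[of "l - w"] by (simp add: algebra_simps)

lemma two_thetas_periodic2:
 "\<theta> (exp (l + \<omega>)) * \<theta> (exp (l + \<omega> - w)) = \<theta> (exp l) * \<theta> (exp (l - w))"
proof -
 have "l + \<omega> - w = (l - w) + \<omega>" by simp
 thus ?thesis by (simp only: exp_2pi)
qed

lemma QQ_periodic:
 assumes "\<theta> (exp l) * \<theta> (exp (l - w)) ~= 0"
 shows "Q (l + of_real L) - Q (l + of_real L - w) = Q l - Q (l - w)"
 using Q_L[of l] Q_L[of "l - w"] assms by (simp add: P_eq_0_iff algebra_simps)

lemma QQ_periodic2:
 "Q (l + \<omega>) - Q (l + \<omega> - w) = Q l - Q (l - w)"
proof -
 have "l + \<omega> - w = (l - w) + \<omega>" by simp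
 thus ?thesis by (simp only: Q_2pi) simp
qed

lemma isCont_Q: "\<theta> (exp u) ~= 0 ==> isCont Q u"
proof -
 assume u: "\<theta> (exp u) ~= 0"
 have "open {u. P u ~= 0}"
  by (rule open_Collect_neq) (auto intro!: holomorphic_on_imp_continuous_on holomorphic_intros)
 thus ?thesis
  using holomorphic_on_imp_continuous_on[OF holomorphic_Q] continuous_on_eq_continuous_at u
  by (auto simp: P_eq_0_iff)
qed

lemma isCont_Q_shift: "\<theta> (exp (u - w)) ~= 0 ==> isCont (%l. Q (l - w)) u"
 using isCont_o2[of u "%l. l - w" Q] isCont_Q[of "u - w"] by auto

lemma QQ_residues:
 assumes z: "\<theta> (- exp w) ~= 0"
 shows "((%l. (l - ipi) * (Q l - Q (l - w))) \<longlongrightarrow> 1) (at (ipi))"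
  and "((%l. (l - (w + ipi)) * (Q l - Q (l - w))) \<longlongrightarrow> -1) (at (w + ipi))"
proof -
 have nz1: "\<theta> (exp (ipi - w)) ~= 0"
  using z theta_minus_exp_inverse[of "exp w"] by (simp add: exp_diff)
 have nz2: "\<theta> (exp (w + ipi)) ~= 0"
  using z by (simp add: exp_add)
 have "((%l. (l - ipi) * Q (l - w)) \<longlongrightarrow> (ipi - ipi) * Q (ipi - w)) (at (ipi))"
  using isCont_Q_shift[OF nz1] by (intro tendsto_intros) (simp add: isCont_def)
 moreover have "((%l. (l - ipi) * Q l) \<longlongrightarrow> 1) (at (ipi))"
  using tendsto_Q_residue[of 0] by simp
 ultimately have "((%l. (l - ipi) * Q l - (l - ipi) * Q (l - w)) \<longlongrightarrow>
   1 - (ipi - ipi) * Q (ipi - w)) (at (ipi))"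
  by (intro tendsto_diff)
 thus "((%l. (l - ipi) * (Q l - Q (l - w))) \<longlongrightarrow> 1) (at (ipi))"
  by (simp add: algebra_simps)
 have "((%l. (l - (w + ipi)) * Q l) \<longlongrightarrow> (w + ipi - (w + ipi)) * Q (w + ipi)) (at (w + ipi))"
  using isCont_Q[OF nz2] by (intro tendsto_intros) (simp add: isCont_def)
 from tendsto_diff[OF this tendsto_Q_residue[of w]]
 show "((%l. (l - (w + ipi)) * (Q l - Q (l - w))) \<longlongrightarrow> -1) (at (w + ipi))"
  by (simp add: right_diff_distrib)
qed

lemma tendsto_div_1_plus_exp:
 "((%l. (l - ipi) / (1 + exp l)) \<longlongrightarrow> -1) (at (ipi))"
proof -
 have "((%l. 1 + exp l) has_field_derivative -1) (at (ipi))"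
  by (auto intro!: derivative_eq_intros)
 from tendsto_simple_zero[OF this] show ?thesis by simp
qed

text \<open>Both summands are elliptic in \<open>l\<close>. Modulo periods their poles lie at \<open>\<i> \<pi>\<close> and \<open>w + \<i> \<pi>\<close>; there
the residue of the series is a multiple of the partial fractions of \<open>1 / \<theta>\<close> and cancels that of \<open>Q\<close>.\<close>

lemma AL_Pd_constant:
 assumes z: "\<theta> (- exp w) ~= 0"
 shows "\<exists>c. \<forall>l. \<theta> (exp l) * \<theta> (exp (l - w)) ~= 0 \<longrightarrow>
     AL (exp (l - w)) (exp l) / \<theta> (exp (l - w)) + (Q l - Q (l - w)) / \<theta> (- exp w) = c"
proof -
 define h where "h = (%l. \<theta> (exp l) * \<theta> (exp (l - w)))"
 define f where "f = (%l. AL (exp (l - w)) (exp l) / \<theta> (exp (l - w)) + (Q l - Q (l - w)) / \<theta> (- exp w))"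
 define T where "T = \<theta> (- exp w)"
 have T: "T ~= 0" using z by (simp add: T_def)
 define Plim where "Plim = (%\<zeta>. ((%l. (l - \<zeta>) * f l) \<longlongrightarrow> 0) (at \<zeta>))"
 have nz1: "\<theta>1 (exp l) ~= 0" if "h l ~= 0" for l
  using that by (auto simp: h_def theta_theta1)
 have nz1': "1 + exp l ~= 0" if "h l ~= 0" for l
  using that by (auto simp: h_def theta_theta1)
 have f_eq: "f l = (exp (l - w) / (1 + exp l) + AL1 (exp (l - w)) (exp l)) / \<theta> (exp (l - w)) + (Q l - Q (l - w)) / T"
  if "h l ~= 0" for l
  using nz1[OF that] by (simp add: f_def AL_split T_def)
 have ev: "eventually (%l. h l ~= 0) (at p)" for p
  using eventually_theta_exp_nz[of w p] by (auto simp: h_def)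
 have P1: "Plim (ipi)"
 proof -
  define p where "p = ipi"
  have ep: "exp p = -1" by (simp add: p_def)
  have epw: "exp (p - w) = - (1 / exp w)" by (simp add: exp_diff ep)
  have \<theta>p: "\<theta> (exp (p - w)) = - T / exp w"
   unfolding epw T_def by (rule theta_minus_exp_inverse) simp
  hence \<theta>p0: "\<theta> (exp (p - w)) ~= 0" using T by simp
  define B where "B = {l. \<theta>1 (exp l) ~= 0}"
  have B: "open B" unfolding B_def
   by (rule open_Collect_neq) (auto intro!: holomorphic_on_imp_continuous_on holomorphic_intros)
  have "p \<in> B" by (simp add: B_def ep theta1_minus1)
  moreover have "(%l. AL1 (exp (l - w)) (exp l)) holomorphic_on B"
   by (rule AL1_exp_holomorphic[OF B]) (simp add: B_def)
  ultimately have c1: "isCont (%l. AL1 (exp (l - w)) (exp l)) p"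
   using holomorphic_on_imp_continuous_on continuous_on_eq_continuous_at[OF B] by blast
  have "(%l. \<theta> (exp (l - w))) holomorphic_on UNIV" by (intro holomorphic_intros) auto
  hence c2: "isCont (%l. \<theta> (exp (l - w))) p"
   using holomorphic_on_imp_continuous_on continuous_on_eq_continuous_at[OF open_UNIV] by blast
  have l1: "((%l. (l - p) / (1 + exp l)) \<longlongrightarrow> -1) (at p)"
   using tendsto_div_1_plus_exp by (simp add: p_def)
  have l2: "((%l. (l - p) * (Q l - Q (l - w))) \<longlongrightarrow> 1) (at p)"
   using QQ_residues(1)[OF z] by (simp add: p_def)
  have "((%l. ((l - p) / (1 + exp l) * exp (l - w) + (l - p) * AL1 (exp (l - w)) (exp l)) / \<theta> (exp (l - w))
       + (l - p) * (Q l - Q (l - w)) / T)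
     \<longlongrightarrow> (-1 * exp (p - w) + (p - p) * AL1 (exp (p - w)) (exp p)) / \<theta> (exp (p - w)) + 1 / T) (at p)"
   using \<theta>p0 T c1 c2 by (intro tendsto_intros l1 l2) (auto simp: isCont_def)
  also have "(-1 * exp (p - w) + (p - p) * AL1 (exp (p - w)) (exp p)) / \<theta> (exp (p - w)) + 1 / T = 0"
   using T unfolding \<theta>p by (simp add: epw)
  finally have "((%l. ((l - p) / (1 + exp l) * exp (l - w) + (l - p) * AL1 (exp (l - w)) (exp l)) / \<theta> (exp (l - w))
       + (l - p) * (Q l - Q (l - w)) / T) \<longlongrightarrow> 0) (at p)" .
  moreover have "eventually (%l. ((l - p) / (1 + exp l) * exp (l - w) + (l - p) * AL1 (exp (l - w)) (exp l)) / \<theta> (exp (l - w))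
       + (l - p) * (Q l - Q (l - w)) / T = (l - p) * f l) (at p)"
   using ev[of p]
  proof eventually_elim
   case (elim l)
   have "((l - p) / a * e + (l - p) * A) / t + (l - p) * X / T = (l - p) * ((e / a + A) / t + X / T)" for a e A t X
    by (simp add: distrib_left add_divide_distrib)
   thus ?case unfolding f_eq[OF elim] .
  qed
  ultimately show ?thesis unfolding Plim_def p_def[symmetric] by (rule Lim_transform_eventually)
 qed
 have P2: "Plim (w + ipi)"
 proof -
  define p where "p = w + ipi"
  have ep: "exp p = - exp w" by (simp add: p_def exp_add)
  have epw: "exp (p - w) = - 1" by (simp add: p_def)
  have hT: "\<theta> (exp p) = T" by (simp add: ep T_def)
  have nz1p: "1 + exp p ~= 0" "\<theta>1 (exp p) ~= 0" using T hT by (auto simp: theta_theta1)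
  define B where "B = {l. \<theta> (exp l) ~= 0}"
  have B: "open B" unfolding B_def
   by (rule open_Collect_neq) (auto intro!: holomorphic_on_imp_continuous_on holomorphic_intros)
  have pB: "p \<in> B" using T by (simp add: B_def hT)
  have "(%l. exp (l - w) / (1 + exp l) + AL1 (exp (l - w)) (exp l)) holomorphic_on B"
   by (intro holomorphic_intros AL1_exp_holomorphic[OF B]) (auto simp: B_def theta_theta1)
  with pB have c1: "isCont (%l. exp (l - w) / (1 + exp l) + AL1 (exp (l - w)) (exp l)) p"
   using holomorphic_on_imp_continuous_on continuous_on_eq_continuous_at[OF B] by blast
  have v: "exp (p - w) / (1 + exp p) + AL1 (exp (p - w)) (exp p) = - (qpc qc ^ 3) / T"
   using AL_split[of "-1" "- exp w"] AL_minus1[of "exp w"] z nz1p by (simp add: epw ep T_def)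
  have l1: "((%l. (l - p) / \<theta> (exp (l - w))) \<longlongrightarrow> - (1 / qpc qc ^ 3)) (at p)"
   using tendsto_div_theta_exp[of w] by (simp add: p_def)
  have l2: "((%l. (l - p) * (Q l - Q (l - w))) \<longlongrightarrow> -1) (at p)"
   using QQ_residues(2)[OF z] by (simp add: p_def)
  have "((%l. (l - p) / \<theta> (exp (l - w)) * (exp (l - w) / (1 + exp l) + AL1 (exp (l - w)) (exp l))
       + (l - p) * (Q l - Q (l - w)) / T)
     \<longlongrightarrow> - (1 / qpc qc ^ 3) * (exp (p - w) / (1 + exp p) + AL1 (exp (p - w)) (exp p)) + (-1) / T) (at p)"
   by (rule tendsto_add[OF tendsto_mult[OF l1 c1[unfolded isCont_def]] tendsto_divide[OF l2 tendsto_const T]])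
  also have "- (1 / qpc qc ^ 3) * (exp (p - w) / (1 + exp p) + AL1 (exp (p - w)) (exp p)) + (-1) / T = 0"
   unfolding v by simp
  finally have "((%l. (l - p) / \<theta> (exp (l - w)) * (exp (l - w) / (1 + exp l) + AL1 (exp (l - w)) (exp l))
       + (l - p) * (Q l - Q (l - w)) / T) \<longlongrightarrow> 0) (at p)" .
  moreover have "eventually (%l. (l - p) / \<theta> (exp (l - w)) * (exp (l - w) / (1 + exp l) + AL1 (exp (l - w)) (exp l))
       + (l - p) * (Q l - Q (l - w)) / T = (l - p) * f l) (at p)"
   using ev[of p]
  proof eventually_elim
   case (elim l)
   have "(l - p) / t * A + (l - p) * X / T = (l - p) * (A / t + X / T)" for A t X
    by (simp add: distrib_left)
   thus ?case unfolding f_eq[OF elim] .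
  qed
  ultimately show ?thesis unfolding Plim_def p_def[symmetric] by (rule Lim_transform_eventually)
 qed
 have "\<exists>c. \<forall>l. h l ~= 0 \<longrightarrow> f l = c"
 proof (rule doubly_periodic_imp_constant[of L "2 * pi"])
  show "h holomorphic_on UNIV" unfolding h_def by (intro holomorphic_intros) auto
  obtain l0 where "h l0 ~= 0" using eventually_happens[OF ev[of 0]] by auto
  thus "h (SOME l. h l ~= 0) ~= 0" by (rule someI)
  have op: "open {l. h l ~= 0}" unfolding h_def by (rule theta_exp_nz_open)
  have "(%l. (exp (l - w) / (1 + exp l) + AL1 (exp (l - w)) (exp l)) / \<theta> (exp (l - w)) + (Q l - Q (l - w)) / T) holomorphic_on {l. h l ~= 0}"
   by (intro holomorphic_intros AL1_exp_holomorphic[OF op]) (use nz1 nz1' T in \<open>auto simp: h_def\<close>)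
  thus "f holomorphic_on {l. h l ~= 0}"
   by (rule holomorphic_transform) (use f_eq in auto)
  show "h (u + of_real L) = 0 \<longleftrightarrow> h u = 0" for u
   unfolding h_def by (rule two_thetas_periodic)
  show "h (u + \<omega>) = 0 \<longleftrightarrow> h u = 0" for u
   unfolding h_def two_thetas_periodic2 ..
  show "f (u + \<omega>) = f u" for u
  proof -
   have "u + \<omega> - w = (u - w) + \<omega>" by simp
   hence "exp (u + \<omega> - w) = exp (u - w)" by (simp only: exp_2pi)
   thus ?thesis unfolding f_def QQ_periodic2 by (simp only: exp_2pi)
  qed
  show "f (u + of_real L) = f u" if "h u ~= 0" for u
  proof -
   have e: "exp (u + of_real L) = qc * exp u" "exp (u + of_real L - w) = qc * exp (u - w)"
    by (simp_all add: exp_add exp_diff)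
   have "\<theta> (exp (u - w)) ~= 0" using that by (simp add: h_def)
   thus ?thesis
    unfolding f_def QQ_periodic[OF that[unfolded h_def]] unfolding e
    by (simp add: AL_q theta_q)
  qed
  show "\<exists>m n \<zeta>0. \<zeta> = \<zeta>0 + of_int m * of_real L + of_int n * (\<omega>) \<and>
      ((%u. (u - \<zeta>0) * f u) \<longlongrightarrow> 0) (at \<zeta>0)" if "h \<zeta> = 0" for \<zeta>
   using zeros_two_thetas[of \<zeta> w Plim, OF that[unfolded h_def] P1 P2] by (simp only: Plim_def)
 qed auto
 thus ?thesis unfolding h_def f_def .
qed

text \<open>Again two elliptic functions of the first point with the same two poles and residues. The
constant is zero because the quotient vanishes when the two points agree.\<close>

lemma QQ_theta_quotient:
 assumes l1: "\<theta> (exp l1) ~= 0" "\<theta> (exp (l1 - w)) ~= 0" and l2: "\<theta> (exp l2) ~= 0" "\<theta> (exp (l2 - w)) ~= 0"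
  and z: "\<theta> (- exp w) ~= 0"
 shows "(Q l1 - Q (l1 - w)) - (Q l2 - Q (l2 - w))
  = qpc qc ^ 3 * \<theta> (- exp w) * \<theta> (- exp (l1 - l2)) * \<theta> (- exp (l1 + l2 - w))
   / (\<theta> (exp l1) * \<theta> (exp l2) * \<theta> (exp (l1 - w)) * \<theta> (exp (w - l2)))"
proof -
 define h where "h = (%l. \<theta> (exp l) * \<theta> (exp (l - w)))"
 define T where "T = \<theta> (- exp w)"
 define K where "K = qpc qc ^ 3"
 define n where "n = (%l. \<theta> (- exp (l - l2)) * \<theta> (- exp (l + l2 - w)))"
 define a where "a = \<theta> (exp l2)"
 define b where "b = \<theta> (exp (w - l2))"
 define f where "f = (%l. (Q l - Q (l - w)) - K * T * n l / (\<theta> (exp l) * a * \<theta> (exp (l - w)) * b))"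
 have T: "T ~= 0" using z by (simp add: T_def)
 have K: "K ~= 0" by (simp add: K_def)
 have a: "a ~= 0" using l2 by (simp add: a_def)
 have inv: "\<theta> (exp (- u)) = \<theta> (exp u) / exp u" for u
  using theta_inverse[of "exp u"] by (simp add: exp_minus inverse_eq_divide)
 have b_eq: "\<theta> (exp (l2 - w)) = b / exp (w - l2)"
  using inv[of "w - l2"] by (simp add: b_def)
 hence b: "b ~= 0" using l2 by auto
 have ev: "eventually (%l. h l ~= 0) (at p)" for p
  using eventually_theta_exp_nz[of w p] by (auto simp: h_def)
 define Plim where "Plim = (%\<zeta>. ((%l. (l - \<zeta>) * f l) \<longlongrightarrow> 0) (at \<zeta>))"
 have n_cont: "isCont n p" for p
 proof -
  have "n holomorphic_on UNIV" unfolding n_def by (intro holomorphic_intros) auto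
  thus ?thesis using holomorphic_on_imp_continuous_on continuous_on_eq_continuous_at[OF open_UNIV] by blast
 qed
 have t_cont: "isCont (%l. \<theta> (exp (l - v))) p" for p v
 proof -
  have "(%l. \<theta> (exp (l - v))) holomorphic_on UNIV" by (intro holomorphic_intros) auto
  thus ?thesis using holomorphic_on_imp_continuous_on continuous_on_eq_continuous_at[OF open_UNIV] by blast
 qed
 have P1: "Plim (ipi)"
 proof -
  define p where "p = ipi"
  have ep: "exp p = -1" by (simp add: p_def)
  have epw: "exp (p - w) = - (1 / exp w)" by (simp add: exp_diff ep)
  have \<theta>p: "\<theta> (exp (p - w)) = - T / exp w"
   unfolding epw T_def by (rule theta_minus_exp_inverse) simp
  hence \<theta>p0: "\<theta> (exp (p - w)) ~= 0" using T by simp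
  have "- exp (p - l2) = exp (- l2)" "- exp (p + l2 - w) = exp (l2 - w)"
   by (simp_all add: exp_add exp_diff ep exp_minus divide_inverse)
  hence np: "n p = a / exp l2 * (b / exp (w - l2))"
   unfolding n_def by (simp only: inv[of l2] b_eq a_def)
  have l1: "((%l. (l - p) / \<theta> (exp l)) \<longlongrightarrow> - (1 / K)) (at p)"
   using tendsto_div_theta_exp[of 0] by (simp add: p_def K_def)
  have l2': "((%l. (l - p) * (Q l - Q (l - w))) \<longlongrightarrow> 1) (at p)"
   using QQ_residues(1)[OF z] by (simp add: p_def)
  have "((%l. (l - p) * (Q l - Q (l - w)) - (l - p) / \<theta> (exp l) * (K * T * n l / (a * \<theta> (exp (l - w)) * b)))
   \<longlongrightarrow> 1 - (- (1 / K)) * (K * T * n p / (a * \<theta> (exp (p - w)) * b))) (at p)"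
   using \<theta>p0 a b
   by (intro tendsto_diff tendsto_mult tendsto_divide tendsto_const l1 l2'
      n_cont[of p, unfolded isCont_def] t_cont[where v = w and p = p, unfolded isCont_def]) auto
  also have "1 - (- (1 / K)) * (K * T * n p / (a * \<theta> (exp (p - w)) * b)) = 0"
   unfolding np \<theta>p using K T a b by (simp add: exp_diff field_simps)
  finally have "((%l. (l - p) * (Q l - Q (l - w)) - (l - p) / \<theta> (exp l) * (K * T * n l / (a * \<theta> (exp (l - w)) * b))) \<longlongrightarrow> 0) (at p)" .
  moreover have "(%l. (l - p) * (Q l - Q (l - w)) - (l - p) / \<theta> (exp l) * (K * T * n l / (a * \<theta> (exp (l - w)) * b))) = (%l. (l - p) * f l)"
   by (simp add: f_def fun_eq_iff right_diff_distrib mult_ac)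
  ultimately show ?thesis unfolding Plim_def p_def[symmetric] by simp
 qed
 have P2: "Plim (w + ipi)"
 proof -
  define p where "p = w + ipi"
  have ep: "exp p = - exp w" by (simp add: p_def exp_add)
  have \<theta>p: "\<theta> (exp p) = T" by (simp add: ep T_def)
  have "- exp (p - l2) = exp (w - l2)" "- exp (p + l2 - w) = exp l2"
   by (simp_all add: exp_add exp_diff ep)
  hence np: "n p = b * a"
   unfolding n_def by (simp only: b_def a_def)
  have l1: "((%l. (l - p) / \<theta> (exp (l - w))) \<longlongrightarrow> - (1 / K)) (at p)"
   using tendsto_div_theta_exp[of w] by (simp add: p_def K_def)
  have l2': "((%l. (l - p) * (Q l - Q (l - w))) \<longlongrightarrow> -1) (at p)"
   using QQ_residues(2)[OF z] by (simp add: p_def)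
  have "((%l. (l - p) * (Q l - Q (l - w)) - (l - p) / \<theta> (exp (l - w)) * (K * T * n l / (\<theta> (exp l) * a * b)))
   \<longlongrightarrow> -1 - (- (1 / K)) * (K * T * n p / (\<theta> (exp p) * a * b))) (at p)"
   using T \<theta>p a b n_cont[of p] t_cont[where v = 0 and p = p]
   by (intro tendsto_diff tendsto_mult tendsto_divide tendsto_const l1 l2') (auto simp: isCont_def)
  also have "-1 - (- (1 / K)) * (K * T * n p / (\<theta> (exp p) * a * b)) = 0"
   unfolding np \<theta>p using K T a b by (simp add: field_simps)
  finally have "((%l. (l - p) * (Q l - Q (l - w)) - (l - p) / \<theta> (exp (l - w)) * (K * T * n l / (\<theta> (exp l) * a * b))) \<longlongrightarrow> 0) (at p)" .
  moreover have "(%l. (l - p) * (Q l - Q (l - w)) - (l - p) / \<theta> (exp (l - w)) * (K * T * n l / (\<theta> (exp l) * a * b))) = (%l. (l - p) * f l)"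
   by (simp add: f_def fun_eq_iff right_diff_distrib mult_ac)
  ultimately show ?thesis unfolding Plim_def p_def[symmetric] by simp
 qed
 have "\<exists>c. \<forall>l. h l ~= 0 \<longrightarrow> f l = c"
 proof (rule doubly_periodic_imp_constant[of L "2 * pi"])
  show "h holomorphic_on UNIV" unfolding h_def by (intro holomorphic_intros) auto
  show "h l1 ~= 0" using l1 by (simp add: h_def)
  show "f holomorphic_on {l. h l ~= 0}"
   unfolding f_def n_def by (intro holomorphic_intros) (use a b in \<open>auto simp: h_def\<close>)
  show "h (u + of_real L) = 0 \<longleftrightarrow> h u = 0" for u
   unfolding h_def by (rule two_thetas_periodic)
  show "h (u + \<omega>) = 0 \<longleftrightarrow> h u = 0" for u
   unfolding h_def two_thetas_periodic2 ..
  show "f (u + \<omega>) = f u" for u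
  proof -
   have "u + \<omega> - w = (u - w) + \<omega>" 
    "u + \<omega> - l2 = (u - l2) + \<omega>"
    "u + \<omega> + l2 - w = (u + l2 - w) + \<omega>" by simp_all
   hence "exp (u + \<omega> - w) = exp (u - w)"
    "exp (u + \<omega> - l2) = exp (u - l2)"
    "exp (u + \<omega> + l2 - w) = exp (u + l2 - w)" by (simp_all only: exp_2pi)
   thus ?thesis unfolding f_def QQ_periodic2 n_def by (simp only: exp_2pi)
  qed
  show "f (u + of_real L) = f u" if "h u ~= 0" for u
  proof -
   have e: "exp (u + of_real L) = qc * exp u" "exp (u + of_real L - w) = qc * exp (u - w)"
    "- exp (u + of_real L - l2) = qc * (- exp (u - l2))"
    "- exp (u + of_real L + l2 - w) = qc * (- exp (u + l2 - w))"
    by (simp_all add: exp_add exp_diff)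
   have "exp (u - l2) * exp (u + l2 - w) = exp u * exp (u - w)"
    unfolding exp_add[symmetric] by (rule arg_cong[of _ _ exp]) simp
   hence ee: "N1 / (- exp (u - l2)) * (N2 / (- exp (u + l2 - w))) = N1 * N2 / (exp u * exp (u - w))" for N1 N2
    by simp
   have "K * T * n (u + of_real L) / (\<theta> (exp (u + of_real L)) * a * \<theta> (exp (u + of_real L - w)) * b)
     = K * T * (\<theta> (- exp (u - l2)) / (- exp (u - l2)) * (\<theta> (- exp (u + l2 - w)) / (- exp (u + l2 - w))))
      / (\<theta> (exp u) / exp u * a * (\<theta> (exp (u - w)) / exp (u - w)) * b)"
    unfolding n_def e by (subst (1 2 3 4) theta_q) simp_all
   also have "\<dots> = K * T * n u / (\<theta> (exp u) * a * \<theta> (exp (u - w)) * b)"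
    unfolding ee n_def by (simp add: divide_simps)
   finally show ?thesis
    unfolding f_def QQ_periodic[OF that[unfolded h_def]] by simp
  qed
  show "\<exists>m n \<zeta>0. \<zeta> = \<zeta>0 + of_int m * of_real L + of_int n * (\<omega>) \<and>
      ((%u. (u - \<zeta>0) * f u) \<longlongrightarrow> 0) (at \<zeta>0)" if "h \<zeta> = 0" for \<zeta>
   using zeros_two_thetas[of \<zeta> w Plim, OF that[unfolded h_def] P1 P2] by (simp only: Plim_def)
 qed auto
 then obtain c where c: "\<And>l. h l ~= 0 ==> f l = c" by blast
 have f2: "f l2 = Q l2 - Q (l2 - w)" by (simp add: f_def n_def)
 have f12: "f l1 = f l2" using c[of l1] c[of l2] l1 l2 by (simp add: h_def)
 have "(Q l1 - Q (l1 - w)) - (Q l2 - Q (l2 - w)) = K * T * n l1 / (\<theta> (exp l1) * a * \<theta> (exp (l1 - w)) * b)"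
  using f12[unfolded f2] by (simp only: f_def diff_eq_eq) (simp add: algebra_simps)
 thus ?thesis by (simp add: K_def T_def n_def a_def b_def mult_ac)
qed

end

section \<open>Integration tools\<close>

lemma exp_substitution:
 fixes f :: "real \<Rightarrow> complex"
 shows "set_integrable lborel {0<..} (%t. f t / of_real t) \<longleftrightarrow> integrable lborel (%s. f (exp s))" (is ?A)
  and "set_lebesgue_integral lborel {0<..} (%t. f t / of_real t) = integral\<^sup>L lborel (%s. f (exp s))" (is ?B)
proof -
 have range: "range exp = {0::real<..}"
  by (auto simp: image_iff intro: exI[of _ "ln _"] dest: exp_total)
 have m1: "(%s. f (exp s)) \<in> borel_measurable borel"
  if "(%t. indicator {0<..} t *\<^sub>R (f t / of_real t)) \<in> borel_measurable borel"
 proof -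
  have "(%s. of_real (exp s) * (%t. indicator {0<..} t *\<^sub>R (f t / of_real t)) (exp s)) \<in> borel_measurable borel"
   by (intro borel_measurable_times measurable_compose[OF _ that]) measurable
  thus ?thesis by simp
 qed
 have m2: "(%t. indicator {0<..} t *\<^sub>R (f t / of_real t)) \<in> borel_measurable borel"
  if "(%s. f (exp s)) \<in> borel_measurable borel"
 proof -
  have "(%t. indicator {0<..} t *\<^sub>R ((%s. f (exp s)) (ln t) / of_real t)) \<in> borel_measurable borel"
   by (intro borel_measurable_scaleR borel_measurable_divide measurable_compose[OF _ that]) measurable
  also have "(%t. indicator {0<..} t *\<^sub>R ((%s. f (exp s)) (ln t) / of_real t)) = (%t. indicator {0<..} t *\<^sub>R (f t / of_real t))"
   by (auto simp: indicator_def fun_eq_iff)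
  finally show ?thesis .
 qed
 have simp1: "(%s. \<bar>exp s\<bar> *\<^sub>R (f (exp s) / of_real (exp s))) = (%s. f (exp s))"
  by (simp add: scaleR_conv_of_real fun_eq_iff)
 have cv: "((%s. f (exp s)) absolutely_integrable_on UNIV \<and> integral UNIV (%s. f (exp s)) = b)
  \<longleftrightarrow> ((%t. f t / of_real t) absolutely_integrable_on {0<..} \<and> integral {0<..} (%t. f t / of_real t) = b)" for b
  using has_absolute_integral_change_of_variables_real[of UNIV exp exp "%t. f t / of_real t" b]
  unfolding simp1 range by (auto simp: inj_on_def intro: DERIV_exp)
 have lb1: "(%s. f (exp s)) absolutely_integrable_on UNIV \<longleftrightarrow> integrable lborel (%s. f (exp s))"
  if "(%s. f (exp s)) \<in> borel_measurable borel"
  using integrable_completion[of "%s. f (exp s)" lborel] that by (simp add: set_integrable_def)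
 have lb2: "(%t. f t / of_real t) absolutely_integrable_on {0<..} \<longleftrightarrow> set_integrable lborel {0<..} (%t. f t / of_real t)"
  if "(%s. f (exp s)) \<in> borel_measurable borel"
  using integrable_completion[of "%t. indicator {0<..} t *\<^sub>R (f t / of_real t)" lborel] m2[OF that]
  by (simp add: set_integrable_def)
 show A: ?A
 proof
  assume "set_integrable lborel {0<..} (%t. f t / of_real t)"
  moreover from this have m: "(%s. f (exp s)) \<in> borel_measurable borel"
   using m1 borel_measurable_integrable unfolding set_integrable_def by force
  ultimately show "integrable lborel (%s. f (exp s))"
   using lb1[OF m] lb2[OF m] cv by blast
 next
  assume i: "integrable lborel (%s. f (exp s))"
  hence m: "(%s. f (exp s)) \<in> borel_measurable borel"
   using borel_measurable_integrable by force
  from i show "set_integrable lborel {0<..} (%t. f t / of_real t)"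
   using lb1[OF m] lb2[OF m] cv by blast
 qed
 show ?B
 proof (cases "integrable lborel (%s. f (exp s))")
  case True
  hence m: "(%s. f (exp s)) \<in> borel_measurable borel"
   using borel_measurable_integrable by force
  have a1: "(%s. f (exp s)) absolutely_integrable_on UNIV" using lb1[OF m] True by blast
  hence "integral UNIV (%s. f (exp s)) = integral {0<..} (%t. f t / of_real t)"
   using cv by metis
  moreover have "integral UNIV (%s. f (exp s)) = integral\<^sup>L lborel (%s. f (exp s))"
   using integral_lborel[OF True] by simp
  moreover have "integral {0<..} (%t. f t / of_real t) = set_lebesgue_integral lborel {0<..} (%t. f t / of_real t)"
   using set_borel_integral_eq_integral(2)[of "{0<..}" "%t. f t / of_real t"] True A by simp
  ultimately show ?thesis by simp
 next
  case False
  hence "\<not> integrable lborel (%t. indicator {0<..} t *\<^sub>R (f t / of_real t))" using A by (simp add: set_integrable_def)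
  with False show ?thesis by (simp add: set_lebesgue_integral_def not_integrable_integral_eq)
 qed
qed

lemma exp_substitution_Icc:
 fixes f :: "real \<Rightarrow> complex"
 assumes q: "0 < q"
 shows "set_lebesgue_integral lborel {q..1} (%t. f t / of_real t) = set_lebesgue_integral lborel {ln q..0} (%s. f (exp s))"
proof -
 have "set_lebesgue_integral lborel {q..1} (%t. f t / of_real t)
   = set_lebesgue_integral lborel {0<..} (%t. (indicator {q..1} t *\<^sub>R f t) / of_real t)"
  unfolding set_lebesgue_integral_def
  by (intro Bochner_Integration.integral_cong) (use q in \<open>auto simp: indicator_def\<close>)
 also have "\<dots> = integral\<^sup>L lborel (%s. indicator {q..1} (exp s) *\<^sub>R f (exp s))"
  by (rule exp_substitution(2))
 also have "\<dots> = set_lebesgue_integral lborel {ln q..0} (%s. f (exp s))"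
  unfolding set_lebesgue_integral_def
 proof (intro Bochner_Integration.integral_cong refl)
  fix s :: real
  have "q \<le> exp s \<longleftrightarrow> exp (ln q) \<le> exp s" using q by simp
  hence "exp s \<in> {q..1} \<longleftrightarrow> s \<in> {ln q..0}" by simp
  thus "indicator {q..1} (exp s) *\<^sub>R f (exp s) = indicat_real {ln q..0} s *\<^sub>R f (exp s)"
   by (simp add: indicator_def)
 qed
 finally show ?thesis .
qed

text \<open>The folded series need only be known off a countable set, since its terms may have poles on
the line.\<close>

lemma periodization:
 fixes f F :: "real \<Rightarrow> complex" and L :: real
 assumes L: "L < 0" and f: "integrable lborel f" and N: "countable N"
  and F: "\<And>s. s \<in> {L..0} ==> s \<notin> N ==> ((%n::int. f (s + of_int n * L)) has_sum F s) UNIV"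
 shows "set_integrable lborel {L..0} F" "integral\<^sup>L lborel f = set_lebesgue_integral lborel {L..0} F"
proof -
 define I where "I = (%n::int. {s. L \<le> s - of_int n * L \<and> s - of_int n * L < 0})"
 define d where "d = (from_nat_into (UNIV :: int set))"
 have d: "bij_betw d UNIV UNIV"
  unfolding d_def using bij_betw_from_nat_into[of "UNIV :: int set"] infinite_UNIV_int by simp
 define A where "A = (%i. I (d i))"
 define gg where "gg = (%i s. indicat_real {L..<0} s *\<^sub>R f (s + of_int (d i) * L))"
 have I_meas: "I n \<in> sets borel" for n unfolding I_def by measurable
 have uniq: "m = n" if "s \<in> I m" "s \<in> I n" for s m n
 proof -
  have "s - of_int m * L - (s - of_int n * L) = of_int (n - m) * L" by (simp add: algebra_simps)
  hence "\<bar>of_int (n - m) * L\<bar> < - L" using that by (auto simp: I_def)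
  hence "\<bar>of_int (n - m) :: real\<bar> * (- L) < 1 * (- L)" using L by (simp add: abs_mult)
  hence "\<bar>of_int (n - m) :: real\<bar> < 1" using L by (metis mult_less_cancel_right_pos neg_0_less_iff_less)
  thus ?thesis by linarith
 qed
 have cover: "\<exists>n. s \<in> I n" for s
 proof -
  define n where "n = \<lceil>s / L\<rceil> - 1"
  have "of_int n < s / L" "s / L \<le> of_int n + 1" unfolding n_def by linarith+
  hence "s < of_int n * L" "(of_int n + 1) * L \<le> s" using L by (auto simp: field_simps)
  thus ?thesis by (auto simp: I_def algebra_simps)
 qed
 have disj: "disjoint_family A"
  unfolding disjoint_family_on_def A_def using uniq d by (auto simp: bij_betw_def inj_on_def)
 have UN: "(\<Union>i. A i) = UNIV"
 proof -
  have "s \<in> (\<Union>i. A i)" for s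
  proof -
   obtain n where "s \<in> I n" using cover by blast
   moreover obtain i where "d i = n" using d by (metis bij_betw_imp_surj_on surj_def)
   ultimately show ?thesis by (auto simp: A_def)
  qed
  thus ?thesis by auto
 qed
 have A_meas: "A i \<in> sets lborel" for i using I_meas by (simp add: A_def)
 have f_meas: "f \<in> borel_measurable borel" using f borel_measurable_integrable by force
 have shift: "indicat_real (A i) (of_int (d i) * L + 1 * s) *\<^sub>R f (of_int (d i) * L + 1 * s) = gg i s" for i s
  by (auto simp: gg_def A_def I_def indicator_def add.commute)
 have int_gg: "integrable lborel (gg i)" for i
 proof -
  have "integrable lborel (%s. indicat_real (A i) s *\<^sub>R f s)"
   using f A_meas by (intro integrable_mult_indicator) auto
  from lborel_integrable_real_affine[OF this, of 1 "of_int (d i) * L"] show ?thesis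
   unfolding shift by simp
 qed
 have I_gg: "integral\<^sup>L lborel (gg i) = set_lebesgue_integral lborel (A i) f" for i
  unfolding set_lebesgue_integral_def
  by (subst lborel_integral_real_affine[of 1 _ "of_int (d i) * L"]) (simp_all add: shift[simplified])
 have nn_gg: "(\<integral>\<^sup>+s. ennreal (norm (gg i s)) \<partial>lborel) = (\<integral>\<^sup>+s. ennreal (norm (f s)) * indicator (A i) s \<partial>lborel)" for i
 proof -
  have "(\<integral>\<^sup>+s. ennreal (norm (f s)) * indicator (A i) s \<partial>lborel)
   = (\<integral>\<^sup>+s. ennreal (norm (f (of_int (d i) * L + 1 * s))) * indicator (A i) (of_int (d i) * L + 1 * s) \<partial>lborel)"
   using f_meas A_meas by (subst nn_integral_real_affine[of _ 1 "of_int (d i) * L"]) auto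
  also have "\<dots> = (\<integral>\<^sup>+s. ennreal (norm (gg i s)) \<partial>lborel)"
   unfolding shift[symmetric] by (intro nn_integral_cong) (simp add: indicator_def)
  finally show ?thesis ..
 qed
 have tot: "(\<Sum>i. \<integral>\<^sup>+s. ennreal (norm (gg i s)) \<partial>lborel) = (\<integral>\<^sup>+s. ennreal (norm (f s)) \<partial>lborel)"
 proof -
  have "(\<integral>\<^sup>+s. ennreal (norm (f s)) \<partial>lborel) = (\<integral>\<^sup>+s. (\<Sum>i. ennreal (norm (f s)) * indicator (A i) s) \<partial>lborel)"
  proof (intro nn_integral_cong)
   fix s :: real
   obtain i where "s \<in> A i" using UN by blast
   from suminf_cmult_indicator[OF disj this, of "%_. ennreal (norm (f s))"]
   show "ennreal (norm (f s)) = (\<Sum>i. ennreal (norm (f s)) * indicator (A i) s)" ..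
  qed
  also have "\<dots> = (\<Sum>i. \<integral>\<^sup>+s. ennreal (norm (f s)) * indicator (A i) s \<partial>lborel)"
   using f_meas A_meas by (intro nn_integral_suminf) auto
  finally show ?thesis by (simp add: nn_gg)
 qed
 have fin: "(\<integral>\<^sup>+s. ennreal (norm (f s)) \<partial>lborel) < \<infinity>"
  using f by (simp add: integrable_iff_bounded)
 have gg_meas: "gg i \<in> borel_measurable lborel" for i using int_gg borel_measurable_integrable by blast
 have s1: "summable (%i. \<integral>s. norm (gg i s) \<partial>lborel)"
 proof (rule summable_suminf_not_top)
  have "(\<Sum>i. ennreal (\<integral>s. norm (gg i s) \<partial>lborel)) = (\<Sum>i. \<integral>\<^sup>+s. ennreal (norm (gg i s)) \<partial>lborel)"
   using int_gg by (intro arg_cong[of _ _ suminf] ext nn_integral_eq_integral[symmetric] integrable_norm) auto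
  thus "(\<Sum>i. ennreal (\<integral>s. norm (gg i s) \<partial>lborel)) ~= top" using tot fin by simp
 qed simp
 have s2: "AE s in lborel. summable (%i. norm (gg i s))"
 proof -
  have "(\<integral>\<^sup>+s. (\<Sum>i. ennreal (norm (gg i s))) \<partial>lborel) = (\<integral>\<^sup>+s. ennreal (norm (f s)) \<partial>lborel)"
   using gg_meas tot by (subst nn_integral_suminf) auto
  hence "AE s in lborel. (\<Sum>i. ennreal (norm (gg i s))) ~= \<infinity>"
   using fin gg_meas by (intro nn_integral_noteq_infinite) auto
  thus ?thesis by eventually_elim (rule summable_suminf_not_top, auto)
 qed
 have eq: "(\<Sum>i. gg i s) = indicat_real {L..0} s *\<^sub>R F s" if "s \<notin> insert 0 N" for s
 proof (cases "s \<in> {L..<0}")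
  case True
  hence "((%n::int. f (s + of_int n * L)) has_sum F s) UNIV" using F that by auto
  hence "((%i. f (s + of_int (d i) * L)) has_sum F s) UNIV"
   using has_sum_reindex_bij_betw[OF d, of "%n. f (s + of_int n * L)"] by simp
  from sums_unique[OF has_sum_imp_sums[OF this]] True show ?thesis by (simp add: gg_def)
 next
  case False
  thus ?thesis using that by (auto simp: gg_def indicator_def)
 qed
 have cN: "countable (insert 0 N)" using N by simp
 have i1: "integrable lborel (%s. \<Sum>i. gg i s)" by (rule integrable_suminf[OF int_gg s2 s1])
 show "set_integrable lborel {L..0} F"
  unfolding set_integrable_def
  using i1 integrable_discrete_difference[OF cN, of lborel "%s. \<Sum>i. gg i s" "%s. indicat_real {L..0} s *\<^sub>R F s"] eq
  by (simp add: emeasure_lborel_singleton)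
 have "integral\<^sup>L lborel f = set_lebesgue_integral lborel (\<Union>i. A i) f"
  unfolding UN set_lebesgue_integral_def by simp
 also have "\<dots> = (\<Sum>i. set_lebesgue_integral lborel (A i) f)"
  using f disj by (intro lebesgue_integral_countable_add A_meas) (auto simp: UN set_integrable_def disjoint_family_on_def)
 also have "\<dots> = (\<Sum>i. integral\<^sup>L lborel (gg i))" by (simp add: I_gg)
 also have "\<dots> = (\<integral>s. (\<Sum>i. gg i s) \<partial>lborel)" by (rule integral_suminf[OF int_gg s2 s1, symmetric])
 also have "\<dots> = set_lebesgue_integral lborel {L..0} F"
  unfolding set_lebesgue_integral_def
  by (rule integral_discrete_difference[OF cN]) (use eq in \<open>auto simp: emeasure_lborel_singleton\<close>)
 finally show "integral\<^sup>L lborel f = set_lebesgue_integral lborel {L..0} F" .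
qed

text \<open>Cauchy's estimate turns the local bound on \<open>f\<close> into one on its difference quotients in the
parameter, so the derivative can be taken under the integral.\<close>

lemma holomorphic_on_integral:
 fixes f :: "real \<Rightarrow> complex \<Rightarrow> complex"
 assumes A: "open A" and hol: "\<And>s. f s holomorphic_on A"
  and meas: "\<And>w. w \<in> A ==> (%s. f s w) \<in> borel_measurable lborel"
  and dom: "\<And>w0. w0 \<in> A ==> \<exists>r>0. \<exists>G. integrable lborel G \<and> (\<forall>s. \<forall>w\<in>ball w0 r \<inter> A. norm (f s w) \<le> G s)"
 shows "(%w. \<integral>s. f s w \<partial>lborel) holomorphic_on A"
proof (subst holomorphic_on_open[OF A], intro ballI)
 fix w0 assume w0: "w0 \<in> A"
 from dom[OF w0] obtain r1 G where r1: "r1 > 0" and G: "integrable lborel G"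
  and G_bd: "\<And>s w. w \<in> ball w0 r1 \<inter> A ==> norm (f s w) \<le> G s" by blast
 obtain r2 where r2: "r2 > 0" "ball w0 r2 \<subseteq> A" using A w0 open_contains_ball by blast
 define r where "r = min r1 r2 / 2"
 have r: "r > 0" using r1 r2 by (simp add: r_def)
 have ball2: "ball w0 (2 * r) \<subseteq> ball w0 r1 \<inter> A" using r2 by (auto simp: r_def)
 have deriv_bd: "norm (deriv (f s) z) \<le> G s / (r / 2)" if z: "z \<in> ball w0 r" for s z
 proof -
  have sub: "cball z (r / 2) \<subseteq> ball w0 (2 * r)"
  proof
   fix x assume "x \<in> cball z (r / 2)"
   hence "dist w0 x \<le> dist w0 z + r / 2" using dist_triangle[of w0 x z] by simp
   thus "x \<in> ball w0 (2 * r)" using z r by simp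
  qed
  have "norm ((deriv ^^ 1) (f s) z) \<le> fact 1 * G s / (r / 2) ^ 1"
  proof (rule Cauchy_inequality)
   show "f s holomorphic_on ball z (r / 2)"
    by (rule holomorphic_on_subset[OF hol]) (use sub ball2 in force)
   show "continuous_on (cball z (r / 2)) (f s)"
    by (rule continuous_on_subset[OF holomorphic_on_imp_continuous_on[OF hol]]) (use sub ball2 in force)
   show "norm (f s x) \<le> G s" if "norm (z - x) = r / 2" for x
   proof -
    have "x \<in> cball z (r / 2)" using that by (simp add: dist_norm)
    thus ?thesis using sub ball2 G_bd by blast
   qed
  qed (use r in simp)
  thus ?thesis by simp
 qed
 have diff_bd: "norm ((f s w - f s w0) / (w - w0)) \<le> G s / (r / 2)" if w: "w \<in> ball w0 r" "w ~= w0" for s w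
 proof -
  have "norm (f s w - f s w0) \<le> G s / (r / 2) * norm (w - w0)"
  proof (rule field_differentiable_bound[of "ball w0 r"])
   show "(f s has_field_derivative deriv (f s) z) (at z within ball w0 r)" if "z \<in> ball w0 r" for z
    by (rule holomorphic_derivI[OF hol A]) (use that ball2 r in auto)
  qed (use w r deriv_bd in auto)
  thus ?thesis using w by (simp add: norm_divide divide_le_eq)
 qed
 define F where "F = (%w. \<integral>s. f s w \<partial>lborel)"
 have int: "integrable lborel (%s. f s w)" if "w \<in> ball w0 (2 * r)" for w
 proof -
  have w: "w \<in> ball w0 r1 \<inter> A" using ball2 that by blast
  have "norm (f s w) \<le> norm (G s)" for s using G_bd[OF w, of s] by simp
  thus ?thesis using w by (intro Bochner_Integration.integrable_bound[OF G] meas AE_I2) auto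
 qed
 have "((%w. (F w - F w0) / (w - w0)) \<longlongrightarrow> (\<integral>s. deriv (f s) w0 \<partial>lborel)) (at w0)"
  unfolding tendsto_at_iff_sequentially
 proof (intro allI impI)
  fix X :: "nat \<Rightarrow> complex" assume X: "\<forall>i. X i \<in> UNIV - {w0}" "X \<longlonglongrightarrow> w0"
  have "eventually (%i. X i \<in> ball w0 r) sequentially"
   using X(2) r by (intro topological_tendstoD) auto
  then obtain n0 where n0: "\<And>i. i \<ge> n0 ==> X i \<in> ball w0 r" by (auto simp: eventually_sequentially)
  define Y where "Y = (%i. X (i + n0))"
  have Y: "Y i \<in> ball w0 r" "Y i ~= w0" for i using n0 X(1) by (auto simp: Y_def)
  have Ylim: "Y \<longlonglongrightarrow> w0" unfolding Y_def using X(2) by (rule LIMSEQ_ignore_initial_segment)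
  have Y2: "Y i \<in> A" for i using Y(1)[of i] ball2 r by auto
  have lim: "(%i. (f s (Y i) - f s w0) / (Y i - w0)) \<longlonglongrightarrow> deriv (f s) w0" for s
  proof -
   have "(f s has_field_derivative deriv (f s) w0) (at w0)" by (rule holomorphic_derivI[OF hol A w0])
   hence "((%w. (f s w - f s w0) / (w - w0)) \<longlongrightarrow> deriv (f s) w0) (at w0)" by (simp add: has_field_derivative_iff)
   thus ?thesis using Y Ylim unfolding tendsto_at_iff_sequentially by (auto simp: o_def)
  qed
  have meas': "(%s. (f s (Y i) - f s w0) / (Y i - w0)) \<in> borel_measurable lborel" for i
   by (intro borel_measurable_divide borel_measurable_diff meas Y2 w0) simp_all
  have "(%i. \<integral>s. (f s (Y i) - f s w0) / (Y i - w0) \<partial>lborel) \<longlonglongrightarrow> (\<integral>s. deriv (f s) w0 \<partial>lborel)"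
  proof (rule integral_dominated_convergence)
   show "(%s. deriv (f s) w0) \<in> borel_measurable lborel"
    by (rule borel_measurable_LIMSEQ_metric[OF meas']) (rule lim)
   show "integrable lborel (%s. G s / (r / 2))" using G by simp
  qed (use lim diff_bd Y meas' in auto)
  moreover
  have "(\<integral>s. (f s (Y i) - f s w0) / (Y i - w0) \<partial>lborel) = (F (Y i) - F w0) / (Y i - w0)" for i
  proof -
   have "Y i \<in> ball w0 (2 * r)" "w0 \<in> ball w0 (2 * r)" using Y(1)[of i] r by auto
   thus ?thesis using int by (simp add: F_def)
  qed
  hence "(%i. \<integral>s. (f s (Y i) - f s w0) / (Y i - w0) \<partial>lborel) = (%i. (F (Y i) - F w0) / (Y i - w0))"
   by (rule ext)
  ultimately have "(%i. (F (Y i) - F w0) / (Y i - w0)) \<longlonglongrightarrow> (\<integral>s. deriv (f s) w0 \<partial>lborel)" by (simp only:)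
  hence "(%i. ((%w. (F w - F w0) / (w - w0)) \<circ> X) (i + n0)) \<longlonglongrightarrow> (\<integral>s. deriv (f s) w0 \<partial>lborel)"
   by (simp add: Y_def o_def)
  thus "((%w. (F w - F w0) / (w - w0)) \<circ> X) \<longlonglongrightarrow> (\<integral>s. deriv (f s) w0 \<partial>lborel)"
   by (rule LIMSEQ_offset)
 qed
 thus "\<exists>f'. ((%w. \<integral>s. f s w \<partial>lborel) has_field_derivative f') (at w0)"
  unfolding F_def by (auto simp: has_field_derivative_iff)
qed

lemma set_integral_reflect:
 fixes f :: "real \<Rightarrow> complex"
 shows "set_lebesgue_integral lborel {L..0} (%s. f (L - s)) = set_lebesgue_integral lborel {L..0} f"
 unfolding set_lebesgue_integral_def
 by (subst (2) lborel_integral_real_affine[of "-1" _ L])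
  (auto intro!: Bochner_Integration.integral_cong simp: indicator_def)

text \<open>Under the period a primitive changes by a constant, and this constant is the integral.\<close>

lemma period_integral_shift:
 fixes f :: "complex \<Rightarrow> complex" and L :: real
 assumes L: "L < 0" and U: "open U" "convex U" and hol: "f holomorphic_on U"
  and inU: "\<And>u (s::real). u \<in> U ==> u + of_real s \<in> U"
  and per: "\<And>u. u \<in> U ==> f (u + of_real L) = f u" and v: "0 \<in> U" "v \<in> U"
 shows "set_lebesgue_integral lborel {L..0} (%s. f (of_real s + v)) = set_lebesgue_integral lborel {L..0} (%s. f (of_real s))"
proof -
 obtain G where G: "\<And>u. u \<in> U ==> (G has_field_derivative f u) (at u within U)"
  using holomorphic_convex_primitive'[OF U(2,1) hol] by blast
 have G': "(G has_field_derivative f u) (at u)" if "u \<in> U" for u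
  using G[OF that] at_within_open[OF that U(1)] by simp
 have int: "set_lebesgue_integral lborel {L..0} (%s. f (of_real s + u)) = G u - G (of_real L + u)" if u: "u \<in> U" for u
 proof -
  have in1: "of_real s + u \<in> U" for s :: real using inU[OF u, of s] by (simp add: add.commute)
  have "integral\<^sup>L lborel (%s. indicator {L .. 0} s *\<^sub>R f (of_real s + u)) = G (of_real 0 + u) - G (of_real L + u)"
  proof (rule integral_FTC_atLeastAtMost)
   fix s :: real
   have "((%z. G (z + u)) has_field_derivative f (of_real s + u)) (at (of_real s))"
    using G'[OF in1[of s]] by (simp add: DERIV_shift)
   thus "((%s. G (of_real s + u)) has_vector_derivative f (of_real s + u)) (at s within {L..0})"
    by (rule has_vector_derivative_real_field)
  next
   show "continuous_on {L..0} (%s. f (of_real s + u))"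
    by (rule continuous_on_compose2[OF holomorphic_on_imp_continuous_on[OF hol]])
     (auto intro!: continuous_intros in1)
  qed (use L in simp)
  thus ?thesis by (simp add: set_lebesgue_integral_def)
 qed
 have "(%u. G u - G (of_real L + u)) constant_on U"
 proof -
  have "((%u. G u - G (of_real L + u)) has_field_derivative 0) (at u within U)" if u: "u \<in> U" for u
  proof -
   have "of_real L + u \<in> U" using inU[OF u, of L] by (simp add: add.commute)
   from G'[OF this] have "((%u. G (of_real L + u)) has_field_derivative f (of_real L + u) * 1) (at u)"
    by (intro DERIV_chain2[where f = G and g = "%u. of_real L + u"]) (auto intro!: derivative_eq_intros)
   from DERIV_diff[OF G'[OF u] this] show ?thesis
    using per[OF u] by (auto simp: add.commute intro: has_field_derivative_at_within)
  qed
  from has_field_derivative_zero_constant[OF U(2) this] show ?thesis by (auto simp: constant_on_def)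
 qed
 hence "G v - G (of_real L + v) = G 0 - G (of_real L + 0)" using v unfolding constant_on_def by metis
 thus ?thesis using int[OF v(1)] int[OF v(2)] by simp
qed

lemma sums_set_integral_Icc:
 fixes f :: "nat \<Rightarrow> real \<Rightarrow> complex"
 assumes cont: "\<And>k. continuous_on {a..b} (f k)"
  and bd: "\<And>k s. s \<in> {a..b} ==> norm (f k s) \<le> M k" and M: "summable M"
 shows "(%k. set_lebesgue_integral lborel {a..b} (f k)) sums set_lebesgue_integral lborel {a..b} (%s. \<Sum>k. f k s)"
proof -
 have 1: "integrable lborel (%s. indicat_real {a..b} s *\<^sub>R f k s)" for k
  using borel_integrable_atLeastAtMost'[OF cont[of k]] by (simp add: set_integrable_def)
 have n: "norm (indicat_real {a..b} s *\<^sub>R f k s) \<le> indicat_real {a..b} s * M k" for k s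
  using bd[of s k] by (simp add: indicator_def)
 have i2: "integrable lborel (%s. indicat_real {a..b} s * M k)" for k
  by (intro integrable_mult_left integrable_real_indicator) (auto simp: emeasure_lborel_Icc_eq)
 have "(%k. integral\<^sup>L lborel (%s. indicat_real {a..b} s *\<^sub>R f k s)) sums (\<integral>s. (\<Sum>k. indicat_real {a..b} s *\<^sub>R f k s) \<partial>lborel)"
 proof (rule sums_integral[OF 1])
  show "AE s in lborel. summable (%k. norm (indicat_real {a..b} s *\<^sub>R f k s))"
   by (rule AE_I2, rule summable_comparison_test'[where g = "%k. indicat_real {a..b} _ * M k"])
    (use n M in \<open>auto intro: summable_mult\<close>)
  show "summable (%k. \<integral>s. norm (indicat_real {a..b} s *\<^sub>R f k s) \<partial>lborel)"
  proof (rule summable_comparison_test')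
   show "summable (%k. measure lborel {a..b} * M k)" using M by (rule summable_mult)
   fix k :: nat
   have "(\<integral>s. norm (indicat_real {a..b} s *\<^sub>R f k s) \<partial>lborel) \<le> (\<integral>s. indicat_real {a..b} s * M k \<partial>lborel)"
    by (intro integral_mono integrable_norm 1 i2 n)
   also have "\<dots> = measure lborel {a..b} * M k" by simp
   finally show "norm (\<integral>s. norm (indicat_real {a..b} s *\<^sub>R f k s) \<partial>lborel) \<le> measure lborel {a..b} * M k"
    by simp
  qed
 qed
 also have "(%s. (\<Sum>k. indicat_real {a..b} s *\<^sub>R f k s)) = (%s. indicat_real {a..b} s *\<^sub>R (\<Sum>k. f k s))"
  by (auto simp: indicator_def fun_eq_iff)
 finally show ?thesis by (simp add: set_lebesgue_integral_def)
qed

context qbase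
begin

section \<open>Theta inversion\<close>

abbreviation hq :: real where "hq \<equiv> qhat q"
abbreviation PI :: "(real \<Rightarrow> complex) \<Rightarrow> complex" where
 "PI f \<equiv> set_lebesgue_integral lborel {L..0} f"

lemma ln_hq: "ln hq = 2 * pi\<^sup>2 / L" by (simp add: qhat_def)

lemma hq_pos: "hq > 0" by (simp add: qhat_def)

lemma hq_less_1: "hq < 1"
 unfolding qhat_def using L_neg by (simp add: divide_pos_neg)

lemma qbase_hq: "qbase (hq\<^sup>2)"
 using hq_pos hq_less_1 by unfold_locales (auto simp: power_less_one_iff)

definition en :: "int \<Rightarrow> complex \<Rightarrow> complex" where
 "en n u = exp (2 * of_real pi * \<i> * of_int n * u / lc)"

lemma en_0 [simp]: "en 0 u = 1" by (simp add: en_def)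
lemma en_add: "en n (u + v) = en n u * en n v"
 by (simp add: en_def exp_add[symmetric] add_divide_distrib distrib_left)
lemma en_index_add: "en (m + n) u = en m u * en n u"
 by (simp add: en_def exp_add[symmetric] add_divide_distrib distrib_left distrib_right)
lemma en_powi: "en n u = en 1 u powi n"
 by (simp add: en_def exp_power_int mult_ac)
lemma en_minus: "en n (- u) = en (- n) u" by (simp add: en_def)
lemma en_L [simp]: "en n (u + lc) = en n u"
proof -
 have "en n lc = exp (2 * of_real pi * \<i> * of_int n)" by (simp add: en_def)
 also have "\<dots> = 1" using exp_integer_2pi[OF Ints_of_int, of n]
  by (simp only: mult_ac of_real_mult of_real_of_int_eq of_real_numeral)
 finally have "en n lc = 1" .
 thus ?thesis by (simp add: en_add)
qed
lemma en_nz [simp]: "en n u ~= 0" by (simp add: en_def)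
lemma norm_en_real [simp]: "norm (en n (of_real s)) = 1"
proof -
 have "2 * of_real pi * \<i> * of_int n * of_real s / lc = \<i> * of_real (2 * pi * of_int n * s / L)" by simp
 thus ?thesis unfolding en_def by (simp only: norm_exp_i_times)
qed
lemma holomorphic_en [holomorphic_intros]: "f holomorphic_on A ==> (%x. en n (f x)) holomorphic_on A"
 unfolding en_def by (intro holomorphic_intros) auto
lemma cont_en_real: "continuous_on A (%s. en n (of_real s))"
 unfolding en_def by (intro continuous_intros) auto

lemma en_2pi_i: "en n (\<omega>) = of_real (hq powi (- 2 * n))"
proof -
 have "2 * of_real pi * \<i> * of_int n * (\<omega>) / lc = of_real (of_int (- 2 * n) * (2 * pi\<^sup>2 / L))"
  by (simp add: power2_eq_square field_simps)
 hence "en n (\<omega>) = of_real (exp (of_int (- 2 * n) * (2 * pi\<^sup>2 / L)))"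
  by (simp only: en_def exp_of_real)
 also have "exp (of_int (- 2 * n) * (2 * pi\<^sup>2 / L)) = hq powi (- 2 * n)"
  unfolding qhat_def by (rule exp_power_int[symmetric])
 finally show ?thesis .
qed

lemma en_pi_i: "en n (ipi) = of_real (hq powi (- n))"
proof -
 have "2 * of_real pi * \<i> * of_int n * (ipi) / lc = of_real (of_int (- n) * (2 * pi\<^sup>2 / L))"
  by (simp add: power2_eq_square field_simps)
 hence "en n (ipi) = of_real (exp (of_int (- n) * (2 * pi\<^sup>2 / L)))"
  by (simp only: en_def exp_of_real)
 also have "exp (of_int (- n) * (2 * pi\<^sup>2 / L)) = hq powi (- n)"
  unfolding qhat_def by (rule exp_power_int[symmetric])
 finally show ?thesis .
qed

definition T :: "complex \<Rightarrow> complex" where "T u = thetaq (hq\<^sup>2) (- (of_real hq * en 1 u))"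

definition cf :: "int \<Rightarrow> real" where "cf n = (-1) powi n * hq powi (n * n)"

lemma cf_minus: "cf (- n) = cf n"
 unfolding cf_def minus_mult_minus power_int_minus_one_minus ..

lemma T_has_sum: "((%n. of_real (cf n) * en n u) has_sum T u) UNIV"
proof -
 interpret R: qbase "hq\<^sup>2" by (rule qbase_hq)
 define \<tau> where "\<tau> = - (of_real hq * en 1 u)"
 have "\<tau> ~= 0" using hq_pos by (simp add: \<tau>_def)
 from R.jacobi_triple_product[OF this]
 have "((%n. of_real (qb (hq\<^sup>2) n) * \<tau> powi n) has_sum T u) UNIV"
  by (simp add: T_def \<tau>_def)
 moreover have "of_real (qb (hq\<^sup>2) n) * \<tau> powi n = of_real (cf n) * en n u" for n
 proof -
  have "qb (hq\<^sup>2) n = hq powi (2 * (n * (n - 1) div 2))"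
   unfolding qb_def by (simp only: power_int_mult power_int_numeral)
  also have "\<dots> = hq powi (n * n) / hq powi n"
   unfolding tri_double using hq_pos by (simp add: right_diff_distrib power_int_diff)
  finally have "qb (hq\<^sup>2) n = hq powi (n * n) / hq powi n" .
  moreover have "\<tau> powi n = (-1) powi n * (of_real hq powi n * en n u)"
  proof -
   have "\<tau> = (-1) * (of_real hq * en 1 u)" by (simp add: \<tau>_def)
   thus ?thesis by (simp only: power_int_mult_distrib en_powi[of n])
  qed
  ultimately show ?thesis using hq_pos by (simp add: cf_def of_real_power_int)
 qed
 ultimately show ?thesis by simp
qed

lemma holomorphic_T [holomorphic_intros]: "f holomorphic_on A ==> (%x. T (f x)) holomorphic_on A"
proof -
 interpret R: qbase "hq\<^sup>2" by (rule qbase_hq)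
 assume "f holomorphic_on A"
 thus "(%x. T (f x)) holomorphic_on A"
  unfolding T_def using hq_pos by (intro R.holomorphic_theta' holomorphic_intros) auto
qed

lemma T_L: "T (u + lc) = T u" by (simp add: T_def)

lemma T_2pi: "T (u + \<omega>) = - (en 1 u / of_real hq) * T u"
proof -
 interpret R: qbase "hq\<^sup>2" by (rule qbase_hq)
 define \<tau> where "\<tau> = - (of_real hq * en 1 u)"
 have "\<tau> ~= 0" using hq_pos by (simp add: \<tau>_def)
 define \<sigma> where "\<sigma> = - (of_real hq * en 1 (u + \<omega>))"
 have "en 1 (u + \<omega>) = en 1 u / (of_real hq)\<^sup>2"
  unfolding en_add en_2pi_i by (simp add: power_int_minus power2_eq_square field_simps)
 hence \<sigma>: "of_real (hq\<^sup>2) * \<sigma> = \<tau>" using hq_pos by (simp add: \<sigma>_def \<tau>_def)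
 hence "\<sigma> ~= 0" using \<open>\<tau> ~= 0\<close> by auto
 from R.theta_q[OF this] have "R.\<theta> \<sigma> = R.\<theta> \<tau> * \<sigma>" using \<open>\<sigma> ~= 0\<close> unfolding \<sigma> by simp
 moreover have "\<sigma> = - (en 1 u / of_real hq)"
 proof -
  have "of_real hq * (of_real hq * \<sigma>) = of_real hq * (- en 1 u)"
   using \<sigma> by (simp add: \<tau>_def power2_eq_square mult.assoc)
  hence "of_real hq * \<sigma> = - en 1 u" using hq_pos by (subst (asm) mult_cancel_left) auto
  thus ?thesis using hq_pos by (simp add: field_simps)
 qed
 ultimately show ?thesis by (simp add: T_def \<sigma>_def \<tau>_def)
qed

lemma P_2pi: "P (u + \<omega>) = - (en 1 u / of_real hq) * P u"
proof -
 have 1: "exp (u * (\<omega>) / lc) = en 1 u" by (simp add: en_def mult_ac)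
 have "(\<omega>)\<^sup>2 / (2 * lc) - (\<omega>) / 2 = - of_real (ln hq) - ipi"
  unfolding ln_hq by (simp add: power_mult_distrib power2_eq_square field_simps)
 hence "exp ((\<omega>)\<^sup>2 / (2 * lc) - (\<omega>) / 2) = - (1 / of_real hq)"
  using hq_pos by (simp only: exp_diff exp_minus exp_of_real) (simp add: inverse_eq_divide)
 hence "E (u + \<omega>) = E u * en 1 u * (- (1 / of_real hq))"
  by (simp only: E_add 1)
 thus ?thesis unfolding P_eq exp_2pi by simp
qed

lemma T_pi_i: "T (ipi) = 0"
proof -
 interpret R: qbase "hq\<^sup>2" by (rule qbase_hq)
 have "- (of_real hq * en 1 (ipi)) = -1"
  unfolding en_pi_i using hq_pos by (simp add: power_int_minus)
 thus ?thesis unfolding T_def by simp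
qed

lemma exp_real_E: "E (of_real s) = of_real (exp ((s - L / 2)\<^sup>2 / (2 * L)))"
proof -
 have "(of_real s - lc / 2)\<^sup>2 / (2 * lc) = of_real ((s - L / 2)\<^sup>2 / (2 * L))" by simp
 thus ?thesis unfolding E_eq by (simp only: exp_of_real)
qed

lemma E_normal_density: "E (of_real s) = of_real (normal_density (L / 2) (sqrt (- L)) s / Cq q)"
proof -
 have "normal_density (L / 2) (sqrt (- L)) s / Cq q = exp ((s - L / 2)\<^sup>2 / (2 * L))"
  using L_neg by (simp add: normal_density_def Cq_def mult_ac)
 thus ?thesis by (simp add: exp_real_E)
qed

lemma integral_E: "integrable lborel (%s. E (of_real s))" "(\<integral>s. E (of_real s) \<partial>lborel) = of_real (1 / Cq q)"
proof -
 have s: "sqrt (- L) > 0" using L_neg by simp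
 have i: "integrable lborel (%s. normal_density (L / 2) (sqrt (- L)) s / Cq q)"
  using integrable_normal_density[OF s] by simp
 show "integrable lborel (%s. E (of_real s))"
  unfolding E_normal_density by (rule integrable_of_real[OF i])
 have "(\<integral>s. E (of_real s) \<partial>lborel) = of_real (\<integral>s. normal_density (L / 2) (sqrt (- L)) s / Cq q \<partial>lborel)"
  unfolding E_normal_density by (rule integral_complex_of_real)
 also have "(\<integral>s. normal_density (L / 2) (sqrt (- L)) s / Cq q \<partial>lborel) = 1 / Cq q"
  using integral_normal_density[OF s] by simp
 finally show "(\<integral>s. E (of_real s) \<partial>lborel) = of_real (1 / Cq q)" .
qed

lemma E_lattice_sum: "((%n::int. E (u + of_int n * lc)) has_sum (E u * \<theta> (exp u))) UNIV"
 using has_sum_cmult_right[OF jacobi_triple_product[of "exp u"], of "E u"]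
 by (simp add: E_powi mult_ac)

lemma PI_P: "PI (%s. P (of_real s)) = - lc"
proof -
 have "(\<integral>s. E (of_real s) \<partial>lborel) = PI (%s. E (of_real s) * \<theta> (exp (of_real s)))"
 proof (rule periodization(2)[OF L_neg integral_E(1)])
  show "((%n::int. E (of_real (s + of_int n * L))) has_sum (E (of_real s) * \<theta> (exp (of_real s)))) UNIV" for s
   using E_lattice_sum[of "of_real s"] by simp
 qed (rule countable_empty)
 hence "PI (%s. (- lc * of_real (Cq q)) * (E (of_real s) * \<theta> (exp (of_real s)))) = (- lc * of_real (Cq q)) * of_real (1 / Cq q)"
  by (simp only: set_integral_mult_right integral_E(2))
 thus ?thesis using Cq_pos by (simp add: P_eq mult.assoc)
qed

lemma PI_const: "PI (%s. c) = - lc * c"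
 using L_neg by (simp add: set_lebesgue_integral_def scaleR_conv_of_real)

lemma PI_en: "n ~= 0 ==> PI (%s. en n (of_real s)) = 0"
proof -
 assume n: "n ~= 0"
 define c where "c = 2 * of_real pi * \<i> * of_int n / lc"
 have c: "c ~= 0" using n by (simp add: c_def)
 have e: "en n u = exp (c * u)" for u by (simp add: en_def c_def)
 have "integral\<^sup>L lborel (%s. indicator {L .. 0} s *\<^sub>R en n (of_real s)) = en n (of_real 0) / c - en n (of_real L) / c"
 proof (rule integral_FTC_atLeastAtMost)
  fix s
  have "((%u. en n u / c) has_field_derivative en n (of_real s)) (at (of_real s))"
   unfolding e using c by (auto intro!: derivative_eq_intros)
  thus "((%s. en n (of_real s) / c) has_vector_derivative en n (of_real s)) (at s within {L..0})"
   by (rule has_vector_derivative_real_field)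
 qed (use L_neg cont_en_real in auto)
 moreover have "en n (of_real L) = en n 0" using en_L[of n 0] by simp
 ultimately show ?thesis by (simp add: set_lebesgue_integral_def)
qed

lemma has_sum_int_pairs:
 fixes f :: "int \<Rightarrow> complex"
 assumes "(f has_sum S) UNIV"
 shows "(%n. f (int (Suc n)) + f (- int (Suc n))) sums (S - f 0)" "summable (%n. norm (f (int n)))" "summable (%n. norm (f (- int n)))"
proof -
 have s: "(%n. norm (f n)) summable_on UNIV"
  using has_sum_imp_summable[OF assms] abs_summable_equivalent[of f UNIV] summable_on_iff_abs_summable_on_complex by blast
 have i1: "inj int" and i2: "inj (%n. - int n)" by (auto simp: inj_on_def)
 have "(%n. norm (f n)) summable_on range int" "(%n. norm (f n)) summable_on range (%n. - int n)"
  using summable_on_subset_banach[OF s] by blast+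
 hence s1: "(%n. norm (f (int n))) summable_on UNIV" and s2: "(%n. norm (f (- int n))) summable_on UNIV"
  using summable_on_reindex[OF i1, of "%n. norm (f n)"] summable_on_reindex[OF i2, of "%n. norm (f n)"]
  by (simp_all add: o_def)
 show t1: "summable (%n. norm (f (int n)))" using s1 by (rule summable_on_imp_summable)
 show t2: "summable (%n. norm (f (- int n)))" using s2 by (rule summable_on_imp_summable)
 have t3: "summable (%m. norm (f (- int m - 1)))"
 proof -
  have "- int m - 1 = - int (Suc m)" for m by simp
  thus ?thesis using t2 summable_Suc_iff[of "%n. norm (f (- int n))"] by (simp only:)
 qed
 have S: "S = (\<Sum>m. f (int m)) + (\<Sum>m. f (- int m - 1))"
  using has_sum_unique[OF assms has_sum_int_halves[OF t1 t3]] .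
 have "(%n. f (int (Suc n))) sums ((\<Sum>m. f (int m)) - f (int 0))"
  using summable_sums[OF summable_norm_cancel[OF t1]] by (subst sums_Suc_iff) simp
 note sm = sums_add[OF this summable_sums[OF summable_norm_cancel[OF t3]]]
 have e: "- int n - 1 = - int (Suc n)" for n by simp
 show "(%n. f (int (Suc n)) + f (- int (Suc n))) sums (S - f 0)"
  using sm unfolding S by (simp only: e diff_add_eq of_nat_0)
qed

lemma PI_T_times:
 fixes \<phi> :: "real \<Rightarrow> complex"
 assumes \<phi>: "continuous_on {L..0} \<phi>"
 shows "(%n. of_real (cf (int (Suc n))) * (en (- int (Suc n)) w * PI (%s. en (int (Suc n)) (of_real s) * \<phi> s)
       + en (int (Suc n)) w * PI (%s. en (- int (Suc n)) (of_real s) * \<phi> s)))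
    sums (PI (%s. T (of_real s - w) * \<phi> s) - PI \<phi>)"
proof -
 obtain K where K: "\<And>s. s \<in> {L..0} ==> norm (\<phi> s) \<le> K"
  using compact_imp_bounded[OF compact_continuous_image[OF \<phi> compact_Icc]] unfolding bounded_iff by blast
 have "norm (\<phi> 0) \<le> K" using K[of 0] L_neg by simp
 hence K0: "K \<ge> 0" by (meson norm_ge_zero order_trans)
 define f where "f = (%n s. of_real (cf (int (Suc n))) * (en (- int (Suc n)) w * (en (int (Suc n)) (of_real s) * \<phi> s)
       + en (int (Suc n)) w * (en (- int (Suc n)) (of_real s) * \<phi> s)))"
 define M where "M = (%n. (norm (of_real (cf (int n)) * en (int n) (0 - w)) + norm (of_real (cf (- int n)) * en (- int n) (0 - w))) * K)"
 have ensub: "en n (of_real s - w) = en (-n) w * en n (of_real s)" for n s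
  using en_add[of n "of_real s" "-w"] by (simp add: en_minus)
 have "(%n. PI (f n)) sums PI (%s. \<Sum>n. f n s)"
 proof (rule sums_set_integral_Icc)
  show "continuous_on {L..0} (f k)" for k
   unfolding f_def by (intro continuous_intros cont_en_real \<phi>)
  show "summable (%k. M (Suc k))"
   unfolding M_def using has_sum_int_pairs(2,3)[OF T_has_sum[of "0 - w"]] by (subst summable_Suc_iff) (intro summable_mult2 summable_add, simp_all)
  show "norm (f k s) \<le> M (Suc k)" if s: "s \<in> {L..0}" for k s
  proof -
   define n where "n = int (Suc k)"
   have "norm (f k s) \<le> \<bar>cf n\<bar> * (norm (en (- n) w) * K + norm (en n w) * K)"
    unfolding f_def n_def[symmetric] norm_mult norm_of_real
    by (intro mult_left_mono norm_triangle_le add_mono) (use K[OF s] in \<open>auto simp: norm_mult intro!: mult_left_mono\<close>)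
   also have "\<dots> = M (Suc k)"
    unfolding M_def n_def[symmetric] by (simp add: norm_mult cf_minus en_minus algebra_simps)
   finally show ?thesis .
  qed
 qed
 also have "(%s. \<Sum>n. f n s) = (%s. T (of_real s - w) * \<phi> s - \<phi> s)"
 proof
  fix s
  have "(%n. (of_real (cf (int (Suc n))) * en (int (Suc n)) (of_real s - w) + of_real (cf (- int (Suc n))) * en (- int (Suc n)) (of_real s - w)) * \<phi> s)
     sums ((T (of_real s - w) - of_real (cf 0) * en 0 (of_real s - w)) * \<phi> s)"
   by (rule sums_mult2[OF has_sum_int_pairs(1)[OF T_has_sum[of "of_real s - w"]]])
  moreover have "(of_real (cf (int (Suc n))) * en (int (Suc n)) (of_real s - w) + of_real (cf (- int (Suc n))) * en (- int (Suc n)) (of_real s - w)) * \<phi> s = f n s" for n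
   unfolding f_def ensub cf_minus by (simp add: algebra_simps del: of_nat_Suc)
  ultimately have "(%n. f n s) sums ((T (of_real s - w) - 1) * \<phi> s)" by (simp add: cf_def)
  thus "(\<Sum>n. f n s) = T (of_real s - w) * \<phi> s - \<phi> s" by (simp add: sums_iff algebra_simps)
 qed
 also have "PI (%s. T (of_real s - w) * \<phi> s - \<phi> s) = PI (%s. T (of_real s - w) * \<phi> s) - PI \<phi>"
 proof (rule set_integral_diff(2))
  have "(%u. T (u - w)) holomorphic_on UNIV" by (intro holomorphic_intros)
  hence c: "continuous_on {L..0} (%s. T (of_real s - w))"
   by (rule continuous_on_compose2[OF holomorphic_on_imp_continuous_on]) (auto intro!: continuous_intros)
  show "set_integrable lborel {L..0} (%s. T (of_real s - w) * \<phi> s)"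
   by (intro borel_integrable_atLeastAtMost' continuous_intros c \<phi>)
  show "set_integrable lborel {L..0} \<phi>" by (intro borel_integrable_atLeastAtMost' \<phi>)
 qed
 finally have "(%n. PI (f n)) sums (PI (%s. T (of_real s - w) * \<phi> s) - PI \<phi>)" .
 moreover have "PI (f n) = of_real (cf (int (Suc n))) * (en (- int (Suc n)) w * PI (%s. en (int (Suc n)) (of_real s) * \<phi> s)
       + en (int (Suc n)) w * PI (%s. en (- int (Suc n)) (of_real s) * \<phi> s))" for n
 proof -
  have i: "set_integrable lborel {L..0} (%s. c * (en m (of_real s) * \<phi> s))" for c m
   by (intro borel_integrable_atLeastAtMost' continuous_intros cont_en_real \<phi>)
  show ?thesis
   unfolding f_def set_integral_mult_right
   by (subst set_integral_add(2)[OF i i]) (simp only: set_integral_mult_right)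
 qed
 ultimately show ?thesis by simp
qed

lemma PI_T: "PI (%s. T (of_real s - w)) = - lc"
proof -
 have "PI (%s. T (of_real s - w) * 1) - PI (%s. 1) = 0"
  using PI_T_times[of "%_. 1" w] PI_en by (simp add: sums_iff del: of_nat_Suc)
 thus ?thesis using PI_const[of 1] by (simp add: eq_neg_iff_add_eq_0)
qed

text \<open>Under the shift by \<open>2 \<pi> \<i>\<close> both sides acquire the same factor, so their quotient is elliptic, and its
poles are removable because the zeros agree. The means over a period fix the constant: on one side
it is a Gaussian integral, on the other the zeroth Fourier coefficient.\<close>

theorem theta_inversion: "P = T"
proof -
 have "\<exists>c. \<forall>u. P u ~= 0 \<longrightarrow> T u / P u = c"
 proof (rule doubly_periodic_imp_constant[of L "2 * pi"])
  show "P holomorphic_on UNIV" by (intro holomorphic_intros)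
  show P0: "P 0 ~= 0" using theta_nz_pos[of 1] by (simp add: P_eq_0_iff)
  show "(%u. T u / P u) holomorphic_on {u. P u ~= 0}" by (intro holomorphic_intros) auto
  show "T (u + of_real L) / P (u + of_real L) = T u / P u" for u by (simp add: T_L)
  have hnz: "- (en 1 u / of_real hq) ~= 0" for u using hq_pos by simp
  show "T (u + \<omega>) / P (u + \<omega>) = T u / P u" for u
   unfolding T_2pi P_2pi by (rule nonzero_mult_divide_mult_cancel_left[OF hnz])
  show "P (u + \<omega>) = 0 \<longleftrightarrow> P u = 0" for u
   unfolding P_2pi using hnz[of u] by (simp only: mult_eq_0_iff) simp
  fix \<zeta> assume "P \<zeta> = 0"
  hence "\<theta> (exp \<zeta>) = 0" by (simp add: P_eq_0_iff)
  from theta_exp_zero[OF this] obtain m n :: int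
   where mn: "\<zeta> = ipi + of_int m * lc + of_int n * (\<omega>)" by blast
  have "((%u. (u - ipi) / P u) \<longlongrightarrow> 1 / deriv P (ipi)) (at (ipi))"
  proof (rule tendsto_simple_zero[OF P_has_deriv])
   show "P (ipi) = 0" by (simp add: P_eq_0_iff)
   have "deriv \<theta> (-1) = qpc qc ^ 3" using theta_deriv_minus1 by (rule DERIV_imp_deriv)
   thus "deriv P (ipi) ~= 0" using Cq_pos by (simp add: deriv_P_eq)
  qed
  moreover have "(T \<longlongrightarrow> T (ipi)) (at (ipi))"
  proof -
   have "T holomorphic_on UNIV" using holomorphic_T[of "%x. x" UNIV] by (simp add: holomorphic_on_ident)
   hence "isCont T (ipi)"
    using holomorphic_on_imp_continuous_on continuous_on_eq_continuous_at[OF open_UNIV] by blast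
   thus ?thesis by (simp add: isCont_def)
  qed
  ultimately have "((%u. (u - ipi) / P u * T u) \<longlongrightarrow> 1 / deriv P (ipi) * 0) (at (ipi))"
   unfolding T_pi_i by (rule tendsto_mult)
  hence "((%u. (u - ipi) * (T u / P u)) \<longlongrightarrow> 0) (at (ipi))" by simp
  with mn show "\<exists>m n \<zeta>0. \<zeta> = \<zeta>0 + of_int m * of_real L + of_int n * (\<omega>) \<and>
      ((%u. (u - \<zeta>0) * (T u / P u)) \<longlongrightarrow> 0) (at \<zeta>0)" by blast
 qed auto
 then obtain c where c: "\<And>u. P u ~= 0 ==> T u = c * P u" by (auto simp: field_simps)
 have Pnz: "P (of_real s) ~= 0" for s :: real
  using theta_nz_pos[of "exp s"] by (simp add: P_eq_0_iff exp_of_real)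
 have "PI (%s. T (of_real s - 0)) = PI (%s. c * P (of_real s))" using c Pnz by simp
 hence "- lc = c * (- lc)" unfolding PI_T set_integral_mult_right PI_P .
 hence c1: "c = 1" by simp
 have "P u = T u" for u
 proof -
  have "isCont (%u. P u - T u) u"
  proof -
   have "(%u. P u - T u) holomorphic_on UNIV" by (intro holomorphic_intros)
   thus ?thesis using holomorphic_on_imp_continuous_on continuous_on_eq_continuous_at[OF open_UNIV] by blast
  qed
  hence l: "((%u. P u - T u) \<longlongrightarrow> P u - T u) (at u)" by (simp add: isCont_def)
  have "P holomorphic_on UNIV" by (intro holomorphic_intros)
  from non_zero_neighbour_alt[OF this open_UNIV connected_UNIV UNIV_I UNIV_I Pnz[of 0], of u]
  have "eventually (%u. P u - T u = 0) (at u)"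
   by eventually_elim (use c c1 in auto)
  from Lim_transform_eventually[OF l this] show ?thesis by (simp add: tendsto_const_iff)
 qed
 thus ?thesis by blast
qed

end

context qbase
begin

section \<open>Fourier expansion of the continuous connection coefficient\<close>

lemma P_real_nz: "P (of_real s) ~= 0"
 using theta_nz_pos[of "exp s"] by (simp add: P_eq_0_iff exp_of_real)

lemma theta_exp_real_nz: "\<theta> (exp (of_real s)) ~= 0"
 using P_real_nz[of s] by (simp add: P_eq_0_iff)

lemma cont_Q_real: "continuous_on A (%s. Q (of_real s))"
 by (rule continuous_on_compose2[OF holomorphic_on_imp_continuous_on[OF holomorphic_Q]])
  (auto intro!: continuous_intros simp: P_real_nz)

lemma Q_reflect: "P u ~= 0 ==> Q (lc - u) = - Q u"
 using Q_L[of "- u"] Q_minus[of u] by (simp add: P_minus)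

lemma P_reflect: "P (lc - u) = P u"
 using P_L[of "- u"] by (simp add: P_minus)

lemma PI_Q: "PI (%s. Q (of_real s)) = 0"
proof -
 have "PI (%s. Q (of_real s)) = PI (%s. Q (of_real (L - s)))"
  by (rule set_integral_reflect[symmetric])
 also have "\<dots> = PI (%s. - Q (of_real s))"
  using Q_reflect[OF P_real_nz] by simp
 also have "\<dots> = - PI (%s. Q (of_real s))"
  by (simp add: set_lebesgue_integral_def)
 finally show ?thesis by (simp add: equal_neg_zero)
qed

lemma PI_en_neg_Q: "PI (%s. en (- n) (of_real s) * Q (of_real s)) = - PI (%s. en n (of_real s) * Q (of_real s))"
proof -
 have e: "en (- n) (of_real (L - s)) = en n (of_real s)" for s
  using en_L[of "- n" "- of_real s"] by (simp add: en_minus[of "- n"] add.commute[of lc])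
 have "PI (%s. en (- n) (of_real s) * Q (of_real s)) = PI (%s. en (- n) (of_real (L - s)) * Q (of_real (L - s)))"
  by (rule set_integral_reflect[symmetric])
 also have "\<dots> = PI (%s. - (en n (of_real s) * Q (of_real s)))"
  unfolding e using Q_reflect[OF P_real_nz] by simp
 finally show ?thesis by (simp add: set_lebesgue_integral_def)
qed

lemma PI_geometric:
 assumes a: "0 < a" "a < (1::real)" and e: "e = 1 \<or> e = - 1"
 shows "PI (%s. en (int n) (of_real s) * (of_real a * en e (of_real s) / (1 - of_real a * en e (of_real s))))
  = (if e = -1 \<and> n > 0 then - lc * of_real (a ^ n) else 0)"
proof -
 define f where "f = (%j s. complex_of_real (a ^ Suc j) * en (int n + e * int (Suc j)) (of_real s))"
 have "(%j. PI (f j)) sums PI (%s. \<Sum>j. f j s)"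
 proof (rule sums_set_integral_Icc)
  show "continuous_on {L..0} (f k)" for k unfolding f_def by (intro continuous_intros cont_en_real)
  show "norm (f k s) \<le> a ^ Suc k" for k s using a by (simp add: f_def norm_mult norm_power)
  show "summable (%k. a ^ Suc k)" using a by (simp only: summable_Suc_iff) (auto intro: summable_geometric)
 qed
 also have "(%s. \<Sum>j. f j s) = (%s. en (int n) (of_real s) * (of_real a * en e (of_real s) / (1 - of_real a * en e (of_real s))))"
 proof
  fix s
  define y where "y = of_real a * en e (of_real s)"
  have "norm y < 1" using a by (simp add: y_def norm_mult)
  have "f j s = en (int n) (of_real s) * y * y ^ j" for j
  proof -
   have "en (e * int (Suc j)) (of_real s) = en e (of_real s) ^ Suc j"
    by (simp only: en_powi[of "e * int (Suc j)"] en_powi[of e] power_int_mult power_int_of_nat)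
   thus ?thesis by (simp add: f_def en_index_add y_def power_mult_distrib)
  qed
  hence "(%j. f j s) sums (en (int n) (of_real s) * y * (1 / (1 - y)))"
   using sums_mult[OF geometric_sums[OF \<open>norm y < 1\<close>], of "en (int n) (of_real s) * y"] by simp
  thus "(\<Sum>j. f j s) = en (int n) (of_real s) * (of_real a * en e (of_real s) / (1 - of_real a * en e (of_real s)))"
   by (simp add: sums_iff y_def)
 qed
 finally have s: "(%j. PI (f j)) sums PI (%s. en (int n) (of_real s) * (of_real a * en e (of_real s) / (1 - of_real a * en e (of_real s))))" .
 have PIf: "PI (f j) = (if int n + e * int (Suc j) = 0 then - lc * of_real (a ^ Suc j) else 0)" for j
  unfolding f_def set_integral_mult_right using PI_en[of "int n + e * int (Suc j)"] PI_const[of 1] by auto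
 have "(%j. PI (f j)) sums (if e = -1 \<and> n > 0 then - lc * of_real (a ^ n) else 0)"
 proof (cases "e = -1 \<and> n > 0")
  case True
  then obtain m where m: "n = Suc m" using gr0_implies_Suc by blast
  have "PI (f j) = (if j = m then - lc * of_real (a ^ n) else 0)" for j
   unfolding PIf using True m by auto
  thus ?thesis using True sums_single[of m "%_. - lc * of_real (a ^ n)"] by simp
 next
  case False
  hence "PI (f j) = 0" for j unfolding PIf using e by auto
  hence "(%j. PI (f j)) = (%_. 0)" by simp
  thus ?thesis using False sums_zero by (simp only: if_False)
 qed
 with s show ?thesis by (rule sums_unique2)
qed

text \<open>By theta inversion \<open>Q\<close> is the logarithmic derivative of a product of factors
\<open>1 - a * en 1 u\<close> and \<open>1 - a * en (- 1) u\<close>, whose Fourier coefficients come from geometric series.\<close>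

lemma PI_en_Q:
 assumes n: "n > 0"
 shows "PI (%s. en (int n) (of_real s) * Q (of_real s)) = ipi / of_real (sinh (real n * ln hq))"
proof -
 interpret R: qbase "hq\<^sup>2" by (rule qbase_hq)
 define \<tau> where "\<tau> = (%u. - (complex_of_real hq * en 1 u))"
 have \<tau>nz: "\<tau> u ~= 0" for u using hq_pos by (simp add: \<tau>_def)
 define a where "a = (%k::nat. hq * (hq\<^sup>2) ^ k)"
 have a: "0 < a k" "a k < 1" "a k \<le> hq" for k
 proof -
  have "(hq\<^sup>2) ^ k \<le> 1" by (rule power_le_one[OF zero_le_power2 less_imp_le[OF R.q_less_1]])
  thus "a k \<le> hq" using hq_pos by (simp add: a_def)
  thus "a k < 1" using hq_less_1 by linarith
  show "0 < a k" using hq_pos by (simp add: a_def)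
 qed
 define t where "t = (%k s. of_real (a k) * en (-1) (of_real s) / (1 - of_real (a k) * en (-1) (of_real s))
            - of_real (a k) * en 1 (of_real s) / (1 - of_real (a k) * en 1 (of_real s)))"
 have nz: "1 - complex_of_real (a k) * en e (of_real s) ~= 0" for k e s
 proof
  assume "1 - complex_of_real (a k) * en e (of_real s) = 0"
  hence "norm (complex_of_real (a k) * en e (of_real s)) = 1" by simp
  thus False using a[of k] by (simp add: norm_mult)
 qed
 have Q_sum: "(%k. t k s) sums (lc / (2 * of_real pi * \<i>) * Q (of_real s))" for s
 proof -
  define u where "u = complex_of_real s"
  have Pu: "P u ~= 0" using P_real_nz by (simp add: u_def)
  have T\<tau>: "T v = R.\<theta> (\<tau> v)" for v by (simp add: T_def \<tau>_def)
  have "(\<tau> has_field_derivative 2 * of_real pi * \<i> / lc * \<tau> u) (at u)"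
   unfolding \<tau>_def en_def by (auto intro!: derivative_eq_intros)
  hence "((%v. R.\<theta> (\<tau> v)) has_field_derivative deriv R.\<theta> (\<tau> u) * (2 * of_real pi * \<i> / lc * \<tau> u)) (at u)"
   by (rule DERIV_chain2[where f = R.\<theta> and g = \<tau>, OF R.theta_field_derivative[OF \<tau>nz]])
  hence "deriv P u = deriv R.\<theta> (\<tau> u) * (2 * of_real pi * \<i> / lc * \<tau> u)"
   unfolding theta_inversion T\<tau>[abs_def] by (rule DERIV_imp_deriv)
  moreover have "P u = R.\<theta> (\<tau> u)" unfolding theta_inversion T\<tau> ..
  ultimately have "Q u = 2 * of_real pi * \<i> / lc * R.g (\<tau> u)"
   using Q_eq[OF Pu] by (simp add: R.g_def)
  hence "R.g (\<tau> u) = lc / (2 * of_real pi * \<i>) * Q u" by simp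
  moreover have "R.\<theta> (\<tau> u) ~= 0" using Pu unfolding theta_inversion T\<tau> .
  ultimately have S: "(%k. \<tau> u * of_real (hq\<^sup>2) ^ k / (1 + \<tau> u * of_real (hq\<^sup>2) ^ k)
    - of_real (hq\<^sup>2) / \<tau> u * of_real (hq\<^sup>2) ^ k / (1 + of_real (hq\<^sup>2) / \<tau> u * of_real (hq\<^sup>2) ^ k))
    sums (lc / (2 * of_real pi * \<i>) * Q u)"
   using R.g_sums[OF \<tau>nz, of u] by simp
  have e1: "\<tau> u * of_real (hq\<^sup>2) ^ k = - (of_real (a k) * en 1 u)" for k
   by (simp add: \<tau>_def a_def)
  have e2: "of_real (hq\<^sup>2) / \<tau> u * of_real (hq\<^sup>2) ^ k = - (of_real (a k) * en (-1) u)" for k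
  proof -
   have "en (-1) u = 1 / en 1 u" by (simp add: en_powi[of "-1"] power_int_minus inverse_eq_divide)
   thus ?thesis using hq_pos by (simp add: \<tau>_def a_def power2_eq_square)
  qed
  show ?thesis using S[unfolded e1 e2] unfolding t_def u_def by simp
 qed
 have cont: "continuous_on {L..0} (%s. en (int n) (of_real s) * (of_real (a k) * en e (of_real s) / (1 - of_real (a k) * en e (of_real s))))" for k e
  using nz by (intro continuous_intros cont_en_real) auto
 have bd1: "norm (of_real (a k) * en e (of_real s) / (1 - of_real (a k) * en e (of_real s))) \<le> a k / (1 - hq)" for k e s
 proof -
  have "1 - hq \<le> norm (1 - of_real (a k) * en e (of_real s))"
   using norm_triangle_ineq2[of 1 "of_real (a k) * en e (of_real s)"] a[of k] by (simp add: norm_mult)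
  thus ?thesis using a[of k] hq_less_1 by (simp add: norm_divide norm_mult frac_le)
 qed
 have "(%k. PI (%s. en (int n) (of_real s) * t k s)) sums PI (%s. \<Sum>k. en (int n) (of_real s) * t k s)"
 proof (rule sums_set_integral_Icc)
  show "continuous_on {L..0} (%s. en (int n) (of_real s) * t k s)" for k
   unfolding t_def right_diff_distrib by (intro continuous_on_diff cont)
  show "norm (en (int n) (of_real s) * t k s) \<le> 2 * (a k / (1 - hq))" for k s
   using norm_triangle_ineq4[of "of_real (a k) * en (-1) (of_real s) / (1 - of_real (a k) * en (-1) (of_real s))"
     "of_real (a k) * en 1 (of_real s) / (1 - of_real (a k) * en 1 (of_real s))"] bd1[of k "-1" s] bd1[of k 1 s]
   by (simp add: norm_mult t_def)
  show "summable (%k. 2 * (a k / (1 - hq)))"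
   unfolding a_def using R.q_less_1 R.q_pos by (intro summable_mult summable_divide summable_geometric) auto
 qed
 also have "(%s. \<Sum>k. en (int n) (of_real s) * t k s) = (%s. lc / (2 * of_real pi * \<i>) * (en (int n) (of_real s) * Q (of_real s)))"
 proof
  fix s
  have "(\<Sum>k. en (int n) (of_real s) * t k s) = en (int n) (of_real s) * (lc / (2 * of_real pi * \<i>) * Q (of_real s))"
   by (rule sums_unique[symmetric, OF sums_mult[OF Q_sum]])
  thus "(\<Sum>k. en (int n) (of_real s) * t k s) = lc / (2 * of_real pi * \<i>) * (en (int n) (of_real s) * Q (of_real s))"
   by (simp only: mult_ac)
 qed
 also have "PI \<dots> = lc / (2 * of_real pi * \<i>) * PI (%s. en (int n) (of_real s) * Q (of_real s))"
  by (rule set_integral_mult_right)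
 also have "(%k. PI (%s. en (int n) (of_real s) * t k s)) = (%k. - lc * of_real (hq ^ n) * of_real ((hq\<^sup>2) ^ n) ^ k)"
 proof
  fix k
  have i: "set_integrable lborel {L..0} (%s. en (int n) (of_real s) * (of_real (a k) * en e (of_real s) / (1 - of_real (a k) * en e (of_real s))))" for e
   by (intro borel_integrable_atLeastAtMost' cont)
  have "PI (%s. en (int n) (of_real s) * t k s) = - lc * of_real (a k ^ n) - 0"
   unfolding t_def right_diff_distrib set_integral_diff(2)[OF i i]
   using PI_geometric[OF a(1,2), of "-1" n k] PI_geometric[OF a(1,2), of 1 n k] n by simp
  moreover have "a k ^ n = hq ^ n * ((hq\<^sup>2) ^ n) ^ k"
   unfolding a_def power_mult_distrib by (metis power_mult mult.commute)
  ultimately show "PI (%s. en (int n) (of_real s) * t k s) = - lc * of_real (hq ^ n) * of_real ((hq\<^sup>2) ^ n) ^ k"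
   by (simp only: of_real_mult of_real_power diff_0_right mult.assoc)
 qed
 finally have s: "(%k. - lc * of_real (hq ^ n) * of_real ((hq\<^sup>2) ^ n) ^ k) sums
  (lc / (2 * of_real pi * \<i>) * PI (%s. en (int n) (of_real s) * Q (of_real s)))" .
 define p where "p = (hq\<^sup>2) ^ n"
 have p: "0 < p" "p < 1" using R.q_pos R.q_less_1 n by (auto simp: p_def power_less_one_iff)
 have "(%k. - lc * of_real (hq ^ n) * of_real p ^ k) sums (- lc * of_real (hq ^ n) * (1 / (1 - of_real p)))"
  using p by (intro sums_mult geometric_sums) simp
 with s have "lc / (2 * of_real pi * \<i>) * PI (%s. en (int n) (of_real s) * Q (of_real s)) = - lc * of_real (hq ^ n) * (1 / (1 - of_real p))"
  unfolding p_def by (rule sums_unique2)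
 note h = this
 have cancel: "X = - (c * y)" if "l ~= 0" "c ~= 0" "l / c * X = - l * y" for l c X y :: complex
 proof -
  have "X = c / l * (l / c * X)" using that(1,2) by simp
  also have "\<dots> = - (c * y)" unfolding that(3) using that(1) by simp
  finally show ?thesis .
 qed
 have "PI (%s. en (int n) (of_real s) * Q (of_real s)) = - (2 * of_real pi * \<i> * (of_real (hq ^ n) * (1 / (1 - of_real p))))"
 proof (rule cancel[OF lc_nz])
  show "lc / (2 * of_real pi * \<i>) * PI (%s. en (int n) (of_real s) * Q (of_real s)) = - lc * (of_real (hq ^ n) * (1 / (1 - of_real p)))"
   using h by (simp only: mult.assoc)
 qed simp
 also have "\<dots> = of_real pi * \<i> * of_real (- 2 * hq ^ n / (1 - p))" by simp
 finally have "PI (%s. en (int n) (of_real s) * Q (of_real s)) = of_real pi * \<i> * of_real (- 2 * hq ^ n / (1 - p))" .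
 also have "- 2 * hq ^ n / (1 - p) = 1 / sinh (real n * ln hq)"
 proof -
  have x: "exp (real n * ln hq) = hq ^ n" using hq_pos by (metis exp_ln exp_of_nat_mult)
  have "sinh (real n * ln hq) = (hq ^ n - 1 / hq ^ n) / 2"
   by (simp add: sinh_field_def exp_minus x inverse_eq_divide)
  moreover have pH: "p = hq ^ n * hq ^ n" by (simp add: p_def power2_eq_square power_mult_distrib)
  moreover have "- 2 * H / (1 - H * H) = 1 / ((H - 1 / H) / 2)" if "H > 0" "H * H < 1" for H :: real
  proof -
   have e: "(H - 1 / H) / 2 = (H * H - 1) / (2 * H)" using that by (simp add: field_simps)
   have "1 / ((H - 1 / H) / 2) = 2 * H / (H * H - 1)" unfolding e by simp
   also have "\<dots> = - 2 * H / (1 - H * H)"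
    by (subst frac_eq_eq) (use that in \<open>auto simp: algebra_simps\<close>)
   finally show ?thesis ..
  qed
  ultimately show ?thesis using p hq_pos by (simp only: pH zero_less_power)
 qed
 finally show ?thesis by simp
qed

lemma sinh_hq_nz: "n > 0 ==> sinh (real n * ln hq) ~= 0"
 using hq_pos hq_less_1 by (simp add: sinh_zero_iff)

lemma countable_P_zeros: "countable {s::real. P (of_real s - w) = 0}"
proof -
 define S where "S = (%(m::int, n::int). Re (w + (ipi + of_int m * lc + of_int n * (\<omega>)))) ` UNIV"
 have "s \<in> S" if s: "P (of_real s - w) = 0" for s
 proof -
  obtain m n :: int where "of_real s - w = ipi + of_int m * lc + of_int n * (\<omega>)"
   using theta_exp_zero[of "of_real s - w"] s by (auto simp: P_eq_0_iff)
  hence "of_real s = w + (ipi + of_int m * lc + of_int n * (\<omega>))"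
   by (simp add: algebra_simps)
  hence "s = Re (w + (ipi + of_int m * lc + of_int n * (\<omega>)))"
   by (metis Re_complex_of_real)
  thus ?thesis unfolding S_def by (intro image_eqI[of _ _ "(m, n)"]) auto
 qed
 hence "{s. P (of_real s - w) = 0} \<subseteq> S" by blast
 moreover have "countable S" unfolding S_def by (intro countable_image) simp
 ultimately show ?thesis by (rule countable_subset)
qed

lemma PI_cong_countable:
 assumes "countable N" "\<And>s. s \<in> {L..0} ==> s \<notin> N ==> f s = f' s"
 shows "PI f = PI f'"
 unfolding set_lebesgue_integral_def
 by (rule integral_discrete_difference[OF assms(1)]) (use assms(2) in \<open>auto simp: indicator_def\<close>)

lemma cont_P_shift: "continuous_on A (%s. P (of_real s - w))"
proof -
 have "(%u. P (u - w)) holomorphic_on UNIV" by (intro holomorphic_intros)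
 thus ?thesis
  by (rule continuous_on_compose2[OF holomorphic_on_imp_continuous_on]) (auto intro!: continuous_intros)
qed

lemma Pc_integral: "Pc q w = - (1 / lc) * PI (%s. P (of_real s - w) * (Q (of_real s) - Q (of_real s - w)))"
proof -
 have "set_lebesgue_integral lborel {q..1} (%t. P (of_real (ln t) - w) * Pd q (of_real t) w / of_real t)
  = PI (%s. P (of_real (ln (exp s)) - w) * Pd q (of_real (exp s)) w)"
  by (rule exp_substitution_Icc[OF q_pos])
 also have "\<dots> = PI (%s. P (of_real s - w) * (Q (of_real s) - Q (of_real s - w)))"
  by (simp add: Pd_eq exp_of_real[symmetric])
 finally show ?thesis by (simp add: Pc_def)
qed

text \<open>The other half of the integrand is the derivative of a periodic function.\<close>

lemma Pc_integral2: "Pc q w = - (1 / lc) * PI (%s. P (of_real s - w) * Q (of_real s))"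
proof -
 have hol: "(%u. deriv P (u - w)) holomorphic_on UNIV"
  by (rule holomorphic_on_compose_gen[OF _ holomorphic_deriv_P, unfolded o_def]) (auto intro!: holomorphic_intros)
 have c: "continuous_on {L..0} (%s. deriv P (of_real s - w))"
  by (rule continuous_on_compose2[OF holomorphic_on_imp_continuous_on[OF hol]]) (auto intro!: continuous_intros)
 have d0: "PI (%s. deriv P (of_real s - w)) = 0"
 proof -
  have "integral\<^sup>L lborel (%s. indicator {L .. 0} s *\<^sub>R deriv P (of_real s - w)) = P (of_real 0 - w) - P (of_real L - w)"
  proof (rule integral_FTC_atLeastAtMost)
   fix s
   have "((%u. P (u - w)) has_field_derivative deriv P (of_real s - w) * 1) (at (of_real s))"
    by (rule DERIV_chain2[where f = P and g = "%u. u - w", OF P_has_deriv]) (auto intro!: derivative_eq_intros)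
   hence "((%u. P (u - w)) has_field_derivative deriv P (of_real s - w)) (at (of_real s))" by simp
   thus "((%s. P (of_real s - w)) has_vector_derivative deriv P (of_real s - w)) (at s within {L..0})"
    by (rule has_vector_derivative_real_field)
  qed (use L_neg c in auto)
  moreover have "P (of_real L - w) = P (- w)" using P_L[of "- w"] by (simp add: add.commute)
  ultimately show ?thesis by (simp add: set_lebesgue_integral_def)
 qed
 have "PI (%s. P (of_real s - w) * (Q (of_real s) - Q (of_real s - w)))
   = PI (%s. P (of_real s - w) * Q (of_real s) - deriv P (of_real s - w))"
  by (rule PI_cong_countable[OF countable_P_zeros[of w]]) (simp add: right_diff_distrib P_times_Q)
 also have "\<dots> = PI (%s. P (of_real s - w) * Q (of_real s)) - PI (%s. deriv P (of_real s - w))"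
  by (rule set_integral_diff(2)) (intro borel_integrable_atLeastAtMost' continuous_intros c cont_P_shift cont_Q_real)+
 finally show ?thesis by (simp add: Pc_integral d0)
qed

definition pco :: "nat \<Rightarrow> complex" where
 "pco n = of_real (pi / L * cf (int n) / sinh (real n * ln hq)) * \<i>"

abbreviation pt :: "nat \<Rightarrow> complex \<Rightarrow> complex" where
 "pt n w \<equiv> pco (Suc n) * (en (int (Suc n)) w - en (- int (Suc n)) w)"

lemma Pc_series: "(%n. pt n w) sums Pc q w"
proof -
 have "(%n. - (1 / lc) * (of_real (cf (int (Suc n))) * (en (- int (Suc n)) w * PI (%s. en (int (Suc n)) (of_real s) * Q (of_real s))
       + en (int (Suc n)) w * PI (%s. en (- int (Suc n)) (of_real s) * Q (of_real s)))))
    sums (- (1 / lc) * (PI (%s. T (of_real s - w) * Q (of_real s)) - PI (%s. Q (of_real s))))"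
  by (intro sums_mult PI_T_times cont_Q_real)
 moreover have "- (1 / lc) * (PI (%s. T (of_real s - w) * Q (of_real s)) - PI (%s. Q (of_real s))) = Pc q w"
  unfolding Pc_integral2 PI_Q theta_inversion by simp
 moreover have "- (1 / lc) * (of_real (cf (int (Suc n))) * (en (- int (Suc n)) w * PI (%s. en (int (Suc n)) (of_real s) * Q (of_real s))
       + en (int (Suc n)) w * PI (%s. en (- int (Suc n)) (of_real s) * Q (of_real s))))
   = pt n w" for n
 proof -
  have "- (1 / l) * (c * (A * (p * \<i> / s) + B * (- (p * \<i> / s)))) = (p / l * c / s * \<i>) * (B - A)" for l c A B p s :: complex
   by (cases "l = 0", simp, cases "s = 0", simp, simp add: field_simps)
  thus ?thesis
   unfolding PI_en_neg_Q PI_en_Q[OF zero_less_Suc[of n]] pco_def of_real_mult of_real_divide .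
 qed
 ultimately show ?thesis by (simp only:)
qed

lemma en_diff_sin: "en n w - en (- n) w = 2 * \<i> * sin (of_real (2 * pi * of_int n) * (w / lc))"
proof -
 define A where "A = of_real (2 * pi * of_int n) * (w / lc)"
 have "en n w = exp (\<i> * A)" "en (- n) w = exp (- (\<i> * A))"
  unfolding en_def A_def by (simp_all add: mult_ac)
 thus ?thesis unfolding sin_exp_eq A_def[symmetric] by simp
qed

lemma pco_term: "pco n * (en (int n) w - en (- int n) w) = of_real (- 2 * pi / L) * Pc_term q w n"
proof -
 have cf: "cf (int n) = (- 1) ^ n * hq ^ n\<^sup>2" by (simp add: cf_def power2_eq_square flip: of_nat_mult)
 have "sin (of_real (2 * pi * of_int (int n)) * (w / lc)) = sin (of_real (2 * pi * real n) * (w / lc))" by simp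
 thus ?thesis
  unfolding en_diff_sin pco_def Pc_term_def cf by (simp add: divide_simps)
qed

lemma Pc_term_sums: "summable (Pc_term q w)" "Pc q w = of_real (- 2 * pi / L) * (\<Sum>n. Pc_term q w (Suc n))"
proof -
 define K where "K = complex_of_real (- 2 * pi / L)"
 have K: "K ~= 0" by (simp add: K_def)
 have "(%n. K * Pc_term q w (Suc n)) sums Pc q w"
  using Pc_series[of w] unfolding pco_term K_def .
 hence "(%n. 1 / K * (K * Pc_term q w (Suc n))) sums (1 / K * Pc q w)" by (rule sums_mult)
 hence s: "(%n. Pc_term q w (Suc n)) sums (Pc q w / K)" using K by simp
 hence "summable (%n. Pc_term q w (Suc n))" by (rule sums_summable)
 thus "summable (Pc_term q w)" by (subst (asm) summable_Suc_iff)
 from s K show "Pc q w = of_real (- 2 * pi / L) * (\<Sum>n. Pc_term q w (Suc n))"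
  unfolding K_def[symmetric] by (simp add: sums_iff)
qed

lemma Pc_periodic: "Pc q (w + of_real L) = Pc q w"
proof -
 have "(%n. pt n w) sums Pc q (w + of_real L)"
  using Pc_series[of "w + of_real L"] by (simp only: en_L)
 thus ?thesis using Pc_series[of w] sums_unique2 by blast
qed

text \<open>The shift multiplies the Fourier modes by exponentials whose difference cancels the hyperbolic
sine, and the Fourier series of \<open>P\<close> is left.\<close>

lemma Pc_monodromy:
 "Pc q (w + \<omega>) - Pc q w = \<omega> / lc * (1 - P (w + ipi))"
proof -
 define v where "v = w + ipi"
 have s1: "(%n. pt n (w + \<omega>)
        - pt n w) sums (Pc q (w + \<omega>) - Pc q w)"
  by (intro sums_diff Pc_series)
 have "(%n. - (\<omega> / lc) * (of_real (cf (int (Suc n))) * en (int (Suc n)) v + of_real (cf (- int (Suc n))) * en (- int (Suc n)) v))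
  sums (- (\<omega> / lc) * (T v - of_real (cf 0) * en 0 v))"
  by (intro sums_mult has_sum_int_pairs(1)[OF T_has_sum])
 moreover have "- (\<omega> / lc) * (of_real (cf (int (Suc n))) * en (int (Suc n)) v + of_real (cf (- int (Suc n))) * en (- int (Suc n)) v)
  = pt n (w + \<omega>)
        - pt n w" for n
 proof -
  define k where "k = int (Suc n)"
  define H where "H = hq ^ Suc n"
  have H: "H > 0" using hq_pos by (simp add: H_def)
  have hk: "hq powi k = H" unfolding k_def H_def by (rule power_int_of_nat)
  have hk1: "hq powi (- k) = 1 / H" using hk by (simp only: power_int_minus inverse_eq_divide)
  have "- 2 * k = (- k) + (- k)" "- 2 * (- k) = k + k" by simp_all
  hence hk2: "hq powi (- 2 * k) = 1 / (H * H)" "hq powi (- 2 * (- k)) = H * H" "hq powi (- (- k)) = H"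
   using hq_pos by (simp_all only: power_int_add[OF disjI1[OF less_imp_neq[THEN not_sym]]] hk1 hk minus_minus
     times_divide_times_eq mult_1)
  have "exp (real (Suc n) * ln hq) = H" unfolding H_def using hq_pos by (metis exp_ln exp_of_nat_mult)
  hence sh: "sinh (real (Suc n) * ln hq) = (H - 1 / H) / 2"
   by (simp add: sinh_field_def exp_minus inverse_eq_divide)
  have shnz: "H - 1 / H ~= 0" using sinh_hq_nz[of "Suc n"] unfolding sh by simp
  have e1: "en k (w + \<omega>) = en k w / of_real (H * H)" "en (- k) (w + \<omega>) = en (- k) w * of_real (H * H)"
   unfolding en_add en_2pi_i hk2 by simp_all
  have e2: "en k v = en k w / of_real H" "en (- k) v = en (- k) w * of_real H"
   unfolding v_def en_add en_pi_i hk1 hk2 by simp_all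
  have pk: "pco (Suc n) = of_real (2 * pi / L * cf k / (H - 1 / H)) * \<i>"
   unfolding pco_def sh k_def by simp
  have key: "- (p / l) * (c * (A / h) + c * (B * h)) = p / l * c / (h - 1 / h) * (A / (h * h) - B * (h * h)) - p / l * c / (h - 1 / h) * (A - B)"
   if "h ~= 0" "h - 1 / h ~= 0" "l ~= 0" for p l c A B h :: complex
  proof -
   have "(A / (h * h) - B * (h * h)) - (A - B) = - (h - 1 / h) * (A / h + B * h)"
    using that by (simp add: field_simps)
   moreover have "p / l * c / D * (- D * X) = - (p / l) * c * X" if "D ~= 0" for D X :: complex
    using that by simp
   ultimately have "p / l * c / (h - 1 / h) * ((A / (h * h) - B * (h * h)) - (A - B)) = - (p / l) * c * (A / h + B * h)"
    using that(2) by (simp only:)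
   thus ?thesis by (simp only: right_diff_distrib[symmetric] distrib_left[symmetric] mult.assoc)
  qed
  have Heq: "complex_of_real H - 1 / complex_of_real H = of_real (H - 1 / H)" by simp
  have nz: "complex_of_real H - 1 / complex_of_real H ~= 0"
   unfolding Heq using shnz of_real_eq_0_iff by blast
  show ?thesis
   unfolding k_def[symmetric] e1 e2 pk cf_minus
   using key[of "of_real H" lc "\<omega>" "of_real (cf k)" "en k w" "en (-k) w"] H nz
   by (simp add: mult_ac)
 qed
 ultimately have "(%n. pt n (w + \<omega>)
        - pt n w) sums (- (\<omega> / lc) * (T v - 1))"
  by (simp add: cf_def)
 from sums_unique2[OF s1 this]
 have "Pc q (w + \<omega>) - Pc q w = - (\<omega> / lc) * (T v - 1)" .
 moreover have "- K * (x - 1) = K * (1 - x)" for K x :: complex by (simp add: algebra_simps)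
 ultimately show ?thesis unfolding v_def theta_inversion by (simp only:)
qed

definition strip :: "complex set" where "strip = {u. \<bar>Im u\<bar> < pi}"

lemma strip_props: "open strip" "convex strip"
proof -
 have e: "strip = {u. Im u < pi} \<inter> {u. Im u > - pi}" by (auto simp: strip_def)
 show "open strip" unfolding e by (intro open_Int open_halfspace_Im_lt open_halfspace_Im_gt)
 show "convex strip" unfolding e by (intro convex_Int convex_halfspace_Im_lt convex_halfspace_Im_gt)
qed

lemma P_strip_nz: "u \<in> strip ==> P u ~= 0"
proof
 assume u: "u \<in> strip" "P u = 0"
 then obtain m n :: int where "u = ipi + of_int m * lc + of_int n * (\<omega>)"
  using theta_exp_zero[of u] by (auto simp: P_eq_0_iff)
 hence "Im u = pi * of_int (2 * n + 1)" by (simp add: algebra_simps)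
 hence "\<bar>of_int (2 * n + 1) :: real\<bar> * pi < 1 * pi" using u(1) by (simp add: strip_def abs_mult mult.commute)
 hence "\<bar>of_int (2 * n + 1) :: real\<bar> < 1" by (subst (asm) mult_less_cancel_right_pos) auto
 hence "\<bar>2 * n + 1\<bar> < 1" by linarith
 thus False by presburger
qed

lemma strip_shift: "u \<in> strip ==> u + of_real s \<in> strip" "u \<in> strip ==> - u \<in> strip" "0 \<in> strip"
 by (auto simp: strip_def)

lemma holomorphic_Q_strip: "Q holomorphic_on strip"
 by (rule holomorphic_on_subset[OF holomorphic_Q]) (use P_strip_nz in auto)

text \<open>In the strip \<open>Q\<close> has no poles, so its mean is the same along all horizontal lines.\<close>

lemma PI_Pd_zero: "w \<in> strip ==> PI (%s. Q (of_real s) - Q (of_real s - w)) = 0"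
proof -
 assume w: "w \<in> strip"
 have "PI (%s. Q (of_real s + (- w))) = PI (%s. Q (of_real s))"
  by (rule period_integral_shift[OF L_neg strip_props holomorphic_Q_strip])
   (use w strip_shift P_strip_nz Q_L in auto)
 moreover have c: "continuous_on {L..0} (%s. Q (of_real s - w))"
  by (rule continuous_on_compose2[OF holomorphic_on_imp_continuous_on[OF holomorphic_Q_strip]])
   (use w in \<open>auto intro!: continuous_intros simp: strip_def\<close>)
 ultimately show ?thesis
  using set_integral_diff(2)[OF borel_integrable_atLeastAtMost'[OF cont_Q_real] borel_integrable_atLeastAtMost'[OF c]]
  by simp
qed

lemma Pc_strip: "w \<in> strip ==> Pc q w = 1 / lc * PI (%s. P (of_real s) * Q (of_real s - w))"
proof -
 assume w: "w \<in> strip"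
 have "PI (%s. P (of_real s) * Q (of_real s - w)) = PI (%s. P (of_real (L - s)) * Q (of_real (L - s) - w))"
  by (rule set_integral_reflect[symmetric])
 also have "\<dots> = PI (%s. - (P (of_real s + w - w) * Q (of_real s + w)))"
 proof -
  have "P (of_real (L - s)) * Q (of_real (L - s) - w) = - (P (of_real s + w - w) * Q (of_real s + w))" for s
  proof -
   have "of_real s + w \<in> strip" using strip_shift(1)[OF w, of s] by (simp add: add.commute)
   from Q_reflect[OF P_strip_nz[OF this]] have "Q (of_real (L - s) - w) = - Q (of_real s + w)"
    by (simp add: algebra_simps)
   thus ?thesis using P_reflect[of "of_real s"] by simp
  qed
  thus ?thesis by simp
 qed
 also have "\<dots> = - PI (%s. P (of_real s + w - w) * Q (of_real s + w))" by (simp add: set_lebesgue_integral_def)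
 also have "PI (%s. P (of_real s + w - w) * Q (of_real s + w)) = PI (%s. P (of_real s - w) * Q (of_real s))"
 proof (rule period_integral_shift[OF L_neg strip_props, where f = "%u. P (u - w) * Q u"])
  show "(%u. P (u - w) * Q u) holomorphic_on strip"
   by (intro holomorphic_intros holomorphic_Q_strip)
  show "P (u + of_real L - w) * Q (u + of_real L) = P (u - w) * Q u" if "u \<in> strip" for u
   using P_L[of "u - w"] Q_L[OF P_strip_nz[OF that]] by (simp add: algebra_simps)
 qed (use w strip_shift in auto)
 finally show ?thesis by (simp add: Pc_integral2)
qed

lemma PI_P_times_s: "PI (%s. P (of_real s) * of_real s) = - lc * lc / 2"
proof -
 have i: "set_integrable lborel {L..0} (%s. P (of_real s) * of_real s)"
  "set_integrable lborel {L..0} (%s. P (of_real s) * lc)"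
  using cont_P_shift[of _ 0] by (auto intro!: borel_integrable_atLeastAtMost' continuous_intros)
 have "PI (%s. P (of_real s) * of_real s) = PI (%s. P (of_real (L - s)) * of_real (L - s))"
  by (rule set_integral_reflect[symmetric])
 also have "\<dots> = PI (%s. P (of_real s) * lc - P (of_real s) * of_real s)"
  using P_reflect by (simp add: right_diff_distrib)
 also have "\<dots> = - lc * lc - PI (%s. P (of_real s) * of_real s)"
  by (subst set_integral_diff(2)[OF i(2,1)]) (simp add: PI_P)
 finally have F: "PI (%s. P (of_real s) * of_real s) = - lc * lc - PI (%s. P (of_real s) * of_real s)" .
 have "x = y / 2" if "x = y - x" for x y :: complex using that by (simp add: field_simps)
 from this[OF F] show ?thesis .
qed

lemma Pc_strip2: "w \<in> strip ==> Pc q w = w / lc + 1 / lc * PI (%s. P (of_real s) * g (exp (of_real s - w)))"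
proof -
 assume w: "w \<in> strip"
 define f1 where "f1 = (%s::real. P (of_real s) * of_real s)"
 define f2 where "f2 = (%s::real. P (of_real s))"
 define f3 where "f3 = (%s. P (of_real s) * g (exp (of_real s - w)))"
 define c where "c = w / lc + 1 / 2"
 have Qs: "P (of_real s) * Q (of_real s - w) = (1 / lc * f1 s - c * f2 s) + f3 s" for s
  by (simp add: Q_def f1_def f2_def f3_def c_def field_simps)
 have cP: "continuous_on {L..0} (%s. P (of_real s))" using cont_P_shift[of "{L..0}" 0] by simp
 have i1: "set_integrable lborel {L..0} (%s. 1 / lc * f1 s)" and i2: "set_integrable lborel {L..0} (%s. c * f2 s)"
  unfolding f1_def f2_def by (intro borel_integrable_atLeastAtMost' continuous_intros cP)+
 have "continuous_on {L..0} (%s. P (of_real s) * Q (of_real s - w))"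
  by (intro continuous_intros cP continuous_on_compose2[OF holomorphic_on_imp_continuous_on[OF holomorphic_Q_strip]])
   (use w in \<open>auto intro!: continuous_intros simp: strip_def\<close>)
 moreover have "f3 = (%s. P (of_real s) * Q (of_real s - w) - (1 / lc * f1 s - c * f2 s))"
  unfolding Qs by simp
 ultimately have i3: "set_integrable lborel {L..0} f3"
  unfolding f1_def f2_def by (intro borel_integrable_atLeastAtMost') (auto intro!: continuous_intros cP)
 have "PI (%s. P (of_real s) * Q (of_real s - w)) = (1 / lc * PI f1 - c * PI f2) + PI f3"
  unfolding Qs set_integral_add(2)[OF set_integral_diff(1)[OF i1 i2] i3] set_integral_diff(2)[OF i1 i2]
  by simp
 also have "\<dots> = (1 / lc * (- lc * lc / 2) - c * (- lc)) + PI f3"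
  unfolding f1_def f2_def PI_P_times_s PI_P ..
 also have "\<dots> = w + PI f3" by (simp add: c_def field_simps)
 finally show ?thesis
  unfolding Pc_strip[OF w] f3_def by (simp add: distrib_left)
qed

end

context qbase
begin

section \<open>Limits at the powers of q\<close>

lemma norm_en_le: "norm u \<le> R ==> norm (en n u) \<le> norm (en \<bar>n\<bar> (of_real R * \<i>))"
proof -
 assume u: "norm u \<le> R"
 have "Re (2 * of_real pi * \<i> * of_int n * u / lc) = - (2 * pi * of_int n * Im u / L)"
  by simp
 also have "\<dots> \<le> \<bar>2 * pi * of_int n * Im u / L\<bar>" by (rule abs_ge_minus_self)
 also have "\<dots> = 2 * pi * of_int \<bar>n\<bar> * \<bar>Im u\<bar> / - L"
  using L_neg by (simp add: abs_mult)
 also have "\<dots> \<le> 2 * pi * of_int \<bar>n\<bar> * R / - L"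
  using u abs_Im_le_cmod[of u] L_neg by (intro divide_right_mono mult_left_mono) auto
 also have "\<dots> = Re (2 * of_real pi * \<i> * of_int \<bar>n\<bar> * (of_real R * \<i>) / lc)" by simp
 finally show ?thesis by (simp add: en_def norm_exp_eq_Re)
qed

lemma Pc_uniform_limit:
 "uniform_limit (cball 0 R) (%N w. \<Sum>n<N. pt n w) (Pc q) sequentially"
proof -
 define c where "c = \<bar>pi / L\<bar> / \<bar>sinh (ln hq)\<bar>"
 have lh: "ln hq < 0" using hq_pos hq_less_1 by simp
 have sl: "\<bar>sinh (ln hq)\<bar> > 0" using sinh_hq_nz[of 1] by simp
 have pco_bd: "norm (pco (Suc n)) \<le> c * \<bar>cf (int (Suc n))\<bar>" for n
 proof -
  have "real (Suc n) * ln hq \<le> 1 * ln hq" using lh by (intro mult_right_mono_neg) auto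
  hence "sinh (real (Suc n) * ln hq) \<le> sinh (ln hq)" by simp
  moreover have "sinh (ln hq) < 0" using lh by simp
  ultimately have "\<bar>sinh (ln hq)\<bar> \<le> \<bar>sinh (real (Suc n) * ln hq)\<bar>" by linarith
  hence "\<bar>pi / L * cf (int (Suc n))\<bar> / \<bar>sinh (real (Suc n) * ln hq)\<bar> \<le> \<bar>pi / L * cf (int (Suc n))\<bar> / \<bar>sinh (ln hq)\<bar>"
   using sl by (intro divide_left_mono mult_pos_pos) linarith+
  thus ?thesis unfolding pco_def c_def norm_mult norm_of_real abs_divide abs_mult by (simp add: mult_ac)
 qed
 define M where "M = (%n. c * 2 * norm (of_real (cf (int (Suc n))) * en (int (Suc n)) (of_real R * \<i>)))"
 have "summable M"
  unfolding M_def using has_sum_int_pairs(2)[OF T_has_sum[of "of_real R * \<i>"]]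
  by (intro summable_mult) (simp only: summable_Suc_iff[of "%n. norm (of_real (cf (int n)) * en (int n) (of_real R * \<i>))"])
 have "uniform_limit (cball 0 R) (%N w. \<Sum>n<N. pt n w)
  (%w. \<Sum>n. pt n w) sequentially"
 proof (rule Weierstrass_m_test[OF _ \<open>summable M\<close>])
  fix n w assume w: "w \<in> cball (0::complex) R"
  define k where "k = int (Suc n)"
  have k: "\<bar>k\<bar> = k" "\<bar>- k\<bar> = k" by (simp_all add: k_def)
  have "norm (en k w - en (- k) w) \<le> norm (en k w) + norm (en (- k) w)" by (rule norm_triangle_ineq4)
  also have "\<dots> \<le> 2 * norm (en k (of_real R * \<i>))"
   using norm_en_le[of w R k] norm_en_le[of w R "- k"] w unfolding k by simp
  finally have 1: "norm (en k w - en (- k) w) \<le> 2 * norm (en k (of_real R * \<i>))" .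
  have "norm (pco (Suc n) * (en k w - en (- k) w)) \<le> (c * \<bar>cf k\<bar>) * (2 * norm (en k (of_real R * \<i>)))"
   unfolding norm_mult by (intro mult_mono 1 pco_bd[of n, folded k_def]) (use sl in \<open>auto simp: c_def\<close>)
  thus "norm (pt n w) \<le> M n"
   unfolding M_def k_def norm_mult norm_of_real by (simp only: mult_ac)
 qed
 moreover have "(%w. \<Sum>n. pt n w) = Pc q"
  using Pc_series by (simp only: sums_iff)
 ultimately show ?thesis by simp
qed

lemma holomorphic_Pc: "Pc q holomorphic_on UNIV"
proof (rule holomorphic_uniform_sequence)
 show "(%w. \<Sum>n<N. pt n w) holomorphic_on UNIV" for N
  by (intro holomorphic_intros)
 show "\<exists>d>0. cball x d \<subseteq> UNIV \<and> uniform_limit (cball x d) (%N w. \<Sum>n<N. pt n w) (Pc q) sequentially" for x :: complex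
 proof (intro exI[of _ 1] conjI)
  have "cball x 1 \<subseteq> cball 0 (norm x + 1)"
  proof
   fix y assume "y \<in> cball x 1"
   thus "y \<in> cball 0 (norm x + 1)" using norm_triangle_ineq2[of y x] by (simp add: dist_norm norm_minus_commute)
  qed
  thus "uniform_limit (cball x 1) (%N w. \<Sum>n<N. pt n w) (Pc q) sequentially"
   by (rule uniform_limit_on_subset[OF Pc_uniform_limit])
 qed auto
qed simp

lemma en_int_L: "en n (of_int m * lc) = 1"
proof -
 have "en n (of_int m * lc) = exp (2 * of_real pi * \<i> * of_int (n * m))" by (simp add: en_def mult_ac)
 also have "\<dots> = 1" using exp_integer_2pi[OF Ints_of_int, of "n * m"]
  by (simp only: mult_ac of_real_mult of_real_of_int_eq of_real_numeral)
 finally show ?thesis .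
qed

lemma Pc_int_L: "Pc q (of_int m * lc) = 0"
 using Pc_series[of "of_int m * lc"] by (simp add: en_int_L sums_iff)

lemma Pc_deriv_int_L:
 "summable (limit_term q)"
 "deriv (Pc q) (of_int m * lc) = - of_real ((2 * pi / L)\<^sup>2 * (\<Sum>n. limit_term q (Suc n)))"
proof -
 define z where "z = complex_of_int m * lc"
 define f where "f = (%N w. \<Sum>n<N. pt n w)"
 have "(%N. deriv (f N) z) \<longlonglongrightarrow> deriv (Pc q) z"
 proof (rule deriv_complex_uniform_limit)
  show "uniform_limit (ball 0 (norm z + 1)) f (Pc q) sequentially"
   unfolding f_def by (rule uniform_limit_on_subset[OF Pc_uniform_limit[of "norm z + 1"]]) auto
  show "\<forall>\<^sub>F n in sequentially. f n holomorphic_on ball 0 (norm z + 1)"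
   unfolding f_def by (intro always_eventually allI holomorphic_intros)
 qed auto
 moreover have "deriv (f N) z = (\<Sum>n<N. of_real (- ((2 * pi / L)\<^sup>2 * limit_term q (Suc n))))" for N
 proof -
  have de: "(en k has_field_derivative 2 * of_real pi * \<i> * of_int k / lc) (at z)" for k
  proof -
   have "(en k has_field_derivative 2 * of_real pi * \<i> * of_int k / lc * en k z) (at z)"
    unfolding en_def[abs_def] by (auto intro!: derivative_eq_intros)
   thus ?thesis by (simp add: z_def en_int_L)
  qed
  have "(f N has_field_derivative (\<Sum>n<N. pco (Suc n) * (2 * of_real pi * \<i> * of_int (int (Suc n)) / lc - 2 * of_real pi * \<i> * of_int (- int (Suc n)) / lc))) (at z)"
   unfolding f_def by (intro DERIV_sum DERIV_cmult DERIV_diff de)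
  hence "deriv (f N) z = (\<Sum>n<N. pco (Suc n) * (2 * of_real pi * \<i> * of_int (int (Suc n)) / lc - 2 * of_real pi * \<i> * of_int (- int (Suc n)) / lc))"
   by (rule DERIV_imp_deriv)
  also have "\<dots> = (\<Sum>n<N. of_real (- ((2 * pi / L)\<^sup>2 * limit_term q (Suc n))))"
  proof (intro sum.cong refl)
   fix n
   define k where "k = Suc n"
   have cf: "cf (int k) = (- 1) ^ k * hq ^ k\<^sup>2" by (simp add: cf_def power2_eq_square flip: of_nat_mult)
   have "pco k * (2 * of_real pi * \<i> * of_int (int k) / lc - 2 * of_real pi * \<i> * of_int (- int k) / lc)
     = of_real (pi / L * cf (int k) / sinh (real k * ln hq) * (4 * pi * real k / L)) * (\<i> * \<i>)"
    unfolding pco_def by (simp add: field_simps)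
   also have "\<dots> = of_real (- ((2 * pi / L)\<^sup>2 * limit_term q k))"
    unfolding limit_term_def cf by (simp add: power2_eq_square field_simps)
   finally show "pco (Suc n) * (2 * of_real pi * \<i> * of_int (int (Suc n)) / lc - 2 * of_real pi * \<i> * of_int (- int (Suc n)) / lc)
     = of_real (- ((2 * pi / L)\<^sup>2 * limit_term q (Suc n)))" by (simp only: k_def)
  qed
  finally show ?thesis .
 qed
 ultimately have s: "(%n. complex_of_real (- ((2 * pi / L)\<^sup>2 * limit_term q (Suc n)))) sums deriv (Pc q) z"
  by (simp add: sums_def)
 define K where "K = - ((2 * pi / L)\<^sup>2)"
 have K: "K ~= 0" by (simp add: K_def)
 have s': "(%n. complex_of_real (K * limit_term q (Suc n))) sums deriv (Pc q) z"
  using s by (simp only: K_def mult_minus_left)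
 hence "summable (%n. complex_of_real (K * limit_term q (Suc n)))" by (rule sums_summable)
 hence "summable (%n. K * limit_term q (Suc n))" by (simp only: summable_complex_of_real)
 hence "summable (%n. limit_term q (Suc n))" using K by (simp add: summable_cmult_iff)
 note S = this
 thus "summable (limit_term q)" by (simp only: summable_Suc_iff)
 have "(%n. complex_of_real (K * limit_term q (Suc n))) sums of_real (K * (\<Sum>n. limit_term q (Suc n)))"
  by (intro sums_of_real sums_mult summable_sums S)
 from sums_unique2[OF s' this] show "deriv (Pc q) (of_int m * lc) = - of_real ((2 * pi / L)\<^sup>2 * (\<Sum>n. limit_term q (Suc n)))"
  by (simp add: z_def K_def)
qed

lemma theta_minus_exp_deriv:
 "((%u. \<theta> (- exp u)) has_field_derivative - (qpc qc ^ 3) * (-1) powi m / of_real (qb q m)) (at (of_int m * lc))"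
proof -
 define p where "p = complex_of_int m * lc"
 have 0: "((%u. \<theta> (exp (u - (p - ipi)))) has_field_derivative - (qpc qc ^ 3)) (at p)"
  using theta_exp_deriv_zero[of "p - ipi"] by simp
 have e: "exp (u - (p - ipi)) = - exp (u - p)" for u
  by (simp add: exp_diff exp_minus field_simps exp_add)
 have eq: "\<theta> (- exp u) = \<theta> (exp (u - (p - ipi))) / ((- exp (u - p)) powi m * of_real (qb q m))" for u
 proof -
  have "- exp u = qc powi m * (- exp (u - p))"
   unfolding exp_int_L[symmetric] p_def by (simp add: exp_diff)
  thus ?thesis using theta_powi[of "- exp (u - p)" m] by (simp add: e)
 qed
 have d: "((%u. (- exp (u - p)) powi m * of_real (qb q m)) field_differentiable at p)"
  by (intro holomorphic_on_imp_differentiable_at[of _ UNIV] holomorphic_intros) auto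
 then obtain D where D: "((%u. (- exp (u - p)) powi m * of_real (qb q m)) has_field_derivative D) (at p)"
  by (auto simp: field_differentiable_def)
 have nz: "(- exp (p - p)) powi m * of_real (qb q m) ~= 0" by simp
 have "\<theta> (exp (p - (p - ipi))) = 0" by simp
 from DERIV_divide[OF 0 D nz] this
 have "((%u. \<theta> (- exp u)) has_field_derivative - (qpc qc ^ 3) / ((- exp (p - p)) powi m * of_real (qb q m))) (at p)"
  unfolding eq[abs_def] by simp
 moreover have "- (qpc qc ^ 3) / ((- exp (p - p)) powi m * of_real (qb q m)) = - (qpc qc ^ 3) * (-1) powi m / of_real (qb q m)"
 proof -
  have "((-1) :: complex) powi m * (-1) powi m = 1" by (simp add: power_int_mult_distrib[symmetric])
  hence "1 / ((-1) :: complex) powi m = (-1) powi m" by (simp add: divide_eq_eq)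
  thus ?thesis by (simp add: divide_inverse mult_ac)
 qed
 ultimately show ?thesis by (simp add: p_def)
qed

lemma limit_at_qpower:
 assumes f: "(f has_field_derivative D) (at (of_int m * lc))" "f (of_int m * lc) = 0"
 shows "((%z. f (Ln z) / \<theta> (- z)) \<longlongrightarrow> - D * ((-1) powi m * of_real (qb q m)) / qpc qc ^ 3) (at (qc powi m))"
proof -
 define p where "p = complex_of_int m * lc"
 have ep: "exp p = qc powi m" unfolding p_def by (rule exp_int_L)
 have qpos: "qc powi m = of_real (q powi m)" "q powi m > 0" using q_pos by (auto simp: of_real_power_int)
 have ln: "Ln (qc powi m) = p"
  unfolding ep[symmetric] p_def using Ln_exp[of "of_int m * lc"] pi_gt_zero by simp
 have nzT: "- (qpc qc ^ 3) * (-1) powi m / of_real (qb q m) ~= 0" by simp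
 have 1: "((%u. (u - p) / \<theta> (- exp u)) \<longlongrightarrow> 1 / (- (qpc qc ^ 3) * (-1) powi m / of_real (qb q m))) (at p)"
 proof (rule tendsto_simple_zero)
  show "((%u. \<theta> (- exp u)) has_field_derivative - (qpc qc ^ 3) * (-1) powi m / of_real (qb q m)) (at p)"
   unfolding p_def by (rule theta_minus_exp_deriv)
  show "\<theta> (- exp p) = 0" unfolding ep theta_eq_0_iff by (auto simp: qpowers_def)
 qed (rule nzT)
 have 2: "((%u. f u / (u - p)) \<longlongrightarrow> D) (at p)"
  using f by (simp add: has_field_derivative_iff p_def)
 have "((%u. f u / (u - p) * ((u - p) / \<theta> (- exp u))) \<longlongrightarrow> D * (1 / (- (qpc qc ^ 3) * (-1) powi m / of_real (qb q m)))) (at p)"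
  by (rule tendsto_mult[OF 2 1])
 also have "D * (1 / (- (qpc qc ^ 3) * (-1) powi m / of_real (qb q m))) = - D * ((-1) powi m * of_real (qb q m)) / qpc qc ^ 3"
 proof -
  have s: "((-1) :: complex) powi m * (-1) powi m = 1" by (simp add: power_int_mult_distrib[symmetric])
  hence "1 / ((-1) :: complex) powi m = (-1) powi m" by (simp add: divide_eq_eq)
  thus ?thesis by (simp add: divide_inverse mult_ac)
 qed
 finally have 3: "((%u. f u / (u - p) * ((u - p) / \<theta> (- exp u))) \<longlongrightarrow> - D * ((-1) powi m * of_real (qb q m)) / qpc qc ^ 3) (at p)" .
 have 4: "((%u. f u / \<theta> (- exp u)) \<longlongrightarrow> - D * ((-1) powi m * of_real (qb q m)) / qpc qc ^ 3) (at p)"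
  by (rule Lim_transform_eventually[OF 3]) (auto simp: eventually_at_filter intro!: always_eventually)
 have nr: "qc powi m \<notin> \<real>\<^sub>\<le>\<^sub>0"
  using qpos(2) unfolding qpos(1) nonpos_Reals_of_real_iff by simp
 have "filterlim Ln (at p) (at (qc powi m))"
 proof (rule filterlim_atI)
  have "isCont Ln (qc powi m)" using nr by (rule continuous_at_Ln)
  thus "(Ln \<longlongrightarrow> p) (at (qc powi m))" by (simp add: isCont_def ln)
  have "eventually (%z. z \<in> - {0::complex}) (at (qc powi m))"
   by (rule eventually_at_in_open') auto
  moreover have "eventually (%z. z ~= qc powi m) (at (qc powi m))" by (simp add: eventually_at_filter)
  ultimately show "eventually (%z. Ln z ~= p) (at (qc powi m))"
  proof eventually_elim
   case (elim z)
   thus ?case using exp_Ln[of z] ep by auto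
  qed
 qed
 from filterlim_compose[OF 4 this]
 have 5: "((%z. f (Ln z) / \<theta> (- exp (Ln z))) \<longlongrightarrow> - D * ((-1) powi m * of_real (qb q m)) / qpc qc ^ 3) (at (qc powi m))" .
 have "eventually (%z. z \<in> - {0::complex}) (at (qc powi m))"
  by (rule eventually_at_in_open') auto
 hence "eventually (%z. f (Ln z) / \<theta> (- exp (Ln z)) = f (Ln z) / \<theta> (- z)) (at (qc powi m))"
  by eventually_elim simp
 from Lim_transform_eventually[OF 5 this] show ?thesis .
qed

lemma isolated_qpower: "eventually (%z. z \<notin> qpowers q \<and> z ~= 0) (at (qc powi m))"
proof -
 have "(%z. \<theta> (- z)) holomorphic_on -{0}" by (intro holomorphic_intros) auto
 moreover have "connected (- {0::complex})" by (rule connected_punctured_universe) simp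
 moreover have "\<theta> (- (-1)) ~= 0" using theta_nz_pos[of 1] by simp
 ultimately have "eventually (%z. \<theta> (- z) ~= 0 \<and> z \<in> -{0}) (at (qc powi m))"
  using non_zero_neighbour_alt[of "%z. \<theta> (- z)" "-{0}" "qc powi m" "-1"] q_pos by (auto simp: open_Compl)
 thus ?thesis by eventually_elim (auto simp: theta_eq_0_iff)
qed

lemma removable_at_qpower:
 assumes f: "f holomorphic_on A" "open A" "of_int m * lc \<in> A" "f (of_int m * lc) = 0"
  and S: "S holomorphic_on UNIV"
 shows "removable_singularity_at (%z. S z / \<theta> (- z) * f (Ln z)) (qc powi m)"
proof -
 define p where "p = complex_of_int m * lc"
 define z0 where "z0 = qc powi m"
 define \<Phi> where "\<Phi> = (%z. S z / \<theta> (- z) * f (Ln z))"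
 have ep: "exp p = z0" unfolding p_def z0_def by (rule exp_int_L)
 have z0pos: "z0 = of_real (q powi m)" "q powi m > 0" using q_pos by (auto simp: of_real_power_int z0_def)
 have ln: "Ln z0 = p"
  unfolding ep[symmetric] p_def using Ln_exp[of "of_int m * lc"] pi_gt_zero by simp
 have nr: "z0 \<notin> \<real>\<^sub>\<le>\<^sub>0"
  using z0pos(2) unfolding z0pos(1) nonpos_Reals_of_real_iff by simp
 define U where "U = (- \<real>\<^sub>\<le>\<^sub>0) \<inter> Ln -` A"
 have U: "open U"
  unfolding U_def by (rule continuous_open_preimage) (auto intro!: continuous_on_Ln simp: f open_Compl)
 have "z0 \<in> U" using nr ln f(3) by (simp add: U_def p_def)
 then obtain r1 where r1: "r1 > 0" "ball z0 r1 \<subseteq> U" using U open_contains_ball by blast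
 from isolated_qpower[of m] obtain r2 where r2: "r2 > 0" "\<And>z. z ~= z0 ==> dist z z0 < r2 ==> z \<notin> qpowers q"
  unfolding eventually_at z0_def[symmetric] by blast
 define r where "r = min r1 r2"
 have r: "r > 0" using r1 r2 by (simp add: r_def)
 have sub: "ball z0 r - {z0} \<subseteq> U" using r1 by (auto simp: r_def)
 have nq: "\<theta> (- z) ~= 0" "z ~= 0" if "z \<in> ball z0 r - {z0}" for z
 proof -
  have "z \<in> U" using that sub by blast
  thus "z ~= 0" by (auto simp: U_def)
  show "\<theta> (- z) ~= 0" using that r2(2)[of z] \<open>z ~= 0\<close> by (auto simp: r_def theta_eq_0_iff dist_commute)
 qed
 have hol: "\<Phi> holomorphic_on ball z0 r - {z0}"
  unfolding \<Phi>_def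
 proof (intro holomorphic_on_mult holomorphic_on_divide)
  show "S holomorphic_on ball z0 r - {z0}" using S holomorphic_on_subset by blast
  show "(%z. \<theta> (- z)) holomorphic_on ball z0 r - {z0}"
   by (intro holomorphic_intros) (use nq in auto)
  have "Ln holomorphic_on ball z0 r - {z0}"
   by (rule holomorphic_on_Ln[THEN holomorphic_on_subset, of "- \<real>\<^sub>\<le>\<^sub>0"]) (use sub in \<open>auto simp: U_def\<close>)
  from holomorphic_on_compose_gen[OF this f(1)] sub
  show "(%z. f (Ln z)) holomorphic_on ball z0 r - {z0}" by (auto simp: o_def U_def)
 qed (use nq in auto)
 have fd: "(f has_field_derivative deriv f p) (at p)"
  by (rule holomorphic_derivI[OF f(1,2)]) (use f(3) in \<open>simp add: p_def\<close>)
 have "((%z. f (Ln z) / \<theta> (- z)) \<longlongrightarrow> - deriv f p * ((-1) powi m * of_real (qb q m)) / qpc qc ^ 3) (at z0)"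
  using limit_at_qpower[of f "deriv f p" m] fd f(4) by (simp add: p_def z0_def)
 moreover have "isCont S z0"
  using holomorphic_on_imp_continuous_on[OF S] continuous_on_eq_continuous_at[OF open_UNIV] by blast
 ultimately have "((%z. (z - z0) * (S z * (f (Ln z) / \<theta> (- z)))) \<longlongrightarrow>
   (z0 - z0) * (S z0 * (- deriv f p * ((-1) powi m * of_real (qb q m)) / qpc qc ^ 3))) (at z0)"
  by (intro tendsto_mult tendsto_diff tendsto_ident_at tendsto_const) (simp_all add: isCont_def)
 hence "((%z. (z - z0) * \<Phi> z) \<longlongrightarrow> 0) (at z0)" by (simp add: \<Phi>_def)
 then obtain k where k: "k holomorphic_on ball z0 r" "\<And>z. z \<in> ball z0 r - {z0} ==> k z = \<Phi> z"
  using holomorphic_on_extend_lim[OF hol] r by (auto simp: interior_open)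
 show ?thesis
  unfolding removable_singularity_at_def z0_def[symmetric]
 proof (intro exI[of _ k] conjI)
  show "k analytic_on {z0}" using k(1) r by (auto simp: analytic_at intro!: exI[of _ "ball z0 r"])
  have "eventually (%z. z \<in> ball z0 r - {z0}) (at z0)" by (rule eventually_at_in_open) (use r in auto)
  thus "\<forall>\<^sub>F x in at z0. k x = S x / \<theta> (- x) * f (Ln x)"
   by eventually_elim (use k(2) in \<open>simp add: \<Phi>_def\<close>)
 qed
qed

lemma lower_bound_1_plus_all:
 assumes K: "compact K" "0 \<notin> K" "\<And>y. y \<in> K ==> \<theta> y ~= 0"
 shows "\<exists>\<delta>>0. \<forall>y\<in>K. \<forall>k::int. \<delta> \<le> norm (1 + y * qc powi k)"
proof (cases "K = {}")
 case False
 have t1: "\<theta>1 y ~= 0" "1 + y ~= 0" if "y \<in> K" for y using K(3)[OF that] by (auto simp: theta_theta1)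
 obtain \<delta> :: real where d: "\<delta> > 0" "\<forall>y\<in>K. \<forall>k::int. k ~= 0 \<longrightarrow> \<delta> \<le> norm (1 + y * qc powi k)"
 proof -
  have "\<exists>\<delta>>0. \<forall>y\<in>K. \<forall>k::int. k ~= 0 \<longrightarrow> \<delta> \<le> norm (1 + y * qc powi k)"
   by (rule lower_bound_1_plus[OF K(1,2) t1(1)])
  thus thesis by (elim exE conjE) (rule that)
 qed
 obtain y0 where y0: "y0 \<in> K" "\<And>y. y \<in> K ==> norm (1 + y0) \<le> norm (1 + y)"
 proof -
  have "continuous_on K (%y. norm (1 + y))" by (intro continuous_intros)
  from continuous_attains_inf[OF K(1) False this] that show thesis by blast
 qed
 have "min \<delta> (norm (1 + y0)) > 0" using d(1) t1(2)[OF y0(1)] by simp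
 moreover have "min \<delta> (norm (1 + y0)) \<le> norm (1 + y * qc powi k)" if "y \<in> K" for y k
  using d(2) y0(2)[OF that] that by (cases "k = 0") (auto simp: min_le_iff_disj)
 ultimately show ?thesis by blast
qed (auto intro: exI[of _ 1])

lemma g_deriv_has_sum:
 assumes l: "lam ~= 0" "\<theta> lam ~= 0"
 shows "((%n::int. lam * qc powi n / (1 + lam * qc powi n)\<^sup>2) has_sum (lam * deriv g lam)) UNIV"
proof -
 define A where "A = {\<tau>. \<tau> ~= 0 \<and> \<theta> \<tau> ~= 0}"
 have A: "open A"
 proof -
  have "open ((-{0}) \<inter> \<theta> -` (-{0}))"
   by (rule continuous_open_preimage[OF holomorphic_on_imp_continuous_on[OF holomorphic_theta]]) (auto simp: open_Compl)
  moreover have "(-{0}) \<inter> \<theta> -` (-{0}) = A" by (auto simp: A_def)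
  ultimately show ?thesis by simp
 qed
 have "lam \<in> A" using l by (simp add: A_def)
 then obtain r where r: "r > 0" "cball lam r \<subseteq> A" using A open_contains_cball by blast
 define K where "K = cball lam r"
 have KA: "K \<subseteq> A" using r by (simp add: K_def)
 have K: "compact K" "0 \<notin> K" "\<And>y. y \<in> K ==> \<theta> y ~= 0" using KA unfolding A_def by (simp add: K_def, blast, blast)
 obtain \<delta> :: real where d: "\<delta> > 0" "\<And>y k. y \<in> K ==> \<delta> \<le> norm (1 + y * qc powi k)"
  using lower_bound_1_plus_all[OF K] by metis
 have K': "compact (inverse ` K)" "0 \<notin> inverse ` K"
  using K(1,2) by (auto intro!: compact_continuous_image continuous_intros)
 have "\<theta> y ~= 0" if "y \<in> inverse ` K" for y
 proof -
  from that obtain x where x: "x \<in> K" "y = 1 / x" by (auto simp: inverse_eq_divide)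
  hence "x ~= 0" using K(2) by auto
  thus ?thesis using theta_inverse[of x] K(3)[OF x(1)] x(2) by simp
 qed
 then obtain \<epsilon> :: real where e': "\<epsilon> > 0" "\<And>y k. y \<in> inverse ` K ==> \<epsilon> \<le> norm (1 + y * qc powi k)"
  using lower_bound_1_plus_all[OF K'] by metis
 have e: "\<epsilon> \<le> norm (1 + qc / y * qc ^ k)" if "y \<in> K" for y and k :: nat
 proof -
  have "1 + inverse y * qc powi (1 + int k) = 1 + qc / y * qc ^ k"
   by (simp add: power_int_add divide_inverse mult_ac)
  thus ?thesis using e'(2)[of "inverse y" "1 + int k"] that by simp
 qed
 have d': "\<delta> \<le> norm (1 + y * qc ^ k)" if "y \<in> K" for y and k :: nat
  using d(2)[OF that, of "int k"] by simp
 obtain R where R: "\<And>y. y \<in> K ==> norm y \<le> R" using compact_imp_bounded[OF K(1)] unfolding bounded_iff by blast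
 obtain R' where R': "\<And>y. y \<in> inverse ` K ==> norm y \<le> R'" using compact_imp_bounded[OF K'(1)] unfolding bounded_iff by blast
 define t where "t = (%k \<tau>. \<tau> * qc ^ k / (1 + \<tau> * qc ^ k) - (qc / \<tau>) * qc ^ k / (1 + qc / \<tau> * qc ^ k))"
 have nz: "1 + y * qc ^ k ~= 0" "1 + qc / y * qc ^ k ~= 0" "y ~= 0" if "y \<in> K" for y and k :: nat
  using d'[OF that, of k] e[OF that, of k] d(1) e'(1) K(2) that by auto
 have ul: "uniform_limit K (%N \<tau>. \<Sum>k<N. t k \<tau>) g sequentially"
 proof -
  have "uniform_limit K (%N \<tau>. \<Sum>k<N. t k \<tau>) (%\<tau>. \<Sum>k. t k \<tau>) sequentially"
  proof (rule Weierstrass_m_test)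
   show "summable (%k. R * q ^ k / \<delta> + q * R' * q ^ k / \<epsilon>)"
    using q_pos q_less_1 by (intro summable_add summable_divide summable_mult summable_geometric) auto
   fix k y assume y: "y \<in> K"
   have "norm (y * qc ^ k / (1 + y * qc ^ k)) \<le> R * q ^ k / \<delta>"
    unfolding norm_divide using R[OF y] d'[OF y, of k] d(1) q_pos
     order_trans[OF norm_ge_zero R[OF y]]
    by (intro frac_le) (auto simp: norm_mult norm_power intro!: mult_right_mono)
   moreover have "norm (qc / y * qc ^ k / (1 + qc / y * qc ^ k)) \<le> q * R' * q ^ k / \<epsilon>"
   proof -
    have "norm (inverse y) \<le> R'" using R'[of "inverse y"] y by simp
    hence "q * norm (inverse y) * q ^ k \<le> q * R' * q ^ k" using q_pos by simp
    moreover have "norm (qc / y * qc ^ k) = q * norm (inverse y) * q ^ k"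
     using q_pos by (simp add: norm_mult norm_divide norm_power norm_inverse divide_inverse)
    ultimately show ?thesis unfolding norm_divide[of "qc / y * qc ^ k"] using e[OF y, of k] e'(1)
      order_trans[OF norm_ge_zero \<open>norm (inverse y) \<le> R'\<close>] q_pos
     by (intro frac_le) auto
   qed
   ultimately show "norm (t k y) \<le> R * q ^ k / \<delta> + q * R' * q ^ k / \<epsilon>"
    unfolding t_def using norm_triangle_ineq4 order_trans add_mono by meson
  qed
  also have "?this \<longleftrightarrow> uniform_limit K (%N \<tau>. \<Sum>k<N. t k \<tau>) g sequentially"
  proof (intro uniform_limit_cong' refl)
   fix y assume y: "y \<in> K"
   show "(\<Sum>k. t k y) = g y" using g_sums[OF nz(3)[OF y] K(3)[OF y]] by (simp add: t_def sums_iff)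
  qed
  finally show ?thesis .
 qed
 have dt: "(t k has_field_derivative (qc ^ k / (1 + y * qc ^ k)\<^sup>2 + (qc / y * qc ^ k / (1 + qc / y * qc ^ k)\<^sup>2) / y)) (at y)" if "y \<in> K" for k y
 proof -
  define a where "a = qc ^ k"
  define b where "b = qc * qc ^ k"
  have n: "1 + y * a ~= 0" "1 + b / y ~= 0" "y ~= 0" using nz(1)[OF that, of k] nz(2)[OF that, of k] nz(3)[OF that] by (auto simp: a_def b_def)
  have n2: "y + b ~= 0" using n by (simp add: field_simps)
  have "((%\<tau>. \<tau> * a / (1 + \<tau> * a)) has_field_derivative a / (1 + y * a)\<^sup>2) (at y)"
   using n by (auto intro!: derivative_eq_intros simp: power2_eq_square field_simps)
  moreover have "((%\<tau>. b / (\<tau> + b)) has_field_derivative - (b / (y + b)\<^sup>2)) (at y)"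
   using n2 by (auto intro!: derivative_eq_intros simp: power2_eq_square)
  ultimately have "((%\<tau>. \<tau> * a / (1 + \<tau> * a) - b / (\<tau> + b)) has_field_derivative a / (1 + y * a)\<^sup>2 - - (b / (y + b)\<^sup>2)) (at y)"
   by (rule DERIV_diff)
  moreover have "b / (y + b)\<^sup>2 = (b / y / (1 + b / y)\<^sup>2) / y"
  proof -
   have "1 + b / y = (y + b) / y" using n by (simp add: field_simps)
   thus ?thesis using n n2 by (simp add: power2_eq_square)
  qed
  ultimately have D: "((%\<tau>. \<tau> * a / (1 + \<tau> * a) - b / (\<tau> + b)) has_field_derivative a / (1 + y * a)\<^sup>2 + (b / y / (1 + b / y)\<^sup>2) / y) (at y)"
   by simp
  have "((t k) has_field_derivative a / (1 + y * a)\<^sup>2 + (b / y / (1 + b / y)\<^sup>2) / y) (at y)"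
  proof (rule has_field_derivative_transform_within_open[OF D, of "- {0, - b}"])
   fix x assume "x \<in> - {0, - b}"
   hence "x ~= 0" "x + b ~= 0" by (auto simp: add_eq_0_iff2)
   hence "b / (x + b) = b / x / (1 + b / x)" by (simp add: field_simps)
   thus "x * a / (1 + x * a) - b / (x + b) = t k x" by (simp add: t_def a_def b_def)
  qed (use n n2 in \<open>auto simp: add_eq_0_iff2 open_Compl\<close>)
  thus ?thesis by (simp add: a_def b_def)
 qed
 have lK: "lam \<in> K" using r by (simp add: K_def)
 define f where "f = (%n::int. lam * qc powi n / (1 + lam * qc powi n)\<^sup>2)"
 have fpos: "f (int k) = lam * (qc ^ k / (1 + lam * qc ^ k)\<^sup>2)" for k by (simp add: f_def)
 have fneg: "f (- int k - 1) = qc / lam * qc ^ k / (1 + qc / lam * qc ^ k)\<^sup>2" for k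
 proof -
  define b where "b = qc / lam * qc ^ k"
  have b: "b ~= 0" using l by (simp add: b_def)
  have "lam * qc powi (- int k - 1) = 1 / b"
   using l by (simp add: b_def power_int_diff power_int_minus field_simps)
  hence "f (- int k - 1) = 1 / b / (1 + 1 / b)\<^sup>2" by (simp add: f_def)
  also have "1 + 1 / b = (1 + b) / b" using b by (simp add: field_simps)
  also have "1 / b / ((1 + b) / b)\<^sup>2 = b / (1 + b)\<^sup>2" using b by (simp add: power2_eq_square)
  finally show ?thesis by (simp add: b_def)
 qed
 have "(%N. deriv (%\<tau>. \<Sum>k<N. t k \<tau>) lam) \<longlonglongrightarrow> deriv g lam"
 proof (rule deriv_complex_uniform_limit)
  show "uniform_limit (ball lam r) (%N \<tau>. \<Sum>k<N. t k \<tau>) g sequentially"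
   by (rule uniform_limit_on_subset[OF ul]) (auto simp: K_def)
  show "\<forall>\<^sub>F n in sequentially. (%\<tau>. \<Sum>k<n. t k \<tau>) holomorphic_on ball lam r"
  proof (intro always_eventually allI holomorphic_on_sum)
   fix i show "t i holomorphic_on ball lam r"
    unfolding holomorphic_on_open[OF open_ball] using dt by (force simp: K_def)
  qed
 qed (use r in auto)
 moreover have "deriv (%\<tau>. \<Sum>k<N. t k \<tau>) lam
   = (\<Sum>k<N. qc ^ k / (1 + lam * qc ^ k)\<^sup>2 + (qc / lam * qc ^ k / (1 + qc / lam * qc ^ k)\<^sup>2) / lam)" for N
  by (intro DERIV_imp_deriv DERIV_sum dt lK)
 ultimately have "(%k. qc ^ k / (1 + lam * qc ^ k)\<^sup>2 + (qc / lam * qc ^ k / (1 + qc / lam * qc ^ k)\<^sup>2) / lam) sums deriv g lam"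
  by (simp add: sums_def)
 hence "(%k. lam * (qc ^ k / (1 + lam * qc ^ k)\<^sup>2 + (qc / lam * qc ^ k / (1 + qc / lam * qc ^ k)\<^sup>2) / lam)) sums (lam * deriv g lam)"
  by (rule sums_mult)
 moreover have "lam * (qc ^ k / (1 + lam * qc ^ k)\<^sup>2 + (qc / lam * qc ^ k / (1 + qc / lam * qc ^ k)\<^sup>2) / lam) = f (int k) + f (- int k - 1)" for k
  unfolding fpos fneg distrib_left using l by simp
 ultimately have S: "(%k. f (int k) + f (- int k - 1)) sums (lam * deriv g lam)" by simp
 have s1: "summable (%k. norm (f (int k)))"
 proof (rule summable_comparison_test')
  show "summable (%k. norm lam * q ^ k / \<delta>\<^sup>2)" using q_pos q_less_1 by (intro summable_divide summable_mult summable_geometric) auto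
  fix k :: nat
  have "norm (f (int k)) = norm lam * q ^ k / (norm (1 + lam * qc ^ k))\<^sup>2"
   using q_pos by (simp add: fpos norm_mult norm_divide norm_power)
  also have "\<dots> \<le> norm lam * q ^ k / \<delta>\<^sup>2"
   using d'[OF lK, of k] d(1) q_pos by (intro frac_le power_mono) auto
  finally show "norm (norm (f (int k))) \<le> norm lam * q ^ k / \<delta>\<^sup>2" by simp
 qed
 have s2: "summable (%k. norm (f (- int k - 1)))"
 proof (rule summable_comparison_test')
  show "summable (%k. q / norm lam * q ^ k / \<epsilon>\<^sup>2)" using q_pos q_less_1 by (intro summable_divide summable_mult summable_geometric) auto
  fix k :: nat
  have "norm (f (- int k - 1)) = q / norm lam * q ^ k / (norm (1 + qc / lam * qc ^ k))\<^sup>2"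
   using q_pos unfolding fneg by (simp only: norm_mult norm_divide norm_power norm_qc)
  also have "\<dots> \<le> q / norm lam * q ^ k / \<epsilon>\<^sup>2"
   using e[OF lK, of k] e'(1) q_pos by (intro frac_le power_mono) auto
  finally show "norm (norm (f (- int k - 1))) \<le> q / norm lam * q ^ k / \<epsilon>\<^sup>2" by simp
 qed
 have "lam * deriv g lam = (\<Sum>k. f (int k)) + (\<Sum>k. f (- int k - 1))"
  using sums_unique2[OF S sums_add[OF summable_sums[OF summable_norm_cancel[OF s1]] summable_sums[OF summable_norm_cancel[OF s2]]]] .
 with has_sum_int_halves[OF s1 s2] show ?thesis by (simp add: f_def)
qed

lemma g_has_derivative:
 assumes "\<theta> \<tau> ~= 0" "\<tau> ~= 0"
 shows "(g has_field_derivative deriv g \<tau>) (at \<tau>)"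
proof -
 define A where "A = (-{0}) \<inter> \<theta> -` (-{0})"
 have A: "open A"
  unfolding A_def by (rule continuous_open_preimage[OF holomorphic_on_imp_continuous_on[OF holomorphic_theta]]) (auto simp: open_Compl)
 have dh: "deriv \<theta> holomorphic_on A"
  by (rule holomorphic_on_subset[OF holomorphic_deriv[OF holomorphic_theta]]) (auto simp: A_def open_Compl)
 have th: "\<theta> holomorphic_on A" by (rule holomorphic_on_subset[OF holomorphic_theta]) (auto simp: A_def)
 have "g holomorphic_on A"
  unfolding g_def[abs_def] by (intro holomorphic_intros dh holomorphic_on_divide th) (auto simp: A_def)
 from holomorphic_derivI[OF this A] assms show ?thesis by (auto simp: A_def)
qed

lemma Pd_at_int_L:
 assumes l: "lam ~= 0" "\<theta> lam ~= 0"
 obtains A where "Pd q lam holomorphic_on A" "open A" "of_int m * lc \<in> A" "Pd q lam (of_int m * lc) = 0"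
  "(Pd q lam has_field_derivative (lam * deriv g lam + 1 / lc)) (at (of_int m * lc))"
proof -
 define l0 where "l0 = Ln lam"
 have el: "exp l0 = lam" using l by (simp add: l0_def)
 define A where "A = {w. \<theta> (exp (l0 - w)) ~= 0}"
 define p where "p = complex_of_int m * lc"
 have Pd: "Pd q lam w = Q l0 - Q (l0 - w)" for w using Pd_eq[of l0 w] by (simp add: el)
 have oA: "open A" unfolding A_def
  by (rule open_Collect_neq) (auto intro!: holomorphic_on_imp_continuous_on holomorphic_intros)
 have qm: "Q (l0 - p) = Q l0" "\<theta> (exp (l0 - p)) ~= 0"
 proof -
  have "P l0 ~= 0" using l el by (simp add: P_eq_0_iff)
  hence "Q (l0 + of_int (- m) * lc) = Q l0" "P (l0 + of_int (- m) * lc) ~= 0"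
   by (simp_all only: Q_int_L P_int_L not_False_eq_True)
  thus "Q (l0 - p) = Q l0" "\<theta> (exp (l0 - p)) ~= 0" by (simp_all add: p_def P_eq_0_iff)
 qed
 have hol: "Pd q lam holomorphic_on A"
  unfolding Pd[abs_def] by (intro holomorphic_intros) (auto simp: A_def)
 have der: "(Pd q lam has_field_derivative (lam * deriv g lam + 1 / lc)) (at p)"
 proof -
  have Qd: "(Q has_field_derivative deriv Q l0) (at l0)"
  proof -
   have "open {u. P u ~= 0}" by (rule open_Collect_neq) (auto intro!: holomorphic_on_imp_continuous_on holomorphic_intros)
   from holomorphic_derivI[OF holomorphic_Q this] show ?thesis using l el by (simp add: P_eq_0_iff)
  qed
  have "((%u. g (exp u)) has_field_derivative deriv g (exp l0) * exp l0) (at l0)"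
   by (rule DERIV_chain2[OF g_has_derivative DERIV_exp]) (use l el in auto)
  hence "((%u. u / lc - 1 / 2 + g (exp u)) has_field_derivative 1 / lc + deriv g (exp l0) * exp l0) (at l0)"
   by (auto intro!: derivative_eq_intros)
  hence "(Q has_field_derivative 1 / lc + lam * deriv g lam) (at l0)"
   unfolding Q_def[abs_def] by (simp add: el mult.commute)
  moreover have "((%u. Q (u - p)) has_field_derivative deriv Q l0) (at l0)"
  proof -
   have "open {u. P u ~= 0}" by (rule open_Collect_neq) (auto intro!: holomorphic_on_imp_continuous_on holomorphic_intros)
   hence "eventually (%u. u \<in> {u. P u ~= 0}) (nhds l0)"
    by (rule eventually_nhds_in_open) (use l el in \<open>simp add: P_eq_0_iff\<close>)
   hence "eventually (%u. Q u = Q (u - p)) (nhds l0)"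
   proof eventually_elim
    case (elim u)
    hence "Q (u + of_int (- m) * lc) = Q u" by (intro Q_int_L) simp
    thus ?case by (simp add: p_def)
   qed
   from DERIV_cong_ev[OF refl this refl] Qd show ?thesis by blast
  qed
  ultimately have "(Q has_field_derivative 1 / lc + lam * deriv g lam) (at (l0 - p))"
   using DERIV_shift[of Q "deriv Q l0" l0 "- p"] DERIV_imp_deriv[of Q "1 / lc + lam * deriv g lam" l0] by simp
  hence "((%w. Q (l0 - w)) has_field_derivative (1 / lc + lam * deriv g lam) * (-1)) (at p)"
   by (intro DERIV_chain2[where f = Q and g = "%w. l0 - w"]) (auto intro!: derivative_eq_intros)
  from DERIV_diff[OF DERIV_const[of "Q l0"] this] show ?thesis
   unfolding Pd[abs_def] by (simp add: add.commute)
 qed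
 show ?thesis
  by (rule that[of A]) (use hol oA der qm Pd in \<open>auto simp: p_def A_def\<close>)
qed

end

context qbase
begin

section \<open>Gaussian and theta kernels\<close>

definition Er :: "real \<Rightarrow> real" where "Er s = exp ((s - L / 2)\<^sup>2 / (2 * L))"

lemma E_of_real: "E (of_real s) = of_real (Er s)"
 by (simp add: exp_real_E Er_def)

lemma Er_pos: "Er s > 0" by (simp add: Er_def)

lemma Er_L: "Er (s + L) = Er s * exp s"
proof -
 have "complex_of_real (Er (s + L)) = of_real (Er s * exp s)"
  unfolding E_of_real[symmetric] of_real_mult of_real_add E_L exp_of_real ..
 thus ?thesis by (simp only: of_real_eq_iff)
qed

lemma cont_Er: "continuous_on A Er"
 unfolding Er_def[abs_def] by (intro continuous_intros) (use L_neg in auto)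

lemma integrable_Er: "integrable lborel Er"
proof -
 have "integrable lborel (%s. complex_of_real (Er s))" using integral_E(1) by (simp add: E_of_real)
 from integrable_Re[OF this] show ?thesis by simp
qed

lemma integral_Er: "(\<integral>s. Er s \<partial>lborel) = 1 / Cq q"
proof -
 have "complex_of_real (\<integral>s. Er s \<partial>lborel) = of_real (1 / Cq q)"
  using integral_E(2) by (simp only: E_of_real integral_complex_of_real)
 thus ?thesis by (simp only: of_real_eq_iff)
qed

lemma integrable_shift_real: "integrable lborel f ==> integrable lborel (%s. f (s + x :: real))"
 for f :: "real \<Rightarrow> 'a::{banach, second_countable_topology}"
 using lborel_integrable_real_affine[of f 1 x] by (simp add: add.commute)

lemma integral_shift_real: "(\<integral>s. f (s + x :: real) \<partial>lborel) = (\<integral>s. f s \<partial>lborel)"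
 for f :: "real \<Rightarrow> 'a::{banach, second_countable_topology}"
 using lborel_integral_real_affine[of 1 f x] by (simp add: add.commute)

lemma norm_E: "norm (E (of_real s - w)) = exp ((Im w)\<^sup>2 / (- 2 * L)) * Er (s - Re w)"
proof -
 have "Re ((of_real s - w - lc / 2)\<^sup>2 / (2 * lc)) = (Im w)\<^sup>2 / (- 2 * L) + (s - Re w - L / 2)\<^sup>2 / (2 * L)"
 proof -
  have "2 * lc = of_real (2 * L)" by simp
  hence "Re ((of_real s - w - lc / 2)\<^sup>2 / (2 * lc)) = Re ((of_real s - w - lc / 2)\<^sup>2) / (2 * L)"
   by (simp only: Re_divide_of_real)
  also have "Re ((of_real s - w - lc / 2)\<^sup>2) = (s - Re w - L / 2)\<^sup>2 - (Im w)\<^sup>2"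
   by (simp add: power2_eq_square)
  finally show ?thesis using L_neg by (simp add: field_simps)
 qed
 thus ?thesis unfolding E_eq norm_exp_eq_Re Er_def by (simp only: exp_add)
qed

text \<open>This reduces the domination of Gaussian transforms, locally in the parameter, to integrability for
single real values of it.\<close>

lemma Er_dominated:
 assumes "\<bar>x - x0\<bar> \<le> 1"
 shows "Er (s - x) \<le> exp (- 1 / (2 * L)) * (Er (s - x0 - 1) + Er (s - x0 + 1))"
proof -
 define a where "a = - 1 / (2 * L)"
 have a: "a > 0" using L_neg by (simp add: a_def divide_neg_neg)
 define y where "y = s - x0 - L / 2"
 define d where "d = x - x0"
 have d: "\<bar>d\<bar> \<le> 1" using assms by (simp add: d_def)
 have Er: "Er t = exp (- a * (t - L / 2)\<^sup>2)" for t by (simp add: Er_def a_def)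
 have "y * d \<le> \<bar>y\<bar> * \<bar>d\<bar>" by (metis abs_ge_self abs_mult)
 also have "\<dots> \<le> \<bar>y\<bar> * 1" using d by (intro mult_left_mono) auto
 finally have "y * d \<le> \<bar>y\<bar>" by simp
 moreover have "- (y - d)\<^sup>2 = - y\<^sup>2 + 2 * (y * d) - d\<^sup>2" by (simp add: power2_eq_square algebra_simps)
 moreover have "1 - (\<bar>y\<bar> - 1)\<^sup>2 = - y\<^sup>2 + 2 * \<bar>y\<bar>" by (simp add: power2_eq_square algebra_simps)
 ultimately have "- (y - d)\<^sup>2 \<le> 1 - (\<bar>y\<bar> - 1)\<^sup>2" using zero_le_power2[of d] by linarith
 from mult_left_mono[OF this, of a] a have "- a * (y - d)\<^sup>2 \<le> a + - a * (\<bar>y\<bar> - 1)\<^sup>2"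
  by (simp add: algebra_simps)
 hence "exp (- a * (y - d)\<^sup>2) \<le> exp a * exp (- a * (\<bar>y\<bar> - 1)\<^sup>2)" by (simp flip: exp_add)
 also have "exp (- a * (\<bar>y\<bar> - 1)\<^sup>2) \<le> exp (- a * (y - 1)\<^sup>2) + exp (- a * (y + 1)\<^sup>2)"
 proof (cases "y \<ge> 0")
  case False
  have "(\<bar>y\<bar> - 1)\<^sup>2 = (y + 1)\<^sup>2" using False by (simp add: power2_eq_square algebra_simps)
  thus ?thesis by simp
 qed simp
 finally have "exp (- a * (y - d)\<^sup>2) \<le> exp a * (exp (- a * (y - 1)\<^sup>2) + exp (- a * (y + 1)\<^sup>2))" by simp
 moreover have "s - x - L / 2 = y - d" "s - x0 - 1 - L / 2 = y - 1" "s - x0 + 1 - L / 2 = y + 1"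
  by (simp_all add: y_def d_def)
 ultimately show ?thesis unfolding Er by (simp only: a_def)
qed

lemma norm_E_dominated:
 assumes "w \<in> ball w0 1"
 shows "norm (E (of_real s - w)) \<le> exp ((\<bar>Im w0\<bar> + 1)\<^sup>2 / (- 2 * L)) * exp (- 1 / (2 * L))
     * (Er (s - Re w0 - 1) + Er (s - Re w0 + 1))"
proof -
 have "norm (w - w0) < 1" using assms by (simp add: dist_norm norm_minus_commute)
 hence 1: "\<bar>Re w - Re w0\<bar> \<le> 1" "\<bar>Im w - Im w0\<bar> \<le> 1"
  using abs_Re_le_cmod[of "w - w0"] abs_Im_le_cmod[of "w - w0"] by auto
 hence "\<bar>Im w\<bar> \<le> \<bar>Im w0\<bar> + 1" by linarith
 hence "(Im w)\<^sup>2 \<le> (\<bar>Im w0\<bar> + 1)\<^sup>2" by (metis abs_ge_zero power2_abs power_mono)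
 hence 2: "exp ((Im w)\<^sup>2 / (- 2 * L)) \<le> exp ((\<bar>Im w0\<bar> + 1)\<^sup>2 / (- 2 * L))"
  using L_neg by (simp add: divide_le_cancel)
 show ?thesis
  unfolding norm_E mult.assoc by (intro mult_mono 2 Er_dominated 1) (auto simp: Er_def)
qed

text \<open>The quotient of the two kernels is a multiple of \<open>1 / P\<close>, and the periodic function \<open>P\<close> is bounded away
from zero in every smaller strip. Integrability against the Gaussian therefore suffices for the theta kernel.\<close>

lemma theta_kernel_le:
 assumes Y: "Y < pi"
 shows "\<exists>c>0. \<forall>u. \<bar>Im u\<bar> \<le> Y \<longrightarrow> norm (1 / \<theta> (exp u)) \<le> c * norm (E u)"
proof (cases "Y \<ge> 0")
 case True
 define K where "K = cbox (Complex L (- Y)) (Complex 0 Y)"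
 have K: "compact K" by (simp add: K_def)
 have Kne: "0 \<in> K" using True L_neg by (simp add: K_def in_cbox_complex_iff)
 have "P holomorphic_on UNIV" by (intro holomorphic_intros)
 hence "continuous_on K P"
  by (rule holomorphic_on_imp_continuous_on[OF holomorphic_on_subset]) simp
 hence "continuous_on K (%u. norm (P u))" by (rule continuous_on_norm)
 then obtain u0 where u0: "u0 \<in> K" "\<And>u. u \<in> K ==> norm (P u0) \<le> norm (P u)"
 proof -
  assume c: "continuous_on K (%u. norm (P u))"
  have "K ~= {}" using Kne by auto
  from continuous_attains_inf[OF K this c] that show thesis by blast
 qed
 have nz: "P u ~= 0" if "\<bar>Im u\<bar> \<le> Y" for u
  using that Y by (intro P_strip_nz) (simp add: strip_def)
 have "P u0 ~= 0" using u0(1) by (intro nz) (auto simp: K_def in_cbox_complex_iff)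
 hence p0: "norm (P u0) > 0" by simp
 have lb: "norm (P u0) \<le> norm (P u)" if u: "\<bar>Im u\<bar> \<le> Y" for u
 proof (rule period_representative[OF u])
  fix n assume "u + of_int n * lc \<in> cbox (Complex L (- Y)) (Complex 0 Y)"
  from u0(2)[OF this[folded K_def]] show ?thesis unfolding P_int_L .
 qed
 define c where "c = - L * Cq q / norm (P u0)"
 have "- L * Cq q > 0" using L_neg Cq_pos by (simp add: mult_neg_pos)
 hence "c > 0" unfolding c_def using p0 by (rule divide_pos_pos)
 moreover have "norm (1 / \<theta> (exp u)) \<le> c * norm (E u)" if u: "\<bar>Im u\<bar> \<le> Y" for u
 proof -
  have "\<theta> (exp u) ~= 0" using nz[OF u] by (simp add: P_eq_0_iff)
  hence "1 / \<theta> (exp u) = - lc * of_real (Cq q) * E u / P u" using L_neg Cq_pos by (simp add: P_eq)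
  also have "norm \<dots> = - L * Cq q * norm (E u) / norm (P u)"
   using L_neg Cq_pos by (simp add: norm_mult norm_divide)
  also have "\<dots> \<le> - L * Cq q * norm (E u) / norm (P u0)"
   using lb[OF u] p0 L_neg Cq_pos by (intro divide_left_mono mult_nonneg_nonneg mult_pos_pos) auto
  finally show ?thesis by (simp add: c_def)
 qed
 ultimately show ?thesis by blast
qed (auto intro: exI[of _ 1])

lemma theta_exp_strip_nz: "u \<in> strip ==> \<theta> (exp u) ~= 0"
 using P_strip_nz[of u] by (simp add: P_eq_0_iff)

lemma Gaussian_measurable:
 fixes h :: "real \<Rightarrow> complex"
 assumes h: "\<And>x. integrable lborel (%s. h s * E (of_real (s - x)))"
 shows "h \<in> borel_measurable lborel"
proof -
 have "(%s. h s * E (of_real (s - 0)) / of_real (Er s)) \<in> borel_measurable lborel"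
  by (intro borel_measurable_divide borel_measurable_integrable[OF h])
   (simp, intro borel_measurable_continuous_onI continuous_intros cont_Er)
 moreover have "(%s. h s * E (of_real (s - 0)) / of_real (Er s)) = h"
  using Er_pos by (auto simp: fun_eq_iff E_of_real less_imp_neq[symmetric])
 ultimately show ?thesis by simp
qed

lemma cont_entire_shift: "f holomorphic_on UNIV ==> continuous_on A (%s. f (of_real s - w))"
 by (rule continuous_on_compose2[OF holomorphic_on_imp_continuous_on]) (auto intro!: continuous_intros)

lemma Gaussian_dominant:
 fixes h :: "real \<Rightarrow> complex"
 assumes h: "\<And>x. integrable lborel (%s. h s * E (of_real (s - x)))"
 shows "\<exists>G. integrable lborel G \<and> (\<forall>s. \<forall>w\<in>ball w0 1. norm (h s * E (of_real s - w)) \<le> G s)"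
proof -
 define c where "c = exp ((\<bar>Im w0\<bar> + 1)\<^sup>2 / (- 2 * L)) * exp (- 1 / (2 * L))"
 define G where "G = (%s. c * (norm (h s * E (of_real (s - (Re w0 + 1)))) + norm (h s * E (of_real (s - (Re w0 - 1))))))"
 have "integrable lborel G"
  unfolding G_def by (intro Bochner_Integration.integrable_add integrable_mult_right integrable_norm h)
 moreover have "norm (h s * E (of_real s - w)) \<le> G s" if "w \<in> ball w0 1" for s w
 proof -
  have "norm (h s) * norm (E (of_real s - w)) \<le> norm (h s) * (c * (Er (s - Re w0 - 1) + Er (s - Re w0 + 1)))"
   unfolding c_def by (intro mult_left_mono norm_E_dominated that) auto
  also have "\<dots> = G s"
  proof -
   have e: "norm (E (of_real (s - x))) = Er (s - x)" for x
    unfolding E_of_real using Er_pos[of "s - x"] by simp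
   show ?thesis unfolding G_def norm_mult e by (simp add: algebra_simps)
  qed
  finally show ?thesis by (simp add: norm_mult)
 qed
 ultimately show ?thesis by blast
qed

lemma Gaussian_transform_entire:
 fixes h :: "real \<Rightarrow> complex"
 assumes h: "\<And>x. integrable lborel (%s. h s * E (of_real (s - x)))"
 shows "integrable lborel (%s. h s * E (of_real s - w))"
  and "(%w. \<integral>s. h s * E (of_real s - w) \<partial>lborel) holomorphic_on UNIV"
proof -
 have E: "E holomorphic_on UNIV" by (intro holomorphic_intros)
 have meas: "(%s. h s * E (of_real s - w)) \<in> borel_measurable lborel" for w
  by (intro borel_measurable_times Gaussian_measurable[OF h])
   (simp, intro borel_measurable_continuous_onI cont_entire_shift E)
 obtain G where G: "integrable lborel G" "\<forall>s. \<forall>v\<in>ball w 1. norm (h s * E (of_real s - v)) \<le> G s"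
  using Gaussian_dominant[OF h] by blast
 have "norm (h s * E (of_real s - w)) \<le> norm (G s)" for s
  using G(2)[rule_format, of w s] by simp
 thus "integrable lborel (%s. h s * E (of_real s - w))"
  by (intro Bochner_Integration.integrable_bound[OF G(1)] meas AE_I2)
 show "(%w. \<integral>s. h s * E (of_real s - w) \<partial>lborel) holomorphic_on UNIV"
 proof (rule holomorphic_on_integral)
  show "\<exists>r>0. \<exists>G. integrable lborel G \<and> (\<forall>s. \<forall>w\<in>ball w0 r \<inter> UNIV. norm (h s * E (of_real s - w)) \<le> G s)" for w0
   using Gaussian_dominant[OF h, of w0] by (intro exI[of _ 1]) simp
 qed (intro meas holomorphic_intros open_UNIV)+
qed

lemma theta_transform_holomorphic:
 fixes h :: "real \<Rightarrow> complex"
 assumes h: "\<And>x. integrable lborel (%s. h s * E (of_real (s - x)))"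
 shows "w \<in> strip ==> integrable lborel (%s. h s / \<theta> (exp (of_real s - w)))"
  and "(%w. \<integral>s. h s / \<theta> (exp (of_real s - w)) \<partial>lborel) holomorphic_on strip"
proof -
 have T: "(%u. \<theta> (exp u)) holomorphic_on UNIV" by (intro holomorphic_intros) auto
 have meas: "(%s. h s / \<theta> (exp (of_real s - w))) \<in> borel_measurable lborel" for w
  by (intro borel_measurable_divide Gaussian_measurable[OF h])
   (simp, intro borel_measurable_continuous_onI cont_entire_shift[of "%u. \<theta> (exp u)"] T)
 have dom: "\<exists>r>0. \<exists>G. integrable lborel G \<and> (\<forall>s. \<forall>w\<in>ball w0 r. norm (h s / \<theta> (exp (of_real s - w))) \<le> G s)"
  if w0: "w0 \<in> strip" for w0
 proof -
  define r where "r = min 1 ((pi - \<bar>Im w0\<bar>) / 2)"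
  have r: "r > 0" using w0 by (simp add: r_def strip_def)
  have Y: "\<bar>Im w0\<bar> + r < pi" using w0 by (simp add: r_def strip_def min_def field_simps)
  obtain c where c: "c > 0" "\<And>u. \<bar>Im u\<bar> \<le> \<bar>Im w0\<bar> + r ==> norm (1 / \<theta> (exp u)) \<le> c * norm (E u)"
   using theta_kernel_le[OF Y] by blast
  obtain G where G0: "integrable lborel G" "\<forall>s. \<forall>w\<in>ball w0 1. norm (h s * E (of_real s - w)) \<le> G s"
   using Gaussian_dominant[OF h] by blast
  note G = G0(1) G0(2)[rule_format]
  have "norm (h s / \<theta> (exp (of_real s - w))) \<le> c * G s" if w: "w \<in> ball w0 r" for s w
  proof -
   have "\<bar>Im w - Im w0\<bar> \<le> r" using w abs_Im_le_cmod[of "w - w0"] by (simp add: dist_norm norm_minus_commute)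
   hence "\<bar>Im (of_real s - w)\<bar> \<le> \<bar>Im w0\<bar> + r" by simp
   from c(2)[OF this] have "norm (h s) * norm (1 / \<theta> (exp (of_real s - w))) \<le> norm (h s) * (c * norm (E (of_real s - w)))"
    by (intro mult_left_mono) auto
   also have "\<dots> = c * norm (h s * E (of_real s - w))" by (simp add: norm_mult)
   also have "\<dots> \<le> c * G s" using c(1) w by (intro mult_left_mono G(2)) (auto simp: r_def)
   finally show ?thesis by (simp add: norm_divide)
  qed
  thus ?thesis using r G(1) by (intro exI[of _ r] conjI exI[of _ "%s. c * G s"] integrable_mult_right) auto
 qed
 show "integrable lborel (%s. h s / \<theta> (exp (of_real s - w)))" if w: "w \<in> strip"
 proof -
  obtain r G where r: "r > 0" and G: "integrable lborel G" "\<forall>s. \<forall>v\<in>ball w r. norm (h s / \<theta> (exp (of_real s - v))) \<le> G s"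
   using dom[OF w] by blast
  have "norm (h s / \<theta> (exp (of_real s - w))) \<le> norm (G s)" for s
   using G(2)[rule_format, of w s] r by simp
  thus ?thesis by (intro Bochner_Integration.integrable_bound[OF G(1)] meas AE_I2)
 qed
 show "(%w. \<integral>s. h s / \<theta> (exp (of_real s - w)) \<partial>lborel) holomorphic_on strip"
 proof (rule holomorphic_on_integral)
  show "open strip" by (rule strip_props)
  show "(%w. h s / \<theta> (exp (of_real s - w))) holomorphic_on strip" for s
  proof -
   have "of_real s - w \<in> strip" if "w \<in> strip" for w
    using strip_shift(1)[OF strip_shift(2)[OF that], of s] by (simp add: add.commute)
   thus ?thesis by (intro holomorphic_intros) (auto dest: theta_exp_strip_nz)
  qed
  show "\<exists>r>0. \<exists>G. integrable lborel G \<and> (\<forall>s. \<forall>w\<in>ball w0 r \<inter> strip. norm (h s / \<theta> (exp (of_real s - w))) \<le> G s)"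
   if w0: "w0 \<in> strip" for w0
  proof -
   obtain r G where "r > 0" "integrable lborel G" "\<forall>s. \<forall>v\<in>ball w0 r. norm (h s / \<theta> (exp (of_real s - v))) \<le> G s"
    using dom[OF w0] by blast
   thus ?thesis by (intro exI[of _ r] conjI exI[of _ G]) simp_all
  qed
 qed (rule meas)
qed

lemma kernel_powers:
 fixes K :: "real \<Rightarrow> real"
 assumes KL: "\<And>s. K (s + L) = K s * exp s"
 shows "K (s - real k * L) = K s * exp (- real k * s + L * (real k * (real k + 1) / 2))"
  and "K (s + real k * L) = K s * exp (real k * s + L * (real k * (real k - 1) / 2))"
proof -
 show "K (s - real k * L) = K s * exp (- real k * s + L * (real k * (real k + 1) / 2))"
 proof (induction k)
  case (Suc k)
  have "K (s - real k * L) = K ((s - real (Suc k) * L) + L)" by (simp add: algebra_simps)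
  also have "\<dots> = K (s - real (Suc k) * L) * exp (s - real (Suc k) * L)" by (rule KL)
  finally have e: "K (s - real k * L) = K (s - real (Suc k) * L) * exp (s - real (Suc k) * L)" .
  have "K (s - real (Suc k) * L) = K (s - real (Suc k) * L) * (exp (s - real (Suc k) * L) * exp (- (s - real (Suc k) * L)))"
   by (simp flip: exp_add)
  also have "\<dots> = K (s - real k * L) * exp (- (s - real (Suc k) * L))"
   unfolding e by (simp only: mult.assoc)
  finally have "K (s - real (Suc k) * L) = K (s - real k * L) * exp (- (s - real (Suc k) * L))" .
  also have "\<dots> = K s * (exp (- real k * s + L * (real k * (real k + 1) / 2)) * exp (- (s - real (Suc k) * L)))"
   unfolding Suc.IH by (simp only: mult.assoc)
  also have "exp (- real k * s + L * (real k * (real k + 1) / 2)) * exp (- (s - real (Suc k) * L))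
    = exp (- real (Suc k) * s + L * (real (Suc k) * (real (Suc k) + 1) / 2))"
   unfolding exp_add[symmetric] by (rule arg_cong[of _ _ exp]) (simp add: field_simps)
  finally show ?case .
 qed simp
 show "K (s + real k * L) = K s * exp (real k * s + L * (real k * (real k - 1) / 2))"
 proof (induction k)
  case (Suc k)
  have "K (s + real (Suc k) * L) = K ((s + real k * L) + L)" by (simp add: algebra_simps)
  also have "\<dots> = K (s + real k * L) * exp (s + real k * L)" by (rule KL)
  also have "\<dots> = K s * (exp (real k * s + L * (real k * (real k - 1) / 2)) * exp (s + real k * L))"
   unfolding Suc.IH by (simp only: mult.assoc)
  also have "exp (real k * s + L * (real k * (real k - 1) / 2)) * exp (s + real k * L)
    = exp (real (Suc k) * s + L * (real (Suc k) * (real (Suc k) - 1) / 2))"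
   unfolding exp_add[symmetric] by (rule arg_cong[of _ _ exp]) (simp add: field_simps)
  finally show ?case .
 qed simp
qed

lemma superexponential_decay: "(%k::nat. exp (- real k * a + L * (real k * (real k + 1) / 2) - L * real k * b)) \<longlonglongrightarrow> 0"
proof -
 obtain k0 :: nat where k0: "(- 1 + a + L * b) / (L / 2) < real k0" using reals_Archimedean2 by blast
 have le: "- real k * a + L * (real k * (real k + 1) / 2) - L * real k * b \<le> - real k" if "k \<ge> k0" for k
 proof -
  have "(- 1 + a + L * b) / (L / 2) \<le> real k + 1" using k0 that by simp
  hence "(real k + 1) * (L / 2) \<le> - 1 + a + L * b" using L_neg by (simp add: divide_le_eq)
  from mult_left_mono[OF this, of "real k"] show ?thesis by (simp add: algebra_simps)
 qed
 have "(%k::nat. exp (- 1 :: real) ^ k) \<longlonglongrightarrow> 0" by (rule LIMSEQ_realpow_zero) auto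
 hence z: "(%k::nat. exp (- real k)) \<longlonglongrightarrow> 0" by (simp add: exp_of_nat_mult[symmetric])
 show ?thesis
 proof (rule tendsto_sandwich[OF _ _ tendsto_const z])
  show "eventually (%k. exp (- real k * a + L * (real k * (real k + 1) / 2) - L * real k * b) \<le> exp (- real k)) sequentially"
   using le by (auto simp: eventually_sequentially)
 qed simp
qed

text \<open>Otherwise \<open>f z\<close> behaves like a nonzero multiple of \<open>z ^ N\<close> at the origin. After
multiplication by \<open>q powi (- k * N)\<close>, the transform at \<open>q ^ k\<close> tends to that multiple of a positive moment of \<open>K\<close>:
near the origin by dominated convergence, while the remaining part carries a factor of order
\<open>q ^ (k * (k + 1) div 2)\<close>.\<close>

lemma transform_uniqueness:
 fixes h :: "real \<Rightarrow> complex" and K :: "real \<Rightarrow> real"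
 assumes Kpos: "\<And>s. K s > 0" and KL: "\<And>s. K (s + L) = K s * exp s" and Ki: "integrable lborel K"
  and hi: "\<And>x. integrable lborel (%s. h s * of_real (K (s - x)))"
  and h0: "\<And>k::nat. (\<integral>s. h s * of_real (K (s - real k * L)) \<partial>lborel) = 0"
  and f: "f holomorphic_on ball 0 \<delta>" "\<delta> > 0" and hf: "\<And>s. exp s < \<delta> ==> h s = f (of_real (exp s))"
  and z: "z \<in> ball 0 \<delta>"
 shows "f z = 0"
proof (rule ccontr)
 assume nz: "f z ~= 0"
 define N where "N = nat (zorder f 0)"
 define gg where "gg = zor_poly f 0"
 obtain r where r: "r > 0" "cball (0::complex) r \<subseteq> ball 0 \<delta>" and gg: "gg holomorphic_on cball 0 r"
  and fgg: "\<And>w. w \<in> cball 0 r ==> f w = gg w * w ^ N" "\<And>w. w \<in> cball 0 r ==> gg w ~= 0"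
 proof -
  have z0: "0 \<in> ball (0::complex) \<delta>" using f(2) by simp
  have "\<exists>r>0. cball (0::complex) r \<subseteq> ball 0 \<delta> \<and> gg holomorphic_on cball 0 r \<and>
    (\<forall>w\<in>cball 0 r. f w = gg w * (w - 0) ^ N \<and> gg w ~= 0)"
   using zorder_exist_zero[OF f(1) open_ball connected_ball z0 bexI[of "%w. f w ~= 0", OF nz z]]
   unfolding N_def gg_def by simp
  then obtain r where "r > 0" "cball (0::complex) r \<subseteq> ball 0 \<delta>" "gg holomorphic_on cball 0 r"
   and e: "\<forall>w\<in>cball 0 r. f w = gg w * (w - 0) ^ N \<and> gg w ~= 0"
   by (elim conjE exE) blast
  thus thesis using e by (intro that[of r]) simp_all
 qed
 define a where "a = ln r"
 have cg: "continuous_on (cball 0 r) gg" using gg by (rule holomorphic_on_imp_continuous_on)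
 obtain G where G: "\<And>w. w \<in> cball 0 r ==> norm (gg w) \<le> G"
 proof -
  have "bounded (gg ` cball 0 r)"
   by (rule compact_imp_bounded[OF compact_continuous_image[OF cg compact_cball]])
  then obtain G where "\<forall>x\<in>gg ` cball 0 r. norm x \<le> G" unfolding bounded_iff by blast
  thus thesis by (intro that[of G]) auto
 qed
 have ea: "exp s \<le> r" if "s \<le> a" for s
 proof -
  have "exp s \<le> exp a" using that by simp
  thus ?thesis using r by (simp add: a_def)
 qed
 have hs: "h s = gg (of_real (exp s)) * of_real (exp (real N * s))" "norm (gg (of_real (exp s))) \<le> G" if "s \<le> a" for s
 proof -
  have i: "complex_of_real (exp s) \<in> cball 0 r" using ea[OF that] by simp
  with subsetD[OF r(2)] have "complex_of_real (exp s) \<in> ball 0 \<delta>" by blast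
  hence "exp s < \<delta>" by simp
  thus "h s = gg (of_real (exp s)) * of_real (exp (real N * s))"
   using hf[of s] fgg(1)[OF i] by (simp add: exp_of_nat_mult)
  show "norm (gg (of_real (exp s))) \<le> G" by (rule G[OF i])
 qed
 define KN where "KN = (%u. exp (real N * u) * K u)"
 have KN_eq: "KN = (%u. exp (- (L * (real N * (real N - 1) / 2))) * K (u + real N * L))"
  unfolding KN_def kernel_powers(2)[of K, OF KL] by (simp add: exp_add exp_minus fun_eq_iff)
 have KNi: "integrable lborel KN" unfolding KN_eq by (intro integrable_mult_right integrable_shift_real Ki)
 have KNpos: "KN u > 0" for u using Kpos by (simp add: KN_def)
 \<comment> \<open>Rescaled so that the contribution of the zero of order \<open>N\<close> has a finite nonzero limit.\<close>
 define J where "J = (%k s. h s * of_real (K (s - real k * L)) * of_real (exp (- L * real k * real N)))"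
 have Ji: "integrable lborel (J k)" for k unfolding J_def by (intro integrable_mult_left hi)
 have J0: "(\<integral>s. J k s \<partial>lborel) = 0" for k unfolding J_def using h0[of k] by simp
 define J1 where "J1 = (%k s. indicator {..a} s *\<^sub>R J k s)"
 define J2 where "J2 = (%k s. indicator {a<..} s *\<^sub>R J k s)"
 have J1i: "integrable lborel (J1 k)" and J2i: "integrable lborel (J2 k)" for k
  unfolding J1_def J2_def by (auto intro!: integrable_mult_indicator Ji)
 have J12: "(\<integral>s. J1 k s \<partial>lborel) + (\<integral>s. J2 k s \<partial>lborel) = 0" for k
 proof -
  have "(\<integral>s. J1 k s \<partial>lborel) + (\<integral>s. J2 k s \<partial>lborel) = (\<integral>s. J1 k s + J2 k s \<partial>lborel)"
   by (rule Bochner_Integration.integral_add[symmetric, OF J1i J2i])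
  also have "(%s. J1 k s + J2 k s) = J k" by (auto simp: J1_def J2_def fun_eq_iff indicator_def)
  finally show ?thesis using J0 by simp
 qed
 have J2lim: "(%k. \<integral>s. J2 k s \<partial>lborel) \<longlonglongrightarrow> 0"
 proof (rule Lim_null_comparison)
  define H where "H = (\<integral>s. norm (h s * of_real (K s)) \<partial>lborel)"
  have hi0: "integrable lborel (%s. h s * of_real (K s))" using hi[of 0] by simp
  show "(%k. exp (- real k * a + L * (real k * (real k + 1) / 2) - L * real k * real N) * H) \<longlonglongrightarrow> 0"
   using tendsto_mult[OF superexponential_decay tendsto_const] by simp
  have "norm (\<integral>s. J2 k s \<partial>lborel) \<le> exp (- real k * a + L * (real k * (real k + 1) / 2) - L * real k * real N) * H" for k
  proof -
   have "norm (\<integral>s. J2 k s \<partial>lborel) \<le> (\<integral>s. norm (J2 k s) \<partial>lborel)" by (rule integral_norm_bound)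
   also have "\<dots> \<le> (\<integral>s. exp (- real k * a + L * (real k * (real k + 1) / 2) - L * real k * real N) * norm (h s * of_real (K s)) \<partial>lborel)"
   proof (rule integral_mono[OF integrable_norm[OF J2i] integrable_mult_right[OF integrable_norm[OF hi0]]])
    fix s :: real
    show "norm (J2 k s) \<le> exp (- real k * a + L * (real k * (real k + 1) / 2) - L * real k * real N) * norm (h s * of_real (K s))"
    proof (cases "a < s")
     case True
     have "norm (J2 k s) = norm (h s) * (K s * (exp (- real k * s + L * (real k * (real k + 1) / 2)) * exp (- L * real k * real N)))"
      using True Kpos[of s] by (simp add: J2_def J_def norm_mult kernel_powers(1)[of K, OF KL] abs_of_pos)
     also have "\<dots> = exp (- real k * s + L * (real k * (real k + 1) / 2) - L * real k * real N) * norm (h s * of_real (K s))"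
     proof -
      have "exp (- real k * s + L * (real k * (real k + 1) / 2)) * exp (- L * real k * real N)
        = exp (- real k * s + L * (real k * (real k + 1) / 2) - L * real k * real N)"
       unfolding exp_add[symmetric] by (rule arg_cong[of _ _ exp]) simp
      thus ?thesis using Kpos[of s] by (simp add: norm_mult abs_of_pos)
     qed
     also have "\<dots> \<le> exp (- real k * a + L * (real k * (real k + 1) / 2) - L * real k * real N) * norm (h s * of_real (K s))"
      using True by (intro mult_right_mono) (auto intro: mult_left_mono)
     finally show ?thesis .
    qed (simp add: J2_def)
   qed
   also have "\<dots> = exp (- real k * a + L * (real k * (real k + 1) / 2) - L * real k * real N) * H"
    unfolding H_def by simp
   finally show ?thesis .
  qed
  thus "eventually (%k. norm (\<integral>s. J2 k s \<partial>lborel) \<le> exp (- real k * a + L * (real k * (real k + 1) / 2) - L * real k * real N) * H) sequentially"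
   by simp
 qed
 have J1eq: "J1 k (u + real k * L) = (if u + real k * L \<le> a then gg (of_real (exp (u + real k * L))) * of_real (KN u) else 0)" for k u
 proof (cases "u + real k * L \<le> a")
  case True
  have "exp (real N * (u + real k * L)) * exp (- L * real k * real N) = exp (real N * u)"
   by (simp add: exp_add[symmetric] algebra_simps)
  hence e: "complex_of_real (exp (real N * (u + real k * L))) * of_real (exp (- L * real k * real N)) = of_real (exp (real N * u))"
   by (simp only: of_real_mult[symmetric])
  have "J1 k (u + real k * L) = gg (of_real (exp (u + real k * L))) *
    (of_real (exp (real N * (u + real k * L))) * of_real (exp (- L * real k * real N))) * of_real (K u)"
   unfolding J1_def J_def using True hs(1)[OF True] by (simp add: mult_ac)
  also have "\<dots> = gg (of_real (exp (u + real k * L))) * of_real (KN u)"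
   unfolding e KN_def by simp
  finally show ?thesis using True by simp
 qed (simp add: J1_def)
 have "(%k. \<integral>u. J1 k (u + real k * L) \<partial>lborel) \<longlonglongrightarrow> (\<integral>u. gg 0 * of_real (KN u) \<partial>lborel)"
 proof (rule integral_dominated_convergence)
  show "integrable lborel (%u. G * KN u)" using KNi by simp
  show "(%u. J1 k (u + real k * L)) \<in> borel_measurable lborel" for k
   by (rule borel_measurable_integrable[OF integrable_shift_real[OF J1i]])
  show "(%u. gg 0 * of_real (KN u)) \<in> borel_measurable lborel"
   using KNi by (intro borel_measurable_integrable integrable_mult_right) simp
  have G0: "G \<ge> 0" using G[of 0] r(1) norm_ge_zero[of "gg 0"] by (simp del: norm_ge_zero)
  show "AE u in lborel. norm (J1 k (u + real k * L)) \<le> G * KN u" for k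
  proof (intro AE_I2)
   fix u :: real
   show "norm (J1 k (u + real k * L)) \<le> G * KN u"
    unfolding J1eq using G0 KNpos[of u] hs(2)[of "u + real k * L"]
    by (auto simp: norm_mult abs_of_pos intro!: mult_right_mono mult_nonneg_nonneg)
  qed
  show "AE u in lborel. (%k. J1 k (u + real k * L)) \<longlonglongrightarrow> gg 0 * of_real (KN u)"
  proof (intro AE_I2)
   fix u :: real
   have q0: "(%k. complex_of_real (exp (u + real k * L))) \<longlonglongrightarrow> 0"
   proof -
    have "(%k. exp u * q ^ k) \<longlonglongrightarrow> exp u * 0"
     using q_pos q_less_1 by (intro tendsto_mult tendsto_const LIMSEQ_realpow_zero) auto
    hence "(%k. exp (u + real k * L)) \<longlonglongrightarrow> 0"
     using q_pos by (simp add: exp_add exp_of_nat_mult)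
    from tendsto_of_real[OF this, where ?'a = complex] show ?thesis by simp
   qed
   have "isCont gg 0"
    using continuous_on_interior[OF cg, of 0] r(1) by simp
   hence "(%k. gg (of_real (exp (u + real k * L)))) \<longlonglongrightarrow> gg 0"
    using q0 by (rule isCont_tendsto_compose)
   hence lim: "(%k. gg (of_real (exp (u + real k * L))) * of_real (KN u)) \<longlonglongrightarrow> gg 0 * of_real (KN u)"
    by (intro tendsto_mult tendsto_const)
   obtain k0 :: nat where k0: "(a - u) / L < real k0" using reals_Archimedean2 by blast
   have "u + real k * L \<le> a" if "k \<ge> k0" for k
   proof -
    have "(a - u) / L \<le> real k" using k0 that by simp
    thus ?thesis using L_neg by (simp add: divide_le_eq)
   qed
   hence "eventually (%k. gg (of_real (exp (u + real k * L))) * of_real (KN u) = J1 k (u + real k * L)) sequentially"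
    unfolding J1eq eventually_sequentially by auto
   from Lim_transform_eventually[OF lim this] show "(%k. J1 k (u + real k * L)) \<longlonglongrightarrow> gg 0 * of_real (KN u)" .
  qed
 qed
 moreover have "(\<integral>u. J1 k (u + real k * L) \<partial>lborel) = - (\<integral>s. J2 k s \<partial>lborel)" for k
  using J12[of k] by (simp add: integral_shift_real eq_neg_iff_add_eq_0)
 ultimately have "(%k. - (\<integral>s. J2 k s \<partial>lborel)) \<longlonglongrightarrow> gg 0 * of_real (\<integral>u. KN u \<partial>lborel)"
  by (simp flip: integral_complex_of_real)
 from LIMSEQ_unique[OF this tendsto_minus[OF J2lim]] have "gg 0 * of_real (\<integral>u. KN u \<partial>lborel) = 0" by simp
 moreover have "gg 0 ~= 0" using fgg(2)[of 0] r(1) by simp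
 ultimately have "(\<integral>u. KN u \<partial>lborel) = 0" by simp
 hence "AE u in lborel. KN u = 0"
  using integral_nonneg_eq_0_iff_AE[OF KNi] KNpos by (simp add: less_imp_le)
 hence "AE u in lborel :: real measure. False" using KNpos by (auto elim!: eventually_mono simp: less_imp_neq[symmetric])
 thus False by (simp add: eventually_False ae_filter_eq_bot_iff)
qed

end

context qbase
begin

lemma qpoch_ge_1: "y \<ge> 0 ==> qpoch (- y) q \<ge> 1"
proof -
 assume y: "y \<ge> 0"
 have "(%n. \<Prod>i\<le>n. 1 - (- y) * q ^ i) \<longlonglongrightarrow> qpoch (- y) q"
  unfolding qpoch_def by (rule convergent_prod_LIMSEQ[OF convergent_qpoch_real])
 moreover have "(\<Prod>i\<le>n. 1 - (- y) * q ^ i) \<ge> 1" for n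
  using y q_pos by (intro prod_ge_1) auto
 ultimately show ?thesis by (intro LIMSEQ_le_const) auto
qed

lemma theta_of_real: "\<theta> (of_real x) = of_real (qpoch q q * qpoch (- x) q * qpoch (- (q / x)) q)"
 using qpoch_of_real[of q] qpoch_of_real[of "- x"] qpoch_of_real[of "- (q / x)"]
 by (simp add: theta_eq)

lemma qpoch_le_theta: "x > 0 ==> qpoch (- x) q \<le> norm (\<theta> (of_real x)) / \<bar>qpoch q q\<bar>"
proof -
 assume x: "x > 0"
 have nz: "\<bar>qpoch q q\<bar> > 0" using qpoch_qc_nz unfolding qpoch_of_real by simp
 have 1: "qpoch (- x) q \<ge> 1" "qpoch (- (q / x)) q \<ge> 1" using x q_pos by (auto intro!: qpoch_ge_1)
 have "qpoch (- x) q * \<bar>qpoch q q\<bar> * 1 \<le> qpoch (- x) q * \<bar>qpoch q q\<bar> * qpoch (- (q / x)) q"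
  using 1 by (intro mult_left_mono) auto
 also have "\<dots> = norm (\<theta> (of_real x))" using 1 unfolding theta_of_real norm_of_real abs_mult by simp
 finally show ?thesis using nz by (simp add: pos_le_divide_eq)
qed

lemma theta_real_pos: "x > 0 ==> \<theta> (of_real x) = of_real (Re (\<theta> (of_real x)))" "x > 0 ==> Re (\<theta> (of_real x)) > 0"
proof -
 show "x > 0 ==> \<theta> (of_real x) = of_real (Re (\<theta> (of_real x)))" unfolding theta_of_real by simp
 assume x: "x > 0"
 have "(\<Sum>n\<in>{0::int}. qb q n * x powi n) \<le> Re (\<theta> (of_real x))"
  by (rule finite_sum_le_has_sum[OF has_sum_qb_abs[OF x]])
   (use x qb_pos in \<open>auto intro!: mult_nonneg_nonneg less_imp_le[OF qb_pos] zero_le_power_int\<close>)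
 thus "Re (\<theta> (of_real x)) > 0" by simp
qed

lemma theta_powi_inverse:
 assumes "x ~= 0" "\<theta> x ~= 0"
 shows "a / \<theta> (qc powi n * x) = a * (x powi n * of_real (qb q n)) / \<theta> x"
 using assms theta_powi[of x n] by simp

section \<open>The kernel \<open>B2\<close> of an entire transform\<close>

lemma product_abs_summable:
 fixes u :: "nat \<Rightarrow> real" and v :: "int \<Rightarrow> real" and F :: "nat \<times> int \<Rightarrow> complex"
 assumes u: "summable u" "\<And>m. u m \<ge> 0" and v: "v summable_on UNIV" "\<And>n. v n \<ge> 0"
  and F: "\<And>m n. norm (F (m, n)) \<le> u m * v n"
 shows "F summable_on UNIV"
proof -
 have "(%p. norm (u (fst p) * v (snd p))) summable_on Sigma UNIV (%_. UNIV)"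
  unfolding Infinite_Sum.abs_summable_on_Sigma_iff
 proof (intro conjI ballI)
  fix m
  have "norm (u m * v n) = u m * v n" for n using u(2)[of m] v(2)[of n] by simp
  thus "(%n. norm (u (fst (m, n)) * v (snd (m, n)))) summable_on UNIV"
   using summable_on_cmult_right[OF v(1), of "u m"] by simp
 next
  have e: "(\<Sum>\<^sub>\<infinity>n. norm (u (fst (m, n)) * v (snd (m, n)))) = u m * infsum v UNIV" for m
  proof -
   have "norm (u m * v n) = u m * v n" for n using u(2)[of m] v(2)[of n] by simp
   thus ?thesis using infsum_cmult_right'[of "u m" v UNIV] by simp
  qed
  have "summable (%m. norm (u m * infsum v UNIV))"
   using u infsum_nonneg[of UNIV v] v by (simp add: summable_mult2)
  hence "(%m. norm (u m * infsum v UNIV)) summable_on UNIV"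
   by (intro norm_summable_imp_summable_on) simp
  thus "(%m. norm (\<Sum>\<^sub>\<infinity>n. norm (u (fst (m, n)) * v (snd (m, n))))) summable_on UNIV" unfolding e .
 qed
 hence s: "(%p. norm (u (fst p) * v (snd p))) summable_on UNIV" by simp
 have "(%p. norm (F p)) summable_on UNIV"
 proof (rule summable_on_comparison_test[OF s])
  fix p show "norm (F p) \<le> norm (u (fst p) * v (snd p))"
   using F[of "fst p" "snd p"] by simp
 qed simp
 thus ?thesis by (rule abs_summable_summable)
qed

lemma iterated_has_sum:
 fixes F :: "nat \<times> int \<Rightarrow> complex"
 assumes F: "F summable_on UNIV"
  and rows: "\<And>m. ((%n. F (m, n)) has_sum gr m) UNIV" and cols: "\<And>n. ((%m. F (m, n)) has_sum hc n) UNIV"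
  and gr: "(gr has_sum V) UNIV"
 shows "(hc has_sum V) UNIV"
proof -
 have t: "(F has_sum infsum F UNIV) (Sigma UNIV (%_. UNIV))" using has_sum_infsum[OF F] by simp
 have "(gr has_sum infsum F UNIV) UNIV" by (rule has_sum_SigmaD[OF t]) (rule rows)
 hence V: "infsum F UNIV = V" using gr has_sum_unique by blast
 have "((%(n, m). F (m, n)) has_sum V) (Sigma UNIV (%_. UNIV))"
  using t unfolding V by (subst (asm) has_sum_swap) (simp add: case_prod_unfold)
 from has_sum_SigmaD[OF this] cols show ?thesis by simp
qed

abbreviation lat :: "(complex \<Rightarrow> complex) \<Rightarrow> complex \<Rightarrow> complex \<Rightarrow> int \<Rightarrow> complex" where
 "lat B l z \<equiv> %n. B (qc powi n * l) / \<theta> (qc powi n * l / z)"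

definition eps :: "(nat \<Rightarrow> complex) \<Rightarrow> complex \<Rightarrow> complex" where "eps e z = (\<Sum>n. e n * z ^ n)"

text \<open>The \<open>q\<close>-Borel transform of the power series with coefficients \<open>e\<close>.\<close>

definition B2 :: "(nat \<Rightarrow> complex) \<Rightarrow> complex \<Rightarrow> complex" where
 "B2 e t = (\<Sum>n. e n * of_real (qb q (int n)) * t ^ n)"

lemma qb_le_1: "qb q (int n) \<le> 1"
proof -
 have "int n * (int n - 1) div 2 \<ge> 0" by (cases n) auto
 thus ?thesis unfolding qb_def using q_pos q_less_1 by (intro power_int_le_one) auto
qed

context
 fixes e :: "nat \<Rightarrow> complex"
 assumes e: "\<And>r. r \<ge> 0 ==> summable (%n. norm (e n) * r ^ n)"
begin

lemma B2_summable: "summable (%n. norm (e n * of_real (qb q (int n)) * t ^ n))"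
proof (rule summable_comparison_test'[OF e[of "norm t"]])
 fix n
 have "norm (e n) * (qb q (int n) * norm t ^ n) \<le> norm (e n) * (1 * norm t ^ n)"
  using qb_le_1 by (intro mult_left_mono mult_right_mono) auto
 thus "norm (norm (e n * of_real (qb q (int n)) * t ^ n)) \<le> norm (e n) * norm t ^ n"
  using qb_pos[of "int n"] by (simp add: norm_mult norm_power mult.assoc)
qed simp

lemma B2_sums: "(%n. e n * of_real (qb q (int n)) * t ^ n) sums B2 e t"
 unfolding B2_def by (rule summable_sums[OF summable_norm_cancel[OF B2_summable]])

lemma eps_sums: "(%n. e n * z ^ n) sums eps e z"
proof -
 have "summable (%n. norm (e n * z ^ n))" using e[of "norm z"] by (simp add: norm_mult norm_power)
 thus ?thesis unfolding eps_def by (rule summable_sums[OF summable_norm_cancel])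
qed

lemma holomorphic_B2: "B2 e holomorphic_on UNIV"
proof -
 have "B2 e holomorphic_on ball 0 (norm t + 1)" for t
  by (rule power_series_holomorphic[of _ _ "%n. e n * of_real (qb q (int n))"]) (use B2_sums in simp)
 hence "B2 e field_differentiable at t" for t
  by (rule holomorphic_on_imp_differentiable_at[of _ "ball 0 (norm t + 1)"]) auto
 thus ?thesis by (simp add: holomorphic_on_def field_differentiable_at_within)
qed

lemma holomorphic_eps: "eps e holomorphic_on UNIV"
proof -
 have "eps e holomorphic_on ball 0 (norm t + 1)" for t
  by (rule power_series_holomorphic[of _ _ e]) (use eps_sums in simp)
 hence "eps e field_differentiable at t" for t
  by (rule holomorphic_on_imp_differentiable_at[of _ "ball 0 (norm t + 1)"]) auto
 thus ?thesis by (simp add: holomorphic_on_def field_differentiable_at_within)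
qed

lemma powi_power_commute: "(a powi n) ^ k = (a ^ k) powi n" for a :: "'b::field"
proof -
 have "(a powi n) powi int k = (a powi int k) powi n" by (simp only: power_int_mult[symmetric] mult.commute)
 thus ?thesis by simp
qed

text \<open>For a monomial this is the triple product at \<open>q ^ k * x\<close>.\<close>

lemma B2_lattice:
 assumes z: "z ~= 0" and l: "lam ~= 0" "\<theta> (lam / z) ~= 0"
 shows "(lat (B2 e) lam z has_sum eps e z) UNIV"
proof -
 define x where "x = lam / z"
 have x: "x ~= 0" "\<theta> x ~= 0" using z l by (auto simp: x_def)
 have zx: "z = lam / x" using z l by (simp add: x_def)
 have ax: "norm x > 0" using x by simp
 define F where "F = (%(k::nat, n::int). e k * of_real (qb q (int k)) * (qc powi n * lam) ^ k * (x powi n * of_real (qb q n)) / \<theta> x)"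
 have row: "((%n. F (k, n)) has_sum e k * z ^ k) UNIV" for k
 proof -
  have "((%n. e k * of_real (qb q (int k)) * lam ^ k / \<theta> x * (of_real (qb q n) * (qc powi (int k) * x) powi n)) has_sum
    e k * of_real (qb q (int k)) * lam ^ k / \<theta> x * \<theta> (qc powi (int k) * x)) UNIV"
   using x q_pos by (intro has_sum_cmult_right jacobi_triple_product) simp
  also have "e k * of_real (qb q (int k)) * lam ^ k / \<theta> x * \<theta> (qc powi (int k) * x) = e k * z ^ k"
   using x theta_powi[of x "int k"] by (simp add: zx power_divide)
  also have "(%n. e k * of_real (qb q (int k)) * lam ^ k / \<theta> x * (of_real (qb q n) * (qc powi (int k) * x) powi n)) = (%n. F (k, n))"
  proof
   fix n
   have "(qc powi n * lam) ^ k = (qc powi int k) powi n * lam ^ k"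
    by (simp only: power_mult_distrib powi_power_commute power_int_of_nat)
   thus "e k * of_real (qb q (int k)) * lam ^ k / \<theta> x * (of_real (qb q n) * (qc powi (int k) * x) powi n) = F (k, n)"
    by (simp add: F_def power_int_mult_distrib mult_ac)
  qed
  finally show ?thesis .
 qed
 have nrow: "((%n. norm (F (k, n))) has_sum norm (e k) * norm z ^ k * (norm (\<theta> (of_real (norm x))) / norm (\<theta> x))) UNIV" for k
 proof -
  define y where "y = q powi (int k) * norm x"
  have y: "y > 0" using q_pos ax by (simp add: y_def)
  have "Re (\<theta> (of_real y)) = norm (\<theta> (of_real y))"
  proof -
   have "norm (\<theta> (of_real y)) = \<bar>Re (\<theta> (of_real y))\<bar>" by (subst theta_real_pos(1)[OF y]) (simp only: norm_of_real)
   thus ?thesis using theta_real_pos(2)[OF y] by simp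
  qed
  also have "norm (\<theta> (of_real y)) = norm (\<theta> (qc powi (int k) * complex_of_real (norm x)))" by (simp add: y_def)
  also have "\<dots> = norm (\<theta> (of_real (norm x))) / (norm x ^ k * qb q (int k))"
   using ax qb_pos[of "int k"] by (subst theta_powi) (simp_all add: norm_divide norm_mult norm_power)
  finally have th: "Re (\<theta> (of_real y)) = norm (\<theta> (of_real (norm x))) / (norm x ^ k * qb q (int k))" .
  have "((%n. norm (e k) * qb q (int k) * norm lam ^ k / norm (\<theta> x) * (qb q n * y powi n)) has_sum
    norm (e k) * qb q (int k) * norm lam ^ k / norm (\<theta> x) * Re (\<theta> (of_real y))) UNIV"
   by (intro has_sum_cmult_right has_sum_qb_abs y)
  also have "norm (e k) * qb q (int k) * norm lam ^ k / norm (\<theta> x) * Re (\<theta> (of_real y))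
    = norm (e k) * norm z ^ k * (norm (\<theta> (of_real (norm x))) / norm (\<theta> x))"
   unfolding th zx norm_divide power_divide using ax by (simp add: mult_ac)
  also have "(%n. norm (e k) * qb q (int k) * norm lam ^ k / norm (\<theta> x) * (qb q n * y powi n)) = (%n. norm (F (k, n)))"
  proof
   fix n
   have "(q powi n * norm lam) ^ k = (q powi int k) powi n * norm lam ^ k"
    by (simp only: power_mult_distrib powi_power_commute power_int_of_nat)
   thus "norm (e k) * qb q (int k) * norm lam ^ k / norm (\<theta> x) * (qb q n * y powi n) = norm (F (k, n))"
    using q_pos qb_pos[of n] qb_pos[of "int k"]
    by (simp add: F_def y_def norm_mult norm_divide norm_power norm_power_int power_int_mult_distrib mult_ac)
  qed
  finally show ?thesis .
 qed
 have "(%p. norm (F p)) summable_on Sigma UNIV (%_. UNIV)"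
  unfolding Infinite_Sum.abs_summable_on_Sigma_iff
 proof (intro conjI ballI)
  fix k show "(%n. norm (F (k, n))) summable_on UNIV" using nrow[of k] has_sum_imp_summable by blast
 next
  have i: "(\<Sum>\<^sub>\<infinity>n. norm (F (k, n))) = norm (e k) * norm z ^ k * (norm (\<theta> (of_real (norm x))) / norm (\<theta> x))" for k
   by (rule infsumI[OF nrow])
  have "summable (%k. norm (norm (e k) * norm z ^ k * (norm (\<theta> (of_real (norm x))) / norm (\<theta> x))))"
   using summable_mult2[OF e[of "norm z"]] by (simp add: abs_mult)
  hence "(%k. norm (norm (e k) * norm z ^ k * (norm (\<theta> (of_real (norm x))) / norm (\<theta> x)))) summable_on UNIV"
   by (intro norm_summable_imp_summable_on) simp
  thus "(%k. norm (\<Sum>\<^sub>\<infinity>n. norm (F (k, n)))) summable_on UNIV" unfolding i .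
 qed
 hence "(%p. norm (F p)) summable_on UNIV" by simp
 hence Fs: "F summable_on UNIV" by (rule abs_summable_summable)
 show ?thesis
 proof (rule iterated_has_sum[OF Fs row])
  have "summable (%k. norm (e k * z ^ k))" using e[of "norm z"] by (simp add: norm_mult norm_power)
  thus "((%k. e k * z ^ k) has_sum eps e z) UNIV" using eps_sums by (rule norm_summable_imp_has_sum)
  fix n :: int
  have "((%k. e k * of_real (qb q (int k)) * (qc powi n * lam) ^ k) has_sum B2 e (qc powi n * lam)) UNIV"
   using B2_summable B2_sums by (rule norm_summable_imp_has_sum)
  from has_sum_cmult_left[OF this, of "x powi n * of_real (qb q n) / \<theta> x"]
  have "((%k. F (k, n)) has_sum B2 e (qc powi n * lam) * (x powi n * of_real (qb q n) / \<theta> x)) UNIV"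
   by (simp add: F_def)
  also have "B2 e (qc powi n * lam) * (x powi n * of_real (qb q n) / \<theta> x) = B2 e (qc powi n * lam) / \<theta> (qc powi n * lam / z)"
   using theta_powi_inverse[OF x, of "B2 e (qc powi n * lam)" n] by (simp add: x_def)
  finally show "((%m. F (m, n)) has_sum B2 e (qc powi n * lam) / \<theta> (qc powi n * lam / z)) UNIV" .
 qed
qed

lemma B2_Gaussian:
 "integrable lborel (%s. B2 e (of_real (exp s)) * E (of_real (s - x)))"
 "(\<integral>s. B2 e (of_real (exp s)) * E (of_real (s - x)) \<partial>lborel) = eps e (of_real (exp x)) / of_real (Cq q)"
proof -
 define f where "f = (%n s. e n * of_real (exp (real n * x)) * of_real (Er (s + (real n * L - x))))"
 have nf: "norm (f n s) = norm (e n) * exp x ^ n * Er (s + (real n * L - x))" for n s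
  using Er_pos by (simp add: f_def norm_mult norm_power exp_of_nat_mult abs_of_pos)
 have fi: "integrable lborel (f n)" for n
  unfolding f_def by (intro integrable_mult_right integrable_of_real integrable_shift_real integrable_Er)
 have fI: "(\<integral>s. f n s \<partial>lborel) = e n * of_real (exp x) ^ n * of_real (1 / Cq q)" for n
  unfolding f_def by (simp add: integral_shift_real integral_Er exp_of_nat_mult)
 have nfI: "(\<integral>s. norm (f n s) \<partial>lborel) = norm (e n) * exp x ^ n * (1 / Cq q)" for n
  unfolding nf by (simp add: integral_shift_real integral_Er)
 have f_eq: "f n s = e n * of_real (qb q (int n)) * of_real (exp s) ^ n * E (of_real (s - x))" for n s
 proof -
  have "complex_of_real (Er (s + (real n * L - x))) = E (of_real (s - x) + of_int (int n) * lc)"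
   unfolding E_of_real[symmetric] by (simp add: algebra_simps)
  also have "\<dots> = E (of_real (s - x)) * exp (of_real (s - x)) ^ n * of_real (qb q (int n))"
   using E_powi[of "of_real (s - x)" "int n"] by (simp only: power_int_of_nat)
  also have "exp (complex_of_real (s - x)) = of_real (exp s) / of_real (exp x)"
   by (simp add: exp_diff exp_of_real)
  finally show ?thesis unfolding f_def
   by (simp add: exp_of_nat_mult power_divide)
 qed
 have sm: "summable (%n. norm (f n s))" for s
 proof -
  have "norm (f n s) = norm (e n * of_real (qb q (int n)) * of_real (exp s) ^ n) * norm (E (of_real (s - x)))" for n
   unfolding f_eq norm_mult ..
  thus ?thesis using summable_mult2[OF B2_summable[of "of_real (exp s)"]] by presburger
 qed
 have sI: "summable (%n. \<integral>s. norm (f n s) \<partial>lborel)"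
  unfolding nfI by (intro summable_mult2 e) simp
 have sum: "(\<Sum>n. f n s) = B2 e (of_real (exp s)) * E (of_real (s - x))" for s
  unfolding f_eq using sums_unique[OF sums_mult2[OF B2_sums]] by metis
 show "integrable lborel (%s. B2 e (of_real (exp s)) * E (of_real (s - x)))"
  using integrable_suminf[OF fi AE_I2[OF sm] sI] unfolding sum .
 have "(%n. \<integral>s. f n s \<partial>lborel) sums (\<integral>s. (\<Sum>n. f n s) \<partial>lborel)"
  by (rule sums_integral[OF fi AE_I2[OF sm] sI])
 moreover have "(%n. \<integral>s. f n s \<partial>lborel) sums (eps e (of_real (exp x)) * of_real (1 / Cq q))"
  unfolding fI by (intro sums_mult2 eps_sums)
 ultimately show "(\<integral>s. B2 e (of_real (exp s)) * E (of_real (s - x)) \<partial>lborel) = eps e (of_real (exp x)) / of_real (Cq q)"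
  unfolding sum using sums_unique2 by fastforce
qed

end

end

section \<open>The kernel attached to an entire function\<close>

locale heine = qbase +
 fixes S :: "complex \<Rightarrow> complex" and M c :: real
 assumes S_hol: "S holomorphic_on UNIV" and M_pos: "0 < M" and c: "0 < c" "c < 1"
  and growth: "\<And>t. norm (S t) \<le> M * qpoch (- (c * norm t)) q"
begin

text \<open>The normalization turns the Cauchy estimates into geometric decay.\<close>

definition bc :: "nat \<Rightarrow> complex" where
 "bc m = (- 1) ^ m * ((deriv ^^ m) S 0 / fact m) / of_real (qb q (int m))"

definition C0 :: real where "C0 = M * norm (\<theta> (of_real c)) / \<bar>qpoch q q\<bar>"

text \<open>On the circle of radius \<open>q powi (- m)\<close> the growth bound is comparable with \<open>\<theta>\<close>, whose
quasi-periodicity gives its exact size.\<close>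

lemma bc_bound: "norm (bc m) \<le> C0 * c ^ m"
proof -
 define r where "r = q powi (- int m)"
 have r: "r > 0" using q_pos by (simp add: r_def)
 have qq: "\<bar>qpoch q q\<bar> > 0" using qpoch_qc_nz unfolding qpoch_of_real by simp
 have "norm ((deriv ^^ m) S 0) \<le> fact m * (M * qpoch (- (c * r)) q) / r ^ m"
 proof (rule Cauchy_inequality)
  show "S holomorphic_on ball 0 r" "continuous_on (cball 0 r) S"
   using S_hol holomorphic_on_subset holomorphic_on_imp_continuous_on by blast+
  show "norm (S x) \<le> M * qpoch (- (c * r)) q" if "norm (0 - x) = r" for x
   using growth[of x] that by simp
 qed (rule r)
 also have "\<dots> \<le> fact m * (M * (norm (\<theta> (of_real (c * r))) / \<bar>qpoch q q\<bar>)) / r ^ m"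
  using M_pos r c by (intro divide_right_mono mult_left_mono qpoch_le_theta) auto
 also have "norm (\<theta> (of_real (c * r))) = norm (\<theta> (of_real c)) / (c powi (- int m) * qb q (- int m))"
 proof -
  have "complex_of_real (c * r) = qc powi (- int m) * of_real c" by (simp add: r_def mult.commute)
  thus ?thesis using c qb_pos[of "- int m"] theta_powi[of "of_real c" "- int m"]
   by (simp only: norm_divide norm_mult norm_power_int norm_of_real abs_of_pos of_real_eq_0_iff less_imp_neq[symmetric] not_False_eq_True)
 qed
 finally have 1: "norm ((deriv ^^ m) S 0) \<le> fact m * (M * (norm (\<theta> (of_real c)) / (c powi (- int m) * qb q (- int m)) / \<bar>qpoch q q\<bar>)) / r ^ m" .
 have one: "qb q (int m) * qb q (- int m) * r ^ m = 1"
 proof -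
  have "r ^ m = q powi (int m * - int m)" unfolding r_def
   by (simp add: power_int_mult[symmetric] mult.commute flip: power_int_of_nat)
  thus ?thesis using qb_add[of "int m" "- int m"] by simp
 qed
 have "norm (bc m) = norm ((deriv ^^ m) S 0) / fact m / qb q (int m)"
  using qb_pos[of "int m"] by (simp add: bc_def norm_mult norm_divide norm_power)
 also have "\<dots> \<le> fact m * (M * (norm (\<theta> (of_real c)) / (c powi (- int m) * qb q (- int m)) / \<bar>qpoch q q\<bar>)) / r ^ m / fact m / qb q (int m)"
  using qb_pos[of "int m"] by (intro divide_right_mono 1) auto
 also have "\<dots> = C0 * c ^ m / (qb q (int m) * qb q (- int m) * r ^ m)"
  using c by (simp add: C0_def power_int_minus field_simps)
 finally show ?thesis unfolding one by simp
qed

lemma C0_nonneg: "C0 \<ge> 0"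
 using M_pos by (simp add: C0_def)

lemma c_summable: "summable (%m. C0 * c ^ m)"
 using c by (intro summable_mult summable_geometric) auto

lemma S_sums: "(%m. bc m * ((- z) ^ m * of_real (qb q (int m)))) sums S z"
proof -
 have "(%n. (deriv ^^ n) S 0 / fact n * (z - 0) ^ n) sums S z"
  by (rule holomorphic_power_series[of S 0 "norm z + 1"])
   (use S_hol in \<open>auto intro: holomorphic_on_subset\<close>)
 moreover have "bc m * ((- z) ^ m * of_real (qb q (int m))) = (deriv ^^ m) S 0 / fact m * (z - 0) ^ m" for m
 proof -
  have "((- 1) ^ m :: complex) * (- z) ^ m = z ^ m" by (simp flip: power_mult_distrib)
  moreover have "bc m * ((- z) ^ m * of_real (qb q (int m))) = (deriv ^^ m) S 0 / fact m * ((- 1) ^ m * (- z) ^ m)"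
   by (simp add: bc_def)
  ultimately show ?thesis by simp
 qed
 ultimately show ?thesis by simp
qed

definition Dz :: "complex \<Rightarrow> complex" where "Dz z = S z / \<theta> (- z)"

lemma Dz_sums:
 assumes z: "z ~= 0" "\<theta> (- z) ~= 0"
 shows "(%m. bc m / \<theta> (- (qc ^ m * z))) sums Dz z" "summable (%m. norm (bc m / \<theta> (- (qc ^ m * z))))"
proof -
 have e: "bc m / \<theta> (- (qc ^ m * z)) = bc m * ((- z) ^ m * of_real (qb q (int m))) / \<theta> (- z)" for m
  using theta_powi_inverse[of "- z" "bc m" "int m"] z by simp
 show "(%m. bc m / \<theta> (- (qc ^ m * z))) sums Dz z"
  unfolding e Dz_def by (intro sums_divide S_sums)
 have "summable (%m. C0 / norm (\<theta> (- z)) * (qb q (int m) * norm z ^ m))"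
  by (intro summable_mult summable_qb_pos) simp
 thus "summable (%m. norm (bc m / \<theta> (- (qc ^ m * z))))"
 proof (rule summable_comparison_test')
  fix m
  have "norm (bc m) \<le> C0 * 1"
   using bc_bound[of m] C0_nonneg c by (elim order_trans, intro mult_left_mono power_le_one) auto
  hence "norm (bc m) * (qb q (int m) * norm z ^ m) / norm (\<theta> (- z)) \<le> C0 * (qb q (int m) * norm z ^ m) / norm (\<theta> (- z))"
   using qb_pos[of "int m"] by (intro divide_right_mono mult_right_mono) auto
  thus "norm (norm (bc m / \<theta> (- (qc ^ m * z)))) \<le> C0 / norm (\<theta> (- z)) * (qb q (int m) * norm z ^ m)"
   unfolding e using qb_pos[of "int m"] by (simp add: norm_mult norm_divide norm_power mult_ac)
 qed
qed

definition B1 :: "complex \<Rightarrow> complex" where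
 "B1 t = (\<Sum>m. bc m / (1 + t * qc powi (int m - 1)))"

text \<open>The complement of the possible poles \<open>- q powi j\<close> with \<open>j \<le> 1\<close>.\<close>

definition B1dom :: "complex set" where
 "B1dom = {t. t ~= 0 \<and> \<theta> t ~= 0} \<union> ball 0 q"

lemma B1dom_locally:
 assumes "t0 \<in> B1dom"
 shows "\<exists>r>0. \<exists>\<delta>>0. cball t0 r \<subseteq> B1dom \<and> (\<forall>t\<in>cball t0 r. \<forall>m::nat. \<delta> \<le> norm (1 + t * qc powi (int m - 1)))"
proof (cases "t0 \<in> ball 0 q")
 case True
 have "open (ball (0::complex) q)" by simp
 with True obtain r where r: "r > 0" "cball t0 r \<subseteq> ball 0 q" using open_contains_cball by blast
 have "t0 + of_real r \<in> cball t0 r" using r by (simp add: dist_norm)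
 obtain t1 where t1: "t1 \<in> cball t0 r" "\<forall>t\<in>cball t0 r. norm t \<le> norm t1"
 proof -
  have "cball t0 r ~= {}" using r by auto
  moreover have "continuous_on (cball t0 r) norm" by (intro continuous_intros)
  ultimately obtain t1 where "t1 \<in> cball t0 r" "\<forall>t\<in>cball t0 r. norm t \<le> norm t1"
   using continuous_attains_sup[OF compact_cball] by blast
  thus thesis by (rule that)
 qed
 have d: "1 - norm t1 / q > 0" using t1(1) r(2) q_pos by (auto simp: field_simps)
 have "1 - norm t1 / q \<le> norm (1 + t * qc powi (int m - 1))" if "t \<in> cball t0 r" for t m
 proof -
  have "q powi (int m - 1) \<le> q powi (- 1)" using q_pos q_less_1 by (intro power_int_decreasing) auto
  hence "norm (t * qc powi (int m - 1)) \<le> norm t1 * (1 / q)"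
   unfolding norm_mult norm_power_int norm_qc using q_pos t1(2) that
   by (intro mult_mono) (auto simp: power_int_minus divide_inverse)
  moreover have "1 - norm (t * qc powi (int m - 1)) \<le> norm (1 + t * qc powi (int m - 1))"
   by (metis norm_diff_ineq norm_one)
  ultimately show ?thesis by simp
 qed
 thus ?thesis using r d by (intro exI[of _ r] conjI exI[of _ "1 - norm t1 / q"]) (auto simp: B1dom_def)
next
 case False
 define A where "A = (-{0}) \<inter> \<theta> -` (-{0})"
 have A: "open A"
  unfolding A_def by (rule continuous_open_preimage[OF holomorphic_on_imp_continuous_on[OF holomorphic_theta]]) (auto simp: open_Compl)
 have "t0 \<in> A" using False assms by (auto simp: A_def B1dom_def)
 then obtain r where r: "r > 0" "cball t0 r \<subseteq> A" using A open_contains_cball by blast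
 have K: "0 \<notin> cball t0 r" "\<And>y. y \<in> cball t0 r ==> \<theta> y ~= 0" using r(2) unfolding A_def by blast+
 obtain \<delta> :: real where d: "\<delta> > 0" "\<forall>y\<in>cball t0 r. \<forall>k::int. \<delta> \<le> norm (1 + y * qc powi k)"
 proof -
  have "\<exists>\<delta>>0. \<forall>y\<in>cball t0 r. \<forall>k::int. \<delta> \<le> norm (1 + y * qc powi k)"
   by (rule lower_bound_1_plus_all[OF compact_cball K])
  thus thesis by (elim exE conjE) (rule that)
 qed
 have "cball t0 r \<subseteq> B1dom" using r(2) by (auto simp: A_def B1dom_def)
 thus ?thesis using r(1) d by (intro exI[of _ r] conjI exI[of _ \<delta>]) simp_all
qed

lemma B1_summable:
 assumes "t \<in> B1dom"
 shows "summable (%m. norm (bc m / (1 + t * qc powi (int m - 1))))"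
proof -
 obtain r \<delta> where "r > 0" "\<delta> > (0::real)" and d: "\<forall>t'\<in>cball t r. \<forall>m::nat. \<delta> \<le> norm (1 + t' * qc powi (int m - 1))"
  using B1dom_locally[OF assms] by blast
 show ?thesis
 proof (rule summable_comparison_test'[OF summable_divide[OF c_summable, of \<delta>]])
  fix m
  have "\<delta> \<le> norm (1 + t * qc powi (int m - 1))" using d \<open>r > 0\<close> by simp
  hence "norm (bc m / (1 + t * qc powi (int m - 1))) \<le> C0 * c ^ m / \<delta>"
   unfolding norm_divide using bc_bound[of m] \<open>\<delta> > 0\<close> C0_nonneg c by (intro frac_le) auto
  thus "norm (norm (bc m / (1 + t * qc powi (int m - 1)))) \<le> C0 * c ^ m / \<delta>" by simp
 qed
qed

lemma open_B1dom: "open B1dom"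
 unfolding open_contains_cball using B1dom_locally by blast

lemma holomorphic_B1: "B1 holomorphic_on B1dom"
proof (rule holomorphic_uniform_sequence[OF open_B1dom])
 have nz: "1 + t * qc powi (int m - 1) ~= 0" if tB: "t \<in> B1dom" for t and m :: nat
 proof -
  obtain r \<delta> where "r > 0" "\<delta> > (0::real)" and d: "\<forall>t'\<in>cball t r. \<forall>m::nat. \<delta> \<le> norm (1 + t' * qc powi (int m - 1))"
   using B1dom_locally[OF tB] by blast
  hence "\<delta> \<le> norm (1 + t * qc powi (int m - 1))" by simp
  thus ?thesis using \<open>\<delta> > 0\<close> by auto
 qed
 show "(%t. \<Sum>m<N. bc m / (1 + t * qc powi (int m - 1))) holomorphic_on B1dom" for N
  by (intro holomorphic_intros) (use nz in auto)
 show "\<exists>d>0. cball x d \<subseteq> B1dom \<and> uniform_limit (cball x d) (%N t. \<Sum>m<N. bc m / (1 + t * qc powi (int m - 1))) B1 sequentially"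
  if x: "x \<in> B1dom" for x
 proof -
  obtain r \<delta> where r: "r > 0" "cball x r \<subseteq> B1dom" and d0: "\<delta> > (0::real)"
   and d: "\<forall>t\<in>cball x r. \<forall>m::nat. \<delta> \<le> norm (1 + t * qc powi (int m - 1))"
   using B1dom_locally[OF x] by blast
  have "uniform_limit (cball x r) (%N t. \<Sum>m<N. bc m / (1 + t * qc powi (int m - 1))) B1 sequentially"
   unfolding B1_def[abs_def]
  proof (rule Weierstrass_m_test[OF _ summable_divide[OF c_summable, of \<delta>]])
   fix m t assume "t \<in> cball x r"
   hence "\<delta> \<le> norm (1 + t * qc powi (int m - 1))" using d by simp
   thus "norm (bc m / (1 + t * qc powi (int m - 1))) \<le> C0 * c ^ m / \<delta>"
    unfolding norm_divide using bc_bound[of m] d0 C0_nonneg c by (intro frac_le) auto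
  qed
  thus ?thesis using r by blast
 qed
qed

lemma pos_in_B1dom: "t > 0 ==> of_real t \<in> B1dom"
 using theta_nz_pos[of t] by (simp add: B1dom_def)

lemma norm_1_plus_pos: "t > 0 ==> norm (1 + complex_of_real t * qc powi k) = 1 + t * q powi k"
proof -
 assume "t > 0"
 have "1 + complex_of_real t * qc powi k = of_real (1 + t * q powi k)" by simp
 moreover have "1 + t * q powi k > 0" using \<open>t > 0\<close> q_pos by (intro add_pos_pos mult_pos_pos) auto
 ultimately show ?thesis by (simp only: norm_of_real abs_of_pos)
qed

lemma B1_bound: "t > 0 ==> norm (B1 (of_real t)) \<le> (\<Sum>m. C0 * c ^ m)"
proof -
 assume t: "t > 0"
 have "norm (B1 (of_real t)) \<le> (\<Sum>m. norm (bc m / (1 + of_real t * qc powi (int m - 1))))"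
  unfolding B1_def by (rule summable_norm[OF B1_summable[OF pos_in_B1dom[OF t]]])
 also have "\<dots> \<le> (\<Sum>m. C0 * c ^ m)"
 proof (rule suminf_le[OF _ B1_summable[OF pos_in_B1dom[OF t]] c_summable])
  fix m
  have "norm (bc m) / (1 + t * q powi (int m - 1)) \<le> C0 * c ^ m / 1"
   using bc_bound[of m] t q_pos C0_nonneg c by (intro frac_le) auto
  thus "norm (bc m / (1 + of_real t * qc powi (int m - 1))) \<le> C0 * c ^ m"
   by (simp add: norm_divide norm_1_plus_pos[OF t])
 qed
 finally show ?thesis .
qed

lemma B1_Gaussian: "integrable lborel (%s. B1 (of_real (exp s)) * E (of_real (s - x)))"
proof (rule Bochner_Integration.integrable_bound)
 show "integrable lborel (%s. (\<Sum>m. C0 * c ^ m) * Er (s + (- x)))"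
  by (intro integrable_mult_right integrable_shift_real integrable_Er)
 have "continuous_on UNIV (%s. B1 (of_real (exp s)) * of_real (Er (s - x)))"
 proof (intro continuous_on_mult continuous_on_of_real)
  show "continuous_on UNIV (%s. B1 (of_real (exp s)))"
   by (rule continuous_on_compose2[OF holomorphic_on_imp_continuous_on[OF holomorphic_B1]])
    (auto intro!: continuous_intros pos_in_B1dom)
  show "continuous_on UNIV (%s. Er (s - x))"
   by (rule continuous_on_compose2[OF cont_Er[of UNIV]]) (auto intro!: continuous_intros)
 qed
 thus "(%s. B1 (of_real (exp s)) * E (of_real (s - x))) \<in> borel_measurable lborel"
  unfolding E_of_real by (simp add: borel_measurable_continuous_onI)
 show "AE s in lborel. norm (B1 (of_real (exp s)) * E (of_real (s - x))) \<le> norm ((\<Sum>m. C0 * c ^ m) * Er (s + (- x)))"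
 proof (intro AE_I2)
  fix s :: real
  have "norm (B1 (of_real (exp s))) * Er (s - x) \<le> (\<Sum>m. C0 * c ^ m) * Er (s - x)"
   using B1_bound[of "exp s"] Er_pos[of "s - x"] by (intro mult_right_mono) auto
  also have "\<dots> \<le> norm ((\<Sum>m. C0 * c ^ m) * Er (s - x))" by simp
  finally show "norm (B1 (of_real (exp s)) * E (of_real (s - x))) \<le> norm ((\<Sum>m. C0 * c ^ m) * Er (s + (- x)))"
   unfolding E_of_real norm_mult using Er_pos[of "s - x"] by simp
 qed
qed

definition kc :: "complex \<Rightarrow> complex" where
 "kc w = (SOME k. \<forall>l. \<theta> (exp l) * \<theta> (exp (l - w)) ~= 0 \<longrightarrow>
  AL (exp (l - w)) (exp l) / \<theta> (exp (l - w)) + (Q l - Q (l - w)) / \<theta> (- exp w) = k)"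

lemma kc: "\<theta> (- exp w) ~= 0 ==> \<theta> (exp l) * \<theta> (exp (l - w)) ~= 0 ==>
  AL (exp (l - w)) (exp l) / \<theta> (exp (l - w)) + (Q l - Q (l - w)) / \<theta> (- exp w) = kc w"
 unfolding kc_def using someI_ex[OF AL_Pd_constant[of w]] by blast

definition kap :: "complex \<Rightarrow> complex" where "kap w = (\<Sum>\<^sub>\<infinity>m. bc m * kc (w + of_nat m * lc))"

lemma theta_shift_zero: "\<tau> ~= 0 ==> \<theta> (qc ^ m * \<tau>) = 0 \<longleftrightarrow> \<theta> \<tau> = 0"
 using theta_powi[of \<tau> "int m"] by simp

text \<open>Interchanging the sums produces the Appell-Lerch series at \<open>q ^ m * \<lambda>\<close>. The model identity applies
to each with \<open>w\<close> replaced by \<open>w + m * L\<close>, which changes neither \<open>\<lambda> / z\<close> nor \<open>Pd\<close>.\<close>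

lemma B1_lattice:
 assumes z: "\<theta> (- exp w) ~= 0" and l: "\<theta> (exp l) ~= 0" "\<theta> (exp (l - w)) ~= 0"
 shows "(lat B1 (exp l) (exp w) has_sum
      (kap w - (Q l - Q (l - w)) * Dz (exp w))) UNIV"
proof -
 define x where "x = exp (l - w)"
 define y where "y = exp l"
 have x: "x ~= 0" "\<theta> x ~= 0" and y: "y ~= 0" "\<theta> y ~= 0" using l by (auto simp: x_def y_def)
 have ym: "qc ^ m * y ~= 0" "\<theta> (qc ^ m * y) ~= 0" "\<theta>1 (qc ^ m * y) ~= 0" for m
 proof -
  show "qc ^ m * y ~= 0" "\<theta> (qc ^ m * y) ~= 0" using y q_pos by (auto simp: theta_shift_zero)
  thus "\<theta>1 (qc ^ m * y) ~= 0" by (auto simp: theta_theta1)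
 qed
 obtain \<delta> :: real where d: "\<delta> > 0" "\<And>k::int. \<delta> \<le> norm (1 + y * qc powi k)"
 proof -
  have "\<exists>\<delta>>0. \<forall>y'\<in>{y}. \<forall>k::int. \<delta> \<le> norm (1 + y' * qc powi k)"
   by (rule lower_bound_1_plus_all) (use y in auto)
  thus thesis using that by blast
 qed
 define F where "F = (%(m::nat, n::int). bc m * (of_real (qb q n) * x powi n) / (1 + y * qc powi (n + int m - 1)))"
 have Fs: "F summable_on UNIV"
 proof (rule product_abs_summable)
  show "summable (%m. C0 * c ^ m / \<delta>)" by (intro summable_divide c_summable)
  show "C0 * c ^ m / \<delta> \<ge> 0" for m using C0_nonneg c d(1) by simp
  show "(%n. qb q n * norm x powi n) summable_on UNIV" using x by (intro summable_qb_abs) simp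
  show "qb q n * norm x powi n \<ge> 0" for n using qb_pos[of n] by (simp add: zero_le_power_int)
  fix m n
  have "norm (F (m, n)) = norm (bc m) * (qb q n * norm x powi n) / norm (1 + y * qc powi (n + int m - 1))"
   using qb_pos[of n] by (simp add: F_def norm_mult norm_divide norm_power_int)
  also have "\<dots> \<le> (C0 * c ^ m) * (qb q n * norm x powi n) / \<delta>"
   using bc_bound[of m] d qb_pos[of n] C0_nonneg c
   by (intro frac_le mult_right_mono mult_nonneg_nonneg) (auto simp: zero_le_power_int)
  finally show "norm (F (m, n)) \<le> C0 * c ^ m / \<delta> * (qb q n * norm x powi n)" by simp
 qed
 have row: "((%n. F (m, n)) has_sum bc m * AL x (qc ^ m * y)) UNIV" for m
 proof -
  have "((%n. bc m * (of_real (qb q n) * x powi n / (1 + qc ^ m * y * qc powi (n - 1)))) has_sum bc m * AL x (qc ^ m * y)) UNIV"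
   by (intro has_sum_cmult_right AL_has_sum x ym)
  moreover have "qc ^ m * y * qc powi (n - 1) = y * qc powi (n + int m - 1)" for n
  proof -
   have "qc powi (n + int m - 1) = qc powi (int m) * qc powi (n - 1)"
    using q_pos by (subst power_int_add[symmetric]) (auto simp: algebra_simps)
   thus ?thesis by (simp add: mult_ac)
  qed
  ultimately show ?thesis by (simp add: F_def)
 qed
 define pd where "pd = Q l - Q (l - w)"
 have AL: "AL x (qc ^ m * y) = \<theta> x * (kc (w + of_nat m * lc) - pd / \<theta> (- (qc ^ m * exp w)))" for m
 proof -
  define l' where "l' = l + of_nat m * lc"
  define w' where "w' = w + of_nat m * lc"
  have em: "exp (of_nat m * lc) = qc ^ m" using exp_int_L[of "int m"] by simp
  have el: "exp l' = qc ^ m * y" "exp w' = qc ^ m * exp w" "l' - w' = l - w"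
   by (simp_all add: l'_def w'_def y_def exp_add em)
  have 1: "\<theta> (- exp w') ~= 0" using theta_shift_zero[of "- exp w" m] z by (simp add: el)
  have 2: "\<theta> (exp l') * \<theta> (exp (l' - w')) ~= 0" using ym(2) x unfolding el x_def[symmetric] by simp
  from kc[OF 1 2] have "AL x (qc ^ m * y) / \<theta> x + pd / \<theta> (- (qc ^ m * exp w)) = kc w'"
   unfolding el x_def[symmetric] pd_def using Q_int_L[of l "int m"] l(1) by (simp add: l'_def P_eq_0_iff)
  hence "AL x (qc ^ m * y) / \<theta> x = kc w' - pd / \<theta> (- (qc ^ m * exp w))" by (simp add: eq_diff_eq)
  thus ?thesis using x by (simp add: w'_def field_simps)
 qed
 have Tsum: "((%m. bc m * AL x (qc ^ m * y)) has_sum infsum F UNIV) UNIV"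
 proof -
  have "(F has_sum infsum F UNIV) (Sigma UNIV (%_. UNIV))" using has_sum_infsum[OF Fs] by simp
  from has_sum_SigmaD[OF this] row show ?thesis by simp
 qed
 have Dsum: "((%m. bc m / \<theta> (- (qc ^ m * exp w))) has_sum Dz (exp w)) UNIV"
  by (rule norm_summable_imp_has_sum[OF Dz_sums(2,1)]) (use z in auto)
 have "((%m. bc m * AL x (qc ^ m * y) * (1 / \<theta> x) + bc m / \<theta> (- (qc ^ m * exp w)) * pd) has_sum
   (infsum F UNIV * (1 / \<theta> x) + Dz (exp w) * pd)) UNIV"
  by (intro has_sum_add has_sum_cmult_left Tsum Dsum)
 also have "(%m. bc m * AL x (qc ^ m * y) * (1 / \<theta> x) + bc m / \<theta> (- (qc ^ m * exp w)) * pd) = (%m. bc m * kc (w + of_nat m * lc))"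
  unfolding AL using x by (simp add: fun_eq_iff algebra_simps)
 finally have kap: "kap w = infsum F UNIV * (1 / \<theta> x) + Dz (exp w) * pd"
  unfolding kap_def by (rule infsumI)
 have "((%n. of_real (qb q n) * x powi n * B1 (qc powi n * y)) has_sum infsum F UNIV) UNIV"
 proof (rule iterated_has_sum[OF Fs row _ Tsum])
  fix n :: int
  have th: "qc powi n * y \<in> B1dom"
   using theta_powi[OF y(1), of n] y q_pos by (simp add: B1dom_def)
  have "(%m. bc m / (1 + qc powi n * y * qc powi (int m - 1))) sums B1 (qc powi n * y)"
   unfolding B1_def by (rule summable_sums[OF summable_norm_cancel[OF B1_summable[OF th]]])
  from has_sum_cmult_right[OF norm_summable_imp_has_sum[OF B1_summable[OF th] this], of "of_real (qb q n) * x powi n"]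
  have X: "((%m. of_real (qb q n) * x powi n * (bc m / (1 + qc powi n * y * qc powi (int m - 1)))) has_sum of_real (qb q n) * x powi n * B1 (qc powi n * y)) UNIV" .
  have "qc powi n * y * qc powi (int m - 1) = y * qc powi (n + int m - 1)" for m
  proof -
   have "qc powi (n + int m - 1) = qc powi n * qc powi (int m - 1)"
    using q_pos by (subst power_int_add[symmetric]) (auto simp: algebra_simps)
   thus ?thesis by (simp add: mult_ac)
  qed
  from X[unfolded this] show "((%m. F (m, n)) has_sum of_real (qb q n) * x powi n * B1 (qc powi n * y)) UNIV"
   by (simp add: F_def mult_ac)
 qed
 from has_sum_cmult_left[OF this, of "1 / \<theta> x"]
 have "((%n. of_real (qb q n) * x powi n * B1 (qc powi n * y) * (1 / \<theta> x)) has_sum infsum F UNIV * (1 / \<theta> x)) UNIV" .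
 also have "infsum F UNIV * (1 / \<theta> x) = kap w - pd * Dz (exp w)" unfolding kap by simp
 also have "(%n. of_real (qb q n) * x powi n * B1 (qc powi n * y) * (1 / \<theta> x)) = lat B1 y (exp w)"
 proof
  fix n
  have "qc powi n * y / exp w = qc powi n * x" by (simp add: x_def y_def exp_diff)
  thus "of_real (qb q n) * x powi n * B1 (qc powi n * y) * (1 / \<theta> x) = B1 (qc powi n * y) / \<theta> (qc powi n * y / exp w)"
   using theta_powi_inverse[OF x, of "B1 (qc powi n * y)" n] by (simp add: mult_ac)
 qed
 finally show ?thesis by (simp add: y_def pd_def)
qed

end

context heine
begin

section \<open>Folding the Laplace transforms\<close>

abbreviation at_slit :: "complex filter" where
 "at_slit \<equiv> inf at_infinity (principal (- \<real>\<^sub>\<le>\<^sub>0))"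
abbreviation jmp :: "complex \<Rightarrow> complex" where
 "jmp w \<equiv> of_real (2 * pi * Cq q) * \<i> * S (exp w) * E (w + ipi)"

text \<open>The discrete transforms along the positive axis are known up to a common term \<open>kp\<close>, and
the Gaussian transform converges.\<close>

definition foldable :: "(complex \<Rightarrow> complex) \<Rightarrow> (complex \<Rightarrow> complex) \<Rightarrow> bool" where
 "foldable B kp \<longleftrightarrow>
  (\<forall>x. integrable lborel (%s. B (of_real (exp s)) * E (of_real (s - x)))) \<and>
  (\<forall>w (s::real). \<theta> (- exp w) ~= 0 \<longrightarrow> \<theta> (exp (of_real s - w)) ~= 0 \<longrightarrow>
    (lat B (of_real (exp s)) (exp w) has_sum
     (kp w - (Q (of_real s) - Q (of_real s - w)) * Dz (exp w))) UNIV)"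

definition GE :: "(complex \<Rightarrow> complex) \<Rightarrow> complex \<Rightarrow> complex" where
 "GE B w = of_real (Cq q) * (\<integral>s. B (of_real (exp s)) * E (of_real s - w) \<partial>lborel)"

definition GT :: "(complex \<Rightarrow> complex) \<Rightarrow> complex \<Rightarrow> complex" where
 "GT B w = - (1 / lc) * (\<integral>s. B (of_real (exp s)) / \<theta> (exp (of_real s - w)) \<partial>lborel)"

lemma holomorphic_GE:
 assumes "\<And>x. integrable lborel (%s. B (of_real (exp s)) * E (of_real (s - x)))"
 shows "GE B holomorphic_on UNIV"
 unfolding GE_def[abs_def] by (intro holomorphic_on_mult holomorphic_on_const Gaussian_transform_entire(2) assms)

lemma holomorphic_GT:
 assumes "\<And>x. integrable lborel (%s. B (of_real (exp s)) * E (of_real (s - x)))"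
 shows "GT B holomorphic_on strip"
 unfolding GT_def[abs_def] by (intro holomorphic_on_mult holomorphic_on_const theta_transform_holomorphic(2) assms)

lemma exp_shift: "complex_of_real (exp (s + of_int n * L)) = qc powi n * of_real (exp s)"
proof -
 have "complex_of_real (exp (s + of_int n * L)) = exp (of_real s + of_int n * lc)"
  by (simp only: exp_of_real[symmetric] of_real_add of_real_mult of_real_of_int_eq)
 also have "\<dots> = exp (of_real s) * qc powi n" by (simp only: exp_add exp_int_L)
 finally show ?thesis by (simp add: exp_of_real mult.commute)
qed

lemma PI_P_shift: "PI (%s. P (of_real s - w)) = - lc"
proof -
 have "P holomorphic_on UNIV" by (intro holomorphic_intros)
 from period_integral_shift[OF L_neg open_UNIV convex_UNIV this, of "- w"]
 have "PI (%s. P (of_real s + - w)) = PI (%s. P (of_real s))" by simp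
 thus ?thesis by (simp add: PI_P)
qed

lemma PI_mult: "PI (%s. a * f s) = a * PI f"
 by (simp add: set_lebesgue_integral_def mult_scaleR_right[symmetric] del: mult_scaleR_right)

text \<open>The lattice sum of the Gaussian kernel is the weight \<open>P\<close>, so the transform is a weighted mean of
discrete transforms; the same mean of \<open>Pd\<close> is \<open>Pc\<close>.\<close>

lemma fold_GE:
 assumes B: "foldable B kp" and w: "\<theta> (- exp w) ~= 0"
 shows "GE B w = kp w - Pc q w * Dz (exp w)"
proof -
 define N where "N = {s::real. P (of_real s - w) = 0}"
 define H where "H = (%s. P (of_real s - w) * (kp w - (Q (of_real s) - Q (of_real s - w)) * Dz (exp w)))"
 define F where "F = (%s. H s * (1 / (- lc * of_real (Cq q))))"
 define f where "f = (%s. B (of_real (exp s)) * E (of_real s - w))"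
 have CL: "- lc * of_real (Cq q) ~= 0" using Cq_pos by simp
 have fi: "integrable lborel f"
  unfolding f_def by (rule Gaussian_transform_entire(1)) (use B in \<open>simp add: foldable_def\<close>)
 have hs: "((%n::int. f (s + of_int n * L)) has_sum F s) UNIV" if s: "s \<in> {L..0}" "s \<notin> N" for s
 proof -
  define x where "x = exp (of_real s - w)"
  have x: "x ~= 0" "\<theta> x ~= 0" using s by (auto simp: x_def N_def P_eq_0_iff)
  have "((%n::int. B (qc powi n * of_real (exp s)) / \<theta> (qc powi n * of_real (exp s) / exp w) * (E (of_real s - w) * \<theta> x)) has_sum
     (kp w - (Q (of_real s) - Q (of_real s - w)) * Dz (exp w)) * (E (of_real s - w) * \<theta> x)) UNIV"
   using B w x by (intro has_sum_cmult_left) (simp add: foldable_def x_def)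
  also have "(kp w - (Q (of_real s) - Q (of_real s - w)) * Dz (exp w)) * (E (of_real s - w) * \<theta> x) = F s"
   using CL Cq_pos by (simp add: F_def H_def P_eq x_def)
  also have "(%n::int. B (qc powi n * of_real (exp s)) / \<theta> (qc powi n * of_real (exp s) / exp w) * (E (of_real s - w) * \<theta> x)) = (%n. f (s + of_int n * L))"
  proof
   fix n
   have 1: "qc powi n * of_real (exp s) / exp w = qc powi n * x" by (simp add: x_def exp_diff exp_of_real)
   have 2: "of_real (s + of_int n * L) - w = (of_real s - w) + of_int n * lc" by simp
   have "f (s + of_int n * L) = B (qc powi n * of_real (exp s)) * (E (of_real s - w) * x powi n * of_real (qb q n))"
    unfolding f_def exp_shift 2 E_powi x_def ..
   thus "B (qc powi n * of_real (exp s)) / \<theta> (qc powi n * of_real (exp s) / exp w) * (E (of_real s - w) * \<theta> x) = f (s + of_int n * L)"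
    unfolding 1 theta_powi_inverse[OF x] using x by simp
  qed
  finally show ?thesis .
 qed
 have cN: "countable N" unfolding N_def by (rule countable_P_zeros)
 note per = periodization[OF L_neg fi cN hs]
 have Hi: "set_integrable lborel {L..0} H"
 proof -
  have "set_integrable lborel {L..0} (%s. - lc * of_real (Cq q) * F s)" by (rule set_integrable_mult_right) (use per(1) in simp)
  moreover have "(%s. - lc * of_real (Cq q) * F s) = H" using Cq_pos by (simp add: F_def fun_eq_iff)
  ultimately show ?thesis by simp
 qed
 define G where "G = (%s. P (of_real s - w) * (Q (of_real s) - Q (of_real s - w)))"
 have Pi: "set_integrable lborel {L..0} (%s. kp w * P (of_real s - w))"
  by (intro set_integrable_mult_right borel_integrable_atLeastAtMost' cont_P_shift)
 have "Dz (exp w) * PI G = PI (%s. Dz (exp w) * G s)" by (rule PI_mult[symmetric])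
 also have "\<dots> = PI (%s. kp w * P (of_real s - w) - H s)"
  by (simp add: G_def H_def algebra_simps)
 also have "\<dots> = PI (%s. kp w * P (of_real s - w)) - PI H"
  by (rule set_integral_diff(2)[OF Pi Hi])
 also have "PI (%s. kp w * P (of_real s - w)) = - lc * kp w" by (simp add: PI_mult PI_P_shift)
 finally have PIH: "PI H = - lc * kp w - Dz (exp w) * PI G" by simp
 have "GE B w = of_real (Cq q) * integral\<^sup>L lborel f" unfolding GE_def f_def ..
 also have "integral\<^sup>L lborel f = PI F" by (rule per(2))
 also have "PI F = 1 / (- lc * of_real (Cq q)) * PI H"
  unfolding F_def by (subst PI_mult[symmetric]) (simp only: mult.commute)
 also have "of_real (Cq q) * (1 / (- lc * of_real (Cq q)) * PI H) = - (1 / lc) * PI H"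
  using Cq_pos by (simp add: field_simps)
 also have "\<dots> = kp w - (- (1 / lc) * PI G) * Dz (exp w)" unfolding PIH by (simp add: field_simps)
 also have "- (1 / lc) * PI G = Pc q w" unfolding G_def by (rule Pc_integral[symmetric])
 finally show ?thesis .
qed

lemma strip_minus: "w \<in> strip ==> of_real s - w \<in> strip"
 using strip_shift(1)[OF strip_shift(2), of w s] by (simp add: add.commute)

lemma fold_GT:
 assumes B: "foldable B kp" and ws: "w \<in> strip" and w: "\<theta> (- exp w) ~= 0"
 shows "GT B w = kp w"
proof -
 define F where "F = (%s. kp w - (Q (of_real s) - Q (of_real s - w)) * Dz (exp w))"
 define f where "f = (%s. B (of_real (exp s)) / \<theta> (exp (of_real s - w)))"
 have fi: "integrable lborel f"
  unfolding f_def by (rule theta_transform_holomorphic(1)[OF _ ws]) (use B in \<open>simp add: foldable_def\<close>)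
 have hs: "((%n::int. f (s + of_int n * L)) has_sum F s) UNIV" if s: "s \<in> {L..0}" "s \<notin> {}" for s
 proof -
  have "\<theta> (exp (of_real s - w)) ~= 0" by (rule theta_exp_strip_nz[OF strip_minus[OF ws]])
  hence "(lat B (of_real (exp s)) (exp w) has_sum F s) UNIV"
   using B w by (simp add: foldable_def F_def)
  also have "lat B (of_real (exp s)) (exp w) = (%n. f (s + of_int n * L))"
  proof
   fix n
   have "exp (of_real (s + of_int n * L) - w) = qc powi n * of_real (exp s) / exp w"
    unfolding exp_shift[symmetric] by (simp only: exp_diff exp_of_real)
   thus "B (qc powi n * of_real (exp s)) / \<theta> (qc powi n * of_real (exp s) / exp w) = f (s + of_int n * L)"
    unfolding f_def exp_shift by simp
  qed
  finally show ?thesis .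
 qed
 note per = periodization[OF L_neg fi countable_empty hs]
 have ki: "set_integrable lborel {L..0} (%s. kp w)"
  by (intro borel_integrable_atLeastAtMost' continuous_intros)
 have "0 = Dz (exp w) * PI (%s. Q (of_real s) - Q (of_real s - w))" using PI_Pd_zero[OF ws] by simp
 also have "\<dots> = PI (%s. Dz (exp w) * (Q (of_real s) - Q (of_real s - w)))" by (rule PI_mult[symmetric])
 also have "\<dots> = PI (%s. kp w - F s)" by (simp add: F_def mult.commute)
 also have "\<dots> = PI (%s. kp w) - PI F" by (rule set_integral_diff(2)[OF ki per(1)])
 also have "PI (%s. kp w) = - lc * kp w" by (rule PI_const)
 finally have "PI F = - lc * kp w" by simp
 moreover have "GT B w = - (1 / lc) * integral\<^sup>L lborel f" unfolding GT_def f_def ..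
 moreover have "integral\<^sup>L lborel f = PI F" by (rule per(2))
 ultimately show ?thesis by simp
qed

lemma ex_real_theta_nz: "\<exists>s::real. \<theta> (exp (of_real s - w)) ~= 0"
proof (rule ccontr)
 assume "\<not> ?thesis"
 hence "{s::real. P (of_real s - w) = 0} = UNIV" by (auto simp: P_eq_0_iff)
 hence "countable (UNIV :: real set)" using countable_P_zeros[of w] by simp
 thus False using uncountable_UNIV_real by blast
qed

text \<open>The discrete transform is a single-valued function of \<open>exp w\<close>, so \<open>kp\<close> changes like \<open>Pd\<close>.\<close>

lemma kappa_jump:
 assumes B: "foldable B kp" and w: "\<theta> (- exp w) ~= 0"
 shows "kp (w + \<omega>) = kp w + \<omega> / lc * Dz (exp w)"
proof -
 obtain s :: real where s: "\<theta> (exp (of_real s - w)) ~= 0" using ex_real_theta_nz by blast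
 define v where "v = w + \<omega>"
 have ev: "exp v = exp w" unfolding v_def by (rule exp_2pi)
 have sv: "of_real s - v + \<omega> = of_real s - w" by (simp add: v_def)
 have e: "exp (of_real s - v) = exp (of_real s - w)" using exp_2pi[of "of_real s - v"] unfolding sv by simp
 have Qv: "Q (of_real s - w) = Q (of_real s - v) + \<omega> / lc"
  using Q_2pi[of "of_real s - v"] unfolding sv .
 have 1: "(lat B (of_real (exp s)) (exp w) has_sum
     (kp w - (Q (of_real s) - Q (of_real s - w)) * Dz (exp w))) UNIV"
  using B w s by (simp add: foldable_def)
 have "\<theta> (- exp v) ~= 0" "\<theta> (exp (of_real s - v)) ~= 0" using w s by (simp_all only: ev e not_False_eq_True)
 with B have "(lat B (of_real (exp s)) (exp v) has_sum
     (kp v - (Q (of_real s) - Q (of_real s - v)) * Dz (exp v))) UNIV"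
  unfolding foldable_def by blast
 from has_sum_unique[OF 1 this[unfolded ev]] show ?thesis
  unfolding Qv v_def[symmetric] by (simp add: algebra_simps)
qed

text \<open>The jumps of \<open>kp\<close> and \<open>Pc\<close> cancel except for the term with \<open>P\<close>. At the powers of \<open>q\<close> the formula
follows by continuation, as both sides are entire.\<close>

lemma GE_jump:
 assumes B: "foldable B kp"
 shows "GE B (w + \<omega>) = GE B w - jmp w"
proof -
 have GE: "GE B holomorphic_on UNIV" by (rule holomorphic_GE) (use B in \<open>simp add: foldable_def\<close>)
 define U where "U = {w. \<theta> (- exp w) ~= 0}"
 have U: "open U" unfolding U_def
  by (rule open_Collect_neq) (auto intro!: holomorphic_on_imp_continuous_on holomorphic_intros)
 have "ipi \<in> U" using theta_nz_pos[of 1] by (simp add: U_def)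
 hence U0: "U ~= {}" by blast
 show ?thesis
 proof (rule analytic_continuation_open[of U UNIV "%w. GE B (w + \<omega>)"
    "%w. GE B w - jmp w", OF U open_UNIV U0])
  show "(%w. GE B (w + \<omega>)) holomorphic_on UNIV"
   by (rule holomorphic_on_compose_gen[OF _ GE, unfolded o_def]) (auto intro!: holomorphic_intros)
  have "(%w. S (exp w)) holomorphic_on UNIV"
   by (rule holomorphic_on_compose_gen[OF _ S_hol, unfolded o_def]) (auto intro!: holomorphic_intros)
  thus "(%w. GE B w - jmp w) holomorphic_on UNIV"
   by (intro holomorphic_intros GE)
  fix w assume "w \<in> U"
  hence w: "\<theta> (- exp w) ~= 0" by (simp add: U_def)
  define D where "D = Dz (exp w)"
  define J where "J = \<omega> / lc"
  define p where "p = P (w + ipi)"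
  have w2: "\<theta> (- exp (w + \<omega>)) ~= 0" using w by (simp only: exp_2pi not_False_eq_True)
  have e: "exp (w + ipi) = - exp w" by (simp add: exp_add)
  have "p * D = - lc * of_real (Cq q) * E (w + ipi) * S (exp w)"
   unfolding p_def D_def Dz_def P_eq e using w by simp
  hence pD: "J * (p * D) = - (jmp w)"
   by (simp add: J_def)
  have pc: "Pc q (w + \<omega>) = Pc q w + J * (1 - p)"
   using Pc_monodromy[of w] unfolding J_def p_def by (simp add: algebra_simps)
  have "GE B (w + \<omega>) = kp w + J * D - (Pc q w + J * (1 - p)) * D"
   unfolding fold_GE[OF B w2] exp_2pi kappa_jump[OF B w] pc D_def J_def ..
  also have "\<dots> = (kp w - Pc q w * D) + J * (p * D)" by (simp add: algebra_simps)
  also have "kp w - Pc q w * D = GE B w" unfolding fold_GE[OF B w] D_def ..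
  finally show "GE B (w + \<omega>) = GE B w - jmp w"
   unfolding pD by simp
 qed auto
qed

lemma foldable_B1: "foldable B1 kap"
 unfolding foldable_def
proof (intro conjI allI impI)
 show "integrable lborel (%s. B1 (of_real (exp s)) * E (of_real (s - x)))" for x by (rule B1_Gaussian)
 fix w and s :: real assume w: "\<theta> (- exp w) ~= 0" "\<theta> (exp (of_real s - w)) ~= 0"
 from B1_lattice[OF w(1) theta_exp_real_nz w(2)]
 show "(lat B1 (of_real (exp s)) (exp w) has_sum
   (kap w - (Q (of_real s) - Q (of_real s - w)) * Dz (exp w))) UNIV"
  by (simp only: exp_of_real)
qed

lemma foldable_sum:
 assumes e: "\<And>r. r \<ge> 0 ==> summable (%n. norm (e n) * r ^ n)"
  and B: "\<And>t::real. t > 0 ==> B (of_real t) = B1 (of_real t) + B2 e (of_real t)"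
 shows "foldable B (%w. kap w + eps e (exp w))"
 unfolding foldable_def
proof (intro conjI allI impI)
 fix x :: real
 have "integrable lborel (%s. B1 (of_real (exp s)) * E (of_real (s - x)) + B2 e (of_real (exp s)) * E (of_real (s - x)))"
  by (intro Bochner_Integration.integrable_add B1_Gaussian B2_Gaussian(1) e)
 also have "(%s. B1 (of_real (exp s)) * E (of_real (s - x)) + B2 e (of_real (exp s)) * E (of_real (s - x)))
   = (%s. B (of_real (exp s)) * E (of_real (s - x)))"
  using B[OF exp_gt_zero] by (simp add: fun_eq_iff distrib_right)
 finally show "integrable lborel (%s. B (of_real (exp s)) * E (of_real (s - x)))" .
next
 fix w and s :: real assume w: "\<theta> (- exp w) ~= 0" "\<theta> (exp (of_real s - w)) ~= 0"
 have th: "\<theta> (of_real (exp s) / exp w) ~= 0" using w(2) by (simp add: exp_diff exp_of_real)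
 have 1: "(lat B1 (of_real (exp s)) (exp w) has_sum
   (kap w - (Q (of_real s) - Q (of_real s - w)) * Dz (exp w))) UNIV"
  using foldable_B1 w by (simp add: foldable_def)
 have 2: "(lat (B2 e) (of_real (exp s)) (exp w) has_sum eps e (exp w)) UNIV"
  by (rule B2_lattice[OF e]) (use th in auto)
 have Bn: "B (qc powi n * of_real (exp s)) = B1 (qc powi n * of_real (exp s)) + B2 e (qc powi n * of_real (exp s))" for n
  unfolding exp_shift[symmetric] by (rule B) simp
 have "(lat B (of_real (exp s)) (exp w) has_sum
   (kap w - (Q (of_real s) - Q (of_real s - w)) * Dz (exp w) + eps e (exp w))) UNIV"
  using has_sum_add[OF 1 2] unfolding Bn add_divide_distrib .
 thus "(lat B (of_real (exp s)) (exp w) has_sum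
   (kap w + eps e (exp w) - (Q (of_real s) - Q (of_real s - w)) * Dz (exp w))) UNIV"
  by (simp add: algebra_simps)
qed

section \<open>The Cauchy-Heine integral\<close>

definition Kt :: "real \<Rightarrow> real" where "Kt s = 1 / Re (\<theta> (of_real (exp s)))"

lemma Kt: "complex_of_real (Kt s) = 1 / \<theta> (of_real (exp s))"
 unfolding Kt_def by (subst (2) theta_real_pos(1)) simp_all

lemma Kt_pos: "Kt s > 0"
 unfolding Kt_def using theta_real_pos(2)[of "exp s"] by simp

lemma Kt_L: "Kt (s + L) = Kt s * exp s"
proof -
 have "complex_of_real (exp (s + L)) = qc * of_real (exp s)" using exp_shift[of s 1] by simp
 hence "complex_of_real (Kt (s + L)) = of_real (Kt s * exp s)"
  using theta_q[of "of_real (exp s)"] by (simp add: Kt)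
 thus ?thesis by (simp only: of_real_eq_iff)
qed

lemma Kt_reflect: "Kt (L - s) = Kt s"
proof -
 have "complex_of_real (exp (L - s)) = qc / of_real (exp s)" using q_pos by (simp add: exp_diff)
 hence "complex_of_real (Kt (L - s)) = of_real (Kt s)"
  using theta_qc_div[of "of_real (exp s)"] by (simp add: Kt)
 thus ?thesis by (simp only: of_real_eq_iff)
qed

lemma Er_integrable_C: "integrable lborel (%s. 1 * E (of_real (s - x)))"
 unfolding E_of_real mult_1_left diff_conv_add_uminus[of _ x]
 by (intro integrable_of_real integrable_shift_real integrable_Er)

lemma integrable_Kt: "integrable lborel Kt"
proof -
 have "integrable lborel (%s. 1 / \<theta> (exp (of_real s - 0)))"
  by (rule theta_transform_holomorphic(1)[OF Er_integrable_C strip_shift(3)])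
 hence "integrable lborel (%s. complex_of_real (Kt s))" by (simp add: Kt exp_of_real)
 from integrable_Re[OF this] show ?thesis by simp
qed

lemma cont_Kt: "continuous_on A Kt"
proof -
 have "continuous_on A (%s. \<theta> (of_real (exp s)))"
  by (rule continuous_on_compose2[OF holomorphic_on_imp_continuous_on[OF holomorphic_theta]])
   (auto intro!: continuous_intros)
 thus ?thesis unfolding Kt_def[abs_def]
  by (intro continuous_intros) (use theta_real_pos(2) in \<open>auto simp: less_imp_neq[symmetric]\<close>)
qed

definition dz :: "real \<Rightarrow> complex" where "dz s = Dz (- of_real (exp s))"

lemma dz_sums: "(%m. bc m * of_real (Kt (s + real m * L))) sums dz s" "summable (%m. norm (bc m * of_real (Kt (s + real m * L))))"
proof -
 have e: "bc m / \<theta> (- (qc ^ m * (- of_real (exp s)))) = bc m * of_real (Kt (s + real m * L))" for m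
  unfolding Kt using exp_shift[of s "int m"] by simp
 have z: "- complex_of_real (exp s) ~= 0" "\<theta> (- (- complex_of_real (exp s))) ~= 0"
  using theta_nz_pos[of "exp s"] by auto
 show "(%m. bc m * of_real (Kt (s + real m * L))) sums dz s" "summable (%m. norm (bc m * of_real (Kt (s + real m * L))))"
  using Dz_sums[OF z] unfolding e dz_def by auto
qed

lemma summable_bc_integral: "summable (%m. \<integral>s. norm (bc m * of_real (Kt (s + real m * L))) \<partial>lborel)"
proof (rule summable_comparison_test')
 define I where "I = (\<integral>s. Kt s \<partial>lborel)"
 have I0: "I \<ge> 0" unfolding I_def using Kt_pos by (intro integral_nonneg_AE AE_I2 less_imp_le) auto
 show "summable (%m. C0 * c ^ m * I)" by (intro summable_mult2 c_summable)
 fix m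
 have "(\<integral>s. norm (bc m * of_real (Kt (s + real m * L))) \<partial>lborel) = (\<integral>s. norm (bc m) * Kt (s + real m * L) \<partial>lborel)"
  using Kt_pos by (simp add: norm_mult abs_of_pos)
 also have "\<dots> = norm (bc m) * I" by (simp add: I_def integral_shift_real)
 finally have "(\<integral>s. norm (bc m * of_real (Kt (s + real m * L))) \<partial>lborel) = norm (bc m) * I" .
 moreover have "norm (bc m) * I \<le> C0 * c ^ m * I" by (intro mult_right_mono bc_bound I0)
 ultimately show "norm (\<integral>s. norm (bc m * of_real (Kt (s + real m * L))) \<partial>lborel) \<le> C0 * c ^ m * I"
  using I0 by simp
qed

lemma integrable_dz: "integrable lborel dz"
proof -
 have i: "integrable lborel (%s. bc m * of_real (Kt (s + real m * L)))" for m
  by (intro integrable_mult_right integrable_of_real integrable_shift_real integrable_Kt)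
 have "integrable lborel (%s. \<Sum>m. bc m * of_real (Kt (s + real m * L)))"
  by (rule integrable_suminf[OF i AE_I2[OF dz_sums(2)] summable_bc_integral])
 thus ?thesis unfolding sums_unique[OF dz_sums(1), symmetric] .
qed

definition CHI :: "complex \<Rightarrow> complex" where
 "CHI z = (\<integral>s. dz s * (of_real (exp s) / (of_real (exp s) + z)) \<partial>lborel)"

lemma CHI_set_integral:
 "set_integrable lborel {0<..} (%t. S (- of_real t) / (\<theta> (of_real t) * (of_real t + z)))
  \<longleftrightarrow> integrable lborel (%s. dz s * (of_real (exp s) / (of_real (exp s) + z)))"
 "set_lebesgue_integral lborel {0<..} (%t. S (- of_real t) / (\<theta> (of_real t) * (of_real t + z))) = CHI z"
proof -
 define f where "f = (%t::real. of_real t * (S (- of_real t) / (\<theta> (of_real t) * (of_real t + z))))"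
 have 1: "set_integrable lborel {0<..} (%t. S (- of_real t) / (\<theta> (of_real t) * (of_real t + z)))
   \<longleftrightarrow> set_integrable lborel {0<..} (%t. f t / of_real t)"
  unfolding set_integrable_def by (intro Bochner_Integration.integrable_cong refl) (auto simp: f_def indicator_def)
 have 2: "set_lebesgue_integral lborel {0<..} (%t. S (- of_real t) / (\<theta> (of_real t) * (of_real t + z)))
   = set_lebesgue_integral lborel {0<..} (%t. f t / of_real t)"
  unfolding set_lebesgue_integral_def by (intro Bochner_Integration.integral_cong refl) (auto simp: f_def indicator_def)
 have 3: "(%s. f (exp s)) = (%s. dz s * (of_real (exp s) / (of_real (exp s) + z)))"
  by (simp add: f_def dz_def Dz_def fun_eq_iff)
 show "set_integrable lborel {0<..} (%t. S (- of_real t) / (\<theta> (of_real t) * (of_real t + z)))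
  \<longleftrightarrow> integrable lborel (%s. dz s * (of_real (exp s) / (of_real (exp s) + z)))"
  unfolding 1 exp_substitution(1) 3 ..
 show "set_lebesgue_integral lborel {0<..} (%t. S (- of_real t) / (\<theta> (of_real t) * (of_real t + z))) = CHI z"
  unfolding 2 exp_substitution(2) 3 CHI_def ..
qed

text \<open>On the positive axis the reflection \<open>t \<mapsto> q * z / t\<close>, applied to each term of the series with its own
shift, turns the Cauchy-Heine integral into the theta transform of \<open>B1\<close>.\<close>

lemma CHI_real: "CHI (exp (of_real y)) = (\<integral>s. B1 (of_real (exp s)) / \<theta> (exp (of_real s - of_real y)) \<partial>lborel)"
proof -
 define f where "f = (%m s. bc m * of_real (Kt (s + real m * L) * (exp s / (exp s + exp y))))"
 \<comment> \<open>The centre of the reflection \<open>s \<mapsto> L + y - s\<close> after the shift by \<open>m * L\<close> in the \<open>m\<close>-th term.\<close>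
 define a where "a = (%m. (1 - real m) * L + y)"
 have rpos: "exp s / (exp s + exp y) \<ge> 0" "exp s / (exp s + exp y) \<le> 1" for s :: real
  by (auto simp: divide_le_eq add_pos_pos intro!: divide_nonneg_nonneg)
 have nf: "norm (f m s) \<le> norm (bc m * of_real (Kt (s + real m * L)))" for m s
 proof -
  have "norm (f m s) = norm (bc m) * (Kt (s + real m * L) * (exp s / (exp s + exp y)))"
   using Kt_pos[of "s + real m * L"] rpos(1)[of s] unfolding f_def norm_mult norm_of_real
   by (subst abs_of_nonneg) (auto intro: mult_nonneg_nonneg)
  also have "\<dots> \<le> norm (bc m) * (Kt (s + real m * L) * 1)"
   using Kt_pos[of "s + real m * L"] rpos(2)[of s] by (intro mult_left_mono) auto
  also have "\<dots> = norm (bc m * of_real (Kt (s + real m * L)))"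
   using Kt_pos[of "s + real m * L"] by (simp add: norm_mult)
  finally show ?thesis .
 qed
 have i0: "integrable lborel (%s. bc m * of_real (Kt (s + real m * L)))" for m
  by (intro integrable_mult_right integrable_of_real integrable_shift_real integrable_Kt)
 have fi: "integrable lborel (f m)" for m
 proof (rule Bochner_Integration.integrable_bound[OF i0[of m] _ AE_I2[OF nf]])
  have "continuous_on UNIV (%s. Kt (s + real m * L))"
   by (rule continuous_on_compose2[OF cont_Kt[of UNIV]]) (auto intro!: continuous_intros)
  moreover have "exp s + exp y ~= 0" for s :: real using add_pos_pos[of "exp s" "exp y"] by simp
  ultimately have "continuous_on UNIV (f m)" unfolding f_def by (intro continuous_intros) auto
  thus "f m \<in> borel_measurable lborel" by (simp add: borel_measurable_continuous_onI)
 qed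
 have fs: "summable (%m. norm (f m s))" for s
  by (rule summable_comparison_test'[OF dz_sums(2)[of s]]) (use nf in simp)
 have fI: "summable (%m. \<integral>s. norm (f m s) \<partial>lborel)"
 proof (rule summable_comparison_test'[OF summable_bc_integral])
  fix m
  have "(\<integral>s. norm (f m s) \<partial>lborel) \<le> (\<integral>s. norm (bc m * of_real (Kt (s + real m * L))) \<partial>lborel)"
   by (intro integral_mono integrable_norm fi i0 nf)
  thus "norm (\<integral>s. norm (f m s) \<partial>lborel) \<le> (\<integral>s. norm (bc m * of_real (Kt (s + real m * L))) \<partial>lborel)"
   by simp
 qed
 have sum_f: "(\<Sum>m. f m s) = dz s * (of_real (exp s) / (of_real (exp s) + exp (of_real y)))" for s
 proof -
  have "(%m. bc m * of_real (Kt (s + real m * L)) * of_real (exp s / (exp s + exp y))) sums (dz s * of_real (exp s / (exp s + exp y)))"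
   by (intro sums_mult2 dz_sums)
  moreover have "(%m. bc m * of_real (Kt (s + real m * L)) * of_real (exp s / (exp s + exp y))) = (%m. f m s)"
   by (simp add: f_def fun_eq_iff)
  ultimately have "(%m. f m s) sums (dz s * of_real (exp s / (exp s + exp y)))" by simp
  from sums_unique[OF this] show ?thesis by (simp add: exp_of_real)
 qed
 have L1: "(%m. \<integral>s. f m s \<partial>lborel) sums CHI (exp (of_real y))"
  using sums_integral[OF fi AE_I2[OF fs] fI] unfolding sum_f CHI_def .
 define h where "h = (%m s. f m (a m + (- 1) * s))"
 have hi: "integrable lborel (h m)" for m
  unfolding h_def by (rule lborel_integrable_real_affine[OF fi]) simp
 have hI: "(\<integral>s. f m s \<partial>lborel) = (\<integral>s. h m s \<partial>lborel)" for m
  unfolding h_def by (subst lborel_integral_real_affine[of "- 1" "f m" "a m"]) simp_all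
 have hnI: "(\<integral>s. norm (f m s) \<partial>lborel) = (\<integral>s. norm (h m s) \<partial>lborel)" for m
  unfolding h_def by (subst lborel_integral_real_affine[of "- 1" "%s. norm (f m s)" "a m"]) simp_all
 have h_eq: "h m s = bc m / (1 + of_real (exp s) * qc powi (int m - 1)) * (1 / \<theta> (exp (of_real s - of_real y)))" for m s
 proof -
  define u where "u = a m + (- 1) * s"
  have "u + real m * L = L - (s - y)" by (simp add: u_def a_def algebra_simps)
  hence 1: "complex_of_real (Kt (u + real m * L)) = 1 / \<theta> (exp (of_real s - of_real y))"
   by (simp add: Kt_reflect Kt exp_of_real[symmetric])
  have "exp u * (exp s * exp (real_of_int (int m - 1) * L)) = exp y"
   unfolding exp_add[symmetric] by (rule arg_cong[of _ _ exp]) (simp add: u_def a_def algebra_simps)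
  moreover have "exp (real_of_int (int m - 1) * L) = q powi (int m - 1)"
  proof -
   have "complex_of_real (exp (0 + real_of_int (int m - 1) * L)) = of_real (q powi (int m - 1))"
    unfolding exp_shift by simp
   thus ?thesis by (simp only: of_real_eq_iff add_0_left)
  qed
  ultimately have "exp u + exp y = exp u * (1 + exp s * q powi (int m - 1))" by (simp add: algebra_simps)
  hence "exp u / (exp u + exp y) = 1 / (1 + exp s * q powi (int m - 1))" by simp
  hence 2: "complex_of_real (exp u / (exp u + exp y)) = 1 / (1 + of_real (exp s) * qc powi (int m - 1))"
   by simp
  show ?thesis unfolding h_def u_def[symmetric] f_def of_real_mult 1 2 by simp
 qed
 have sum_h: "(%m. h m s) sums (B1 (of_real (exp s)) / \<theta> (exp (of_real s - of_real y)))"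
  "summable (%m. norm (h m s))" for s
 proof -
  have d: "of_real (exp s) \<in> B1dom" by (rule pos_in_B1dom) simp
  have "(%m. bc m / (1 + of_real (exp s) * qc powi (int m - 1))) sums B1 (of_real (exp s))"
   unfolding B1_def by (rule summable_sums[OF summable_norm_cancel[OF B1_summable[OF d]]])
  from sums_mult2[OF this, of "1 / \<theta> (exp (of_real s - of_real y))"]
  show "(%m. h m s) sums (B1 (of_real (exp s)) / \<theta> (exp (of_real s - of_real y)))" unfolding h_eq by simp
  show "summable (%m. norm (h m s))" unfolding h_eq norm_mult by (intro summable_mult2 B1_summable d)
 qed
 have "(%m. \<integral>s. h m s \<partial>lborel) sums (\<integral>s. (\<Sum>m. h m s) \<partial>lborel)"
  by (rule sums_integral[OF hi AE_I2[OF sum_h(2)]]) (use fI hnI in simp)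
 with L1 show ?thesis unfolding hI sums_unique[OF sum_h(1), symmetric] using sums_unique2 by blast
qed

text \<open>If \<open>Im z \<noteq> 0\<close> use the imaginary part of \<open>(t + z) * cnj z\<close>, which is \<open>- t * Im z\<close>.\<close>

lemma cone_bound:
 assumes "(z0 :: complex) \<notin> \<real>\<^sub>\<le>\<^sub>0"
 shows "\<exists>r>0. \<exists>d>0. \<forall>z\<in>ball z0 r. \<forall>t>0. t \<le> d * norm (of_real t + z)"
proof (cases "Im z0 = 0")
 case True
 hence pos: "Re z0 > 0" using assms by (auto simp: complex_nonpos_Reals_iff)
 have "t \<le> 1 * norm (of_real t + z)" if "z \<in> ball z0 (Re z0)" "t > 0" for z t
 proof -
  have "\<bar>Re z - Re z0\<bar> < Re z0" using that(1) abs_Re_le_cmod[of "z - z0"] by (simp add: dist_norm norm_minus_commute)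
  thus ?thesis using abs_Re_le_cmod[of "of_real t + z"] by simp
 qed
 thus ?thesis using pos zero_less_one by blast
next
 case False
 define r where "r = \<bar>Im z0\<bar> / 2"
 have r: "r > 0" using False by (simp add: r_def)
 have "t \<le> ((norm z0 + r) / r) * norm (of_real t + z)" if z: "z \<in> ball z0 r" and t: "t > 0" for z t
 proof -
  have d: "norm (z - z0) < r" using z by (simp add: dist_norm norm_minus_commute)
  have "\<bar>Im z - Im z0\<bar> < r" using d abs_Im_le_cmod[of "z - z0"] by simp
  hence im: "\<bar>Im z\<bar> \<ge> r" unfolding r_def by (simp add: abs_if split: if_splits)
  have nz: "norm z \<le> norm z0 + r" using d norm_triangle_ineq2[of z z0] by simp
  have "t * r \<le> t * \<bar>Im z\<bar>" using im t by simp
  also have "\<dots> = \<bar>Im ((of_real t + z) * cnj z)\<bar>" using t by (simp add: algebra_simps abs_mult)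
  also have "\<dots> \<le> norm ((of_real t + z) * cnj z)" by (rule abs_Im_le_cmod)
  also have "\<dots> = norm (of_real t + z) * norm z" by (simp add: norm_mult)
  also have "\<dots> \<le> norm (of_real t + z) * (norm z0 + r)" by (intro mult_left_mono nz) simp
  finally show ?thesis using r by (simp add: field_simps)
 qed
 moreover have "(norm z0 + r) / r > 0" using r by (intro divide_pos_pos add_nonneg_pos) auto
 ultimately show ?thesis using r by blast
qed

lemma CHI_props:
 "z \<notin> \<real>\<^sub>\<le>\<^sub>0 ==> integrable lborel (%s. dz s * (of_real (exp s) / (of_real (exp s) + z)))"
 "CHI holomorphic_on (- \<real>\<^sub>\<le>\<^sub>0)"
proof -
 have meas: "(%s. dz s * (of_real (exp s) / (of_real (exp s) + z))) \<in> borel_measurable lborel" for z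
  by (intro borel_measurable_times borel_measurable_divide borel_measurable_add borel_measurable_integrable[OF integrable_dz])
   (auto intro!: borel_measurable_continuous_onI continuous_intros)
 have dom: "\<exists>r>0. \<exists>G. integrable lborel G \<and> (\<forall>s. \<forall>z\<in>ball z0 r \<inter> - \<real>\<^sub>\<le>\<^sub>0. norm (dz s * (of_real (exp s) / (of_real (exp s) + z))) \<le> G s)"
  if z0: "z0 \<notin> \<real>\<^sub>\<le>\<^sub>0" for z0
 proof -
  obtain r d where r: "r > 0" "d > (0::real)" and rd: "\<forall>z\<in>ball z0 r. \<forall>t>0. t \<le> d * norm (of_real t + z)"
   using cone_bound[OF z0] by blast
  have "norm (dz s * (of_real (exp s) / (of_real (exp s) + z))) \<le> d * norm (dz s)" if z: "z \<in> ball z0 r \<inter> - \<real>\<^sub>\<le>\<^sub>0" for s z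
  proof -
   have "exp s \<le> d * norm (of_real (exp s) + z)" using rd z by simp
   moreover from this have "norm (of_real (exp s) + z) > 0"
    using r(2) exp_gt_zero[of s] by (metis less_le_trans zero_less_mult_pos)
   ultimately have "exp s / norm (of_real (exp s) + z) \<le> d" by (simp add: pos_divide_le_eq)
   from mult_left_mono[OF this norm_ge_zero[of "dz s"]] show ?thesis
    by (simp add: norm_mult norm_divide mult.commute)
  qed
  thus ?thesis using r(1) integrable_dz by (intro exI[of _ r] conjI exI[of _ "%s. d * norm (dz s)"]) auto
 qed
 show "integrable lborel (%s. dz s * (of_real (exp s) / (of_real (exp s) + z)))" if z: "z \<notin> \<real>\<^sub>\<le>\<^sub>0"
 proof -
  obtain r G where r: "r > 0" and G: "integrable lborel G"
   "\<forall>s. \<forall>z'\<in>ball z r \<inter> - \<real>\<^sub>\<le>\<^sub>0. norm (dz s * (of_real (exp s) / (of_real (exp s) + z'))) \<le> G s"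
   using dom[OF z] by blast
  have "norm (dz s * (of_real (exp s) / (of_real (exp s) + z))) \<le> norm (G s)" for s
   using G(2)[rule_format, of z s] r z by simp
  thus ?thesis by (intro Bochner_Integration.integrable_bound[OF G(1)] meas AE_I2)
 qed
 show "CHI holomorphic_on (- \<real>\<^sub>\<le>\<^sub>0)"
  unfolding CHI_def[abs_def]
 proof (rule holomorphic_on_integral)
  show "open (- \<real>\<^sub>\<le>\<^sub>0 :: complex set)" by (simp add: open_Compl)
  have "of_real (exp s) + z ~= 0" if "z \<notin> \<real>\<^sub>\<le>\<^sub>0" for z and s :: real
  proof
   assume "of_real (exp s) + z = 0"
   hence "z = of_real (- exp s)" by (simp add: add_eq_0_iff)
   thus False using that by simp
  qed
  thus "(%z. dz s * (of_real (exp s) / (of_real (exp s) + z))) holomorphic_on - \<real>\<^sub>\<le>\<^sub>0" for s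
   by (intro holomorphic_intros) auto
  show "\<exists>r>0. \<exists>G. integrable lborel G \<and> (\<forall>s. \<forall>w\<in>ball w0 r \<inter> - \<real>\<^sub>\<le>\<^sub>0. norm (dz s * (of_real (exp s) / (of_real (exp s) + w))) \<le> G s)"
   if "w0 \<in> - \<real>\<^sub>\<le>\<^sub>0" for w0 using dom[of w0] that by simp
 qed (rule meas)
qed

lemma exp_strip: "w \<in> strip ==> exp w \<notin> \<real>\<^sub>\<le>\<^sub>0"
proof
 assume w: "w \<in> strip" "exp w \<in> \<real>\<^sub>\<le>\<^sub>0"
 hence "Im (exp w) = 0" "Re (exp w) \<le> 0" by (simp_all add: complex_nonpos_Reals_iff)
 hence sc: "exp (Re w) * sin (Im w) = 0" "exp (Re w) * cos (Im w) \<le> 0" by (simp_all only: Im_exp Re_exp)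
 have s0: "sin (Im w) = 0" using sc(1) by simp
 have b: "- pi < Im w" "Im w < pi" using w(1) unfolding strip_def by simp_all
 have "Im w = 0" by (rule sin_eq_0_pi[OF b s0])
 thus False using sc(2) by simp
qed

lemma CHI_GT: "w \<in> strip ==> - (1 / lc) * CHI (exp w) = GT B1 w"
proof -
 assume w: "w \<in> strip"
 define U where "U = range complex_of_real"
 have "- (1 / lc) * CHI (exp w) - GT B1 w = 0"
 proof (rule analytic_continuation[of "%w. - (1 / lc) * CHI (exp w) - GT B1 w" strip U 0 w])
  have "(%w. CHI (exp w)) holomorphic_on strip"
   by (rule holomorphic_on_compose_gen[OF _ CHI_props(2), unfolded o_def]) (auto intro!: holomorphic_intros dest: exp_strip)
  thus "(%w. - (1 / lc) * CHI (exp w) - GT B1 w) holomorphic_on strip"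
   by (intro holomorphic_intros holomorphic_GT B1_Gaussian)
  show "open strip" "connected strip" using strip_props convex_connected by auto
  show "U \<subseteq> strip" by (auto simp: U_def strip_def)
  show "0 islimpt U"
   unfolding islimpt_approachable U_def
  proof (intro allI impI)
   fix r :: real assume "r > 0"
   thus "\<exists>x'\<in>range complex_of_real. x' ~= 0 \<and> dist x' 0 < r"
    by (intro bexI[of _ "of_real (r / 2)"] conjI rangeI) (auto simp: norm_divide)
  qed
  fix z assume "z \<in> U"
  then obtain y where "z = of_real y" by (auto simp: U_def)
  thus "- (1 / lc) * CHI (exp z) - GT B1 z = 0" by (simp add: GT_def CHI_real)
 qed (use w in \<open>auto simp: strip_def\<close>)
 thus ?thesis by simp
qed

end

context heine
begin

section \<open>Decay at infinity\<close>

lemma Pc_bounded: "\<exists>b\<ge>0. \<forall>w. \<bar>Im w\<bar> \<le> pi \<longrightarrow> norm (Pc q w) \<le> b"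
proof -
 define K where "K = cbox (Complex L (- pi)) (Complex 0 pi)"
 have "continuous_on K (Pc q)"
  by (rule holomorphic_on_imp_continuous_on[OF holomorphic_on_subset[OF holomorphic_Pc]]) simp
 hence "bounded (Pc q ` K)"
  by (intro compact_imp_bounded compact_continuous_image) (simp_all add: K_def)
 then obtain b where b: "\<forall>x\<in>Pc q ` K. norm x \<le> b" unfolding bounded_iff by blast
 have "norm (Pc q u) \<le> max 0 b" if u: "\<bar>Im u\<bar> \<le> pi" for u
 proof (rule period_representative[OF u])
  fix n assume "u + of_int n * lc \<in> cbox (Complex L (- pi)) (Complex 0 pi)"
  hence "norm (Pc q (u + of_int n * lc)) \<le> b" using b unfolding K_def[symmetric] by blast
  thus ?thesis unfolding periodic_int[of "Pc q" lc, OF Pc_periodic] by simp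
 qed
 thus ?thesis by (intro exI[of _ "max 0 b"]) simp
qed

lemma qpoch_right_half: "Re a \<ge> 0 ==> norm (qpc (- a)) \<ge> 1"
proof -
 assume a: "Re a \<ge> 0"
 have "(%n. norm (\<Prod>i\<le>n. 1 - (- a) * qc ^ i)) \<longlonglongrightarrow> norm (qpc (- a))"
  unfolding qpoch_def by (intro tendsto_norm convergent_prod_LIMSEQ convergent_qpoch)
 moreover have "norm (\<Prod>i\<le>n. 1 - (- a) * qc ^ i) \<ge> 1" for n
 proof -
  have "norm (1 - (- a) * qc ^ i) \<ge> 1" for i
  proof -
   have "Re (a * qc ^ i) = Re a * q ^ i" by (simp flip: of_real_power)
   hence "Re (1 - (- a) * qc ^ i) \<ge> 1" using a q_pos by simp
   thus ?thesis using complex_Re_le_cmod order_trans by blast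
  qed
  thus ?thesis by (simp add: prod_norm[symmetric] prod_ge_1)
 qed
 ultimately show ?thesis by (intro LIMSEQ_le_const) auto
qed

lemma theta_lower_bound:
 assumes "Re \<tau> \<ge> 0" "\<tau> ~= 0"
 shows "norm (\<theta> \<tau>) \<ge> norm (qpc qc) * max 1 (norm \<tau>)"
proof -
 have "1 \<le> Re (1 + \<tau>)" using assms by simp
 hence 1: "max 1 (norm \<tau>) \<le> norm (1 + \<tau>)"
  using complex_Re_le_cmod[of "1 + \<tau>"] assms(1)
  by (auto simp: cmod_def power2_eq_square algebra_simps intro!: real_sqrt_le_mono)
 have "Re (\<tau> * qc) \<ge> 0" using assms(1) q_pos by simp
 from qpoch_right_half[OF this] have 2: "1 \<le> norm (qpc (- \<tau> * qc))" by simp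
 have "Re (qc / \<tau>) \<ge> 0" using assms(1) q_pos by (simp add: Re_divide)
 from qpoch_right_half[OF this] have 3: "1 \<le> norm (qpc (- (qc / \<tau>)))" .
 have "norm (\<theta> \<tau>) = norm (qpc qc) * (norm (1 + \<tau>) * norm (qpc (- \<tau> * qc)) * norm (qpc (- (qc / \<tau>))))"
  unfolding theta_eq using qpoch_rec[of "- \<tau>"] by (simp add: norm_mult)
 also have "\<dots> \<ge> norm (qpc qc) * (max 1 (norm \<tau>) * 1 * 1)"
  by (intro mult_left_mono mult_mono 1 2 3 mult_nonneg_nonneg) auto
 finally show ?thesis by simp
qed

lemma theta_right_nz: "Re \<tau> \<ge> 0 ==> \<tau> ~= 0 ==> \<theta> \<tau> ~= 0"
proof -
 assume t: "Re \<tau> \<ge> 0" "\<tau> ~= 0"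
 have "0 < norm (qpc qc) * max 1 (norm \<tau>)" by (intro mult_pos_pos) auto
 also have "\<dots> \<le> norm (\<theta> \<tau>)" by (rule theta_lower_bound[OF t])
 finally show ?thesis by simp
qed

text \<open>A majorant of \<open>B1\<close> on the positive axis and, up to a constant, of \<open>Dz\<close> in the left half plane.\<close>

definition H3 :: "real \<Rightarrow> real" where "H3 R = (\<Sum>m. C0 * c ^ m / max 1 (q ^ m * R))"

lemma H3_bound: "C0 * c ^ m / max 1 y \<le> C0 * c ^ m"
proof -
 have "C0 * c ^ m / max 1 y \<le> C0 * c ^ m / 1" using C0_nonneg c by (intro divide_left_mono) auto
 thus ?thesis by simp
qed

lemma H3_summable: "summable (%m. C0 * c ^ m / max 1 (q ^ m * R))"
 by (rule summable_comparison_test'[OF c_summable]) (use H3_bound C0_nonneg c in simp)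

lemma H3_nonneg: "H3 R \<ge> 0"
 unfolding H3_def using C0_nonneg c by (intro suminf_nonneg H3_summable) simp

lemma H3_tendsto: "(H3 \<longlongrightarrow> 0) at_top"
proof -
 have lim: "((%R. C0 * c ^ m / max 1 (q ^ m * R)) \<longlongrightarrow> 0) at_top" for m
 proof (rule tendsto_divide_0[OF tendsto_const filterlim_at_top_imp_at_infinity])
  have "filterlim (%R. q ^ m * R) at_top at_top"
   using q_pos by (intro filterlim_tendsto_pos_mult_at_top[OF tendsto_const _ filterlim_ident]) simp
  thus "filterlim (%R. max 1 (q ^ m * R)) at_top at_top"
   by (rule filterlim_at_top_mono) simp
 qed
 have "eventually (%(m, R). norm (C0 * c ^ m / max 1 (q ^ m * R)) \<le> C0 * c ^ m) (at_top \<times>\<^sub>F at_top)"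
  using H3_bound C0_nonneg c by (intro always_eventually) auto
 from tannerys_theorem[OF lim this c_summable] show ?thesis
  unfolding H3_def[abs_def] by simp
qed

lemma Dz_decay:
 assumes z: "Re z \<le> 0" "z ~= 0"
 shows "norm (Dz z) \<le> H3 (norm z) / norm (qpc qc)"
proof -
 have k: "norm (qpc qc) > 0" by simp
 have tm: "norm (bc m / \<theta> (- (qc ^ m * z))) \<le> C0 * c ^ m / max 1 (q ^ m * norm z) / norm (qpc qc)" for m
 proof -
  have "Re (- (qc ^ m * z)) \<ge> 0"
   using z(1) q_pos by (simp add: mult_nonneg_nonpos flip: of_real_power)
  from theta_lower_bound[OF this] z(2) q_pos
  have t: "norm (qpc qc) * max 1 (q ^ m * norm z) \<le> norm (\<theta> (- (qc ^ m * z)))" by (simp add: norm_mult norm_power)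
  have "norm (bc m) / norm (\<theta> (- (qc ^ m * z))) \<le> (C0 * c ^ m) / (norm (qpc qc) * max 1 (q ^ m * norm z))"
   using bc_bound[of m] t k C0_nonneg c by (intro frac_le mult_pos_pos) auto
  thus ?thesis by (simp add: norm_divide mult.commute)
 qed
 have nz: "\<theta> (- z) ~= 0"
  using theta_right_nz[of "- z"] z by simp
 have "norm (Dz z) \<le> (\<Sum>m. norm (bc m / \<theta> (- (qc ^ m * z))))"
  unfolding sums_unique[OF Dz_sums(1)[OF z(2) nz]] by (rule summable_norm[OF Dz_sums(2)[OF z(2) nz]])
 also have "\<dots> \<le> (\<Sum>m. C0 * c ^ m / max 1 (q ^ m * norm z) / norm (qpc qc))"
  by (intro suminf_le tm Dz_sums(2) z nz summable_divide H3_summable)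
 also have "\<dots> = H3 (norm z) / norm (qpc qc)" unfolding H3_def by (rule suminf_divide[OF H3_summable])
 finally show ?thesis .
qed

lemma B1_decay: "t > 0 ==> norm (B1 (of_real t)) \<le> H3 t"
proof -
 assume t: "t > 0"
 have "norm (B1 (of_real t)) \<le> (\<Sum>m. norm (bc m / (1 + of_real t * qc powi (int m - 1))))"
  unfolding B1_def by (rule summable_norm[OF B1_summable[OF pos_in_B1dom[OF t]]])
 also have "\<dots> \<le> H3 t"
  unfolding H3_def
 proof (rule suminf_le[OF _ B1_summable[OF pos_in_B1dom[OF t]] H3_summable])
  fix m
  have "q powi int m \<le> q powi (int m - 1)" using q_pos q_less_1 by (intro power_int_decreasing) auto
  hence "t * q ^ m \<le> t * q powi (int m - 1)" using t by simp
  moreover have "t * q powi (int m - 1) > 0" using t q_pos by simp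
  ultimately have "max 1 (q ^ m * t) \<le> 1 + t * q powi (int m - 1)" by (simp add: mult.commute)
  thus "norm (bc m / (1 + of_real t * qc powi (int m - 1))) \<le> C0 * c ^ m / max 1 (q ^ m * t)"
   unfolding norm_divide norm_1_plus_pos[OF t] using bc_bound[of m] C0_nonneg c by (intro frac_le) auto
 qed
 finally show ?thesis .
qed

definition H2 :: "real \<Rightarrow> real" where
 "H2 x = (\<integral>u. norm (B1 (of_real (exp (u + x)))) * Er u \<partial>lborel)"

lemma cont_B1_exp: "continuous_on A (%s. B1 (of_real (exp (s + x))))"
 by (rule continuous_on_compose2[OF holomorphic_on_imp_continuous_on[OF holomorphic_B1]])
  (auto intro!: continuous_intros pos_in_B1dom simp del: of_real_exp)

lemma H2_tendsto: "(H2 \<longlongrightarrow> 0) at_top"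
proof -
 have "((%x. \<integral>u. norm (B1 (of_real (exp (u + x)))) * Er u \<partial>lborel) \<longlongrightarrow> (\<integral>u. 0 \<partial>(lborel :: real measure))) at_top"
 proof (rule integral_dominated_convergence_at_top)
  show "integrable lborel (%u. (\<Sum>m. C0 * c ^ m) * Er u)" using integrable_Er by simp
  show "(%u. norm (B1 (of_real (exp (u + x)))) * Er u) \<in> borel_measurable lborel" for x
   by (simp, intro borel_measurable_continuous_onI continuous_intros cont_B1_exp cont_Er)
  have "norm (norm (B1 (of_real (exp (u + x)))) * Er u) \<le> (\<Sum>m. C0 * c ^ m) * Er u" for x u
   using B1_bound[of "exp (u + x)"] Er_pos[of u] by (auto simp del: of_real_exp intro!: mult_right_mono)
  thus "\<forall>\<^sub>F x in at_top. AE u in lborel. norm (norm (B1 (of_real (exp (u + x)))) * Er u) \<le> (\<Sum>m. C0 * c ^ m) * Er u"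
   by (intro always_eventually allI AE_I2)
  have "((%x. norm (B1 (of_real (exp (u + x)))) * Er u) \<longlongrightarrow> 0 * Er u) at_top" for u
  proof (intro tendsto_mult tendsto_const)
   have "filterlim (%x. exp (u + x)) at_top at_top"
    by (intro filterlim_compose[OF exp_at_top] filterlim_tendsto_add_at_top[OF tendsto_const filterlim_ident])
   from filterlim_compose[OF H3_tendsto this] have 0: "((%x. H3 (exp (u + x))) \<longlongrightarrow> 0) at_top" .
   show "((%x. norm (B1 (of_real (exp (u + x))))) \<longlongrightarrow> 0) at_top"
    by (rule Lim_null_comparison[OF _ 0]) (use B1_decay[OF exp_gt_zero] in \<open>auto simp del: of_real_exp\<close>)
  qed
  thus "AE u in lborel. ((%x. norm (B1 (of_real (exp (u + x)))) * Er u) \<longlongrightarrow> 0) at_top"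
   by (intro AE_I2) simp
 qed simp
 thus ?thesis by (simp add: H2_def[abs_def])
qed

lemma H2_nonneg: "H2 x \<ge> 0"
 unfolding H2_def by (intro integral_nonneg_AE AE_I2) (simp add: less_imp_le[OF Er_pos])

lemma transform_norm_le:
 assumes h: "\<And>x. integrable lborel (%s. h s * E (of_real (s - x)))" and w: "\<bar>Im w\<bar> \<le> pi"
 shows "norm (\<integral>s. h s * E (of_real s - w) \<partial>lborel) \<le> exp (pi\<^sup>2 / (- 2 * L)) * (\<integral>s. norm (h s) * Er (s - Re w) \<partial>lborel)"
  and "integrable lborel (%s. norm (h s) * Er (s - x))"
proof -
 have n: "norm (h s * E (of_real (s - x))) = norm (h s) * Er (s - x)" for s x
  unfolding E_of_real norm_mult using Er_pos[of "s - x"] by simp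
 show i: "integrable lborel (%s. norm (h s) * Er (s - x))" for x
  using integrable_norm[OF h[of x]] unfolding n .
 have "(Im w)\<^sup>2 \<le> pi\<^sup>2" using w by (metis abs_ge_zero power2_abs power_mono)
 hence e: "exp ((Im w)\<^sup>2 / (- 2 * L)) \<le> exp (pi\<^sup>2 / (- 2 * L))" using L_neg by (simp add: divide_le_cancel)
 have "norm (\<integral>s. h s * E (of_real s - w) \<partial>lborel) \<le> (\<integral>s. norm (h s * E (of_real s - w)) \<partial>lborel)"
  by (rule integral_norm_bound)
 also have "\<dots> = exp ((Im w)\<^sup>2 / (- 2 * L)) * (\<integral>s. norm (h s) * Er (s - Re w) \<partial>lborel)"
  unfolding norm_mult norm_E by (subst integral_mult_right_zero[symmetric]) (simp only: mult_ac)
 also have "\<dots> \<le> exp (pi\<^sup>2 / (- 2 * L)) * (\<integral>s. norm (h s) * Er (s - Re w) \<partial>lborel)"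
  by (intro mult_right_mono e integral_nonneg_AE AE_I2) (simp add: less_imp_le[OF Er_pos])
 finally show "norm (\<integral>s. h s * E (of_real s - w) \<partial>lborel) \<le> exp (pi\<^sup>2 / (- 2 * L)) * (\<integral>s. norm (h s) * Er (s - Re w) \<partial>lborel)" .
qed

definition H1 :: "real \<Rightarrow> real" where
 "H1 R = (\<integral>s. norm (dz s) * (exp s / max (exp s) R) \<partial>lborel)"

lemma exp_max: "exp s / max (exp s) R \<ge> (0::real)" "exp s / max (exp s) R \<le> (1::real)"
 by (auto simp: divide_le_eq less_max_iff_disj le_max_iff_disj intro!: divide_nonneg_nonneg)

lemma H1_props:
 shows "(H1 \<longlongrightarrow> 0) at_top" and "H1 R \<ge> 0" and "integrable lborel (%s. norm (dz s) * (exp s / max (exp s) R))"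
proof -
 have meas: "(%s. norm (dz s) * (exp s / max (exp s) R)) \<in> borel_measurable lborel" for R
  using borel_measurable_integrable[OF integrable_dz] by measurable
 have bd: "norm (norm (dz s) * (exp s / max (exp s) R)) \<le> norm (dz s)" for s R
 proof -
  have "norm (norm (dz s) * (exp s / max (exp s) R)) = norm (dz s) * (exp s / max (exp s) R)"
   unfolding real_norm_def by (intro abs_of_nonneg mult_nonneg_nonneg norm_ge_zero exp_max(1))
  also have "\<dots> \<le> norm (dz s) * 1" by (intro mult_left_mono exp_max(2)) simp
  finally show ?thesis by simp
 qed
 have ni: "integrable lborel (%s. norm (dz s))" using integrable_dz by simp
 show "integrable lborel (%s. norm (dz s) * (exp s / max (exp s) R))"
  by (rule Bochner_Integration.integrable_bound[OF ni meas]) (use bd in \<open>auto intro!: AE_I2\<close>)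
 show "H1 R \<ge> 0"
  unfolding H1_def by (intro integral_nonneg_AE AE_I2 mult_nonneg_nonneg exp_max(1)) simp
 have "((%R. \<integral>s. norm (dz s) * (exp s / max (exp s) R) \<partial>lborel) \<longlongrightarrow> (\<integral>s. 0 \<partial>(lborel :: real measure))) at_top"
 proof (rule integral_dominated_convergence_at_top[OF _ meas ni])
  show "AE s in lborel. ((%R. norm (dz s) * (exp s / max (exp s) R)) \<longlongrightarrow> 0) at_top"
  proof (intro AE_I2)
   fix s :: real
   have "filterlim (%R. max (exp s) R) at_top at_top"
    by (rule filterlim_at_top_mono[OF filterlim_ident]) simp
   hence "((%R. exp s / max (exp s) R) \<longlongrightarrow> 0) at_top"
    by (intro tendsto_divide_0[OF tendsto_const filterlim_at_top_imp_at_infinity])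
   from tendsto_mult[OF tendsto_const this, of "norm (dz s)"]
   show "((%R. norm (dz s) * (exp s / max (exp s) R)) \<longlongrightarrow> 0) at_top" by simp
  qed
  show "\<forall>\<^sub>F R in at_top. AE s in lborel. norm (norm (dz s) * (exp s / max (exp s) R)) \<le> norm (dz s)"
   using bd by (intro always_eventually allI AE_I2)
 qed simp
 thus "(H1 \<longlongrightarrow> 0) at_top" by (simp add: H1_def[abs_def])
qed

lemma CHI_right_half:
 assumes z: "Re z \<ge> 0" "z ~= 0"
 shows "norm (CHI z) \<le> H1 (norm z)"
proof -
 have z': "z \<notin> \<real>\<^sub>\<le>\<^sub>0" using z by (auto simp: complex_nonpos_Reals_iff complex_eq_iff)
 have "norm (CHI z) \<le> (\<integral>s. norm (dz s * (of_real (exp s) / (of_real (exp s) + z))) \<partial>lborel)"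
  unfolding CHI_def by (rule integral_norm_bound)
 also have "\<dots> \<le> H1 (norm z)"
  unfolding H1_def
 proof (rule integral_mono[OF integrable_norm[OF CHI_props(1)[OF z']] H1_props(3)])
  fix s :: real
  have "exp s \<le> Re (of_real (exp s) + z)" using z(1) by (simp del: of_real_exp)
  hence 1: "exp s \<le> norm (of_real (exp s) + z)" using complex_Re_le_cmod order_trans by blast
  have 2: "norm z \<le> norm (of_real (exp s) + z)"
  proof -
   have "(Re z)\<^sup>2 \<le> (exp s + Re z)\<^sup>2" using z(1) by (intro power_mono) auto
   thus ?thesis unfolding cmod_def by (intro real_sqrt_le_mono) (simp del: of_real_exp)
  qed
  have "exp s / norm (of_real (exp s) + z) \<le> exp s / max (exp s) (norm z)"
   using 1 2 by (intro divide_left_mono mult_pos_pos) (auto simp: less_max_iff_disj intro: less_le_trans[OF exp_gt_zero])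
  from mult_left_mono[OF this norm_ge_zero[of "dz s"]]
  show "norm (dz s * (of_real (exp s) / (of_real (exp s) + z))) \<le> norm (dz s) * (exp s / max (exp s) (norm z))"
   by (simp add: norm_mult norm_divide del: of_real_exp)
 qed
 finally show ?thesis .
qed

text \<open>Near the cut the integrand is not controlled by the modulus of \<open>z\<close>. The connection formula is, because
the Gaussian transform extends across the cut and \<open>Pc\<close> is bounded on the closed strip.\<close>

lemma CHI_left_half:
 assumes b: "\<And>w. \<bar>Im w\<bar> \<le> pi ==> norm (Pc q w) \<le> b" and z: "Re z < 0" "z \<notin> \<real>\<^sub>\<le>\<^sub>0"
 shows "norm (CHI z) \<le> \<bar>L\<bar> * (Cq q * (exp (pi\<^sup>2 / (- 2 * L)) * H2 (ln (norm z))) + b * (H3 (norm z) / norm (qpc qc)))"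
proof -
 define w where "w = Ln z"
 have z0: "z ~= 0" using z by auto
 have ew: "exp w = z" using z0 by (simp add: w_def)
 have "Im w ~= pi" using Im_Ln_eq_pi[OF z0] z(2) by (auto simp: w_def complex_nonpos_Reals_iff)
 hence ws: "w \<in> strip"
  using Im_Ln_le_pi[OF z0] mpi_less_Im_Ln[OF z0] by (simp add: strip_def w_def abs_less_iff)
 have wi: "\<bar>Im w\<bar> \<le> pi" using ws by (simp add: strip_def)
 have nz: "\<theta> (- exp w) ~= 0"
  using theta_right_nz[of "- z"] z z0 unfolding ew by simp
 have "- (1 / lc) * CHI z = GE B1 w + Pc q w * Dz z"
  using CHI_GT[OF ws] fold_GT[OF foldable_B1 ws nz] fold_GE[OF foldable_B1 nz] unfolding ew by simp
 moreover have "CHI z = - lc * (- (1 / lc) * CHI z)" by simp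
 ultimately have "CHI z = - lc * (GE B1 w + Pc q w * Dz z)" by (simp only:)
 hence "norm (CHI z) = \<bar>L\<bar> * norm (GE B1 w + Pc q w * Dz z)" by (simp add: norm_mult)
 also have "\<dots> \<le> \<bar>L\<bar> * (norm (GE B1 w) + norm (Pc q w) * norm (Dz z))"
  by (intro mult_left_mono) (auto intro: order_trans[OF norm_triangle_ineq] simp: norm_mult)
 also have "\<dots> \<le> \<bar>L\<bar> * (Cq q * (exp (pi\<^sup>2 / (- 2 * L)) * H2 (ln (norm z))) + b * (H3 (norm z) / norm (qpc qc)))"
 proof (intro mult_left_mono add_mono)
  have "(\<integral>s. norm (B1 (of_real (exp s))) * Er (s - Re w) \<partial>lborel) = H2 (Re w)"
   unfolding H2_def
   using integral_shift_real[of "%s. norm (B1 (of_real (exp s))) * Er (s - Re w)" "Re w"] by simp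
  with transform_norm_le(1)[of "%s. B1 (of_real (exp s))" w, OF B1_Gaussian wi]
  have "norm (\<integral>s. B1 (of_real (exp s)) * E (of_real s - w) \<partial>lborel) \<le> exp (pi\<^sup>2 / (- 2 * L)) * H2 (Re w)" by simp
  moreover have "Re w = ln (norm z)" using z0 by (simp add: w_def)
  ultimately show "norm (GE B1 w) \<le> Cq q * (exp (pi\<^sup>2 / (- 2 * L)) * H2 (ln (norm z)))"
   unfolding GE_def norm_mult using Cq_pos by (simp add: mult_left_mono)
  have "b \<ge> 0" using order_trans[OF norm_ge_zero b[of 0]] by simp
  thus "norm (Pc q w) * norm (Dz z) \<le> b * (H3 (norm z) / norm (qpc qc))"
   using z z0 by (intro mult_mono b wi Dz_decay) auto
 qed auto
 finally show ?thesis .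
qed

lemma CHI_tendsto: "(CHI \<longlongrightarrow> 0) at_slit"
proof -
 obtain b where b: "b \<ge> 0" "\<forall>w. \<bar>Im w\<bar> \<le> pi \<longrightarrow> norm (Pc q w) \<le> b" using Pc_bounded by blast
 define bd where "bd = (%R. H1 R + \<bar>L\<bar> * (Cq q * (exp (pi\<^sup>2 / (- 2 * L)) * H2 (ln R)) + b * (H3 R / norm (qpc qc))))"
 have "(bd \<longlongrightarrow> 0 + \<bar>L\<bar> * (Cq q * (exp (pi\<^sup>2 / (- 2 * L)) * 0) + b * (0 / norm (qpc qc)))) at_top"
  unfolding bd_def
  by (intro tendsto_add tendsto_mult tendsto_const tendsto_divide H1_props(1) H3_tendsto
     filterlim_compose[OF H2_tendsto ln_at_top]) simp
 hence "(bd \<longlongrightarrow> 0) at_top" by simp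
 from filterlim_compose[OF this filterlim_norm_at_top]
 have bd: "((%z::complex. bd (norm z)) \<longlongrightarrow> 0) at_slit"
  by (rule tendsto_mono[rotated]) simp
 have "norm (CHI z) \<le> bd (norm z)" if z: "z \<in> - \<real>\<^sub>\<le>\<^sub>0" for z
 proof (cases "Re z \<ge> 0")
  case True
  have "z ~= 0" using z by auto
  moreover have "0 \<le> \<bar>L\<bar> * (Cq q * (exp (pi\<^sup>2 / (- 2 * L)) * H2 (ln (norm z))) + b * (H3 (norm z) / norm (qpc qc)))"
   using Cq_pos b(1) H2_nonneg H3_nonneg by (intro mult_nonneg_nonneg add_nonneg_nonneg divide_nonneg_nonneg) (auto intro: less_imp_le)
  ultimately show ?thesis using CHI_right_half[OF True] by (simp add: bd_def)
 next
  case False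
  thus ?thesis using CHI_left_half[OF b(2)[rule_format], of z] z H1_props(2)[of "norm z"] by (simp add: bd_def)
 qed
 hence "eventually (%z. norm (CHI z) \<le> bd (norm z)) at_slit"
  by (auto simp: eventually_inf_principal intro!: always_eventually)
 from Lim_null_comparison[OF this bd] show ?thesis .
qed

section \<open>The structure of the kernel\<close>

lemma countable_sing: "countable (- B1dom)"
proof -
 have "- B1dom \<subseteq> uminus ` qpowers q"
 proof
  fix t assume "t \<in> - B1dom"
  hence "t ~= 0 \<longrightarrow> \<theta> t = 0" "\<not> norm t < q" by (auto simp: B1dom_def)
  moreover from this have "t ~= 0" using q_pos by auto
  ultimately have "- t \<in> qpowers q" by (simp add: theta_eq_0_iff)
  thus "t \<in> uminus ` qpowers q" by (intro image_eqI[of _ _ "- t"]) auto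
 qed
 moreover have "countable (uminus ` qpowers q)" by (simp add: qpowers_def)
 ultimately show ?thesis by (rule countable_subset)
qed

text \<open>Uniqueness gives the identity near the origin, and removing the countably many possible
poles does not disconnect \<open>D\<close>.\<close>

lemma kernel_determined:
 fixes K :: "real \<Rightarrow> real"
 assumes D: "open D" "connected D" "0 \<in> D" "B holomorphic_on D"
  and e: "\<And>r. r \<ge> 0 ==> summable (%n. norm (e n) * r ^ n)"
  and h: "\<And>s. h s = B (of_real (exp s)) - B1 (of_real (exp s)) - B2 e (of_real (exp s))"
  and K: "\<And>s. K s > 0" "\<And>s. K (s + L) = K s * exp s" "integrable lborel K"
  and hi: "\<And>x. integrable lborel (%s. h s * of_real (K (s - x)))"
  and h0: "\<And>x. (\<integral>s. h s * of_real (K (s - x)) \<partial>lborel) = 0"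
  and t: "t \<in> D \<inter> B1dom"
 shows "B t = B1 t + B2 e t"
proof -
 have "open (D \<inter> ball 0 q)" "0 \<in> D \<inter> ball 0 q" using D q_pos by auto
 then obtain \<delta> where d: "\<delta> > 0" "ball 0 \<delta> \<subseteq> D \<inter> ball 0 q" using open_contains_ball by blast
 have sub: "ball 0 \<delta> \<subseteq> D \<inter> B1dom" using d by (auto simp: B1dom_def)
 have B2h: "B2 e holomorphic_on UNIV" by (rule holomorphic_B2[OF e])
 have z: "B z - B1 z - B2 e z = 0" if "z \<in> ball 0 \<delta>" for z
 proof (rule transform_uniqueness[OF K hi h0 _ d(1) _ that])
  show "(%z. B z - B1 z - B2 e z) holomorphic_on ball 0 \<delta>"
   using sub by (intro holomorphic_on_diff holomorphic_on_subset[OF D(4)] holomorphic_on_subset[OF holomorphic_B1]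
     holomorphic_on_subset[OF B2h]) auto
 qed (rule h)
 have "connected (D - (- B1dom))"
  by (rule connected_open_diff_countable[OF _ D(1,2) countable_sing]) simp
 hence conn: "connected (D \<inter> B1dom)" by (simp add: Diff_eq)
 show ?thesis
 proof (rule analytic_continuation_open[of "ball 0 \<delta>" "D \<inter> B1dom" B "%t. B1 t + B2 e t", OF _ _ _ conn sub])
  show "B holomorphic_on D \<inter> B1dom" by (rule holomorphic_on_subset[OF D(4)]) simp
  show "(%t. B1 t + B2 e t) holomorphic_on D \<inter> B1dom"
   by (intro holomorphic_on_add holomorphic_on_subset[OF holomorphic_B1] holomorphic_on_subset[OF B2h]) auto
  show "B z = B1 z + B2 e z" if "z \<in> ball 0 \<delta>" for z using z[OF that] by (simp add: algebra_simps)
 qed (use d t D open_B1dom in auto)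
qed

lemma structure_CH:
 assumes D: "open D" "connected D" "0 \<in> D" "B holomorphic_on D"
  and Bi: "\<And>x. integrable lborel (%s. B (of_real (exp s)) * E (of_real (s - x)))"
  and GT: "\<And>y. GT B (of_real y) = GT B1 (of_real y)"
  and t: "t \<in> D \<inter> B1dom"
 shows "B t = B1 t"
proof -
 have B20: "B2 (%_. 0) t = 0" for t by (simp add: B2_def)
 define h where "h = (%s. B (of_real (exp s)) - B1 (of_real (exp s)))"
 have st: "complex_of_real x \<in> strip" for x by (simp add: strip_def)
 have e: "h s * of_real (Kt (s - x)) = B (of_real (exp s)) / \<theta> (exp (of_real s - of_real x)) - B1 (of_real (exp s)) / \<theta> (exp (of_real s - of_real x))" for s x
  unfolding h_def Kt by (simp add: diff_divide_distrib flip: exp_of_real)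
 note i = theta_transform_holomorphic(1)[OF Bi st] theta_transform_holomorphic(1)[OF B1_Gaussian st]
 have "B t = B1 t + B2 (%_. 0) t"
 proof (rule kernel_determined[OF D _ _ Kt_pos Kt_L integrable_Kt _ _ t])
  show "integrable lborel (%s. h s * of_real (Kt (s - x)))" for x
   unfolding e by (rule Bochner_Integration.integrable_diff[OF i])
  have "(\<integral>s. h s * of_real (Kt (s - x)) \<partial>lborel) = - lc * (GT B (of_real x) - GT B1 (of_real x))" for x
   unfolding e Bochner_Integration.integral_diff[OF i] GT_def by (simp add: algebra_simps)
  thus "(\<integral>s. h s * of_real (Kt (s - x)) \<partial>lborel) = 0" for x by (simp add: GT)
 qed (simp_all add: h_def B20)
 thus ?thesis by (simp add: B20)
qed

text \<open>Through the logarithm \<open>\<psi>\<close> descends to the punctured plane, and boundedness removes the puncture.\<close>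

lemma periodic_expansion:
 assumes \<psi>: "\<psi> holomorphic_on UNIV" and per: "\<And>w. \<psi> (w + \<omega>) = \<psi> w"
  and bd: "\<And>w. Re w \<le> a ==> \<bar>Im w\<bar> \<le> pi ==> norm (\<psi> w) \<le> bnd"
 obtains e :: "nat \<Rightarrow> complex" where "\<And>r. r \<ge> 0 ==> summable (%n. norm (e n) * r ^ n)" "\<And>w. \<psi> w = eps e (exp w)"
proof -
 have inv: "\<psi> u = \<psi> v" if uv: "exp u = exp v" for u v
 proof -
  obtain n :: int where "u = v + (of_int (2 * n) * pi) * \<i>" using uv unfolding exp_eq by blast
  hence "u = v + of_int n * (\<omega>)" by simp
  thus ?thesis by (simp only: periodic_int[of \<psi>, OF per])
 qed
 define \<phi> where "\<phi> = (%z. \<psi> (Ln z))"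
 have 1: "\<phi> holomorphic_on - \<real>\<^sub>\<le>\<^sub>0"
  unfolding \<phi>_def by (rule holomorphic_on_compose_gen[OF _ \<psi>, unfolded o_def]) (auto intro!: holomorphic_intros)
 have "(%z. \<psi> (Ln (- z) + ipi)) holomorphic_on {z. - z \<notin> \<real>\<^sub>\<le>\<^sub>0}"
  by (rule holomorphic_on_compose_gen[OF _ \<psi>, unfolded o_def]) (auto intro!: holomorphic_intros)
 moreover have "\<psi> (Ln (- z) + ipi) = \<phi> z" if "z \<in> {z. - z \<notin> \<real>\<^sub>\<le>\<^sub>0}" for z
 proof -
  have "z ~= 0" using that by auto
  thus ?thesis unfolding \<phi>_def by (intro inv) (simp add: exp_add)
 qed
 ultimately have 2: "\<phi> holomorphic_on {z. - z \<notin> \<real>\<^sub>\<le>\<^sub>0}" by (rule holomorphic_transform)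
 have o: "open (- \<real>\<^sub>\<le>\<^sub>0 :: complex set)" "open {z::complex. - z \<notin> \<real>\<^sub>\<le>\<^sub>0}"
 proof -
  show "open (- \<real>\<^sub>\<le>\<^sub>0 :: complex set)" by (simp add: open_Compl)
  hence "open (uminus -` (- \<real>\<^sub>\<le>\<^sub>0 :: complex set))" by (rule open_vimage) (intro continuous_intros)
  thus "open {z::complex. - z \<notin> \<real>\<^sub>\<le>\<^sub>0}" by (simp add: vimage_def)
 qed
 have "\<phi> holomorphic_on (- \<real>\<^sub>\<le>\<^sub>0 \<union> {z. - z \<notin> \<real>\<^sub>\<le>\<^sub>0})" by (rule holomorphic_on_Un[OF 1 2 o])
 hence hol: "\<phi> holomorphic_on UNIV - {0}"
  by (rule holomorphic_on_subset) (auto simp: complex_nonpos_Reals_iff complex_eq_iff)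
 have "eventually (%z. z \<in> ball 0 (exp a) - {0}) (at (0::complex))"
  by (rule eventually_at_in_open) auto
 hence "eventually (%z. norm (\<phi> z) \<le> bnd) (at 0)"
 proof eventually_elim
  case (elim z)
  hence "z ~= 0" "norm z < exp a" by auto
  moreover from this have "ln (norm z) < ln (exp a)" by (subst ln_less_cancel_iff) auto
  ultimately show ?case unfolding \<phi>_def
   using Im_Ln_le_pi[of z] mpi_less_Im_Ln[of z] by (intro bd) (auto simp: abs_le_iff)
 qed
 hence "\<exists>k. k holomorphic_on UNIV \<and> (\<forall>z\<in>UNIV - {0}. k z = \<phi> z)"
  using holomorphic_on_extend_bounded[of \<phi> UNIV 0] hol by auto
 then obtain k where k: "k holomorphic_on UNIV" "\<And>z. z ~= 0 ==> k z = \<phi> z" by blast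
 define e where "e = (%n. (deriv ^^ n) k 0 / fact n)"
 have ks: "(%n. e n * z ^ n) sums k z" for z
 proof -
  have "(%n. (deriv ^^ n) k 0 / fact n * (z - 0) ^ n) sums k z"
   by (rule holomorphic_power_series[of k 0 "norm z + 1"]) (use k(1) in \<open>auto intro: holomorphic_on_subset\<close>)
  thus ?thesis by (simp add: e_def)
 qed
 show thesis
 proof (rule that[of e])
  fix r :: real assume r: "r \<ge> 0"
  have "summable (%n. norm (e n * of_real r ^ n))"
   by (rule powser_insidea[OF sums_summable[OF ks[of "of_real (r + 1)"]]]) (use r in \<open>simp del: of_real_add\<close>)
  thus "summable (%n. norm (e n) * r ^ n)" using r by (simp add: norm_mult norm_power)
 next
  fix w
  have "k (exp w) = \<psi> (Ln (exp w))" using k(2)[of "exp w"] unfolding \<phi>_def by simp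
  also have "\<dots> = \<psi> w" by (rule inv) simp
  finally show "\<psi> w = eps e (exp w)" using sums_unique[OF ks[of "exp w"]] by (simp only: eps_def)
 qed
qed

lemma transform_bounded_left:
 assumes h: "\<And>x. integrable lborel (%s. h s * E (of_real (s - x)))" and b: "\<And>s. s \<le> a ==> norm (h s) \<le> b" "b \<ge> 0"
 shows "\<exists>bnd. \<forall>w. Re w \<le> a \<longrightarrow> \<bar>Im w\<bar> \<le> pi \<longrightarrow> norm (\<integral>s. h s * E (of_real s - w) \<partial>lborel) \<le> bnd"
proof (intro exI allI impI)
 fix w assume w: "Re w \<le> a" "\<bar>Im w\<bar> \<le> pi"
 have i1: "integrable lborel (%s. b * Er (s + (- Re w)))" by (intro integrable_mult_right integrable_shift_real integrable_Er)
 note i2 = transform_norm_le(2)[OF h w(2), where x = a]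
 have "(\<integral>s. norm (h s) * Er (s - Re w) \<partial>lborel) \<le> (\<integral>s. b * Er (s + (- Re w)) + norm (h s) * Er (s - a) \<partial>lborel)"
 proof (rule integral_mono[OF transform_norm_le(2)[OF h w(2)] Bochner_Integration.integrable_add[OF i1 i2]])
  fix s :: real
  show "norm (h s) * Er (s - Re w) \<le> b * Er (s + (- Re w)) + norm (h s) * Er (s - a)"
  proof (cases "s \<le> a")
   case True
   thus ?thesis using b(1)[OF True] Er_pos[of "s - Re w"] Er_pos[of "s - a"]
    by (simp add: mult_right_mono add_increasing2)
  next
   case False
   hence "(s - a - L / 2)\<^sup>2 \<le> (s - Re w - L / 2)\<^sup>2" using w L_neg by (intro power_mono) auto
   hence "Er (s - Re w) \<le> Er (s - a)" using L_neg by (simp add: Er_def divide_le_cancel)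
   hence "norm (h s) * Er (s - Re w) \<le> norm (h s) * Er (s - a)" by (intro mult_left_mono) auto
   moreover have "b * Er (s + (- Re w)) \<ge> 0" using b(2) Er_pos[of "s + (- Re w)"] by simp
   ultimately show ?thesis by linarith
  qed
 qed
 also have "\<dots> = b * (1 / Cq q) + (\<integral>s. norm (h s) * Er (s - a) \<partial>lborel)"
  unfolding Bochner_Integration.integral_add[OF i1 i2] by (simp add: integral_shift_real[of Er "- Re w", simplified] integral_Er)
 finally show "norm (\<integral>s. h s * E (of_real s - w) \<partial>lborel)
   \<le> exp (pi\<^sup>2 / (- 2 * L)) * (b * (1 / Cq q) + (\<integral>s. norm (h s) * Er (s - a) \<partial>lborel))"
  by (intro order_trans[OF transform_norm_le(1)[OF h w(2)]] mult_left_mono) auto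
qed

text \<open>The Gaussian transforms of \<open>B\<close> and \<open>B1\<close> have the same jump, so their difference is an entire function
of \<open>exp w\<close>. The entire kernel with this transform accounts for the whole difference.\<close>

lemma structure_conn:
 assumes D: "open D" "connected D" "0 \<in> D" "B holomorphic_on D"
  and Bi: "\<And>x. integrable lborel (%s. B (of_real (exp s)) * E (of_real (s - x)))"
  and jump: "\<And>w. GE B (w + \<omega>) = GE B w - jmp w"
 obtains e where "\<And>r. r \<ge> 0 ==> summable (%n. norm (e n) * r ^ n)"
  "\<And>t. t \<in> D \<inter> B1dom ==> B t = B1 t + B2 e t"
proof -
 define h where "h = (%s. B (of_real (exp s)) - B1 (of_real (exp s)))"
 have hE: "h s * E v = B (of_real (exp s)) * E v - B1 (of_real (exp s)) * E v" for s v by (simp add: h_def left_diff_distrib)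
 have hi: "integrable lborel (%s. h s * E (of_real (s - x)))" for x
  unfolding hE by (intro Bochner_Integration.integrable_diff Bi B1_Gaussian)
 define \<psi> where "\<psi> = (%w. GE B w - GE B1 w)"
 have \<psi>_eq: "\<psi> w = of_real (Cq q) * (\<integral>s. h s * E (of_real s - w) \<partial>lborel)" for w
 proof -
  have "(\<integral>s. h s * E (of_real s - w) \<partial>lborel) = (\<integral>s. B (of_real (exp s)) * E (of_real s - w) \<partial>lborel) - (\<integral>s. B1 (of_real (exp s)) * E (of_real s - w) \<partial>lborel)"
   unfolding hE by (intro Bochner_Integration.integral_diff Gaussian_transform_entire(1) Bi B1_Gaussian)
  thus ?thesis by (simp add: \<psi>_def GE_def right_diff_distrib)
 qed
 have "open (D \<inter> ball 0 q)" "0 \<in> D \<inter> ball 0 q" using D q_pos by auto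
 then obtain r where r: "r > 0" "cball 0 r \<subseteq> D \<inter> ball 0 q" using open_contains_cball by blast
 have "continuous_on (cball 0 r) (%t. B t - B1 t)"
  by (intro continuous_on_diff holomorphic_on_imp_continuous_on holomorphic_on_subset[OF D(4)] holomorphic_on_subset[OF holomorphic_B1])
   (use r in \<open>auto simp: B1dom_def\<close>)
 hence "bounded ((%t. B t - B1 t) ` cball 0 r)" by (intro compact_imp_bounded compact_continuous_image) auto
 then obtain b where b: "\<forall>x\<in>(%t. B t - B1 t) ` cball 0 r. norm x \<le> b" unfolding bounded_iff by blast
 have "norm (h s) \<le> max 0 b" if "s \<le> ln r" for s
 proof -
  have "exp s \<le> exp (ln r)" using that by simp
  hence "complex_of_real (exp s) \<in> cball 0 r" using r(1) by (simp del: of_real_exp)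
  from bspec[OF b imageI[OF this]] show ?thesis by (simp add: h_def)
 qed
 from transform_bounded_left[OF hi this] obtain bnd where
  bnd: "\<forall>w. Re w \<le> ln r \<longrightarrow> \<bar>Im w\<bar> \<le> pi \<longrightarrow> norm (\<integral>s. h s * E (of_real s - w) \<partial>lborel) \<le> bnd" by auto
 obtain e where e: "\<And>r. r \<ge> 0 ==> summable (%n. norm (e n) * r ^ n)" "\<And>w. \<psi> w = eps e (exp w)"
 proof (rule periodic_expansion[of \<psi> "ln r" "Cq q * bnd"])
  show "\<psi> holomorphic_on UNIV" unfolding \<psi>_def by (intro holomorphic_on_diff holomorphic_GE Bi B1_Gaussian)
  show "\<psi> (w + \<omega>) = \<psi> w" for w unfolding \<psi>_def jump GE_jump[OF foldable_B1] by simp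
  show "norm (\<psi> w) \<le> Cq q * bnd" if "Re w \<le> ln r" "\<bar>Im w\<bar> \<le> pi" for w
   unfolding \<psi>_eq norm_mult using bnd that Cq_pos by (simp add: mult_left_mono)
 qed (rule that)
 define h' where "h' = (%s. h s - B2 e (of_real (exp s)))"
 have h'E: "h' s * of_real (Er (s - x)) = h s * E (of_real (s - x)) - B2 e (of_real (exp s)) * E (of_real (s - x))" for s x
  unfolding E_of_real h'_def by (simp add: left_diff_distrib)
 have "B t = B1 t + B2 e t" if t: "t \<in> D \<inter> B1dom" for t
 proof (rule kernel_determined[OF D e(1) _ Er_pos Er_L integrable_Er _ _ t])
  show "h' s = B (of_real (exp s)) - B1 (of_real (exp s)) - B2 e (of_real (exp s))" for s by (simp add: h'_def h_def)
  show "integrable lborel (%s. h' s * of_real (Er (s - x)))" for x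
   unfolding h'E by (intro Bochner_Integration.integrable_diff hi B2_Gaussian(1) e(1))
  show "(\<integral>s. h' s * of_real (Er (s - x)) \<partial>lborel) = 0" for x
  proof -
   have "(\<integral>s. h' s * of_real (Er (s - x)) \<partial>lborel) = (\<integral>s. h s * E (of_real (s - x)) \<partial>lborel) - eps e (of_real (exp x)) / of_real (Cq q)"
    unfolding h'E by (subst Bochner_Integration.integral_diff) (simp_all only: hi B2_Gaussian[OF e(1)])
   also have "eps e (of_real (exp x)) = of_real (Cq q) * (\<integral>s. h s * E (of_real (s - x)) \<partial>lborel)"
    using e(2)[of "of_real x"] \<psi>_eq[of "of_real x"] by (simp only: exp_of_real of_real_diff)
   finally show ?thesis using Cq_pos by simp
  qed
 qed
 from that[OF e(1) this] show thesis .
qed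

end

context qbase
begin

section \<open>The connection coefficients in closed form\<close>

lemma admissible_nz:
 assumes "admissible q lam w"
 shows "lam ~= 0" "\<theta> lam ~= 0" "\<theta> (lam / exp w) ~= 0"
proof -
 show "lam ~= 0" "\<theta> lam ~= 0" using assms by (auto simp: admissible_def theta_eq_0_iff)
 show "\<theta> (lam / exp w) ~= 0"
 proof
  assume "\<theta> (lam / exp w) = 0"
  then obtain n where n: "- (lam / exp w) = qc powi n" by (auto simp: theta_eq_0_iff qpowers_def)
  have "qc powi (- n) * qc powi n = 1" using q_pos by (simp add: power_int_minus)
  hence "exp w = exp w * (qc powi (- n) * qc powi n)" by simp
  also have "\<dots> = - (qc powi (- n) * lam)" unfolding n[symmetric] by simp
  finally show False using assms by (auto simp: admissible_def)
 qed
qed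

lemma Pd_second_form:
 assumes a: "admissible q lam w"
 shows "exp l = lam ==> Pd q lam w = lam * Pq' q l / P l - lam * Pq' q (l - w) / (exp w * P (l - w))"
  and "Pd q lam (w + lc) = Pd q lam w"
proof -
 note nz = admissible_nz[OF a]
 show "Pd q lam w = lam * Pq' q l / P l - lam * Pq' q (l - w) / (exp w * P (l - w))" if l: "exp l = lam"
 proof -
  have "P l ~= 0" "P (l - w) ~= 0" using nz by (auto simp: P_eq_0_iff exp_diff l)
  hence "Pd q lam w = deriv P l / P l - deriv P (l - w) / P (l - w)" using Pd_eq[of l w] by (simp add: l Q_eq)
  thus ?thesis using nz(1) by (simp add: Pq'_def exp_diff l)
 qed
 define l where "l = Ln lam"
 have l: "exp l = lam" using nz by (simp add: l_def)
 have e: "l - (w + lc) + lc = l - w" by simp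
 have "P (l - w) ~= 0" using nz by (auto simp: P_eq_0_iff exp_diff l)
 hence "P (l - (w + lc)) ~= 0" using P_L[of "l - (w + lc)"] unfolding e by simp
 from Q_L[OF this] show "Pd q lam (w + lc) = Pd q lam w"
  using Pd_eq[of l "w + lc"] Pd_eq[of l w] unfolding e l by simp
qed

lemma integral_q1_substitution:
 assumes "\<And>t. t > 0 ==> f t = k t / of_real t"
 shows "set_lebesgue_integral lborel {q..1} f = PI (%s. k (exp s))"
proof -
 have "set_lebesgue_integral lborel {q..1} f = set_lebesgue_integral lborel {q..1} (%t. k t / of_real t)"
  unfolding set_lebesgue_integral_def
  by (intro Bochner_Integration.integral_cong refl) (use assms q_pos in \<open>auto simp: indicator_def\<close>)
 also have "\<dots> = PI (%s. k (exp s))" by (rule exp_substitution_Icc[OF q_pos])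
 finally show ?thesis .
qed

lemma Pc_integral_forms:
 assumes w: "\<bar>Im w\<bar> < pi"
 shows "Pc q w = w / lc + 1 / (exp w * lc) *
     set_lebesgue_integral lborel {q..1} (%t. P (of_real (ln t)) * (deriv \<theta> (of_real t / exp w) / \<theta> (of_real t / exp w)))"
  and "Pc q w = 1 / (exp w * lc) *
     set_lebesgue_integral lborel {q..1} (%t. P (of_real (ln t)) * Pq' q (of_real (ln t) - w) / P (of_real (ln t) - w))"
proof -
 have ws: "w \<in> strip" using w by (simp add: strip_def)
 have PIm: "PI (%s. exp w * f s) = exp w * PI f" for f by simp
 have "set_lebesgue_integral lborel {q..1} (%t. P (of_real (ln t)) * (deriv \<theta> (of_real t / exp w) / \<theta> (of_real t / exp w)))
   = PI (%s. of_real (exp s) * (P (of_real (ln (exp s))) * (deriv \<theta> (of_real (exp s) / exp w) / \<theta> (of_real (exp s) / exp w))))"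
  by (rule integral_q1_substitution) simp
 also have "\<dots> = PI (%s. exp w * (P (of_real s) * g (exp (of_real s - w))))"
  by (simp add: g_def exp_diff exp_of_real mult_ac)
 finally show "Pc q w = w / lc + 1 / (exp w * lc) *
   set_lebesgue_integral lborel {q..1} (%t. P (of_real (ln t)) * (deriv \<theta> (of_real t / exp w) / \<theta> (of_real t / exp w)))"
  unfolding PIm using Pc_strip2[OF ws] by simp
 have nz: "P (of_real s - w) ~= 0" for s :: real
  using P_strip_nz[OF strip_shift(1)[OF strip_shift(2)[OF ws]], of s] by (simp add: add.commute)
 have "set_lebesgue_integral lborel {q..1} (%t. P (of_real (ln t)) * Pq' q (of_real (ln t) - w) / P (of_real (ln t) - w))
   = PI (%s. of_real (exp s) * (P (of_real (ln (exp s))) * Pq' q (of_real (ln (exp s)) - w) / P (of_real (ln (exp s)) - w)))"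
  by (rule integral_q1_substitution) simp
 also have "\<dots> = PI (%s. exp w * (P (of_real s) * Q (of_real s - w)))"
  by (simp add: Q_eq[OF nz] Pq'_def exp_diff exp_of_real mult_ac)
 finally show "Pc q w = 1 / (exp w * lc) *
   set_lebesgue_integral lborel {q..1} (%t. P (of_real (ln t)) * Pq' q (of_real (ln t) - w) / P (of_real (ln t) - w))"
  unfolding PIm using Pc_strip[OF ws] by simp
qed

lemma Pd_difference:
 assumes a1: "admissible q lam1 w" and a2: "admissible q lam2 w"
 shows "Pd q lam1 w - Pd q lam2 w = qpc qc ^ 3 * \<theta> (- exp w) * \<theta> (- lam1 / lam2) * \<theta> (- lam1 * lam2 / exp w)
     / (\<theta> lam1 * \<theta> lam2 * \<theta> (lam1 / exp w) * \<theta> (exp w / lam2))"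
proof (cases "exp w \<in> qpowers q")
 case True
 then obtain m where m: "exp w = qc powi m" by (auto simp: qpowers_def)
 have "Pd q lam w = (w - of_int m * lc) / lc" if "admissible q lam w" for lam
 proof -
  note nz = admissible_nz[OF that]
  obtain A where "Pd q lam (of_int m * lc) = 0" using Pd_at_int_L[OF nz(1,2)] by metis
  thus ?thesis unfolding Pd_def exp_int_L m by (simp add: diff_divide_distrib add_eq_0_iff)
 qed
 hence "Pd q lam1 w - Pd q lam2 w = 0" using a1 a2 by simp
 moreover have "\<theta> (- exp w) = 0" using True by (simp add: theta_eq_0_iff)
 ultimately show ?thesis by simp
next
 case False
 define l1 l2 where "l1 = Ln lam1" and "l2 = Ln lam2"
 note n1 = admissible_nz[OF a1] and n2 = admissible_nz[OF a2]
 have l: "exp l1 = lam1" "exp l2 = lam2" using n1 n2 by (simp_all add: l1_def l2_def)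
 have "\<theta> (- exp w) ~= 0" using False by (simp add: theta_eq_0_iff)
 from QQ_theta_quotient[of l1 w l2, OF _ _ _ _ this] n1 n2 show ?thesis
  using Pd_eq[of l1 w] Pd_eq[of l2 w] by (simp add: l exp_diff exp_add)
qed

lemma Pc_limit:
 "((%z. Pc q (Ln z) / \<theta> (- z)) \<longlongrightarrow>
   of_real ((- 1) powi m * q powi (m * (m - 1) div 2) / qpoch q q ^ 3 * (2 * pi / L)\<^sup>2 * (\<Sum>n. limit_term q (Suc n))))
  (at (qc powi m))"
proof -
 have "(Pc q has_field_derivative deriv (Pc q) (of_int m * lc)) (at (of_int m * lc))"
  by (rule holomorphic_derivI[OF holomorphic_Pc open_UNIV]) simp
 from limit_at_qpower[OF this Pc_int_L] show ?thesis
  unfolding Pc_deriv_int_L(2) qpoch_of_real by (simp add: qb_def mult_ac)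
qed

lemma Pd_limit:
 assumes l: "lam ~= 0" "\<theta> lam ~= 0"
 shows "((%z. Pd q lam (Ln z) / \<theta> (- z)) \<longlongrightarrow>
   of_real ((- 1) powi (m - 1) * q powi (m * (m - 1) div 2) / qpoch q q ^ 3) * (of_real (1 / L) + lam * deriv g lam))
  (at (qc powi m))"
proof -
 obtain A where A: "Pd q lam (of_int m * lc) = 0"
  "(Pd q lam has_field_derivative (lam * deriv g lam + 1 / lc)) (at (of_int m * lc))"
  using Pd_at_int_L[OF l, of m] by metis
 define X where "X = lam * deriv g lam + 1 / lc"
 have X: "of_real (1 / L) + lam * deriv g lam = X" by (simp add: X_def)
 have "((- 1) :: complex) powi (m - 1) = - ((- 1) powi m)" by (simp add: power_int_diff)
 hence "of_real ((- 1) powi (m - 1) * q powi (m * (m - 1) div 2) / qpoch q q ^ 3) * X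
   = - X * ((- 1) powi m * of_real (qb q m)) / qpc qc ^ 3"
  unfolding qpoch_of_real by (simp add: qb_def mult_ac)
 with limit_at_qpower[OF A(2,1)] show ?thesis unfolding X X_def[symmetric] by (simp only:)
qed

end

section \<open>The transforms of a given function\<close>

locale kernel = heine +
 fixes B :: "complex \<Rightarrow> complex" and D :: "complex set"
 assumes D: "open D" "connected D" "0 \<in> D" "B holomorphic_on D"
  and D_pos: "\<And>t::real. 0 < t ==> of_real t \<in> D"
  and LE_def: "\<And>w. \<bar>Im w\<bar> < pi ==> LapE_defined q B w"
begin

lemma Bi: "integrable lborel (%s. B (of_real (exp s)) * E (of_real (s - x)))"
proof -
 have "LapE_defined q B (of_real x)" by (rule LE_def) simp
 thus ?thesis
  unfolding LapE_defined_def exp_substitution(1)[of "%t. B (of_real t) * E (of_real (ln t) - of_real x)"] by simp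
qed

lemma LapE_GE: "LapE q B w = GE B w"
 unfolding LapE_def GE_def exp_substitution(2)[of "%t. B (of_real t) * E (of_real (ln t) - w)"] by simp

lemma Laptheta_GT: "Laptheta q B (exp w) = GT B w"
 unfolding Laptheta_def GT_def exp_substitution(2)[of "%t. B (of_real t) / \<theta> (of_real t / exp w)"]
 by (simp add: exp_diff exp_of_real)

lemma slit_exp: "z \<notin> \<real>\<^sub>\<le>\<^sub>0 ==> exp (Ln z) = z \<and> Ln z \<in> strip"
proof -
 assume z: "z \<notin> \<real>\<^sub>\<le>\<^sub>0"
 hence z0: "z ~= 0" by auto
 have "Im (Ln z) ~= pi" using Im_Ln_eq_pi[OF z0] z by (auto simp: complex_nonpos_Reals_iff)
 thus ?thesis using Im_Ln_le_pi[OF z0] mpi_less_Im_Ln[OF z0] z0 by (simp add: strip_def abs_less_iff)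
qed

lemma CH_iff: "cauchy_heine q S B \<longleftrightarrow> (\<forall>w\<in>strip. GT B w = GT B1 w)"
proof -
 have eq: "of_real (- 1 / L) * CHI (exp w) = GT B1 w" if "w \<in> strip" for w
  using CHI_GT[OF that] by simp
 show ?thesis
 proof
  assume "cauchy_heine q S B"
  thus "\<forall>w\<in>strip. GT B w = GT B1 w"
   unfolding cauchy_heine_def CHI_set_integral(2) using exp_strip eq Laptheta_GT by metis
 next
  assume G: "\<forall>w\<in>strip. GT B w = GT B1 w"
  show "cauchy_heine q S B"
   unfolding cauchy_heine_def CHI_set_integral
  proof (intro allI impI conjI)
   fix z :: complex assume z: "z \<notin> \<real>\<^sub>\<le>\<^sub>0"
   show "integrable lborel (%s. dz s * (of_real (exp s) / (of_real (exp s) + z)))" by (rule CHI_props(1)[OF z])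
   show "Laptheta q B z = of_real (- 1 / L) * CHI z"
    using slit_exp[OF z] G eq[of "Ln z"] Laptheta_GT[of "Ln z"] by simp
  qed
 qed
qed

text \<open>Off the principal sheet the formula is forced by \<open>fold_GE\<close> and \<open>fold_GT\<close>.\<close>

definition FT :: "complex \<Rightarrow> complex" where
 "FT w = (if w \<in> strip then GT B w else GE B w + Dz (exp w) * Pc q w)"

lemma GE_unique:
 assumes "FE holomorphic_on UNIV" "\<And>w. \<bar>Im w\<bar> < pi ==> FE w = LapE q B w"
 shows "FE w = GE B w"
proof -
 have "strip ~= {}" using strip_shift(3) by blast
 from analytic_continuation_open[OF strip_props(1) open_UNIV this connected_UNIV subset_UNIV assms(1) holomorphic_GE[OF Bi]]
 show ?thesis using assms(2) by (simp add: LapE_GE strip_def)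
qed

context
 fixes e :: "nat \<Rightarrow> complex"
 assumes e: "\<And>r. r \<ge> 0 ==> summable (%n. norm (e n) * r ^ n)"
  and BB: "\<And>t. t \<in> D \<inter> B1dom ==> B t = B1 t + B2 e t"
begin

lemma foldable_B: "foldable B (%w. kap w + eps e (exp w))"
 by (rule foldable_sum[OF e]) (use BB D_pos pos_in_B1dom in auto)

lemma FT_eq: "\<theta> (- exp w) ~= 0 ==> FT w = kap w + eps e (exp w)"
 using fold_GT[OF foldable_B] fold_GE[OF foldable_B] by (simp add: FT_def mult.commute)

lemma conts: "continuations q B (GE B) FT"
proof -
 define U where "U = {w. \<theta> (- exp w) ~= 0}"
 have U: "open U" unfolding U_def
  by (rule open_Collect_neq) (auto intro!: holomorphic_on_imp_continuous_on holomorphic_intros)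
 have Sexp: "(%w. S (exp w)) holomorphic_on U"
  by (rule holomorphic_on_compose_gen[OF _ S_hol, unfolded o_def]) (auto intro!: holomorphic_intros)
 have "(%w. GE B w + Dz (exp w) * Pc q w) holomorphic_on U"
  unfolding Dz_def
  by (intro holomorphic_on_add holomorphic_on_mult holomorphic_on_divide Sexp
     holomorphic_on_subset[OF holomorphic_GE[OF Bi]] holomorphic_on_subset[OF holomorphic_Pc] holomorphic_intros)
   (auto simp: U_def)
 moreover have "GE B w + Dz (exp w) * Pc q w = FT w" if "w \<in> U" for w
  using fold_GE[OF foldable_B, of w] FT_eq[of w] that by (simp add: U_def mult.commute)
 ultimately have 1: "FT holomorphic_on U" by (rule holomorphic_transform)
 have 2: "FT holomorphic_on strip"
  by (rule holomorphic_transform[OF holomorphic_GT[OF Bi]]) (simp add: FT_def)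
 have "FT holomorphic_on (U \<union> strip)" by (rule holomorphic_on_Un[OF 1 2 U strip_props(1)])
 hence "FT holomorphic_on (- {w. exp w \<in> qpowers q \<and> Im w ~= 0})"
  by (rule holomorphic_on_subset) (auto simp: U_def strip_def theta_eq_0_iff)
 thus ?thesis
  unfolding continuations_def using holomorphic_GE[OF Bi]
  by (auto simp: LapE_GE Laptheta_GT FT_def strip_def)
qed

lemma conn: "connection_formulas q S (GE B) FT"
 unfolding connection_formulas_def
proof (intro conjI allI impI)
 fix w
 show "GE B (w + \<omega>) = GE B w - jmp w"
  by (rule GE_jump[OF foldable_B])
 assume "exp w \<notin> qpowers q"
 hence w: "\<theta> (- exp w) ~= 0" by (simp add: theta_eq_0_iff)
 hence "\<theta> (- exp (w + \<omega>)) ~= 0" by (simp only: exp_2pi not_False_eq_True)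
 from FT_eq[OF this] kappa_jump[OF foldable_B w] FT_eq[OF w]
 show "FT (w + \<omega>) = FT w + of_real (2 * pi) * \<i> * S (exp w) / (lc * \<theta> (- exp w))"
  by (simp add: Dz_def exp_2pi)
qed

lemma FT_minus_GE: "exp w \<notin> qpowers q ==> FT w - GE B w = S (exp w) / \<theta> (- exp w) * Pc q w"
proof -
 assume "exp w \<notin> qpowers q"
 hence w: "\<theta> (- exp w) ~= 0" by (simp add: theta_eq_0_iff)
 show ?thesis using fold_GE[OF foldable_B w] FT_eq[OF w] by (simp add: Dz_def mult.commute)
qed

lemma FT_minus_Laplam:
 assumes a: "admissible q lam w" and lD: "\<forall>n::int. qc powi n * lam \<in> D" and w: "exp w \<notin> qpowers q"
 shows "FT w - Laplam q lam B (exp w) = S (exp w) / \<theta> (- exp w) * Pd q lam w"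
proof -
 note nz = admissible_nz[OF a]
 define l where "l = Ln lam"
 have l: "exp l = lam" using nz by (simp add: l_def)
 have w': "\<theta> (- exp w) ~= 0" using w by (simp add: theta_eq_0_iff)
 have "B (qc powi n * lam) = B1 (qc powi n * lam) + B2 e (qc powi n * lam)" for n
  using lD nz theta_powi[OF nz(1), of n] q_pos by (intro BB) (simp add: B1dom_def)
 hence Bn: "B (qc powi n * lam) / \<theta> (qc powi n * lam / exp w) =
   B1 (qc powi n * lam) / \<theta> (qc powi n * lam / exp w) + B2 e (qc powi n * lam) / \<theta> (qc powi n * lam / exp w)" for n
  by (simp add: add_divide_distrib)
 have 1: "(lat B1 lam (exp w) has_sum
   (kap w - (Q l - Q (l - w)) * Dz (exp w))) UNIV"
  using B1_lattice[of w l] w' nz by (simp add: l exp_diff)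
 have 2: "(lat (B2 e) lam (exp w) has_sum eps e (exp w)) UNIV"
  by (rule B2_lattice[OF e]) (use nz in auto)
 have "Laplam q lam B (exp w) = kap w - (Q l - Q (l - w)) * Dz (exp w) + eps e (exp w)"
  unfolding Laplam_def Bn by (rule infsumI[OF has_sum_add[OF 1 2]])
 hence "FT w - Laplam q lam B (exp w) = (Q l - Q (l - w)) * Dz (exp w)" using FT_eq[OF w'] by simp
 moreover have "Pd q lam w = Q l - Q (l - w)" using Pd_eq[of l w] unfolding l .
 ultimately show ?thesis by (simp only: Dz_def mult.commute)
qed

lemma GT_eps: "w \<in> strip ==> GT B w = GT B1 w + eps e (exp w)"
proof -
 assume w: "w \<in> strip"
 define U where "U = {w. \<theta> (- exp w) ~= 0} \<inter> strip"
 have U: "open U" unfolding U_def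
  by (intro open_Int strip_props open_Collect_neq) (auto intro!: holomorphic_on_imp_continuous_on holomorphic_intros)
 have "of_real (pi / 2) * \<i> \<in> U"
  using theta_right_nz[of "- \<i>"] exp_Euler[of "of_real (pi / 2)"] pi_gt_zero
  by (simp add: U_def strip_def mult.commute)
 hence U0: "U ~= {}" by blast
 have ee: "(%w. eps e (exp w)) holomorphic_on strip"
  by (rule holomorphic_on_compose_gen[OF _ holomorphic_eps[OF e], unfolded o_def]) (auto intro!: holomorphic_intros)
 show ?thesis
 proof (rule analytic_continuation_open[of U strip "GT B" "%w. GT B1 w + eps e (exp w)", OF U strip_props(1) U0 convex_connected[OF strip_props(2)]])
  show "GT B holomorphic_on strip" by (rule holomorphic_GT[OF Bi])
  show "(%w. GT B1 w + eps e (exp w)) holomorphic_on strip"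
   by (rule holomorphic_on_add[OF holomorphic_GT[OF B1_Gaussian] ee])
  show "GT B z = GT B1 z + eps e (exp z)" if "z \<in> U" for z
   using fold_GT[OF foldable_B, of z] fold_GT[OF foldable_B1, of z] that by (simp add: U_def)
 qed (use w in \<open>auto simp: U_def\<close>)
qed

text \<open>The entire function by which the two transforms differ tends to zero along the slit plane, hence by
continuity at infinity, and vanishes by Liouville.\<close>

lemma CH_of_limit:
 assumes lim: "(Laptheta q B \<longlongrightarrow> 0) at_slit"
 shows "cauchy_heine q S B"
proof -
 have "((%z. Laptheta q B z - - (1 / lc) * CHI z) \<longlongrightarrow> 0 - - (1 / lc) * 0) at_slit"
  by (intro tendsto_diff tendsto_mult tendsto_const lim CHI_tendsto)
 moreover have "Laptheta q B z - - (1 / lc) * CHI z = eps e z" if "z \<in> - \<real>\<^sub>\<le>\<^sub>0" for z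
  using slit_exp[of z] that GT_eps[of "Ln z"] CHI_GT[of "Ln z"] Laptheta_GT[of "Ln z"] by simp
 hence "eventually (%z. Laptheta q B z - - (1 / lc) * CHI z = eps e z) at_slit"
  by (auto simp: eventually_inf_principal intro!: always_eventually)
 ultimately have l0: "(eps e \<longlongrightarrow> 0) at_slit"
  using Lim_transform_eventually by fastforce
 have l1: "(eps e \<longlongrightarrow> 0) at_infinity"
  unfolding tendsto_iff eventually_at_infinity
 proof (intro allI impI)
  fix \<epsilon> :: real assume "\<epsilon> > 0"
  hence "eventually (%z. dist (eps e z) 0 < \<epsilon> / 2) at_slit"
   using l0 by (intro tendstoD) auto
  then obtain R where R: "\<And>z. norm z \<ge> R ==> z \<notin> \<real>\<^sub>\<le>\<^sub>0 ==> norm (eps e z) < \<epsilon> / 2"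
   by (auto simp: eventually_inf_principal eventually_at_infinity)
  have "norm (eps e z) \<le> \<epsilon> / 2" if z: "norm z \<ge> R" for z
  proof (cases "z \<in> \<real>\<^sub>\<le>\<^sub>0")
   case True
   define X where "X = (%n. z + of_real (inverse (real (Suc n))) * \<i>)"
   have "(%n. z + of_real (inverse (real (Suc n))) * \<i>) \<longlonglongrightarrow> z + of_real 0 * \<i>"
    by (intro tendsto_add tendsto_mult tendsto_const tendsto_of_real LIMSEQ_inverse_real_of_nat)
   hence "X \<longlonglongrightarrow> z" by (simp add: X_def)
   moreover have "isCont (eps e) z"
    using holomorphic_on_imp_continuous_on[OF holomorphic_eps[OF e]] continuous_on_eq_continuous_at[OF open_UNIV] by blast
   ultimately have "(%n. norm (eps e (X n))) \<longlonglongrightarrow> norm (eps e z)"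
    by (intro tendsto_norm isCont_tendsto_compose[of z "eps e"])
   moreover have "norm (eps e (X n)) \<le> \<epsilon> / 2" for n
   proof -
    have Iz: "Im z = 0" using True by (simp add: complex_nonpos_Reals_iff)
    have "norm z \<le> norm (X n)" unfolding cmod_def using Iz by (intro real_sqrt_le_mono) (simp add: X_def)
    moreover have "X n \<notin> \<real>\<^sub>\<le>\<^sub>0" using Iz by (simp add: X_def complex_nonpos_Reals_iff)
    ultimately show ?thesis using R[of "X n"] z by simp
   qed
   ultimately show ?thesis by (intro LIMSEQ_le_const2) auto
  qed (use R[OF z] in simp)
  thus "\<exists>b. \<forall>z. b \<le> norm z \<longrightarrow> dist (eps e z) 0 < \<epsilon>"
   using \<open>\<epsilon> > 0\<close> by (intro exI[of _ R]) (force simp: dist_norm)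
 qed
 have "eps e z = 0" for z by (rule Liouville_weak_0[OF holomorphic_eps[OF e] l1])
 thus ?thesis unfolding CH_iff using GT_eps by simp
qed

end

lemma CH_structure:
 assumes "cauchy_heine q S B" "t \<in> D \<inter> B1dom"
 shows "B t = B1 t + B2 (%_. 0) t"
proof -
 have "GT B (of_real y) = GT B1 (of_real y)" for y
  using assms(1) unfolding CH_iff by (simp add: strip_def)
 from structure_CH[OF D Bi this assms(2)] show ?thesis by (simp add: B2_def)
qed

lemma CH_limit:
 assumes "cauchy_heine q S B"
 shows "(Laptheta q B \<longlongrightarrow> 0) at_slit"
proof -
 have "((%z. of_real (- 1 / L) * CHI z) \<longlongrightarrow> of_real (- 1 / L) * 0) at_slit"
  by (intro tendsto_mult tendsto_const CHI_tendsto)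
 moreover have "eventually (%z. of_real (- 1 / L) * CHI z = Laptheta q B z) at_slit"
  using assms unfolding cauchy_heine_def CHI_set_integral(2)
  by (auto simp: eventually_inf_principal intro!: always_eventually)
 ultimately show ?thesis using Lim_transform_eventually by fastforce
qed

lemma conn_structure:
 assumes "continuations q B FE Ft" "connection_formulas q S FE Ft"
 obtains e where "\<And>r. r \<ge> 0 ==> summable (%n. norm (e n) * r ^ n)" "\<And>t. t \<in> D \<inter> B1dom ==> B t = B1 t + B2 e t"
proof -
 have FE: "FE w = GE B w" for w
  by (rule GE_unique) (use assms(1) in \<open>auto simp: continuations_def\<close>)
 have jump: "GE B (w + \<omega>) = GE B w - jmp w" for w
  using assms(2) unfolding connection_formulas_def FE by blast
 show thesis
 proof (rule structure_conn[OF D Bi jump])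
  fix e assume e: "\<And>r. r \<ge> 0 ==> summable (%n. norm (e n) * r ^ n)" and b: "\<And>t. t \<in> D \<inter> B1dom ==> B t = B1 t + B2 e t"
  show thesis by (rule that[OF e b])
 qed
qed

lemma summable_zero: "summable (%n. norm ((%_. 0 :: complex) n) * r ^ n)" by simp

lemma equivalence:
 "cauchy_heine q S B \<longleftrightarrow>
  (\<exists>FE Ft. continuations q B FE Ft \<and> connection_formulas q S FE Ft) \<and>
  (Laptheta q B \<longlongrightarrow> 0) at_slit"
proof
 assume ch: "cauchy_heine q S B"
 from conts[OF summable_zero CH_structure[OF ch]] conn[OF summable_zero CH_structure[OF ch]] CH_limit[OF ch]
 show "(\<exists>FE Ft. continuations q B FE Ft \<and> connection_formulas q S FE Ft) \<and>
  (Laptheta q B \<longlongrightarrow> 0) at_slit" by blast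
next
 assume "(\<exists>FE Ft. continuations q B FE Ft \<and> connection_formulas q S FE Ft) \<and>
  (Laptheta q B \<longlongrightarrow> 0) at_slit"
 then obtain FE Ft where c: "continuations q B FE Ft" "connection_formulas q S FE Ft"
  and lim: "(Laptheta q B \<longlongrightarrow> 0) at_slit" by blast
 show "cauchy_heine q S B"
 proof (rule conn_structure[OF c])
  fix e assume e: "\<And>r. r \<ge> 0 ==> summable (%n. norm (e n) * r ^ n)" and b: "\<And>t. t \<in> D \<inter> B1dom ==> B t = B1 t + B2 e t"
  show "cauchy_heine q S B" by (rule CH_of_limit[OF e b lim])
 qed
qed

lemma differences:
 assumes hyp: "cauchy_heine q S B \<or> (\<exists>FE Ft. continuations q B FE Ft \<and> connection_formulas q S FE Ft)"
 shows "\<exists>FE Ft. continuations q B FE Ft \<and> connection_formulas q S FE Ft \<and>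
   (\<forall>w. exp w \<notin> qpowers q \<longrightarrow> Ft w - FE w = S (exp w) / \<theta> (- exp w) * Pc q w) \<and>
   (\<forall>lam w. admissible q lam w \<and> (\<forall>n::int. qc powi n * lam \<in> D) \<and>
     Laplam_defined q lam B (exp w) \<and> exp w \<notin> qpowers q \<longrightarrow>
     Ft w - Laplam q lam B (exp w) = S (exp w) / \<theta> (- exp w) * Pd q lam w)"
proof -
 obtain e where e: "\<And>r. r \<ge> 0 ==> summable (%n. norm (e n) * r ^ n)" and BB: "\<And>t. t \<in> D \<inter> B1dom ==> B t = B1 t + B2 e t"
  using hyp
 proof (elim disjE exE conjE)
  assume ch: "cauchy_heine q S B"
  show thesis by (rule that[OF summable_zero CH_structure[OF ch]])
 next
  fix FE Ft assume c: "continuations q B FE Ft" "connection_formulas q S FE Ft"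
  show thesis
  proof (rule conn_structure[OF c])
  fix e assume e: "\<And>r. r \<ge> 0 ==> summable (%n. norm (e n) * r ^ n)" and b: "\<And>t. t \<in> D \<inter> B1dom ==> B t = B1 t + B2 e t"
   show thesis by (rule that[OF e b])
  qed
 qed
 have 1: "\<forall>w. exp w \<notin> qpowers q \<longrightarrow> FT w - GE B w = S (exp w) / \<theta> (- exp w) * Pc q w"
  using FT_minus_GE[OF e BB] by simp
 have 2: "\<forall>lam w. admissible q lam w \<and> (\<forall>n::int. qc powi n * lam \<in> D) \<and>
     Laplam_defined q lam B (exp w) \<and> exp w \<notin> qpowers q \<longrightarrow>
     FT w - Laplam q lam B (exp w) = S (exp w) / \<theta> (- exp w) * Pd q lam w"
  using FT_minus_Laplam[OF e BB] by simp
 from conts[OF e BB] conn[OF e BB] 1 2 show ?thesis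
  by (intro exI[of _ "GE B"] exI[of _ FT] conjI)
qed

end

theorem theorem3p1:
  fixes q M c r :: real and a :: "nat \<Rightarrow> complex"
    and B S :: "complex \<Rightarrow> complex" and D :: "complex set"
  assumes q: "0 < q" "q < 1"
    and B_series: "0 < r" "\<And>t. norm t < r \<Longrightarrow> (\<lambda>n. a n * t ^ n) sums B t"
    and B_continuation: "open D" "connected D" "0 \<in> D" "\<And>t::real. 0 < t \<Longrightarrow> of_real t \<in> D"
          "B holomorphic_on D"
    and LE_defined: "\<And>w. \<bar>Im w\<bar> < pi \<Longrightarrow> LapE_defined q B w"
    and Ltheta_defined: "\<And>z. z \<notin> \<real>\<^sub>\<le>\<^sub>0 \<Longrightarrow> Laptheta_defined q B z"
    and S_entire: "S holomorphic_on UNIV" "entire_order S = 0" "entire_type S = 0"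
    and S_growth: "0 < M" "0 < c" "c < 1" "\<And>t. norm (S t) \<le> M * qpoch (- (c * norm t)) q"
    and hyp: "cauchy_heine q S B \<or>
              (\<exists>FE Ft. continuations q B FE Ft \<and> connection_formulas q S FE Ft)"
  shows
    "\<comment> \<open>Equivalence of the two hypotheses. The second one determines the transform only up to an
        additive entire function (e.g. B = 1, S = 0), hence the normalization at infinity.\<close>
     (cauchy_heine q S B \<longleftrightarrow>
       (\<exists>FE Ft. continuations q B FE Ft \<and> connection_formulas q S FE Ft) \<and>
       (Laptheta q B \<longlongrightarrow> 0) (inf at_infinity (principal (- \<real>\<^sub>\<le>\<^sub>0)))) \<and>

     \<comment> \<open>The two difference formulas, on the whole Riemann surface.\<close>
     (\<exists>FE Ft. continuations q B FE Ft \<and> connection_formulas q S FE Ft \<and>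
       (\<forall>w. exp w \<notin> qpowers q \<longrightarrow>
          Ft w - FE w = S (exp w) / thetaq q (- exp w) * Pc q w) \<and>
       (\<forall>lam w. admissible q lam w \<and> (\<forall>n::int. of_real q powi n * lam \<in> D) \<and>
          Laplam_defined q lam B (exp w) \<and> exp w \<notin> qpowers q \<longrightarrow>
          Ft w - Laplam q lam B (exp w) = S (exp w) / thetaq q (- exp w) * Pd q lam w)) \<and>

     \<comment> \<open>Second form of Pd, for any branch l of the logarithm of lam, and q-periodicity.\<close>
     (\<forall>lam w. admissible q lam w \<longrightarrow>
       (\<forall>l. exp l = lam \<longrightarrow>
          Pd q lam w = lam * Pq' q l / Pq q l
                       - lam * Pq' q (l - w) / (exp w * Pq q (l - w))) \<and>
       Pd q lam (w + of_real (ln q)) = Pd q lam w) \<and>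

     \<comment> \<open>The other forms of Pc (the two integrals on the principal sheet), and q-periodicity.\<close>
     (\<forall>w. \<bar>Im w\<bar> < pi \<longrightarrow>
       Pc q w = w / of_real (ln q) + 1 / (exp w * of_real (ln q)) *
         set_lebesgue_integral lborel {q..1} (\<lambda>t. Pq q (of_real (ln t)) *
           (thetaq' q (of_real t / exp w) / thetaq q (of_real t / exp w)))) \<and>
     (\<forall>w. \<bar>Im w\<bar> < pi \<longrightarrow>
       Pc q w = 1 / (exp w * of_real (ln q)) *
         set_lebesgue_integral lborel {q..1} (\<lambda>t. Pq q (of_real (ln t)) *
           Pq' q (of_real (ln t) - w) / Pq q (of_real (ln t) - w))) \<and>
     (\<forall>w. summable (Pc_term q w) \<and>
       Pc q w = of_real (- 2 * pi / ln q) * (\<Sum>n. Pc_term q w (Suc n))) \<and>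
     (\<forall>w. Pc q (w + of_real (ln q)) = Pc q w) \<and>

     \<comment> \<open>The difference of two Pd, and q-periodicity.\<close>
     (\<forall>lam1 lam2 w. admissible q lam1 w \<and> admissible q lam2 w \<longrightarrow>
       Pd q lam1 w - Pd q lam2 w
         = lam1 * thetaq' q lam1 / thetaq q lam1
           - lam1 * thetaq' q (lam1 / exp w) / (exp w * thetaq q (lam1 / exp w))
           - lam2 * thetaq' q lam2 / thetaq q lam2
           + lam2 * thetaq' q (lam2 / exp w) / (exp w * thetaq q (lam2 / exp w)) \<and>
       Pd q lam1 w - Pd q lam2 w
         = qpoch (of_real q) (of_real q) ^ 3 * thetaq q (- exp w) * thetaq q (- lam1 / lam2)
             * thetaq q (- lam1 * lam2 / exp w)
           / (thetaq q lam1 * thetaq q lam2 * thetaq q (lam1 / exp w) * thetaq q (exp w / lam2)) \<and>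
       Pd q lam1 (w + of_real (ln q)) - Pd q lam2 (w + of_real (ln q))
         = Pd q lam1 w - Pd q lam2 w) \<and>

     \<comment> \<open>Removable singularities at the powers of q on the principal sheet.\<close>
     (\<forall>m::int.
       removable_singularity_at (\<lambda>z. S z / thetaq q (- z) * Pc q (Ln z)) (of_real q powi m) \<and>
       summable (limit_term q) \<and>
       ((\<lambda>z. Pc q (Ln z) / thetaq q (- z)) \<longlongrightarrow>
          of_real ((- 1) powi m * q powi (m * (m - 1) div 2) / qpoch q q ^ 3
            * (2 * pi / ln q)\<^sup>2 * (\<Sum>n. limit_term q (Suc n))))
         (at (of_real q powi m))) \<and>
     (\<forall>(m::int) lam. lam \<noteq> 0 \<and> - lam \<notin> qpowers q \<longrightarrow>
       removable_singularity_at (\<lambda>z. S z / thetaq q (- z) * Pd q lam (Ln z)) (of_real q powi m) \<and>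
       (\<lambda>n::int. lam * of_real q powi n / (1 + lam * of_real q powi n)\<^sup>2) summable_on UNIV \<and>
       ((\<lambda>z. Pd q lam (Ln z) / thetaq q (- z)) \<longlongrightarrow>
          of_real ((- 1) powi (m - 1) * q powi (m * (m - 1) div 2) / qpoch q q ^ 3)
            * (of_real (1 / ln q)
               + (\<Sum>\<^sub>\<infinity>n::int. lam * of_real q powi n / (1 + lam * of_real q powi n)\<^sup>2)))
         (at (of_real q powi m)) \<and>
       ((\<lambda>z. Pd q lam (Ln z) / thetaq q (- z)) \<longlongrightarrow>
          of_real ((- 1) powi (m - 1) * q powi (m * (m - 1) div 2) / qpoch q q ^ 3)
            * (of_real (1 / ln q) + lam * deriv (\<lambda>x. x * thetaq' q x / thetaq q x) lam))
         (at (of_real q powi m)))"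
proof -
 interpret kernel q S M c B D
  by unfold_locales (use q S_entire(1) S_growth B_continuation LE_defined in auto)
 have th: "lam ~= 0 ==> - lam \<notin> qpowers q ==> thetaq q lam ~= 0" for lam
  by (simp add: theta_eq_0_iff)
 have g_eq: "g = (%x. x * thetaq' q x / thetaq q x)" by (simp add: fun_eq_iff g_def)
 show ?thesis
 proof (intro conjI, goal_cases)
  case 1
  show ?case by (rule equivalence)
 next
  case 2
  show ?case by (rule differences[OF hyp])
 next
  case 3
  show ?case by (intro allI impI conjI Pd_second_form)
 next
  case 4
  show ?case by (intro allI impI Pc_integral_forms)
 next
  case 5
  show ?case by (intro allI impI Pc_integral_forms)
 next
  case 6
  show ?case by (intro allI conjI Pc_term_sums)
 next
  case 7
  show ?case by (intro allI Pc_periodic)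
 next
  case 8
  show ?case
  proof (intro allI impI, elim conjE, intro conjI)
   fix lam1 lam2 w assume a: "admissible q lam1 w" "admissible q lam2 w"
   show "Pd q lam1 w - Pd q lam2 w
    = lam1 * thetaq' q lam1 / thetaq q lam1
     - lam1 * thetaq' q (lam1 / exp w) / (exp w * thetaq q (lam1 / exp w))
     - lam2 * thetaq' q lam2 / thetaq q lam2
     + lam2 * thetaq' q (lam2 / exp w) / (exp w * thetaq q (lam2 / exp w))"
    by (simp add: Pd_def)
   show "Pd q lam1 w - Pd q lam2 w
    = qpoch (of_real q) (of_real q) ^ 3 * thetaq q (- exp w) * thetaq q (- lam1 / lam2)
      * thetaq q (- lam1 * lam2 / exp w)
     / (thetaq q lam1 * thetaq q lam2 * thetaq q (lam1 / exp w) * thetaq q (exp w / lam2))"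
    by (rule Pd_difference[OF a])
   show "Pd q lam1 (w + of_real (ln q)) - Pd q lam2 (w + of_real (ln q)) = Pd q lam1 w - Pd q lam2 w"
    by (simp only: Pd_second_form(2)[OF a(1)] Pd_second_form(2)[OF a(2)])
  qed
 next
  case 9
  show ?case
   by (intro allI conjI Pc_limit Pc_deriv_int_L(1)
      removable_at_qpower[OF holomorphic_Pc open_UNIV UNIV_I Pc_int_L S_hol])
 next
  case 10
  show ?case
  proof (intro allI impI, elim conjE, intro conjI)
   fix m :: int and lam :: complex assume lam: "lam ~= 0" "- lam \<notin> qpowers q"
   note l = lam(1) th[OF lam]
   obtain A where A: "Pd q lam holomorphic_on A" "open A" "of_int m * of_real (ln q) \<in> A"
    "Pd q lam (of_int m * of_real (ln q)) = 0" using Pd_at_int_L[OF l, of m] by metis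
   show "removable_singularity_at (%z. S z / thetaq q (- z) * Pd q lam (Ln z)) (of_real q powi m)"
    by (rule removable_at_qpower[OF A S_hol])
   note hs = g_deriv_has_sum[OF l]
   show "(%n::int. lam * of_real q powi n / (1 + lam * of_real q powi n)\<^sup>2) summable_on UNIV"
    by (rule has_sum_imp_summable[OF hs])
   show "((%z. Pd q lam (Ln z) / thetaq q (- z)) \<longlongrightarrow>
     of_real ((- 1) powi (m - 1) * q powi (m * (m - 1) div 2) / qpoch q q ^ 3)
      * (of_real (1 / ln q)
       + (\<Sum>\<^sub>\<infinity>n::int. lam * of_real q powi n / (1 + lam * of_real q powi n)\<^sup>2)))
    (at (of_real q powi m))"
    unfolding infsumI[OF hs] by (rule Pd_limit[OF l])
   show "((%z. Pd q lam (Ln z) / thetaq q (- z)) \<longlongrightarrow>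
     of_real ((- 1) powi (m - 1) * q powi (m * (m - 1) div 2) / qpoch q q ^ 3)
      * (of_real (1 / ln q) + lam * deriv (%x. x * thetaq' q x / thetaq q x) lam))
    (at (of_real q powi m))"
    using Pd_limit[OF l] unfolding g_eq .
  qed
 qed
qed

end
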